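(* Let $\Omega$ be a smooth bounded domain in $\mathbb{R}^N$, $N\ge 2$, let $p>1$ with $p\neq 3$, and let $f(u)=\frac{1}{(1-u)^p}$. Suppose \[ \frac{N}{4} < \frac{p}{p+1} + \frac{p-1}{p+1}\left( \sqrt{\frac{2p}{p-1}} + \sqrt{\frac{2p}{p-1}-\sqrt{\frac{2p}{p-1}}} - \frac12 \right). \] Then the extremal solution $u^*$ associated with the problem $(N)_{\lambda^*}$: $\Delta^2 u=\lambda^* f(u)$ in $\Omega$, $u=\Delta u=0$ on $\partial\Omega$, satisfies $\sup_\Omega u^*<1$.
   Context: For $\lambda\ge 0$, $(N)_\lambda$ denotes the fourth order Navier problem \[ \Delta^2 u=\lambda f(u)\ \text{ in }\Omega,\qquad u=\Delta u=0\ \text{ on }\partial\Omega, \] here with $f(u)=(1-u)^{-p}$. A smooth solution $u$ of $(N)_\lambda$ takes values in the domain $u<1$ of $f$ (on $\overline\Omega$). A smooth solution $u$ of $(N)_\lambda$ is called minimal if $u\le v$ a.e. in $\Omega$ for any solution $v$ of $(N)_\lambda$. The extremal parameter is $\lambda^*:=\sup\{\lambda>0:\ \text{there exists a smooth solution of }(N)_\lambda\}$. It is known that $0<\lambda^*<\infty$, that for each $0<\lambda<\lambda^*$ there exists a smooth minimal solution $u_\lambda$ of $(N)_\lambda$, and that for each $x\in\Omega$ the map $\lambda\mapsto u_\lambda(x)$ is strictly increasing on $(0,\lambda^* )$. The extremal solution is defined by $u^*(x):=\lim_{\lambda\nearrow\lambda^*}u_\lambda(x)$ for $x\in\Omega$.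 *)

theory Defs
  imports "HOL-Analysis.Analysis"
begin

primrec iter_partial :: "'a list \<Rightarrow> ('a::euclidean_space \<Rightarrow> real) \<Rightarrow> 'a \<Rightarrow> real" where
  "iter_partial [] u = u"
| "iter_partial (b # bs) u = (\<lambda>x. frechet_derivative (iter_partial bs u) (at x) b)"

text \<open>On an open set this is \<open>C\<^sup>\<infinity>\<close>: differentiability of all iterated partial derivatives
  already forces their continuity.\<close>

definition smooth_on :: "'a::euclidean_space set \<Rightarrow> ('a \<Rightarrow> real) \<Rightarrow> bool" where
  "smooth_on S u \<longleftrightarrow> open S \<and>
     (\<forall>bs. set bs \<subseteq> Basis \<longrightarrow> (\<forall>x\<in>S. iter_partial bs u differentiable (at x)))"

text \<open>\<open>C\<^sup>\<infinity>\<close> up to the boundary: every partial derivative, computed in the open set, extends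
  continuously to the closure; for the function itself the extension is the function.
  Values of \<open>u\<close> outside the closure play no role.\<close>

definition smooth_up_to_boundary :: "'a::euclidean_space set \<Rightarrow> ('a \<Rightarrow> real) \<Rightarrow> bool" where
  "smooth_up_to_boundary \<Omega> u \<longleftrightarrow> smooth_on \<Omega> u \<and> continuous_on (closure \<Omega>) u \<and>
     (\<forall>bs. set bs \<subseteq> Basis \<longrightarrow>
        (\<exists>g. continuous_on (closure \<Omega>) g \<and> (\<forall>x\<in>\<Omega>. g x = iter_partial bs u x)))"

definition laplacian :: "('a::euclidean_space \<Rightarrow> real) \<Rightarrow> 'a \<Rightarrow> real" where
  "laplacian u = (\<lambda>x. \<Sum>b\<in>Basis. iter_partial [b, b] u x)"

text \<open>Near each boundary point the set is, after a rotation taking the unit vector \<open>e\<close> to a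
  coordinate direction, the region above the graph of a smooth function \<open>\<gamma>\<close> of the component
  \<open>x - (x \<bullet> e) *\<^sub>R e\<close> orthogonal to \<open>e\<close>.\<close>

definition smooth_boundary :: "'a::euclidean_space set \<Rightarrow> bool" where
  "smooth_boundary \<Omega> \<longleftrightarrow>
     (\<forall>x0\<in>frontier \<Omega>. \<exists>r e \<gamma>. r > 0 \<and> norm e = 1 \<and> smooth_on UNIV \<gamma> \<and>
        \<Omega> \<inter> ball x0 r = {x \<in> ball x0 r. x \<bullet> e > \<gamma> (x - (x \<bullet> e) *\<^sub>R e)})"

definition smooth_bounded_domain :: "'a::euclidean_space set \<Rightarrow> bool" where
  "smooth_bounded_domain \<Omega> \<longleftrightarrow>
     open \<Omega> \<and> connected \<Omega> \<and> \<Omega> \<noteq> {} \<and> bounded \<Omega> \<and> smooth_boundary \<Omega>"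

definition nonlinearity :: "real \<Rightarrow> real \<Rightarrow> real" where
  "nonlinearity p t = 1 / (1 - t) powr p"

text \<open>The boundary value of the Laplacian is that of its continuous extension from \<open>\<Omega>\<close>,
  hence the limit in the last clause.\<close>

definition smooth_solution ::
  "'a::euclidean_space set \<Rightarrow> real \<Rightarrow> real \<Rightarrow> ('a \<Rightarrow> real) \<Rightarrow> bool" where
  "smooth_solution \<Omega> p lam u \<longleftrightarrow>
     smooth_up_to_boundary \<Omega> u \<and>
     (\<forall>x\<in>closure \<Omega>. u x < 1) \<and>
     (\<forall>x\<in>\<Omega>. laplacian (laplacian u) x = lam * nonlinearity p (u x)) \<and>
     (\<forall>x\<in>frontier \<Omega>. u x = 0) \<and>
     (\<forall>x\<in>frontier \<Omega>. (laplacian u \<longlongrightarrow> 0) (at x within \<Omega>))"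

definition minimal_solution ::
  "'a::euclidean_space set \<Rightarrow> real \<Rightarrow> real \<Rightarrow> ('a \<Rightarrow> real) \<Rightarrow> bool" where
  "minimal_solution \<Omega> p lam u \<longleftrightarrow> smooth_solution \<Omega> p lam u \<and>
     (\<forall>v. smooth_solution \<Omega> p lam v \<longrightarrow> (AE x in lebesgue_on \<Omega>. u x \<le> v x))"

definition extremal_parameter :: "'a::euclidean_space set \<Rightarrow> real \<Rightarrow> ereal" where
  "extremal_parameter \<Omega> p = Sup {ereal lam |lam. lam > 0 \<and> (\<exists>u. smooth_solution \<Omega> p lam u)}"

text \<open>The real number \<open>L\<close> is the extremal parameter; it is automatically positive and finite,
  since the supremum of the empty set is \<open>-\<infinity>\<close>. Minimal solutions are unique on the closure of
  \<open>\<Omega>\<close> by continuity, so the choice of \<open>U\<close> does not matter and \<open>w\<close> is determined on \<open>\<Omega>\<close>.\<close>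

definition extremal_solution ::
  "'a::euclidean_space set \<Rightarrow> real \<Rightarrow> ('a \<Rightarrow> real) \<Rightarrow> bool" where
  "extremal_solution \<Omega> p w \<longleftrightarrow>
     (\<exists>L U. ereal L = extremal_parameter \<Omega> p \<and>
        (\<forall>lam. 0 < lam \<and> lam < L \<longrightarrow> minimal_solution \<Omega> p lam (U lam)) \<and>
        (\<forall>x\<in>\<Omega>. ((\<lambda>lam. U lam x) \<longlongrightarrow> w x) (at_left L)))"

end

(* If lambda < mu and (N)_mu has a solution, monotone iteration below it, together with regularity
   up to the boundary, gives a solution of (N)_lambda that lies below every solution of (N)_mu; in
   particular the minimal solutions are ordered. By Picone's inequality the difference of two of them,
   and its negative Laplacian, make the smaller one stable. Let V denote the negative Laplacian of u.
   Testing stability with ((V - 1)_+)^t and using the pointwise bound of (1 - u)^(1 - p) by V^2 bounds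
   the integral of (1 - u)^(-q), uniformly for lambda close to the extremal parameter, for some
   q > N (p + 1) / 4. Weighted mean values of V on balls turn this into
   V <= C (1 - max u)^((1 - p) / 2), and near the maximum of u the same integral then bounds
   1 - max u away from zero. *)
theory Submission
 imports Defs "HOL-Complex_Analysis.Great_Picard"
begin

section \<open>Smooth functions\<close>

text \<open>The analysis rests on the maximum principle, translation invariance of the integral and
  explicit comparison functions. A larger solution is at hand throughout, so it serves as barrier
  for every linear problem of the iteration, and these are solved by a difference scheme trapped
  below it. Stability at \<open>lam\<close> is read off from a solution at some larger parameter;
  the strict inequality makes both differences positive. The shift in \<open>V - 1\<close> makes
  supports compact, because \<open>V\<close> vanishes on the boundary. With a = sqrt (2p/(p-1)) and
  t > 1, the energy inequality has a good sign as long as t^2 < a (2t - 1), that is t < a + sqrt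
  (a^2 - a); it then controls q = (p+1)/2 + (p-1) t, and the dimension condition says exactly that N
  (p+1)/4 lies below the limiting value of q. For the gap \<delta> = 1 - max u the natural length
  scale is r = \<delta>^((p+1)/4), for which r^4 \<delta>^(-p) = \<delta>; both mean value arguments
  use it.\<close>

definition pd :: "'a::euclidean_space => ('a => real) => 'a => real" where
 "pd v u = (%x. frechet_derivative u (at x) v)"

lemma iter_partial_append: "iter_partial (bs @ cs) u = iter_partial bs (iter_partial cs u)"
 by (induction bs) auto

lemma iter_partial_pd [simp]: "iter_partial (b # bs) u = pd b (iter_partial bs u)"
 by (simp add: pd_def)

declare iter_partial.simps(2) [simp del]

lemma pd_eqI: "(f has_derivative f') (at x) ==> pd v f x = f' v"
 unfolding pd_def using frechet_derivative_at by metis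

lemma differentiable_has_derivative_pd:
 "f differentiable at x ==> (f has_derivative (%v. pd v f x)) (at x)"
 by (simp add: pd_def frechet_derivative_works)

text \<open>\<open>frechet_derivative\<close> is a choice operator, so equality of the values
  follows from equality of the two predicates it chooses from. Points where no derivative exists are
  thereby covered as well.\<close>

lemma pd_cong_open:
 assumes "open S" "x \<in> S" "!!y. y \<in> S ==> f y = g y"
 shows "pd v f x = pd v g x"
proof -
 have "(f has_derivative f') (at x) \<longleftrightarrow> (g has_derivative f') (at x)" for f'
  using assms has_derivative_transform_within_open[of f f' x UNIV S g]
   has_derivative_transform_within_open[of g f' x UNIV S f] by auto
 then show ?thesis
  by (simp add: pd_def frechet_derivative_def)
qed

lemma differentiable_cong_open:
 assumes "open S" "x \<in> S" "!!y. y \<in> S ==> f y = g y" "f differentiable at x"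
 shows "g differentiable at x"
 using assms has_derivative_transform_within_open unfolding differentiable_def by metis

lemma smooth_on_open: "smooth_on S u ==> open S"
 by (simp add: smooth_on_def)

lemma smooth_on_differentiable: "smooth_on S u ==> x \<in> S ==> u differentiable at x"
 unfolding smooth_on_def using iter_partial.simps(1) by (metis empty_subsetI list.set(1))

lemma smooth_on_pd_Basis:
 assumes "smooth_on S u" "b \<in> Basis"
 shows "smooth_on S (pd b u)"
 unfolding smooth_on_def
proof (intro conjI allI impI ballI)
 show "open S" using assms(1) smooth_on_open by blast
 fix bs x assume *: "set bs \<subseteq> (Basis :: 'a set)" "x \<in> S"
 have "iter_partial bs (pd b u) = iter_partial (bs @ [b]) u"
  by (simp add: iter_partial_append)
 then show "iter_partial bs (pd b u) differentiable at x"
  using assms * unfolding smooth_on_def by (metis Un_least empty_subsetI insert_subset list.simps(15) set_append list.set(1))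
qed

lemma smooth_on_iter_partial:
 "smooth_on S u ==> set bs \<subseteq> Basis ==> smooth_on S (iter_partial bs u)"
 by (induction bs) (auto intro: smooth_on_pd_Basis)

text \<open>If \<open>P\<close> holds only for differentiable functions and is stable under partial
  derivatives up to equality on \<open>S\<close>, then every iterated partial of a member is
  represented on \<open>S\<close> by a member. Smoothness proofs thus reduce to naming a class
  closed under differentiation.\<close>

lemma smooth_on_coinduct:
 assumes "open S" "P u"
  and diff: "!!f x. P f ==> x \<in> S ==> f differentiable at x"
  and step: "!!f b. P f ==> b \<in> Basis ==> \<exists>g. P g & (\<forall>x\<in>S. pd b f x = g x)"
 shows "smooth_on S u"
proof -
 have *: "\<exists>g. P g & (\<forall>x\<in>S. iter_partial bs u x = g x)" if "set bs \<subseteq> Basis" for bs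
  using that
 proof (induction bs)
  case Nil then show ?case using \<open>P u\<close> by auto
 next
  case (Cons b bs)
  then obtain g where g: "P g" "\<forall>x\<in>S. iter_partial bs u x = g x" by auto
  obtain h where "P h" "\<forall>x\<in>S. pd b g x = h x"
   using step[OF g(1), of b] Cons.prems by auto
  moreover have "\<forall>x\<in>S. iter_partial (b # bs) u x = pd b g x"
   using pd_cong_open[OF \<open>open S\<close>] g(2) by (metis iter_partial_pd)
  ultimately show ?case by metis
 qed
 show ?thesis unfolding smooth_on_def
 proof (intro conjI allI impI ballI)
  fix bs x assume "set bs \<subseteq> (Basis :: 'a set)" "x \<in> S"
  then obtain g where "P g" "\<forall>x\<in>S. iter_partial bs u x = g x" using * by blast
  then show "iter_partial bs u differentiable at x"
   using differentiable_cong_open[OF \<open>open S\<close> \<open>x \<in> S\<close>, of g] diff[of g x] \<open>x \<in> S\<close> by metis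
 qed fact
qed

lemma smooth_on_cong:
 assumes "smooth_on S f" "!!x. x \<in> S ==> f x = g x"
 shows "smooth_on S g"
proof (rule smooth_on_coinduct[where P = "%g. \<exists>f. smooth_on S f & (\<forall>x\<in>S. f x = g x)"])
 show "open S" using assms smooth_on_open by blast
 fix g :: "'a => real" assume g: "\<exists>f. smooth_on S f & (\<forall>x\<in>S. f x = g x)"
 { fix x assume "x \<in> S" then show "g differentiable at x"
  using g differentiable_cong_open[OF \<open>open S\<close>] smooth_on_differentiable by metis }
 fix b :: 'a assume "b \<in> Basis"
 obtain f where f: "smooth_on S f" "\<forall>x\<in>S. f x = g x" using g by blast
 then have "\<forall>x\<in>S. pd b f x = pd b g x"
  using pd_cong_open[OF \<open>open S\<close>, of _ f g b] by blast
 moreover have "smooth_on S (pd b f)"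
  using f smooth_on_pd_Basis \<open>b \<in> Basis\<close> by blast
 ultimately show "\<exists>h. (\<exists>f. smooth_on S f & (\<forall>x\<in>S. f x = h x)) & (\<forall>x\<in>S. pd b g x = h x)"
  by (intro exI[of _ "pd b g"]) blast
qed (use assms in auto)

lemma smooth_on_subset:
 assumes "smooth_on S f" "open T" "T \<subseteq> S"
 shows "smooth_on T f"
 using assms unfolding smooth_on_def by auto

section \<open>Closure properties of smooth functions and the product and chain rules\<close>

lemma smooth_on_const: "open S ==> smooth_on S (%x. c)"
proof (rule smooth_on_coinduct[where P = "%f. \<exists>c. f = (%x. c)"])
 fix f :: "'a => real" and b :: 'a assume "\<exists>c. f = (%x. c)"
 then obtain c where "f = (%x. c)" by blast
 then have "pd b f x = 0" for x using pd_eqI[of "%x. c" "%_. 0" x b] by simp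
 then show "\<exists>g. (\<exists>c. g = (%x. c)) & (\<forall>x\<in>S. pd b f x = g x)" by metis
qed auto

lemma smooth_on_coord:
 assumes "open S" shows "smooth_on S (%x. x \<bullet> v)"
proof (rule smooth_on_coinduct[where P = "%f. (\<exists>c. f = (%x. c)) \<or> f = (%x. x \<bullet> v)"])
 fix f :: "'a => real" and b :: 'a
 assume "(\<exists>c. f = (%x. c)) \<or> f = (%x. x \<bullet> v)"
 moreover have "((%x. x \<bullet> v) has_derivative (%h. h \<bullet> v)) (at x)" for x :: 'a
  by (auto intro!: derivative_eq_intros)
 ultimately have "(\<forall>x. pd b f x = 0) \<or> (\<forall>x. pd b f x = b \<bullet> v)"
  using pd_eqI[of "%x. _" "%_. 0" _ b] pd_eqI[of _ "%h. h \<bullet> v" _ b] by (metis has_derivative_const)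
 then show "\<exists>g. ((\<exists>c. g = (%x. c)) \<or> g = (%x. x \<bullet> v)) & (\<forall>x\<in>S. pd b f x = g x)" by metis
qed (use assms in auto)

lemma pd_const [simp]: "pd v (%x. c) x = 0"
 using pd_eqI[of "%x. c" "%_. 0" x v] by simp

lemma pd_inner [simp]: "pd v (%x. x \<bullet> w) x = v \<bullet> w"
proof -
 have "((%x. x \<bullet> w) has_derivative (%h. h \<bullet> w)) (at x)" for x :: 'a
  by (auto intro!: derivative_eq_intros)
 then show ?thesis using pd_eqI by blast
qed

lemma pd_add:
 assumes "f differentiable at x" "g differentiable at x"
 shows "pd v (%x. f x + g x) x = pd v f x + pd v g x"
 using pd_eqI[OF has_derivative_add[OF assms[THEN differentiable_has_derivative_pd]]] by simp

lemma pd_diff: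
 assumes "f differentiable at x" "g differentiable at x"
 shows "pd v (%x. f x - g x) x = pd v f x - pd v g x"
 using pd_eqI[OF has_derivative_diff[OF assms[THEN differentiable_has_derivative_pd]]] by simp

lemma pd_minus:
 assumes "f differentiable at x"
 shows "pd v (%x. - f x) x = - pd v f x"
 using pd_eqI[OF has_derivative_minus[OF assms[THEN differentiable_has_derivative_pd]]] by simp

lemma pd_mult:
 assumes "f differentiable at x" "g differentiable at x"
 shows "pd v (%x. f x * g x) x = pd v f x * g x + f x * pd v g x"
 using pd_eqI[OF has_derivative_mult[OF assms[THEN differentiable_has_derivative_pd]]] by simp

lemma pd_cmult:
 assumes "f differentiable at x"
 shows "pd v (%x. c * f x) x = c * pd v f x"
 using pd_mult[of "%x. c" x f v] assms by simp

lemma pd_sum: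
 assumes "!!i. i \<in> I ==> f i differentiable at x"
 shows "pd v (%x. \<Sum>i\<in>I. f i x) x = (\<Sum>i\<in>I. pd v (f i) x)"
proof -
 have "((%x. \<Sum>i\<in>I. f i x) has_derivative (%v. \<Sum>i\<in>I. pd v (f i) x)) (at x)"
  using assms by (intro has_derivative_sum differentiable_has_derivative_pd)
 then show ?thesis using pd_eqI by blast
qed

lemma pd_real_comp:
 fixes F :: "real => real"
 assumes "(F has_real_derivative F') (at (f x))" "f differentiable at x"
 shows "(%x. F (f x)) differentiable at x" "pd v (%x. F (f x)) x = F' * pd v f x"
proof -
 have "((%x. F (f x)) has_derivative (%v. F' * pd v f x)) (at x)"
  using has_derivative_compose[OF differentiable_has_derivative_pd[OF assms(2)], of F]
   assms(1) by (simp add: has_field_derivative_def)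
 then show "(%x. F (f x)) differentiable at x" "pd v (%x. F (f x)) x = F' * pd v f x"
  using pd_eqI differentiable_def by blast+
qed

lemma pd_lincomb:
 assumes "f differentiable at x"
 shows "pd v f x = (\<Sum>b\<in>Basis. (v \<bullet> b) * pd b f x)"
proof -
 have "linear (%v. pd v f x)"
  using differentiable_has_derivative_pd[OF assms] has_derivative_linear by blast
 then have "pd (\<Sum>b\<in>Basis. (v \<bullet> b) *\<^sub>R b) f x = (\<Sum>b\<in>Basis. (v \<bullet> b) * pd b f x)"
  using linear_sum[of "%v. pd v f x" "%b. (v \<bullet> b) *\<^sub>R b" Basis] linear_cmul[of "%v. pd v f x"]
  by simp
 then show ?thesis by (simp add: euclidean_representation)
qed

lemma pd_vec_comp:
 fixes F :: "'b::euclidean_space => real" and \<Phi> :: "'a::euclidean_space => 'b"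
 assumes F: "F differentiable at (\<Phi> x)" and \<Phi>: "!!b. b \<in> Basis ==> (%x. \<Phi> x \<bullet> b) differentiable at x"
 shows "(%x. F (\<Phi> x)) differentiable at x"
  "pd v (%x. F (\<Phi> x)) x = (\<Sum>b\<in>Basis. pd b F (\<Phi> x) * pd v (%x. \<Phi> x \<bullet> b) x)"
proof -
 define D where "D = (%v. \<Sum>b\<in>Basis. pd v (%x. \<Phi> x \<bullet> b) x *\<^sub>R b)"
 have "(\<Phi> has_derivative D) (at x)"
  unfolding has_derivative_componentwise_within[of \<Phi>]
  using differentiable_has_derivative_pd[OF \<Phi>] by (simp add: D_def)
 then have "((%x. F (\<Phi> x)) has_derivative (%v. pd (D v) F (\<Phi> x))) (at x)"
  using has_derivative_compose differentiable_has_derivative_pd[OF F] by blast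
 moreover have "pd (D v) F (\<Phi> x) = (\<Sum>b\<in>Basis. pd b F (\<Phi> x) * pd v (%x. \<Phi> x \<bullet> b) x)" for v
  by (subst pd_lincomb[OF F]) (simp add: D_def mult.commute)
 ultimately show "(%x. F (\<Phi> x)) differentiable at x"
  "pd v (%x. F (\<Phi> x)) x = (\<Sum>b\<in>Basis. pd b F (\<Phi> x) * pd v (%x. \<Phi> x \<bullet> b) x)"
  using pd_eqI differentiable_def by (blast, metis)
qed

text \<open>The closure of the smooth functions under algebraic operations and compositions is closed
 under differentiation, hence consists of smooth functions.\<close>

inductive smc :: "'a::euclidean_space set => ('a => real) => bool" for S where
 base: "smooth_on S f ==> smc S f"
| add: "smc S f ==> smc S g ==> smc S (%x. f x + g x)"
| mult: "smc S f ==> smc S g ==> smc S (%x. f x * g x)"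
| real_comp: "smooth_on T F ==> smc S f ==> (!!x. x \<in> S ==> f x \<in> T) ==> smc S (%x. F (f x :: real))"
| vec_comp: "smooth_on T F ==> (!!b. b \<in> Basis ==> smc S (%x. \<Phi> x \<bullet> b)) ==> (!!x. x \<in> S ==> \<Phi> x \<in> T)
   ==> smc S (%x. F (\<Phi> x :: 'a))"

lemma smc_sum:
 assumes "finite I" "open S" "!!i. i \<in> I ==> smc S (f i)"
 shows "smc S (%x. \<Sum>i\<in>I. f i x)"
 using assms(1,3)
 by (induction I rule: finite_induct) (simp_all add: smc.base smooth_on_const assms(2) smc.add)

lemma smc_step:
 assumes "open S" "smc S f"
 shows "(\<forall>x\<in>S. f differentiable at x) & (\<forall>b\<in>Basis. \<exists>g. smc S g & (\<forall>x\<in>S. pd b f x = g x))"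
 using assms(2)
proof induction
 case (base f)
 then show ?case using smooth_on_differentiable smc.base smooth_on_pd_Basis by blast
next
 case (add f g)
 show ?case
 proof (intro conjI ballI)
  fix b :: 'a assume "b \<in> Basis"
  then obtain f' g' where "smc S f'" "\<forall>x\<in>S. pd b f x = f' x" "smc S g'" "\<forall>x\<in>S. pd b g x = g' x"
   using add.IH by metis
  then show "\<exists>h. smc S h & (\<forall>x\<in>S. pd b (%x. f x + g x) x = h x)"
   using add.IH by (intro exI[of _ "%x. f' x + g' x"]) (simp add: pd_add smc.add)
 qed (use add.IH in auto)
next
 case (mult f g)
 show ?case
 proof (intro conjI ballI)
  fix b :: 'a assume "b \<in> Basis"
  then obtain f' g' where "smc S f'" "\<forall>x\<in>S. pd b f x = f' x" "smc S g'" "\<forall>x\<in>S. pd b g x = g' x"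
   using mult.IH by metis
  then show "\<exists>h. smc S h & (\<forall>x\<in>S. pd b (%x. f x * g x) x = h x)"
   using mult by (intro exI[of _ "%x. f' x * g x + f x * g' x"]) (simp add: smc.add smc.mult pd_mult)
 qed (use mult.IH in auto)
next
 case (real_comp T F f)
 have D: "(F has_real_derivative pd 1 F (f x)) (at (f x))" if "x \<in> S" for x
 proof -
  have "(F has_derivative (%v. pd v F (f x))) (at (f x))"
   using real_comp smooth_on_differentiable differentiable_has_derivative_pd that by blast
  moreover have "pd v F (f x) = pd 1 F (f x) * v" for v
   using linear_cmul[OF has_derivative_linear[OF calculation], of v 1] by simp
  then have "(%v. pd v F (f x)) = (*) (pd 1 F (f x))"
   by (rule ext)
  ultimately show ?thesis by (simp add: has_field_derivative_def)
 qed
 show ?case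
 proof (intro conjI ballI)
  fix x assume "x \<in> S" then show "(%x. F (f x)) differentiable at x"
   using pd_real_comp(1)[where f=f, OF D] real_comp.IH by blast
 next
  fix b :: 'a assume "b \<in> Basis"
  then obtain f' where "smc S f'" "\<forall>x\<in>S. pd b f x = f' x" using real_comp.IH by metis
  moreover have "smc S (%x. pd 1 F (f x))"
   using real_comp by (intro smc.real_comp[of T "pd 1 F"] smooth_on_pd_Basis) auto
  ultimately have "smc S (%x. pd 1 F (f x) * f' x)" by (intro smc.mult)
  moreover have "\<forall>x\<in>S. pd b (%x. F (f x)) x = pd 1 F (f x) * f' x"
   using pd_real_comp(2)[where f=f, OF D] real_comp.IH \<open>\<forall>x\<in>S. pd b f x = f' x\<close> by simp
  ultimately show "\<exists>h. smc S h & (\<forall>x\<in>S. pd b (%x. F (f x)) x = h x)" by blast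
 qed
next
 case (vec_comp T F \<Phi>)
 have D: "F differentiable at (\<Phi> x)" if "x \<in> S" for x
  using vec_comp smooth_on_differentiable that by blast
 show ?case
 proof (intro conjI ballI)
  fix x assume "x \<in> S" then show "(%x. F (\<Phi> x)) differentiable at x"
   using pd_vec_comp(1)[where F=F and \<Phi>=\<Phi>, OF D] vec_comp.IH by blast
 next
  fix b :: 'a assume "b \<in> Basis"
  then have "\<forall>c\<in>Basis. \<exists>g. smc S g & (\<forall>x\<in>S. pd b (%x. \<Phi> x \<bullet> c) x = g x)" using vec_comp.IH by blast
  then obtain g where g: "!!c. c \<in> Basis ==> smc S (g c)"
   "!!c x. c \<in> Basis ==> x \<in> S ==> pd b (%x. \<Phi> x \<bullet> c) x = g c x" by metis
  have "smc S (%x. pd c F (\<Phi> x))" if "c \<in> Basis" for c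
   by (rule smc.vec_comp[of T "pd c F"]) (use vec_comp that smooth_on_pd_Basis in auto)
  then have "smc S (%x. \<Sum>c\<in>Basis. pd c F (\<Phi> x) * g c x)"
   by (intro smc_sum finite_Basis assms smc.mult g)
  moreover have "\<forall>x\<in>S. pd b (%x. F (\<Phi> x)) x = (\<Sum>c\<in>Basis. pd c F (\<Phi> x) * g c x)"
   using vec_comp.IH by (simp add: pd_vec_comp(2) D g(2))
  ultimately show "\<exists>h. smc S h & (\<forall>x\<in>S. pd b (%x. F (\<Phi> x)) x = h x)" by blast
 qed
qed

lemma smc_smooth: "open S ==> smc S f ==> smooth_on S f"
 by (rule smooth_on_coinduct[where P = "smc S"]) (use smc_step in blast)+

lemma smooth_on_add: "smooth_on S f ==> smooth_on S g ==> smooth_on S (%x. f x + g x)"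
 and smooth_on_mult: "smooth_on S f ==> smooth_on S g ==> smooth_on S (%x. f x * g x)"
 and smooth_on_real_comp:
  "smooth_on T F ==> smooth_on S f ==> (!!x. x \<in> S ==> f x \<in> T) ==> smooth_on S (%x. F (f x :: real))"
proof -
 show "smooth_on S f ==> smooth_on S g ==> smooth_on S (%x. f x + g x)"
  by (rule smc_smooth[OF smooth_on_open smc.add[OF smc.base smc.base]])
 show "smooth_on S f ==> smooth_on S g ==> smooth_on S (%x. f x * g x)"
  by (rule smc_smooth[OF smooth_on_open smc.mult[OF smc.base smc.base]])
 show "smooth_on T F ==> smooth_on S f ==> (!!x. x \<in> S ==> f x \<in> T) ==> smooth_on S (%x. F (f x))"
  using smc_smooth[OF _ smc.real_comp[of T F S f]] smc.base[of S f] smooth_on_open by blast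
qed

lemma smooth_on_vec_comp:
 fixes \<Phi> :: "'a::euclidean_space => 'a"
 assumes "open S" "smooth_on T F" "!!b. b \<in> Basis ==> smooth_on S (%x. \<Phi> x \<bullet> b)" "!!x. x \<in> S ==> \<Phi> x \<in> T"
 shows "smooth_on S (%x. F (\<Phi> x))"
 by (rule smc_smooth[OF assms(1) smc.vec_comp[of T F]]) (use assms smc.base in auto)

lemma smooth_on_cmult: "smooth_on S f ==> smooth_on S (%x. c * f x)"
 using smooth_on_mult[OF smooth_on_const[of S c]] smooth_on_open by blast

lemma smooth_on_minus: "smooth_on S f ==> smooth_on S (%x. - f x)"
 using smooth_on_cmult[of S f "-1"] by simp

lemma smooth_on_diff: "smooth_on S f ==> smooth_on S g ==> smooth_on S (%x. f x - g x)"
 using smooth_on_add[OF _ smooth_on_minus, of S f g] by simp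

lemma smooth_on_sum:
 assumes "finite I" "open S" "!!i. i \<in> I ==> smooth_on S (f i)"
 shows "smooth_on S (%x. \<Sum>i\<in>I. f i x)"
 by (rule smc_smooth[OF assms(2) smc_sum[OF assms(1,2) smc.base]]) (fact assms(3))

lemma smooth_on_power: "smooth_on S f ==> smooth_on S (%x. f x ^ n)"
 by (induction n) (simp_all add: smooth_on_mult smooth_on_const smooth_on_open)

lemma smooth_on_pd:
 assumes "smooth_on S u"
 shows "smooth_on S (pd v u)"
proof -
 have "smooth_on S (%x. \<Sum>b\<in>Basis. (v \<bullet> b) * pd b u x)"
  by (intro smooth_on_sum smooth_on_cmult smooth_on_pd_Basis[OF assms] finite_Basis smooth_on_open[OF assms])
 then show ?thesis
  by (rule smooth_on_cong) (simp add: pd_lincomb[OF smooth_on_differentiable[OF assms], of _ v])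
qed

lemma smooth_on_continuous: "smooth_on S u ==> continuous_on S u"
 by (meson continuous_at_imp_continuous_on differentiable_imp_continuous_within smooth_on_differentiable)

lemma pd_real_DERIV: "(F has_real_derivative d) (at x) ==> pd 1 F x = d"
 using pd_eqI[of F "(*) d" x 1] by (simp add: has_field_derivative_def)


text \<open>The finite linear combinations of the family form a class closed under differentiation.
  Two summands are allowed in the derivative because the flat functions \<open>exp_bump\<close> need
  both.\<close>

lemma smooth_on_real_family:
 fixes F :: "'i => real => real"
 assumes "open S" and D: "!!i. \<exists>j k c d. \<forall>x\<in>S. (F i has_real_derivative c * F j x + d * F k x) (at x)"
 shows "smooth_on S (F i)"
proof (rule smooth_on_coinduct[where P = "%f. \<exists>I c. finite I & (\<forall>x\<in>S. f x = (\<Sum>i\<in>I. c i * F i x))"])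
 show "\<exists>I c. finite I & (\<forall>x\<in>S. F i x = (\<Sum>i\<in>I. c i * F i x))"
  by (intro exI[of _ "{i}"] exI[of _ "%_. 1"]) auto
 obtain j k c d where *: "!!i x. x \<in> S ==> (F i has_real_derivative c i * F (j i) x + d i * F (k i) x) (at x)"
  using D by metis
 fix f assume "\<exists>I c. finite I & (\<forall>x\<in>S. f x = (\<Sum>i\<in>I. c i * F i x))"
 then obtain I a where I: "finite I" "!!x. x \<in> S ==> f x = (\<Sum>i\<in>I. a i * F i x)" by blast
 have D: "(f has_real_derivative (\<Sum>i\<in>I. a i * (c i * F (j i) x + d i * F (k i) x))) (at x)" if "x \<in> S" for x
 proof -
  have "((%x. \<Sum>i\<in>I. a i * F i x) has_real_derivative
    (\<Sum>i\<in>I. a i * (c i * F (j i) x + d i * F (k i) x))) (at x)"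
   by (intro derivative_intros DERIV_cmult * that)
  then show ?thesis
   by (rule has_field_derivative_transform_within_open[OF _ \<open>open S\<close> that]) (simp add: I(2))
 qed
 then show "x \<in> S ==> f differentiable at x" for x
  using D[of x] unfolding has_field_derivative_def differentiable_def by blast
 fix b :: real assume "b \<in> Basis"
 then have "b = 1" by simp
 define J where "J = j ` I \<union> k ` I"
 \<comment> \<open>Different indices \<open>i\<close> may share a successor, so the coefficient of
   \<open>F l\<close> gathers all contributions that lead to \<open>l\<close>.\<close>
 define a' where "a' l = (\<Sum>i\<in>I. a i * ((if l = j i then c i else 0) + (if l = k i then d i else 0)))" for l
 have "finite J" using I by (simp add: J_def)
 have "(\<Sum>i\<in>I. a i * (c i * F (j i) x + d i * F (k i) x)) = (\<Sum>l\<in>J. a' l * F l x)" for x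
 proof -
  have "(\<Sum>l\<in>J. a' l * F l x) = (\<Sum>l\<in>J. \<Sum>i\<in>I. a i * ((if l = j i then c i else 0) + (if l = k i then d i else 0)) * F l x)"
   by (simp add: a'_def sum_distrib_right)
  also have "... = (\<Sum>i\<in>I. \<Sum>l\<in>J. a i * ((if l = j i then c i else 0) + (if l = k i then d i else 0)) * F l x)"
   by (rule sum.swap)
  also have "... = (\<Sum>i\<in>I. a i * (c i * F (j i) x + d i * F (k i) x))"
  proof (rule sum.cong[OF refl])
   fix i assume "i \<in> I"
   then have "j i \<in> J" "k i \<in> J" by (auto simp: J_def)
   have "(\<Sum>l\<in>J. a i * ((if l = j i then c i else 0) + (if l = k i then d i else 0)) * F l x)
    = (\<Sum>l\<in>J. (if l = j i then a i * c i * F l x else 0) + (if l = k i then a i * d i * F l x else 0))"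
    by (intro sum.cong) (auto simp: algebra_simps)
   also have "... = a i * (c i * F (j i) x + d i * F (k i) x)"
    using \<open>finite J\<close> \<open>j i \<in> J\<close> \<open>k i \<in> J\<close> by (simp add: sum.distrib sum.delta algebra_simps)
   finally show "(\<Sum>l\<in>J. a i * ((if l = j i then c i else 0) + (if l = k i then d i else 0)) * F l x)
    = a i * (c i * F (j i) x + d i * F (k i) x)" .
  qed
  finally show ?thesis by simp
 qed
 then show "\<exists>g. (\<exists>I c. finite I & (\<forall>x\<in>S. g x = (\<Sum>i\<in>I. c i * F i x))) & (\<forall>x\<in>S. pd b f x = g x)"
  using \<open>finite J\<close> pd_real_DERIV[OF D] \<open>b = 1\<close>
  by (intro exI[of _ "%x. \<Sum>l\<in>J. a' l * F l x"]) auto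
qed (fact assms)

lemma smooth_on_powr: "smooth_on {0<..} (%x::real. x powr a)"
proof (rule smooth_on_real_family[where F = "%a x. x powr a"])
 fix a :: real
 show "\<exists>j k c d. \<forall>x\<in>{0<..}. ((%x. x powr a) has_real_derivative c * x powr j + d * x powr k) (at x)"
  by (intro exI[of _ "a - 1"] exI[of _ a] exI[of _ "0::real"] exI[of _ "a - 1"])
   (auto intro!: derivative_eq_intros)
qed auto


section \<open>Directional derivatives and the symmetry of second derivatives\<close>

lemma pd_scaleR: "f differentiable at x ==> pd (c *\<^sub>R v) f x = c * pd v f x"
 using linear_cmul[OF has_derivative_linear[OF differentiable_has_derivative_pd[of f x]], of c v] by simp

lemma pd_vadd: "f differentiable at x ==> pd (v + w) f x = pd v f x + pd w f x"
 using linear_add[OF has_derivative_linear[OF differentiable_has_derivative_pd[of f x]], of v w] by simp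

lemma pd_vminus: "f differentiable at x ==> pd (- v) f x = - pd v f x"
 using pd_scaleR[of f x "-1" v] by simp

lemma pd_comp:
 assumes "(\<Phi> has_derivative D) (at x)" "F differentiable at (\<Phi> x)"
 shows "(%x. F (\<Phi> x)) differentiable at x" "pd v (%x. F (\<Phi> x)) x = pd (D v) F (\<Phi> x)"
proof -
 have "((%x. F (\<Phi> x)) has_derivative (%v. pd (D v) F (\<Phi> x))) (at x)"
  using has_derivative_compose[OF assms(1) differentiable_has_derivative_pd[OF assms(2)]] .
 then show "(%x. F (\<Phi> x)) differentiable at x" "pd v (%x. F (\<Phi> x)) x = pd (D v) F (\<Phi> x)"
  using pd_eqI[of "%x. F (\<Phi> x)" "%v. pd (D v) F (\<Phi> x)" x v] differentiable_def by blast+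
qed

lemma pd_line_DERIV:
 assumes "f differentiable at (x + s *\<^sub>R v)"
 shows "((%s. f (x + s *\<^sub>R v)) has_real_derivative pd v f (x + s *\<^sub>R v)) (at s)"
proof -
 have "((%s. x + s *\<^sub>R v) has_derivative (%h. h *\<^sub>R v)) (at s)"
  by (auto intro!: derivative_eq_intros)
 from has_derivative_compose[OF this differentiable_has_derivative_pd[OF assms]]
 have "((%s. f (x + s *\<^sub>R v)) has_derivative (%h. h * pd v f (x + s *\<^sub>R v))) (at s)"
  by (simp add: pd_scaleR[OF assms])
 moreover have "(%h. h * pd v f (x + s *\<^sub>R v)) = (*) (pd v f (x + s *\<^sub>R v))" by (simp add: fun_eq_iff)
 ultimately show ?thesis by (simp add: has_field_derivative_def)
qed

text \<open>The mean value theorem is used twice, for the increment in direction \<open>w\<close> as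
  a function of the shift along \<open>v\<close>, and then along \<open>w\<close>. The second
  difference is symmetric in \<open>v\<close> and \<open>w\<close>, which is what
  \<open>pd_commute\<close> exploits.\<close>

lemma mixed_difference_MVT:
 assumes u: "smooth_on S u" and "h > 0"
  and S: "!!s t. 0 <= s ==> s <= h ==> 0 <= t ==> t <= h ==> x + s *\<^sub>R v + t *\<^sub>R w \<in> S"
 shows "\<exists>s t. 0 < s & s < h & 0 < t & t < h \<and>
  u (x + h *\<^sub>R v + h *\<^sub>R w) - u (x + h *\<^sub>R v) - u (x + h *\<^sub>R w) + u x
   = h * h * pd w (pd v u) (x + s *\<^sub>R v + t *\<^sub>R w)"
proof -
 have "\<exists>s>0. s < h & (u (x + h *\<^sub>R w + h *\<^sub>R v) - u (x + h *\<^sub>R v)) - (u (x + h *\<^sub>R w + 0 *\<^sub>R v) - u (x + 0 *\<^sub>R v)) =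
  (h - 0) * (pd v u (x + h *\<^sub>R w + s *\<^sub>R v) - pd v u (x + s *\<^sub>R v))"
 proof (rule MVT2)
  fix s :: real assume "0 <= s" "s <= h"
  then have "x + h *\<^sub>R w + s *\<^sub>R v \<in> S" "x + s *\<^sub>R v \<in> S"
   using S[of s h] S[of s 0] \<open>h > 0\<close> by (auto simp: algebra_simps)
  then show "((%s. u (x + h *\<^sub>R w + s *\<^sub>R v) - u (x + s *\<^sub>R v)) has_real_derivative
    pd v u (x + h *\<^sub>R w + s *\<^sub>R v) - pd v u (x + s *\<^sub>R v)) (at s)"
   by (intro DERIV_diff pd_line_DERIV smooth_on_differentiable[OF u])
 qed fact
 then obtain s where s: "0 < s" "s < h"
  "u (x + h *\<^sub>R w + h *\<^sub>R v) - u (x + h *\<^sub>R v) - (u (x + h *\<^sub>R w) - u x) =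
   h * (pd v u (x + h *\<^sub>R w + s *\<^sub>R v) - pd v u (x + s *\<^sub>R v))" by auto
 have "\<exists>t>0. t < h & pd v u (x + s *\<^sub>R v + h *\<^sub>R w) - pd v u (x + s *\<^sub>R v + 0 *\<^sub>R w)
   = (h - 0) * pd w (pd v u) (x + s *\<^sub>R v + t *\<^sub>R w)"
  by (rule MVT2[OF \<open>h > 0\<close>])
   (intro pd_line_DERIV smooth_on_differentiable[OF smooth_on_pd[OF u]] S, use s in auto)
 then obtain t where t: "0 < t" "t < h"
  "pd v u (x + s *\<^sub>R v + h *\<^sub>R w) - pd v u (x + s *\<^sub>R v) = h * pd w (pd v u) (x + s *\<^sub>R v + t *\<^sub>R w)"
  by auto
 show ?thesis
  using s t by (intro exI[of _ s] exI[of _ t]) (simp add: add.assoc add.commute add.left_commute)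
qed

lemma pd_commute:
 assumes u: "smooth_on S u" and x: "x \<in> S"
 shows "pd v (pd w u) x = pd w (pd v u) x"
proof -
 have "\<bar>pd v (pd w u) x - pd w (pd v u) x\<bar> <= e" if "e > 0" for e
 proof -
  have "open S" using u smooth_on_open by blast
  have c: "isCont (pd v (pd w u)) x" "isCont (pd w (pd v u)) x"
   using smooth_on_continuous[OF smooth_on_pd[OF smooth_on_pd[OF u]]] x \<open>open S\<close> continuous_on_eq_continuous_at by blast+
  obtain d1 where d1: "d1 > 0" "!!y. dist y x < d1 ==> dist (pd v (pd w u) y) (pd v (pd w u) x) < e/2"
   using c(1) \<open>e > 0\<close> unfolding continuous_at_eps_delta by (metis half_gt_zero)
  obtain d2 where d2: "d2 > 0" "!!y. dist y x < d2 ==> dist (pd w (pd v u) y) (pd w (pd v u) x) < e/2"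
   using c(2) \<open>e > 0\<close> unfolding continuous_at_eps_delta by (metis half_gt_zero)
  obtain d3 where d3: "d3 > 0" "ball x d3 \<subseteq> S" using \<open>open S\<close> x open_contains_ball by blast
  define d where "d = min d1 (min d2 d3)"
  \<comment> \<open>Small enough that the parallelogram spanned by \<open>h *\<^sub>R v\<close> and
    \<open>h *\<^sub>R w\<close> at \<open>x\<close> stays in the ball of radius \<open>d\<close>;
    the summand 1 covers vanishing directions.\<close>
  define h where "h = d / (2 * (norm v + norm w + 1))"
  have "d > 0" "h > 0" using d1 d2 d3 by (auto simp: d_def h_def add_nonneg_pos)
  have near: "dist (x + s *\<^sub>R v + t *\<^sub>R w) x < d" if "0 <= s" "s <= h" "0 <= t" "t <= h" for s t
  proof -
   have "dist (x + s *\<^sub>R v + t *\<^sub>R w) x = norm (s *\<^sub>R v + t *\<^sub>R w)" by (simp add: dist_norm)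
   also have "... <= s * norm v + t * norm w"
    using norm_triangle_ineq[of "s *\<^sub>R v" "t *\<^sub>R w"] that by simp
   also have "... <= h * norm v + h * norm w" by (intro add_mono mult_right_mono) (use that in auto)
   also have "... <= h * (norm v + norm w + 1)" using \<open>h > 0\<close> by (simp add: algebra_simps)
   also have "... = d / 2" unfolding h_def using add_nonneg_pos[of "norm v + norm w" 1] by (simp add: field_simps)
   also have "... < d" using \<open>d > 0\<close> by simp
   finally show ?thesis .
  qed
  have inS: "x + s *\<^sub>R v + t *\<^sub>R w \<in> S" "x + t *\<^sub>R w + s *\<^sub>R v \<in> S"
   if "0 <= s" "s <= h" "0 <= t" "t <= h" for s t
   using near[OF that] d3 by (auto simp: d_def dist_commute subset_iff algebra_simps)
  obtain s t where 1: "0 < s" "s < h" "0 < t" "t < h"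
   "u (x + h *\<^sub>R v + h *\<^sub>R w) - u (x + h *\<^sub>R v) - u (x + h *\<^sub>R w) + u x
    = h * h * pd w (pd v u) (x + s *\<^sub>R v + t *\<^sub>R w)"
   using mixed_difference_MVT[OF u \<open>h > 0\<close> inS(1)] by blast
  obtain s' t' where 2: "0 < s'" "s' < h" "0 < t'" "t' < h"
   "u (x + h *\<^sub>R w + h *\<^sub>R v) - u (x + h *\<^sub>R w) - u (x + h *\<^sub>R v) + u x
    = h * h * pd v (pd w u) (x + s' *\<^sub>R w + t' *\<^sub>R v)"
   using mixed_difference_MVT[OF u \<open>h > 0\<close> inS(2)] by blast
  have "h * h * pd w (pd v u) (x + s *\<^sub>R v + t *\<^sub>R w) = h * h * pd v (pd w u) (x + s' *\<^sub>R w + t' *\<^sub>R v)"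
  proof -
   have "x + h *\<^sub>R w + h *\<^sub>R v = x + h *\<^sub>R v + h *\<^sub>R w" by (simp add: algebra_simps)
   from 1(5) 2(5)[unfolded this] show ?thesis by linarith
  qed
  then have eq: "pd w (pd v u) (x + s *\<^sub>R v + t *\<^sub>R w) = pd v (pd w u) (x + t' *\<^sub>R v + s' *\<^sub>R w)"
   using \<open>h > 0\<close> by (simp add: add.commute add.left_commute)
  have "dist (pd v (pd w u) (x + t' *\<^sub>R v + s' *\<^sub>R w)) (pd v (pd w u) x) < e/2"
   using near[of t' s'] 2 d1(2) by (simp add: d_def)
  moreover have "dist (pd w (pd v u) (x + s *\<^sub>R v + t *\<^sub>R w)) (pd w (pd v u) x) < e/2"
   using near[of s t] 1 d2(2) by (simp add: d_def)
  ultimately show ?thesis using eq by (simp add: dist_real_def abs_if split: if_splits)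
 qed
 then have "\<bar>pd v (pd w u) x - pd w (pd v u) x\<bar> <= 0"
  by (meson dense_ge)
 then show ?thesis by simp
qed

subsection \<open>The Laplacian\<close>

lemma laplacian_pd: "laplacian u x = (\<Sum>b\<in>Basis. pd b (pd b u) x)"
 by (simp add: laplacian_def)

lemma smooth_on_laplacian: "smooth_on S u ==> smooth_on S (laplacian u)"
 unfolding laplacian_def
 by (intro smooth_on_sum finite_Basis smooth_on_iter_partial) (auto dest: smooth_on_open)

lemma laplacian_cong_open:
 assumes "open S" "x \<in> S" "!!y. y \<in> S ==> f y = g y"
 shows "laplacian f x = laplacian g x"
 unfolding laplacian_pd
 by (intro sum.cong refl pd_cong_open[OF assms(1,2)] pd_cong_open[OF assms(1)] assms(3))

lemma iter_partial_cong_open: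
 assumes "open S" "x \<in> S" "!!y. y \<in> S ==> f y = g y"
 shows "iter_partial bs f x = iter_partial bs g x"
 using assms(2)
proof (induction bs arbitrary: x)
 case (Cons b bs)
 show ?case unfolding iter_partial_pd
  by (rule pd_cong_open[OF assms(1) Cons.prems]) (rule Cons.IH)
qed (simp add: assms)

lemma laplacian_add:
 assumes f: "smooth_on S f" and g: "smooth_on S g" and x: "x \<in> S"
 shows "laplacian (%x. f x + g x) x = laplacian f x + laplacian g x"
proof -
 note o = smooth_on_open[OF f]
 have "pd b (pd b (%x. f x + g x)) x = pd b (pd b f) x + pd b (pd b g) x" for b
 proof -
  have "pd b (pd b (%x. f x + g x)) x = pd b (%x. pd b f x + pd b g x) x"
   by (rule pd_cong_open[OF o x]) (intro pd_add smooth_on_differentiable[OF f] smooth_on_differentiable[OF g])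
  also have "... = pd b (pd b f) x + pd b (pd b g) x"
   by (intro pd_add smooth_on_differentiable[OF smooth_on_pd[OF f]] smooth_on_differentiable[OF smooth_on_pd[OF g]] x)
  finally show ?thesis .
 qed
 then show ?thesis by (simp add: laplacian_pd sum.distrib)
qed

lemma laplacian_cmult:
 assumes f: "smooth_on S f" and x: "x \<in> S"
 shows "laplacian (%x. c * f x) x = c * laplacian f x"
proof -
 note o = smooth_on_open[OF f]
 have "pd b (pd b (%x. c * f x)) x = c * pd b (pd b f) x" for b
 proof -
  have "pd b (pd b (%x. c * f x)) x = pd b (%x. c * pd b f x) x"
   by (rule pd_cong_open[OF o x]) (intro pd_cmult smooth_on_differentiable[OF f])
  also have "... = c * pd b (pd b f) x"
   by (intro pd_cmult smooth_on_differentiable[OF smooth_on_pd[OF f]] x)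
  finally show ?thesis .
 qed
 then show ?thesis by (simp add: laplacian_pd sum_distrib_left)
qed

lemma laplacian_minus:
 assumes f: "smooth_on S f" and x: "x \<in> S"
 shows "laplacian (%x. - f x) x = - laplacian f x"
 using laplacian_cmult[OF assms, of "-1"] by simp

lemma laplacian_diff:
 assumes f: "smooth_on S f" and g: "smooth_on S g" and x: "x \<in> S"
 shows "laplacian (%x. f x - g x) x = laplacian f x - laplacian g x"
 using laplacian_add[OF f smooth_on_minus[OF g] x] laplacian_minus[OF g x] by simp

lemma laplacian_const [simp]: "laplacian (%x. c) x = 0"
proof -
 have "pd b (%x. c) = (%x::'a. 0)" for b by auto
 then show ?thesis by (simp add: laplacian_pd)
qed

lemma laplacian_real_comp:
 assumes f: "smooth_on S f" and x: "x \<in> S" and T: "!!x. x \<in> S ==> f x \<in> T"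
  and F: "!!t. t \<in> T ==> (F has_real_derivative F1 t) (at t)"
   "!!t. t \<in> T ==> (F1 has_real_derivative F2 t) (at t)"
 shows "laplacian (%x. F (f x)) x = F1 (f x) * laplacian f x + F2 (f x) * (\<Sum>b\<in>Basis. (pd b f x)\<^sup>2)"
proof -
 note o = smooth_on_open[OF f]
 note c1 = pd_real_comp[where F=F and f=f, OF F(1)[OF T] smooth_on_differentiable[OF f]]
 note c2 = pd_real_comp[where F=F1 and f=f, OF F(2)[OF T] smooth_on_differentiable[OF f]]
 have "pd b (pd b (%x. F (f x))) x = F1 (f x) * pd b (pd b f) x + F2 (f x) * (pd b f x)\<^sup>2" for b
 proof -
  have "pd b (pd b (%x. F (f x))) x = pd b (%x. F1 (f x) * pd b f x) x"
   by (rule pd_cong_open[OF o x]) (rule c1(2))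
  also have "... = pd b (%x. F1 (f x)) x * pd b f x + F1 (f x) * pd b (pd b f) x"
   by (rule pd_mult[OF c2(1)[OF x x] smooth_on_differentiable[OF smooth_on_pd[OF f] x]])
  also have "pd b (%x. F1 (f x)) x = F2 (f x) * pd b f x"
   by (rule c2(2)[OF x x])
  finally show ?thesis by (simp add: power2_eq_square)
 qed
 then show ?thesis by (simp add: laplacian_pd sum_distrib_left sum.distrib)
qed

lemma laplacian_pd_commute:
 assumes u: "smooth_on S u" and x: "x \<in> S"
 shows "laplacian (pd v u) x = pd v (laplacian u) x"
proof -
 note o = smooth_on_open[OF u]
 have "pd b (pd b (pd v u)) x = pd v (pd b (pd b u)) x" for b
 proof -
  have "pd b (pd b (pd v u)) x = pd b (pd v (pd b u)) x"
   by (rule pd_cong_open[OF o x]) (rule pd_commute[OF u])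
  also have "... = pd v (pd b (pd b u)) x"
   by (rule pd_commute[OF smooth_on_pd[OF u] x])
  finally show ?thesis .
 qed
 moreover have "pd v (laplacian u) x = (\<Sum>b\<in>Basis. pd v (pd b (pd b u)) x)"
 proof -
  have "laplacian u = (%x. \<Sum>b\<in>Basis. pd b (pd b u) x)" by (rule ext) (rule laplacian_pd)
  then show ?thesis
   using pd_sum[of Basis "%b. pd b (pd b u)" x v] smooth_on_differentiable[OF smooth_on_pd[OF smooth_on_pd[OF u]] x]
   by simp
 qed
 ultimately show ?thesis by (simp add: laplacian_pd)
qed

lemma laplacian_iter_partial_commute:
 assumes u: "smooth_on S u" and x: "x \<in> S" and "set bs \<subseteq> Basis"
 shows "laplacian (iter_partial bs u) x = iter_partial bs (laplacian u) x"
 using x assms(3)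
proof (induction bs arbitrary: x)
 case (Cons b bs)
 have "smooth_on S (iter_partial bs u)" using Cons.prems u by (intro smooth_on_iter_partial) auto
 then have "laplacian (iter_partial (b # bs) u) x = pd b (laplacian (iter_partial bs u)) x"
  using laplacian_pd_commute Cons.prems by simp
 also have "... = pd b (iter_partial bs (laplacian u)) x"
  by (rule pd_cong_open[OF smooth_on_open[OF u] Cons.prems(1)]) (rule Cons.IH, use Cons.prems in auto)
 finally show ?case by simp
qed simp

lemma has_derivative_norm_sq: "((%x. (x - a) \<bullet> (x - a)) has_derivative (%h. 2 * (h \<bullet> (x - a)))) (at x)"
 by (auto intro!: derivative_eq_intros simp: inner_commute algebra_simps)

lemma smooth_on_norm_sq:
 assumes "open S" shows "smooth_on S (%x. (x - a) \<bullet> (x - a))"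
proof -
 have "smooth_on S (%x. \<Sum>b\<in>Basis. (x \<bullet> b - a \<bullet> b) * (x \<bullet> b - a \<bullet> b))"
  by (intro smooth_on_sum finite_Basis assms smooth_on_mult smooth_on_diff smooth_on_coord smooth_on_const)
 moreover have "(x - a) \<bullet> (x - a) = (\<Sum>b\<in>Basis. (x \<bullet> b - a \<bullet> b) * (x \<bullet> b - a \<bullet> b))" for x
  by (subst euclidean_inner) (simp add: inner_diff_left)
 ultimately show ?thesis by simp
qed

lemma pd_norm_sq: "pd v (%x. (x - a) \<bullet> (x - a)) x = 2 * (v \<bullet> (x - a))"
 using pd_eqI[OF has_derivative_norm_sq] .

lemma laplacian_norm_sq: "laplacian (%x::'a::euclidean_space. (x - a) \<bullet> (x - a)) x = 2 * DIM('a)"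
proof -
 have "pd b (pd b (%x::'a. (x - a) \<bullet> (x - a))) x = 2" if "b \<in> Basis" for b
 proof -
  have "pd b (%x::'a. (x - a) \<bullet> (x - a)) = (%x. 2 * (b \<bullet> (x - a)))" by (rule ext) (rule pd_norm_sq)
  moreover have "((%x. 2 * (b \<bullet> (x - a))) has_derivative (%h. 2 * (b \<bullet> h))) (at x)"
   by (auto intro!: derivative_eq_intros)
  ultimately show ?thesis using that by (simp add: pd_eqI)
 qed
 then show ?thesis by (simp add: laplacian_pd)
qed

subsection \<open>Maximum principle\<close>

text \<open>Along the line through \<open>x\<close> the first derivative vanishes at the minimum. A
  negative second derivative would make it negative just to the right, and the mean value theorem
  would produce a smaller value.\<close>

lemma pd_pd_nonneg_at_min:
 assumes Z: "smooth_on S Z" and x: "x \<in> S" and min: "!!y. y \<in> S ==> Z x <= Z y"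
 shows "pd v (pd v Z) x >= 0"
proof (rule ccontr)
 assume neg: "\<not> pd v (pd v Z) x >= 0"
 define f where "f s = Z (x + s *\<^sub>R v)" for s
 define f' where "f' s = pd v Z (x + s *\<^sub>R v)" for s
 have "v \<noteq> 0" using neg pd_scaleR[of "pd v Z" x 0 v] smooth_on_differentiable[OF smooth_on_pd[OF Z] x] by auto
 obtain d where d: "d > 0" "ball x d \<subseteq> S" using smooth_on_open[OF Z] x open_contains_ball by blast
 define c where "c = d / norm v"
 have "c > 0" using d \<open>v \<noteq> 0\<close> by (simp add: c_def)
 have inS: "x + s *\<^sub>R v \<in> S" if "\<bar>s\<bar> < c" for s
  using that d \<open>v \<noteq> 0\<close> by (auto simp: c_def subset_iff dist_norm field_simps)
 have D1: "(f has_real_derivative f' s) (at s)" if "\<bar>s\<bar> < c" for s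
  unfolding f_def f'_def by (rule pd_line_DERIV) (rule smooth_on_differentiable[OF Z inS[OF that]])
 have D2: "(f' has_real_derivative pd v (pd v Z) (x + s *\<^sub>R v)) (at s)" if "\<bar>s\<bar> < c" for s
  unfolding f'_def by (rule pd_line_DERIV) (rule smooth_on_differentiable[OF smooth_on_pd[OF Z] inS[OF that]])
 have "f' 0 = 0"
 proof (rule DERIV_local_min[OF D1 \<open>c > 0\<close>])
  show "\<forall>y. \<bar>0 - y\<bar> < c --> f 0 <= f y" using min inS by (simp add: f_def)
 qed (use \<open>c > 0\<close> in auto)
 have "\<exists>e>0. \<forall>h>0. h < e --> f' (0 + h) < f' 0"
  by (rule DERIV_neg_dec_right[OF D2]) (use neg \<open>c > 0\<close> in auto)
 then obtain e where e: "e > 0" "!!h. 0 < h ==> h < e ==> f' h < 0" using \<open>f' 0 = 0\<close> by auto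
 define t where "t = min e c / 2"
 have t: "0 < t" "t < e" "t < c" using e(1) \<open>c > 0\<close> by (auto simp: t_def min_def)
 have "\<exists>z>0. z < t & f t - f 0 = (t - 0) * f' z"
  by (rule MVT2) (use t D1 in auto)
 then obtain z where z: "0 < z" "z < t" "f t - f 0 = t * f' z" by auto
 then have "f t < f 0" using e(2)[of z] t mult_pos_neg[of t "f' z"] by simp
 moreover have "f 0 <= f t" using min inS[of t] t by (simp add: f_def)
 ultimately show False by simp
qed

lemma laplacian_nonneg_at_min:
 assumes "smooth_on S Z" and "x \<in> S" and "!!y. y \<in> S ==> Z x <= Z y"
 shows "laplacian Z x >= 0"
 unfolding laplacian_pd by (rule sum_nonneg) (rule pd_pd_nonneg_at_min[OF assms])

text \<open>The data are prescribed on all of \<open>K - R\<close> instead of a frontier, so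
  \<open>R\<close> can later be a level region or a half ball on which a differential inequality
  happens to hold.\<close>

lemma strict_maximum_principle:
 assumes K: "compact K" "R \<subseteq> K" "continuous_on K Z"
  and Z: "smooth_on R Z" "!!x. x \<in> R ==> laplacian Z x < 0"
  and bd: "!!x. x \<in> K - R ==> Z x >= 0" and x: "x \<in> K"
 shows "Z x >= 0" "x \<in> R ==> Z x > 0"
proof -
 obtain y where y: "y \<in> K" "!!z. z \<in> K ==> Z y <= Z z"
  using continuous_attains_inf[OF K(1) _ K(3)] x by blast
 have R: "\<not> (\<forall>y\<in>R. Z z <= Z y)" if "z \<in> R" for z
  using laplacian_nonneg_at_min[OF Z(1) that] Z(2)[OF that] by fastforce
 have "y \<notin> R" using R[of y] y K(2) by blast
 then have "Z y >= 0" using bd y(1) by blast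
 then show *: "Z x >= 0" using y(2)[OF x] by simp
 show "Z x > 0" if "x \<in> R"
 proof (rule ccontr)
  assume "\<not> Z x > 0"
  then show False using R[OF that] y(2) K(2) \<open>Z y >= 0\<close> by force
 qed
qed

text \<open>Adding a small multiple of the paraboloid \<open>q\<close>, which is nonnegative on
  \<open>K\<close> and has strictly negative Laplacian, reduces to the strict case; the multiple
  then tends to zero. The paraboloid is centred at the point under consideration.\<close>

lemma maximum_principle:
 fixes Z :: "'a::euclidean_space => real"
 assumes K: "compact K" "R \<subseteq> K" "continuous_on K Z"
  and Z: "smooth_on R Z" "!!x. x \<in> R ==> laplacian Z x <= 0"
  and bd: "!!x. x \<in> K - R ==> Z x >= 0" and x: "x \<in> K"
 shows "Z x >= 0"
proof -
 note o = smooth_on_open[OF Z(1)]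
 obtain B where B: "B > 0" "K \<subseteq> cball x B"
  using bounded_subset_ballD[OF compact_imp_bounded[OF K(1)], of x] ball_subset_cball by blast
 define q where "q y = B\<^sup>2 - (y - x) \<bullet> (y - x)" for y
 have q: "q y >= 0" if "y \<in> K" for y
  using B that power_mono[of "norm (y - x)" B 2]
  by (auto simp: q_def subset_iff dist_norm norm_minus_commute simp flip: power2_norm_eq_inner)
 have s: "smooth_on R q" unfolding q_def
  by (intro smooth_on_diff smooth_on_const smooth_on_norm_sq o)
 have lq: "laplacian q y = - (2 * DIM('a))" if "y \<in> R" for y
  unfolding q_def
  by (subst laplacian_diff[OF smooth_on_const[OF o] smooth_on_norm_sq[OF o] that]) (simp add: laplacian_norm_sq)
 have "Z x + e * q x >= 0" if "e > 0" for e
 proof (rule strict_maximum_principle(1)[where Z = "%x. Z x + e * q x", OF K(1,2) _ _ _ _ x])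
  show "continuous_on K (%x. Z x + e * q x)"
   unfolding q_def by (intro continuous_intros K)
  show "smooth_on R (%x. Z x + e * q x)"
   by (rule smooth_on_add[OF Z(1) smooth_on_cmult[OF s]])
  fix y assume y: "y \<in> R"
  have L: "laplacian (%x. Z x + e * q x) y = laplacian Z y + e * (- (2 * DIM('a)))"
   using laplacian_add[OF Z(1) smooth_on_cmult[OF s] y] laplacian_cmult[OF s y] lq[OF y] by simp
  show "laplacian (%x. Z x + e * q x) y < 0"
  proof -
   have "e * real (2 * DIM('a)) > 0" using \<open>e > 0\<close> by simp
   then show ?thesis using Z(2)[OF y] L by linarith
  qed
 next
  fix y assume "y \<in> K - R"
  then show "Z y + e * q y >= 0"
   using bd[of y] q[of y] \<open>e > 0\<close> by simp
 qed
 then have *: "- Z x <= e * B\<^sup>2" if "e > 0" for e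
  using that by (force simp: q_def)
 have "- Z x <= e" if "e > 0" for e
  using *[of "e / B\<^sup>2"] that B(1) by simp
 then have "- Z x <= 0" by (meson dense_ge)
 then show ?thesis by simp
qed

lemma maximum_principle_abs:
 fixes f g :: "'a::euclidean_space => real"
 assumes K: "compact K" "R \<subseteq> K" "continuous_on K f" "continuous_on K g"
  and s: "smooth_on R f" "smooth_on R g" "!!x. x \<in> R ==> \<bar>laplacian f x\<bar> <= - laplacian g x"
  and bd: "!!x. x \<in> K - R ==> \<bar>f x\<bar> <= g x" and x: "x \<in> K"
 shows "\<bar>f x\<bar> <= g x"
proof -
 have "0 <= g x - f x"
  by (rule maximum_principle[where Z = "%x. g x - f x", OF K(1,2) continuous_on_diff[OF K(4,3)] smooth_on_diff[OF s(2,1)] _ _ x])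
   (use s(3) bd laplacian_diff[OF s(2,1)] in \<open>force simp: abs_le_iff\<close>)+
 moreover have "0 <= g x + f x"
  by (rule maximum_principle[where Z = "%x. g x + f x", OF K(1,2) continuous_on_add[OF K(4,3)] smooth_on_add[OF s(2,1)] _ _ x])
   (use s(3) bd laplacian_add[OF s(2,1)] in \<open>force simp: abs_le_iff\<close>)+
 ultimately show ?thesis by linarith
qed

lemma compact_bound:
 fixes f :: "'a::topological_space => real"
 assumes "compact K" "continuous_on K f"
 obtains B where "B >= 0" "!!x. x \<in> K ==> \<bar>f x\<bar> <= B"
proof -
 obtain B where B: "\<forall>y\<in>f ` K. norm y <= B"
  using compact_imp_bounded[OF compact_continuous_image[OF assms(2,1)]] unfolding bounded_iff by blast
 have "\<bar>f x\<bar> <= max B 0" if "x \<in> K" for x using B that by fastforce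
 then show ?thesis using that[of "max B 0"] by simp
qed


subsection \<open>Interior estimates\<close>

lemma DERIV_zero_bound:
 fixes g :: "real => real"
 assumes D: "(g has_real_derivative D) (at 0)" and "g 0 = 0" "r > 0"
  and b: "!!s. 0 < s ==> s < r ==> \<bar>g s\<bar> <= c * s"
 shows "\<bar>D\<bar> <= c"
proof -
 have "((%h. (g (0 + h) - g 0) / h) \<longlongrightarrow> D) (at 0)" using D by (simp add: DERIV_def)
 then have "((%h. (g (0 + h) - g 0) / h) \<longlongrightarrow> D) (at_right 0)"
  using filterlim_at_split by blast
 then have L: "((%h. \<bar>g h / h\<bar>) \<longlongrightarrow> \<bar>D\<bar>) (at_right 0)"
  using tendsto_rabs \<open>g 0 = 0\<close> by force
 have "eventually (%h. \<bar>g h / h\<bar> <= c) (at_right 0)"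
 proof -
  have "eventually (%h. h \<in> {0<..<r}) (at_right (0::real))"
   using \<open>r > 0\<close> eventually_at_right_real by blast
  then show ?thesis
   by eventually_elim (use b in \<open>auto simp: abs_divide divide_le_eq\<close>)
 qed
 then show ?thesis using tendsto_upperbound[OF L] by simp
qed

text \<open>Comparison on a half ball of the odd part of \<open>w\<close> with a quadratic barrier.\<close>

lemma interior_gradient:
 fixes w :: "'a::euclidean_space => real"
 assumes w: "smooth_on S w" and e: "e \<in> Basis" and r: "r > 0" "cball x0 r \<subseteq> S"
  and b: "!!x. x \<in> cball x0 r ==> \<bar>w x\<bar> <= M" "!!x. x \<in> cball x0 r ==> \<bar>laplacian w x\<bar> <= A"
 shows "\<bar>pd e w x0\<bar> <= (real DIM('a))\<^sup>2 * M / r + A * r"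
proof -
 let ?N = "real DIM('a)"
 have ee: "e \<bullet> e = 1" using e by simp
 have N: "?N >= 1" using DIM_positive[where 'a='a] by (metis One_nat_def Suc_leI of_nat_1 of_nat_le_iff)
 have M: "M >= 0" "A >= 0" using b[of x0] r by force+
 define t where "t x = x \<bullet> e - x0 \<bullet> e" for x
 define \<rho> where "\<rho> x = x - (2 * t x) *\<^sub>R e" for x
 define K where "K = cball x0 r \<inter> {x. 0 <= t x}"
 define R where "R = ball x0 r \<inter> {x. 0 < t x}"
 have ct: "continuous_on T t" for T unfolding t_def by (intro continuous_intros)
 have t_alt: "t x = (x - x0) \<bullet> e" for x by (simp add: t_def inner_diff_left)
 have o: "open R" "compact K" "R \<subseteq> K"
  using open_Int[OF open_ball open_Collect_less[OF continuous_on_const ct]] compact_Int_closed[OF compact_cball closed_Collect_le[OF continuous_on_const ct]]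
  unfolding R_def K_def by auto
 have "norm (\<rho> x - x0) = norm (x - x0)" for x
 proof -
  define d where "d = x - x0"
  have "(d - (2 * (d \<bullet> e)) *\<^sub>R e) \<bullet> (d - (2 * (d \<bullet> e)) *\<^sub>R e) = d \<bullet> d"
   by (simp add: inner_diff_left inner_diff_right inner_commute[of e d] ee)
  moreover have "\<rho> x - x0 = d - (2 * (d \<bullet> e)) *\<^sub>R e" unfolding \<rho>_def t_alt d_def by (simp only: diff_diff_eq add.commute)
  ultimately have "(\<rho> x - x0) \<bullet> (\<rho> x - x0) = (x - x0) \<bullet> (x - x0)" by (simp only: d_def)
  then show ?thesis by (simp add: norm_eq)
 qed
 then have \<rho>K: "\<rho> x \<in> cball x0 r \<longleftrightarrow> x \<in> cball x0 r" for x by (simp add: dist_norm norm_minus_commute)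
 have RK: "x \<in> cball x0 r" if "x \<in> R" for x using that by (simp add: R_def)
 \<comment> \<open>Odd part of \<open>w\<close> under the reflection \<open>\<rho>\<close> in the
   hyperplane t = 0. It vanishes on the flat side of the half ball and has the same derivative along
   \<open>e\<close> at the centre.\<close>
 define \<phi> where "\<phi> x = (1/2) * (w x - w (\<rho> x))" for x
 have sR: "smooth_on R w" by (rule smooth_on_subset[OF w o(1)]) (use RK r in blast)
 have s\<rho>: "smooth_on R (%x. w (\<rho> x))"
 proof (rule smooth_on_vec_comp[OF o(1) w])
  show "smooth_on R (%x. \<rho> x \<bullet> b)" for b
   unfolding \<rho>_def t_def inner_diff_left inner_scaleR_left by (intro smooth_on_diff smooth_on_mult smooth_on_coord smooth_on_const o)
  show "\<rho> x \<in> S" if "x \<in> R" for x using RK[OF that] \<rho>K r by blast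
 qed
 have s\<phi>: "smooth_on R \<phi>" unfolding \<phi>_def by (intro smooth_on_cmult smooth_on_diff sR s\<rho>)
 have D\<rho>: "(\<rho> has_derivative (%h. h - (2 * (h \<bullet> e)) *\<^sub>R e)) (at x)" for x
  unfolding \<rho>_def t_def by (auto intro!: derivative_eq_intros)
 have lap\<rho>: "laplacian (%x. w (\<rho> x)) x = laplacian w (\<rho> x)" if x: "x \<in> R" for x
  unfolding laplacian_pd
 proof (rule sum.cong[OF refl])
  fix b :: 'a assume b: "b \<in> Basis"
  define c :: real where "c = (if b = e then - 1 else 1)"
  have \<sigma>: "b - (2 * (b \<bullet> e)) *\<^sub>R e = c *\<^sub>R b" using b e by (auto simp: c_def inner_Basis scaleR_2)
  have 1: "pd b (%x. f (\<rho> x)) y = c * pd b f (\<rho> y)" if "smooth_on S f" "y \<in> R" for f y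
  proof -
   have d: "f differentiable at (\<rho> y)" by (rule smooth_on_differentiable[OF that(1)]) (use RK[OF that(2)] \<rho>K r in blast)
   show ?thesis using pd_comp(2)[OF D\<rho> d, of b] pd_scaleR[OF d] by (simp add: \<sigma>)
  qed
  have "pd b (pd b (%x. w (\<rho> x))) x = pd b (%x. c * pd b w (\<rho> x)) x"
   by (rule pd_cong_open[OF o(1) x 1[OF w]])
  also have "... = c * (c * pd b (pd b w) (\<rho> x))"
   using 1[OF smooth_on_pd[OF w] x] pd_cmult[OF pd_comp(1)[OF D\<rho> smooth_on_differentiable[OF smooth_on_pd[OF w]]]] RK[OF x] \<rho>K r by (metis subsetD)
  finally show "pd b (pd b (%x. w (\<rho> x))) x = pd b (pd b w) (\<rho> x)" by (simp add: c_def split: if_splits)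
 qed
 have lap\<phi>: "\<bar>laplacian \<phi> x\<bar> <= A" if x: "x \<in> R" for x
 proof -
  have "laplacian \<phi> x = (1/2) * (laplacian w x - laplacian w (\<rho> x))"
   unfolding \<phi>_def using laplacian_cmult[OF smooth_on_diff[OF sR s\<rho>] x, of "1/2"] laplacian_diff[OF sR s\<rho> x] lap\<rho>[OF x] by simp
  then show ?thesis using b(2)[of x] b(2)[of "\<rho> x"] RK[OF x] \<rho>K[of x] by (simp add: abs_le_iff)
 qed
 \<comment> \<open>\<open>c1\<close> makes the barrier reach \<open>M\<close> on the sphere,
   \<open>c3\<close> makes its Laplacian equal to \<open>- A\<close>, and \<open>c2 = c3 * r\<close>
   makes \<open>c2 * t - c3 * t^2\<close> nonnegative for 0 <= t <= r. The resulting slope at the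
   centre is \<open>c2\<close>.\<close>
 define c1 where "c1 = M / r\<^sup>2"
 define c2 where "c2 = ?N * M / r + A * r / 2"
 define c3 where "c3 = ?N * M / r\<^sup>2 + A / 2"
 have c13: "0 <= c1" "c1 <= c3" using M N r mult_right_mono[of 1 ?N "M / r\<^sup>2"] by (auto simp: c1_def c3_def)
 have c23: "c2 = c3 * r" using r by (simp add: c2_def c3_def power2_eq_square field_simps)
 define \<psi> where "\<psi> x = c1 * ((x - x0) \<bullet> (x - x0)) + (c2 * t x - c3 * (t x)\<^sup>2)" for x
 have st: "smooth_on R t" unfolding t_def by (intro smooth_on_diff smooth_on_coord smooth_on_const o)
 have s2: "smooth_on R (%x. c2 * t x - c3 * (t x)\<^sup>2)"
  by (intro smooth_on_diff smooth_on_cmult smooth_on_power st)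
 have s1: "smooth_on R (%x. c1 * ((x - x0) \<bullet> (x - x0)))"
  by (intro smooth_on_cmult smooth_on_norm_sq o)
 have s\<psi>: "smooth_on R \<psi>" unfolding \<psi>_def by (rule smooth_on_add[OF s1 s2])
 have lap\<psi>: "laplacian \<psi> x = - A" if x: "x \<in> R" for x
 proof -
  have pdt: "pd b t = (%x. b \<bullet> e)" for b unfolding t_def
   by (rule ext) (subst pd_diff, auto intro: differentiable_inner)
  then have lt: "laplacian t x = 0" by (simp add: laplacian_pd)
  have "laplacian (%x. (t x)\<^sup>2) x = 2 * t x * laplacian t x + 2 * (\<Sum>b\<in>Basis. (pd b t x)\<^sup>2)"
   by (rule laplacian_real_comp[where T = UNIV and F = "%s. s\<^sup>2" and ?F1.0 = "%s. 2 * s" and ?F2.0 = "%s. 2", OF st x])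
    (auto intro!: derivative_eq_intros)
  also have "(\<Sum>b\<in>Basis. (pd b t x)\<^sup>2) = 1"
   using euclidean_inner[of e e] ee by (simp add: pdt power2_eq_square inner_commute)
  finally have lt2: "laplacian (%x. (t x)\<^sup>2) x = 2" using lt by simp
  have "laplacian (%x. c2 * t x - c3 * (t x)\<^sup>2) x = - 2 * c3"
   using laplacian_diff[OF smooth_on_cmult[OF st] smooth_on_cmult[OF smooth_on_power[OF st]] x, of c2 c3 2]
    laplacian_cmult[OF st x, of c2] laplacian_cmult[OF smooth_on_power[OF st] x, of c3 2] lt lt2 by simp
  moreover have "laplacian (%x. c1 * ((x - x0) \<bullet> (x - x0))) x = c1 * (2 * ?N)"
   using laplacian_cmult[OF smooth_on_norm_sq[OF o(1)] x, of c1 x0] laplacian_norm_sq[of x0 x] by simp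
  ultimately have "laplacian \<psi> x = c1 * (2 * ?N) - 2 * c3"
   unfolding \<psi>_def using laplacian_add[OF s1 s2 x] by simp
  also have "... = - A" by (simp add: c1_def c3_def)
  finally show ?thesis .
 qed
 have \<psi>bd: "\<bar>\<phi> x\<bar> <= \<psi> x" if x: "x \<in> K - R" for x
 proof -
  have xc: "x \<in> cball x0 r" "0 <= t x" "t x = 0 \<or> norm (x - x0) = r"
   using x by (auto simp: K_def R_def dist_norm norm_minus_commute)
  have "t x <= r" using Cauchy_Schwarz_ineq2[of "x - x0" e] e xc(1) by (simp add: t_alt dist_norm norm_minus_commute)
  then have q: "c2 * t x - c3 * (t x)\<^sup>2 >= 0"
   using c23 xc(2) c13 mult_left_mono[of "t x" r "c3 * t x"] by (simp add: power2_eq_square algebra_simps)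
  show ?thesis
  proof (cases "t x = 0")
   case True
   then have "\<phi> x = 0" by (simp add: \<phi>_def \<rho>_def)
   then show ?thesis using True c13 by (simp add: \<psi>_def)
  next
   case False
   then have "(x - x0) \<bullet> (x - x0) = r\<^sup>2" using xc(3) by (simp add: power2_norm_eq_inner[symmetric])
   then have "M <= \<psi> x" using q r by (simp add: \<psi>_def c1_def)
   moreover have "\<bar>\<phi> x\<bar> <= M" using b(1)[of x] b(1)[of "\<rho> x"] xc(1) \<rho>K[of x] by (simp add: \<phi>_def abs_le_iff)
   ultimately show ?thesis by simp
  qed
 qed
 have "continuous_on K \<rho>" unfolding \<rho>_def t_def by (intro continuous_intros)
 then have cw: "continuous_on K \<phi>" unfolding \<phi>_def using r \<rho>K
  by (intro continuous_intros continuous_on_subset[OF smooth_on_continuous[OF w]] continuous_on_compose2[OF smooth_on_continuous[OF w]])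
   (auto simp: K_def simp del: mem_cball)
 have c\<psi>: "continuous_on K \<psi>" unfolding \<psi>_def t_def by (intro continuous_intros)
 have main: "\<bar>\<phi> x\<bar> <= \<psi> x" if "x \<in> K" for x
  by (rule maximum_principle_abs[OF o(2,3) cw c\<psi> s\<phi> s\<psi> _ \<psi>bd that]) (simp_all add: lap\<phi> lap\<psi>)
 have "\<bar>pd e w x0\<bar> <= c2"
 proof (rule DERIV_zero_bound[OF _ _ r(1)])
  have d: "w differentiable at x0" by (rule smooth_on_differentiable[OF w]) (use r in auto)
  have "((%s. (1/2) * (w (x0 + s *\<^sub>R e) - w (x0 + s *\<^sub>R (- e)))) has_real_derivative (1/2) * (pd e w (x0 + 0 *\<^sub>R e) - pd (- e) w (x0 + 0 *\<^sub>R (- e)))) (at 0)"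
   by (rule DERIV_cmult[OF DERIV_diff[OF pd_line_DERIV pd_line_DERIV]]) (use d in auto)
  then show "((%s. (1/2) * (w (x0 + s *\<^sub>R e) - w (x0 + s *\<^sub>R (- e)))) has_real_derivative pd e w x0) (at 0)"
   using pd_vminus[OF d, of e] by simp
  fix s :: real assume s: "0 < s" "s < r"
  have tx: "t (x0 + s *\<^sub>R e) = s" by (simp add: t_def inner_add_left ee)
  have "x0 + s *\<^sub>R e \<in> K" using s e by (simp add: K_def tx dist_norm)
  then have "\<bar>\<phi> (x0 + s *\<^sub>R e)\<bar> <= \<psi> (x0 + s *\<^sub>R e)" by (rule main)
  moreover have "(2 * s) *\<^sub>R e = s *\<^sub>R e + s *\<^sub>R e" using scaleR_left_distrib[of s s e] by simp
  then have "\<rho> (x0 + s *\<^sub>R e) = x0 + s *\<^sub>R (- e)" by (simp add: \<rho>_def tx)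
  moreover have "\<psi> (x0 + s *\<^sub>R e) <= c2 * s"
   using c13 mult_right_mono[OF c13(2), of "s\<^sup>2"] by (simp add: \<psi>_def tx ee power2_eq_square)
  ultimately show "\<bar>(1/2) * (w (x0 + s *\<^sub>R e) - w (x0 + s *\<^sub>R (- e)))\<bar> <= c2 * s"
   unfolding \<phi>_def by simp
 qed simp
 also have "c2 <= ?N\<^sup>2 * M / r + A * r"
 proof -
  have "?N * M / r <= ?N\<^sup>2 * M / r" unfolding power2_eq_square using N M r by (intro divide_right_mono mult_right_mono) auto
  moreover have "A * r / 2 <= A * r" using mult_nonneg_nonneg[OF M(2) less_imp_le[OF r(1)]] by simp
  ultimately show ?thesis unfolding c2_def by linarith
 qed
 finally show ?thesis .
qed

lemma pd_pd_bound:
 fixes g :: "'a::euclidean_space => real"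
 assumes g: "smooth_on S g" and z: "z \<in> S"
  and M: "!!b c. b \<in> Basis ==> c \<in> Basis ==> \<bar>pd b (pd c g) z\<bar> <= M"
 shows "\<bar>pd v (pd v g) z\<bar> <= (real DIM('a))\<^sup>2 * M * (norm v)\<^sup>2"
proof -
 note o = smooth_on_open[OF g]
 have d: "pd c g differentiable at z" for c using smooth_on_differentiable[OF smooth_on_pd[OF g] z] .
 have 1: "pd b (pd v g) z = (\<Sum>c\<in>Basis. (v \<bullet> c) * pd b (pd c g) z)" for b
 proof -
  have "pd b (pd v g) z = pd b (%y. \<Sum>c\<in>Basis. (v \<bullet> c) * pd c g y) z"
   by (rule pd_cong_open[OF o z]) (rule pd_lincomb[OF smooth_on_differentiable[OF g]])
  also have "... = (\<Sum>c\<in>Basis. pd b (%y. (v \<bullet> c) * pd c g y) z)"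
   by (rule pd_sum) (intro differentiable_mult d differentiable_const)
  also have "... = (\<Sum>c\<in>Basis. (v \<bullet> c) * pd b (pd c g) z)"
   by (intro sum.cong refl pd_cmult d)
  finally show ?thesis .
 qed
 have "M >= 0" using M SOME_Basis by force
 have "pd v (pd v g) z = (\<Sum>b\<in>Basis. (v \<bullet> b) * pd b (pd v g) z)"
  by (rule pd_lincomb[OF d])
 also have "... = (\<Sum>b\<in>Basis. \<Sum>c\<in>Basis. (v \<bullet> b) * ((v \<bullet> c) * pd b (pd c g) z))"
  by (simp add: 1 sum_distrib_left)
 also have "\<bar>...\<bar> <= (\<Sum>b\<in>(Basis::'a set). \<Sum>c\<in>(Basis::'a set). norm v * (norm v * M))"
  by (rule order.trans[OF sum_abs], rule sum_mono, rule order.trans[OF sum_abs], rule sum_mono)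
   (auto simp: abs_mult intro!: mult_mono M Basis_le_norm \<open>M >= 0\<close>)
 also have "... = (real DIM('a))\<^sup>2 * M * (norm v)\<^sup>2" by (simp add: power2_eq_square)
 finally show ?thesis .
qed

lemma taylor2:
 fixes g :: "'a::euclidean_space => real"
 assumes g: "smooth_on S g" and "ball x d \<subseteq> S" and y: "y \<in> ball x d"
  and M: "!!b c z. b \<in> Basis ==> c \<in> Basis ==> z \<in> ball x d ==> \<bar>pd b (pd c g) z\<bar> <= M"
 shows "\<bar>g y - g x - pd (y - x) g x\<bar> <= (real DIM('a))\<^sup>2 * M * (norm (y - x))\<^sup>2"
proof -
 define v where "v = y - x"
 have inb: "x + s *\<^sub>R v \<in> ball x d" if "0 <= s" "s <= 1" for s
 proof -
  have "norm (s *\<^sub>R v) <= 1 * norm v" using that mult_right_mono[of s 1 "norm v"] by simp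
  then show ?thesis using y by (simp add: v_def dist_norm norm_minus_commute)
 qed
 have inS: "x + s *\<^sub>R v \<in> S" if "0 <= s" "s <= 1" for s using inb[OF that] assms(2) by blast
 have "\<exists>s>0. s < 1 & g (x + 1 *\<^sub>R v) - g (x + 0 *\<^sub>R v) = (1 - 0) * pd v g (x + s *\<^sub>R v)"
  by (rule MVT2) (auto intro!: pd_line_DERIV smooth_on_differentiable[OF g] inS)
 then obtain s where s: "0 < s" "s < 1" "g y - g x = pd v g (x + s *\<^sub>R v)" by (auto simp: v_def)
 have "\<exists>q>0. q < s & pd v g (x + s *\<^sub>R v) - pd v g (x + 0 *\<^sub>R v) = (s - 0) * pd v (pd v g) (x + q *\<^sub>R v)"
  by (rule MVT2) (use s in \<open>auto intro!: pd_line_DERIV smooth_on_differentiable[OF smooth_on_pd[OF g]] inS\<close>)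
 then obtain q where q: "0 < q" "q < s" "pd v g (x + s *\<^sub>R v) - pd v g x = s * pd v (pd v g) (x + q *\<^sub>R v)" by auto
 have "\<bar>g y - g x - pd v g x\<bar> = s * \<bar>pd v (pd v g) (x + q *\<^sub>R v)\<bar>"
  using s q by (simp add: abs_mult)
 also have "... <= 1 * \<bar>pd v (pd v g) (x + q *\<^sub>R v)\<bar>" using s by (intro mult_right_mono) auto
 also have "... <= (real DIM('a))\<^sup>2 * M * (norm v)\<^sup>2"
  using pd_pd_bound[OF g inS[of q], of M v] M inb[of q] s q by simp
 finally show ?thesis by (simp add: v_def)
qed

subsection \<open>Limits of smooth functions\<close>

text \<open>The bound is asked only from some index on, which may depend on the point: a mollified
  function satisfies the mollified equation near a point only once the mollifier is small
  enough.\<close>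

definition loc_bounded :: "'a::euclidean_space set => (nat => 'a => real) => bool" where
 "loc_bounded S w \<longleftrightarrow> (\<forall>x\<in>S. \<exists>d>0. \<exists>M n0. ball x d \<subseteq> S & (\<forall>n\<ge>n0. \<forall>y\<in>ball x d. \<bar>w n y\<bar> <= M))"

lemma loc_bounded_pd:
 fixes w :: "nat => 'a::euclidean_space => real"
 assumes w: "!!n. smooth_on S (w n)" and b: "loc_bounded S w" "loc_bounded S (%n. laplacian (w n))"
  and e: "e \<in> Basis"
 shows "loc_bounded S (%n. pd e (w n))"
 unfolding loc_bounded_def
proof
 fix x assume x: "x \<in> S"
 obtain d1 M1 n1 where 1: "d1 > 0" "ball x d1 \<subseteq> S" "!!n y. n >= n1 ==> y \<in> ball x d1 ==> \<bar>w n y\<bar> <= M1"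
  using b(1) x unfolding loc_bounded_def by blast
 obtain d2 M2 n2 where 2: "d2 > 0" "!!n y. n >= n2 ==> y \<in> ball x d2 ==> \<bar>laplacian (w n) y\<bar> <= M2"
  using b(2) x unfolding loc_bounded_def by blast
 define d where "d = min d1 d2 / 2"
 have d: "d > 0" using 1 2 by (simp add: d_def)
 have sub: "cball y (d / 2) \<subseteq> ball x d1" "cball y (d / 2) \<subseteq> ball x d2" if "y \<in> ball x d" for y
 proof -
  have "dist x z < 2 * d" if "z \<in> cball y (d / 2)" for z
   using dist_triangle[of x z y] \<open>y \<in> ball x d\<close> that d by simp
  then show "cball y (d / 2) \<subseteq> ball x d1" "cball y (d / 2) \<subseteq> ball x d2" by (force simp: d_def)+
 qed
 have "\<bar>pd e (w n) y\<bar> <= (real DIM('a))\<^sup>2 * M1 / (d / 2) + M2 * (d / 2)" if "n >= max n1 n2" "y \<in> ball x d" for n y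
  by (rule interior_gradient[OF w e]) (use sub[OF that(2)] 1 2 that d in auto)
 moreover have "ball x d \<subseteq> S" using 1(2) d by (auto simp: d_def)
 ultimately show "\<exists>d>0. \<exists>M n0. ball x d \<subseteq> S & (\<forall>n\<ge>n0. \<forall>y\<in>ball x d. \<bar>pd e (w n) y\<bar> <= M)"
  using d by blast
qed

lemma loc_bounded_cong:
 assumes "loc_bounded S w" "!!n x. x \<in> S ==> w n x = v n x"
 shows "loc_bounded S v"
 unfolding loc_bounded_def
proof
 fix x assume "x \<in> S"
 then obtain d M n0 where *: "d > 0" "ball x d \<subseteq> S" "\<forall>n\<ge>n0. \<forall>y\<in>ball x d. \<bar>w n y\<bar> <= M"
  using assms(1) unfolding loc_bounded_def by blast
 then have "\<forall>n\<ge>n0. \<forall>y\<in>ball x d. \<bar>v n y\<bar> <= M" using assms(2) by (metis subsetD)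
 then show "\<exists>d>0. \<exists>M n0. ball x d \<subseteq> S & (\<forall>n\<ge>n0. \<forall>y\<in>ball x d. \<bar>v n y\<bar> <= M)" using * by blast
qed

text \<open>The truncation at order \<open>k\<close> lets semilinear equations be bootstrapped.\<close>

lemma loc_bounded_iter_partial:
 fixes w :: "nat => 'a::euclidean_space => real"
 assumes w: "!!n. smooth_on S (w n)" and b: "loc_bounded S w"
  and l: "!!bs. set bs \<subseteq> Basis ==> length bs <= k ==> loc_bounded S (%n. iter_partial bs (laplacian (w n)))"
 shows "set bs \<subseteq> Basis ==> length bs <= Suc k ==> loc_bounded S (%n. iter_partial bs (w n))"
proof (induction bs)
 case Nil then show ?case using b by simp
next
 case (Cons c bs)
 have "loc_bounded S (%n. pd c (iter_partial bs (w n)))"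
 proof (rule loc_bounded_pd)
  show "smooth_on S (iter_partial bs (w n))" for n using smooth_on_iter_partial[OF w] Cons.prems by simp
  show "loc_bounded S (%n. iter_partial bs (w n))" using Cons by simp
  show "loc_bounded S (%n. laplacian (iter_partial bs (w n)))"
   by (rule loc_bounded_cong[OF l]) (use Cons.prems laplacian_iter_partial_commute[OF w] in auto)
  show "c \<in> Basis" using Cons.prems by simp
 qed
 then show ?case by simp
qed

text \<open>The second order Taylor remainder is bounded uniformly in \<open>n\<close> near
  \<open>x\<close>. Convergence of the values therefore forces the partial derivatives to be Cauchy,
  and the remainder estimate survives the limit and yields differentiability of \<open>f\<close>. No
  subsequence is extracted.\<close>

lemma limit_step:
 fixes g :: "nat => 'a::euclidean_space => real"
 assumes g: "!!n. smooth_on S (g n)" and x: "x \<in> S"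
  and b: "!!bs. set bs \<subseteq> Basis ==> loc_bounded S (%n. iter_partial bs (g n))"
  and lim: "!!x. x \<in> S ==> (%n. g n x) \<longlonglongrightarrow> f x"
 shows "f differentiable at x" "(%n. pd v (g n) x) \<longlonglongrightarrow> pd v f x"
proof -
 have o: "open S" using g smooth_on_open by blast
 have "\<forall>q\<in>(Basis::'a set) \<times> (Basis::'a set). \<exists>d>0. \<exists>M n0. \<forall>n\<ge>n0. \<forall>y\<in>ball x d. \<bar>pd (fst q) (pd (snd q) (g n)) y\<bar> <= M"
 proof
  fix q :: "'a \<times> 'a" assume "q \<in> Basis \<times> Basis"
  then have "loc_bounded S (%n. iter_partial [fst q, snd q] (g n))" by (intro b) auto
  then show "\<exists>d>0. \<exists>M n0. \<forall>n\<ge>n0. \<forall>y\<in>ball x d. \<bar>pd (fst q) (pd (snd q) (g n)) y\<bar> <= M"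
   using x unfolding loc_bounded_def by fastforce
 qed
 then obtain d M n0 where dMn: "!!q. q \<in> (Basis::'a set) \<times> (Basis::'a set) ==> d q > (0::real)"
   "!!q n y. q \<in> (Basis::'a set) \<times> (Basis::'a set) ==> n >= n0 q ==> y \<in> ball x (d q) ==> \<bar>pd (fst q) (pd (snd q) (g n)) y\<bar> <= M q"
  by metis
 obtain d0 where d0: "d0 > 0" "ball x d0 \<subseteq> S" using o x open_contains_ball by blast
 let ?BB = "(Basis::'a set) \<times> (Basis::'a set)"
 have fin: "finite ?BB" by simp
 have ne: "?BB \<noteq> {}" using nonempty_Basis by auto
 define D where "D = min d0 (Min (d ` ?BB))"
 define C where "C = (real DIM('a))\<^sup>2 * Max (M ` ?BB)"
 define m where "m = Max (n0 ` ?BB)"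
 have D: "D > 0" using d0 dMn fin ne by (simp add: D_def Min_gr_iff)
 have DS: "ball x D \<subseteq> S" using d0 by (auto simp: D_def)
 have tay: "\<bar>g n y - g n x - pd (y - x) (g n) x\<bar> <= C * (norm (y - x))\<^sup>2" if "n >= m" "y \<in> ball x D" for n y
  unfolding C_def
 proof (rule taylor2[OF g DS that(2)])
  fix b c z assume bc: "b \<in> (Basis::'a set)" "c \<in> (Basis::'a set)" and z: "z \<in> ball x D"
  have q: "(b, c) \<in> ?BB" using bc by simp
  have "n0 (b, c) <= m" unfolding m_def using q fin by (intro Max_ge) auto
  moreover have "D <= d (b, c)" unfolding D_def using q fin by (intro min.coboundedI2 Min_le) auto
  ultimately have "\<bar>pd b (pd c (g n)) z\<bar> <= M (b, c)" using dMn(2)[OF q, of n z] that z by force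
  also have "... <= Max (M ` ?BB)" using q fin by (intro Max_ge) auto
  finally show "\<bar>pd b (pd c (g n)) z\<bar> <= Max (M ` ?BB)" .
 qed
 have C: "C >= 0"
 proof -
  obtain b where b: "b \<in> (Basis::'a set)" using nonempty_Basis by blast
  have "x + (D/2) *\<^sub>R b \<in> ball x D" using D b by (simp add: dist_norm)
  from order.trans[OF abs_ge_zero tay[OF _ this, of m]] show ?thesis
   using D b by (simp add: zero_le_mult_iff zero_less_divide_iff)
 qed
 have cauchy: "Cauchy (%n. pd b (g n) x)" if b: "b \<in> Basis" for b
 proof (rule metric_CauchyI)
  fix e :: real assume e: "e > 0"
  \<comment> \<open>With this step the Taylor error is at most \<open>e / 8 * h\<close>. Two such
    errors and two value differences below \<open>e * h / 4\<close> add up to less than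
    \<open>e * h\<close>.\<close>
  define h where "h = min (D / 2) (e / (8 * (C + 1)))"
  have h: "0 < h" "h < D" "C * h <= e / 8"
  proof -
   show "0 < h" "h < D" using D e C by (auto simp: h_def)
   have "C * h <= (C + 1) * (e / (8 * (C + 1)))" using C e D by (intro mult_mono) (auto simp: h_def)
   moreover have "(C + 1) * (e / (8 * (C + 1))) = e / 8" using C by (simp add: field_simps)
   ultimately show "C * h <= e / 8" by linarith
  qed
  define y where "y = x + h *\<^sub>R b"
  have y: "y \<in> ball x D" "norm (y - x) = h" using h b by (auto simp: y_def dist_norm)
  have "Cauchy (%n. g n y)" "Cauchy (%n. g n x)" using lim x y DS by (meson LIMSEQ_imp_Cauchy subsetD)+
  moreover have eh: "e * h / 4 > 0" using e h by simp
  ultimately obtain N1 N2 where N: "!!i j. i >= N1 ==> j >= N1 ==> dist (g i y) (g j y) < e * h / 4"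
    "!!i j. i >= N2 ==> j >= N2 ==> dist (g i x) (g j x) < e * h / 4" unfolding Cauchy_def by metis
  have "dist (pd b (g i) x) (pd b (g j) x) < e" if ij: "i >= max m (max N1 N2)" "j >= max m (max N1 N2)" for i j
  proof -
   have pdy: "pd (y - x) (g i) x = h * pd b (g i) x" for i
    using pd_scaleR[OF smooth_on_differentiable[OF g x]] by (simp add: y_def)
   have Ch: "C * h\<^sup>2 <= e / 8 * h" using h mult_right_mono[OF h(3), of h] by (simp add: power2_eq_square)
   have "\<bar>g i y - g i x - h * pd b (g i) x\<bar> <= e / 8 * h" "\<bar>g j y - g j x - h * pd b (g j) x\<bar> <= e / 8 * h"
    using tay[OF _ y(1)] Ch ij pdy y(2) by (smt (verit) max.boundedE)+
   moreover have "\<bar>g i y - g j y\<bar> < e * h / 4" "\<bar>g i x - g j x\<bar> < e * h / 4"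
    using N ij by (auto simp: dist_real_def)
   ultimately have "\<bar>h * pd b (g i) x - h * pd b (g j) x\<bar> < e * h" by linarith
   then have "h * \<bar>pd b (g i) x - pd b (g j) x\<bar> < h * e" using h by (simp add: abs_mult mult.commute flip: right_diff_distrib)
   then show ?thesis using h by (simp add: dist_real_def)
  qed
  then show "\<exists>M. \<forall>m\<ge>M. \<forall>n\<ge>M. dist (pd b (g m) x) (pd b (g n) x) < e" by blast
 qed
 then have "\<forall>b\<in>Basis. \<exists>l. (%n. pd b (g n) x) \<longlonglongrightarrow> l" using Cauchy_convergent_iff convergent_def by blast
 then obtain L where L: "!!b. b \<in> Basis ==> (%n. pd b (g n) x) \<longlonglongrightarrow> L b" by metis
 define Df where "Df v = (\<Sum>b\<in>Basis. (v \<bullet> b) * L b)" for v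
 have lv: "(%n. pd v (g n) x) \<longlonglongrightarrow> Df v" for v
 proof -
  have "(%n. \<Sum>b\<in>Basis. (v \<bullet> b) * pd b (g n) x) \<longlonglongrightarrow> Df v" unfolding Df_def
   by (intro tendsto_sum tendsto_mult tendsto_const L)
  then show ?thesis by (simp only: pd_lincomb[OF smooth_on_differentiable[OF g x], of v])
 qed
 have est: "\<bar>f y - f x - Df (y - x)\<bar> <= C * (norm (y - x))\<^sup>2" if y: "y \<in> ball x D" for y
 proof (rule tendsto_upperbound)
  show "(%n. \<bar>g n y - g n x - pd (y - x) (g n) x\<bar>) \<longlonglongrightarrow> \<bar>f y - f x - Df (y - x)\<bar>"
   by (intro tendsto_rabs tendsto_diff lim lv x) (use y DS in blast)
  show "\<forall>\<^sub>F n in sequentially. \<bar>g n y - g n x - pd (y - x) (g n) x\<bar> <= C * (norm (y - x))\<^sup>2"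
   using tay[OF _ y] eventually_sequentially by blast
 qed simp
 have "(f has_derivative Df) (at x)"
  unfolding has_derivative_at_within
 proof (intro conjI)
  show "bounded_linear Df" unfolding Df_def
   by (intro bounded_linear_sum bounded_linear_mult_const bounded_linear_inner_left)
  show "((%y. (f y - f x - Df (y - x)) /\<^sub>R norm (y - x)) \<longlongrightarrow> 0) (at x)"
  proof (rule Lim_null_comparison)
   have "\<forall>\<^sub>F y in at x. y \<in> ball x D - {x}"
    using D by (intro eventually_at_in_open) auto
   then show "\<forall>\<^sub>F y in at x. norm ((f y - f x - Df (y - x)) /\<^sub>R norm (y - x)) <= C * norm (y - x)"
   proof eventually_elim
    case (elim y)
    then show ?case using est[of y] by (simp add: power2_eq_square field_simps)
   qed
   show "((%y. C * norm (y - x)) \<longlongrightarrow> 0) (at x)"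
    by (auto intro!: tendsto_eq_intros)
  qed
 qed
 then show "f differentiable at x" "(%n. pd v (g n) x) \<longlonglongrightarrow> pd v f x"
  using lv[of v] pd_eqI[of f Df x v] differentiable_def by auto
qed

text \<open>The pointwise limits of sequences all of whose iterated partials are locally bounded
  form a class closed under \<open>pd\<close>, since \<open>limit_step\<close> exhibits
  \<open>pd b f\<close> as the limit of the sequence of derivatives.\<close>

lemma limit_smooth:
 fixes w :: "nat => 'a::euclidean_space => real"
 assumes w: "!!n. smooth_on S (w n)"
  and b: "!!bs. set bs \<subseteq> Basis ==> loc_bounded S (%n. iter_partial bs (w n))"
  and lim: "!!x. x \<in> S ==> (%n. w n x) \<longlonglongrightarrow> f x"
 shows "smooth_on S f"
  and "x \<in> S ==> set bs \<subseteq> Basis ==> (%n. iter_partial bs (w n) x) \<longlonglongrightarrow> iter_partial bs f x"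
proof -
 define P where "P f \<longleftrightarrow> (\<exists>g. (\<forall>n. smooth_on S (g n)) \<and>
  (\<forall>bs. set bs \<subseteq> Basis --> loc_bounded S (%n. iter_partial bs (g n))) & (\<forall>x\<in>S. (%n. g n x) \<longlonglongrightarrow> f x))" for f :: "'a => real"
 have step: "(\<forall>n. smooth_on S (pd c (g n))) \<and>
   (\<forall>bs. set bs \<subseteq> Basis --> loc_bounded S (%n. iter_partial bs (pd c (g n)))) & (\<forall>x\<in>S. (%n. pd c (g n) x) \<longlonglongrightarrow> pd c f x)"
  if "c \<in> Basis" "\<forall>n. smooth_on S (g n)"
   "\<forall>bs. set bs \<subseteq> Basis --> loc_bounded S (%n. iter_partial bs (g n))" "\<forall>x\<in>S. (%n. g n x) \<longlonglongrightarrow> f x" for c f g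
 proof (intro conjI allI ballI impI)
  show "smooth_on S (pd c (g n))" for n using that smooth_on_pd by blast
  show "(%n. pd c (g n) x) \<longlonglongrightarrow> pd c f x" if "x \<in> S" for x
   by (rule limit_step(2)[of S g x f]) (use \<open>x \<in> S\<close> \<open>\<forall>n. smooth_on S (g n)\<close> \<open>\<forall>bs. set bs \<subseteq> Basis --> loc_bounded S (%n. iter_partial bs (g n))\<close> \<open>\<forall>x\<in>S. (%n. g n x) \<longlonglongrightarrow> f x\<close> in auto)
  fix bs assume "set bs \<subseteq> (Basis :: 'a set)"
  then have "loc_bounded S (%n. iter_partial (bs @ [c]) (g n))" using that by simp
  then show "loc_bounded S (%n. iter_partial bs (pd c (g n)))" by (simp add: iter_partial_append)
 qed
 show "smooth_on S f"
 proof (rule smooth_on_coinduct[where P = P])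
  show "open S" using w smooth_on_open by blast
  show "P f" unfolding P_def using assms by blast
  show "f differentiable at x" if "P f" "x \<in> S" for f x
   using that limit_step(1)[of S _ x f] unfolding P_def by blast
  show "\<exists>g. P g & (\<forall>x\<in>S. pd b f x = g x)" if "P f" "b \<in> Basis" for f b
  proof -
   obtain g where "\<forall>n. smooth_on S (g n)" "\<forall>bs. set bs \<subseteq> Basis --> loc_bounded S (%n. iter_partial bs (g n))"
    "\<forall>x\<in>S. (%n. g n x) \<longlonglongrightarrow> f x" using \<open>P f\<close> unfolding P_def by blast
   from step[OF that(2) this] have "P (pd b f)" unfolding P_def by (rule exI[of _ "%n. pd b (g n)"])
   then show ?thesis by (intro exI[of _ "pd b f"]) simp
  qed
 qed
 have "(\<forall>n. smooth_on S (%x. iter_partial bs (w n) x)) \<and>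
  (\<forall>cs. set cs \<subseteq> Basis --> loc_bounded S (%n. iter_partial cs (iter_partial bs (w n)))) \<and>
   (\<forall>x\<in>S. (%n. iter_partial bs (w n) x) \<longlonglongrightarrow> iter_partial bs f x)" if "set bs \<subseteq> Basis"
  using that
 proof (induction bs)
  case Nil
  show ?case
  proof (intro conjI allI ballI impI)
   show "smooth_on S (%x. iter_partial [] (w n) x)" for n using w[of n] by simp
   show "loc_bounded S (%n. iter_partial cs (iter_partial [] (w n)))" if "set cs \<subseteq> Basis" for cs
    using b[OF that] by simp
   show "(%n. iter_partial [] (w n) x) \<longlonglongrightarrow> iter_partial [] f x" if "x \<in> S" for x
    using lim[OF that] by simp
  qed
 next
  case (Cons c bs)
  have c: "c \<in> Basis" "set bs \<subseteq> Basis" using Cons.prems by auto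
  from step[OF c(1), of "%n. iter_partial bs (w n)" "iter_partial bs f"] Cons.IH[OF c(2)]
  show ?case unfolding iter_partial_pd by fast
 qed
 then show "x \<in> S ==> set bs \<subseteq> Basis ==> (%n. iter_partial bs (w n) x) \<longlonglongrightarrow> iter_partial bs f x" by blast
qed


subsection \<open>Mollification\<close>

text \<open>The powers of \<open>inverse t\<close> are built in so that the family is closed under
  differentiation; \<open>exp_bump 0\<close> is the usual function exp (-1/t) that is flat at
  0.\<close>

definition exp_bump :: "nat => real => real" where
 "exp_bump k t = (if t > 0 then exp (- inverse t) * inverse t ^ k else 0)"

lemma exp_bump_tendsto: "(exp_bump k \<longlongrightarrow> 0) (at_right 0)"
proof -
 have "((%x::real. x ^ k / exp x) \<longlongrightarrow> 0) at_top" by (rule tendsto_power_div_exp_0)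
 then have "((%t::real. inverse t ^ k / exp (inverse t)) \<longlongrightarrow> 0) (at_right 0)"
  using filterlim_compose filterlim_inverse_at_top_right by blast
 then show ?thesis
 proof (rule Lim_transform_eventually)
  show "\<forall>\<^sub>F t in at_right 0. inverse t ^ k / exp (inverse t) = exp_bump k t"
   unfolding eventually_at_filter by (auto simp: exp_bump_def exp_minus field_simps)
 qed
qed

lemma exp_bump_DERIV:
 "(exp_bump k has_real_derivative 1 * exp_bump (k + 2) t + (- real k) * exp_bump (k + 1) t) (at t)"
proof -
 consider "t > 0" | "t < 0" | "t = 0" by linarith
 then show ?thesis
 proof cases
  case 1
  have D: "((%t. exp (- inverse t) * inverse t ^ k) has_real_derivative
    1 * exp_bump (k + 2) t + (- real k) * exp_bump (k + 1) t) (at t)"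
   using 1
   by (cases k) (auto intro!: derivative_eq_intros simp: exp_bump_def field_simps power2_eq_square,
    metis One_nat_def power_eq_if)
  show ?thesis
   by (rule has_field_derivative_transform_within_open[OF D, of "{0<..}"]) (use 1 in \<open>auto simp: exp_bump_def\<close>)
 next
  case 2
  have "((%t. 0) has_real_derivative 0) (at t)" by simp
  then have "(exp_bump k has_real_derivative 0) (at t)"
   by (rule has_field_derivative_transform_within_open[of _ _ _ "{..<0}"]) (use 2 in \<open>auto simp: exp_bump_def\<close>)
  then show ?thesis using 2 by (simp add: exp_bump_def)
 next
  case 3
  \<comment> \<open>From the right the difference quotient at 0 is \<open>exp_bump (Suc k)\<close>
    itself, which tends to 0.\<close>
  have "((%h. (exp_bump k (0 + h) - exp_bump k 0) / h) \<longlongrightarrow> 0) (at 0)"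
  proof (rule filterlim_split_at_real)
   show "((%h. (exp_bump k (0 + h) - exp_bump k 0) / h) \<longlongrightarrow> 0) (at_left 0)"
    by (rule Lim_transform_eventually[OF tendsto_const])
     (auto simp: eventually_at_filter exp_bump_def)
   show "((%h. (exp_bump k (0 + h) - exp_bump k 0) / h) \<longlongrightarrow> 0) (at_right 0)"
    by (rule Lim_transform_eventually[OF exp_bump_tendsto[of "Suc k"]])
     (auto simp: eventually_at_filter exp_bump_def field_simps)
  qed
  then show ?thesis using 3 by (simp add: DERIV_def exp_bump_def)
 qed
qed

lemma smooth_on_exp_bump: "smooth_on UNIV (exp_bump k)"
proof (rule smooth_on_real_family[where F = exp_bump])
 fix k
 show "\<exists>j l c d. \<forall>x\<in>UNIV. (exp_bump k has_real_derivative c * exp_bump j x + d * exp_bump l x) (at x)"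
  by (intro exI ballI) (rule exp_bump_DERIV)
qed simp

lemma integrable_bounded_support:
 fixes f :: "'a::euclidean_space => real"
 assumes "f \<in> borel_measurable borel" "!!x. \<bar>f x\<bar> <= B" "bounded K" "!!x. x \<notin> K ==> f x = 0"
 shows "integrable lborel f"
proof -
 obtain r where r: "K \<subseteq> cball 0 r" using bounded_subset_ballD[OF assms(3), of 0] ball_subset_cball by (meson subset_trans)
 have e: "emeasure lborel (cball (0::'a) r) < \<infinity>" by (rule emeasure_bounded_finite) simp
 have int: "integrable lborel (%x. B * indicator (cball (0::'a) r) x :: real)"
  by (intro integrable_mult_right integrable_real_indicator e) simp
 have "norm (f x) <= norm (B * indicator (cball 0 r) x)" for x
 proof (cases "x \<in> K")
  case True
  then have "x \<in> cball 0 r" using r by blast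
  then show ?thesis using assms(2)[of x] by (simp add: indicator_def)
 qed (simp add: assms(4))
 then have AE: "AE x in lborel. norm (f x) <= norm (B * indicator (cball (0::'a) r) x)" by (intro AE_I2)
 have "f \<in> borel_measurable lborel" using assms(1) by simp
 from Bochner_Integration.integrable_bound[OF int this AE] show ?thesis .
qed

lemma integrable_compact_support:
 fixes f :: "'a::euclidean_space => real"
 assumes "continuous_on UNIV f" "bounded K" "!!x. x \<notin> K ==> f x = 0"
 shows "integrable lborel f"
proof -
 obtain r where r: "K \<subseteq> cball 0 r" using bounded_subset_ballD[OF assms(2), of 0] ball_subset_cball by (meson subset_trans)
 obtain B where B: "B >= 0" "!!x. x \<in> cball 0 r ==> \<bar>f x\<bar> <= B"
  by (rule compact_bound[OF compact_cball[of 0 r] continuous_on_subset[OF assms(1) subset_UNIV]]) blast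
 have "\<bar>f x\<bar> <= B" for x using B(1) B(2)[of x] assms(3)[of x] r by (cases "x \<in> K") force+
 moreover have "f \<in> borel_measurable borel" using assms(1) by (rule borel_measurable_continuous_onI)
 ultimately show ?thesis using assms(2,3) by (intro integrable_bounded_support)
qed

lemma lborel_integral_shift:
 fixes f :: "'a::euclidean_space => real"
 assumes "f \<in> borel_measurable borel"
 shows "(LBINT x. f (x + c)) = (LBINT x. f x)"
proof -
 have "(LBINT x. f x) = (\<integral>x. f x \<partial>distr lborel borel ((+) c))" by (simp add: lborel_distr_plus)
 also have "... = (LBINT x. f (c + x))" by (rule integral_distr) (use assms in auto)
 finally show ?thesis by (simp add: add.commute)
qed

lemma lborel_integral_reflect:
 fixes f :: "'a::euclidean_space => real"
 assumes "f \<in> borel_measurable borel"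
 shows "(LBINT x. f (c - x)) = (LBINT x. f x)"
proof -
 have "lborel = density (distr lborel borel (%x::'a. c + (-1) *\<^sub>R x)) (%_. \<bar>-1::real\<bar>^DIM('a))"
  by (rule lborel_affine) simp
 also have "... = distr lborel borel (%x::'a. c - x)"
  by (simp add: density_1)
 finally have "(LBINT x. f x) = (\<integral>x. f x \<partial>distr lborel borel (%x::'a. c - x))" by simp
 also have "... = (LBINT x. f (c - x))" by (rule integral_distr) (use assms in auto)
 finally show ?thesis by simp
qed

lemma mollifier_exists:
 assumes "\<delta> > 0"
 obtains \<eta> :: "'a::euclidean_space => real" where "smooth_on UNIV \<eta>" "!!x. \<eta> x >= 0"
  "!!x. norm x >= \<delta> ==> \<eta> x = 0" "integrable lborel \<eta>" "(LBINT x. \<eta> x) = 1"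
proof -
 define k :: "'a => real" where "k x = exp_bump 0 (\<delta>\<^sup>2 - (x - 0) \<bullet> (x - 0))" for x
 have s: "smooth_on UNIV k" unfolding k_def
  by (rule smooth_on_real_comp[OF smooth_on_exp_bump])
   (intro smooth_on_diff smooth_on_const smooth_on_norm_sq open_UNIV, simp)
 have k: "k x >= 0" "k x = 0 \<longleftrightarrow> norm x >= \<delta>" for x
 proof -
  have "\<delta>\<^sup>2 - (x - 0) \<bullet> (x - 0) > 0 \<longleftrightarrow> (norm x)\<^sup>2 < \<delta>\<^sup>2" by (simp add: power2_norm_eq_inner)
  also have "... \<longleftrightarrow> norm x < \<delta>"
   using power2_less_imp_less[of "norm x" \<delta>] power_strict_mono[of "norm x" \<delta> 2] \<open>\<delta> > 0\<close> by auto
  finally have "\<delta>\<^sup>2 - (x - 0) \<bullet> (x - 0) > 0 \<longleftrightarrow> norm x < \<delta>" .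
  then show "k x >= 0" "k x = 0 \<longleftrightarrow> norm x >= \<delta>" by (auto simp: k_def exp_bump_def)
 qed
 have int: "integrable lborel k"
  by (rule integrable_compact_support[OF smooth_on_continuous[OF s], of "cball 0 \<delta>"]) (use k in auto)
 have "(LBINT x. k x) \<noteq> 0"
 proof
  assume "(LBINT x. k x) = 0"
  then have "AE x in lborel. k x = 0"
   using integral_nonneg_eq_0_iff_AE[OF int] k by auto
  then have "AE x in lborel. x \<notin> ball (0::'a) \<delta>" by (simp add: k(2) not_less)
  then have "ball (0::'a) \<delta> \<in> null_sets lborel" by (subst (asm) AE_iff_null) (auto simp: ball_def)
  then have "negligible (ball (0::'a) \<delta>)" using negligible_iff_null_sets null_sets_completionI by blast
  then show False using open_not_negligible[of "ball (0::'a) \<delta>"] \<open>\<delta> > 0\<close> by simp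
 qed
 moreover have "(LBINT x. k x) >= 0" using k by simp
 ultimately have pos: "(LBINT x. k x) > 0" by simp
 show ?thesis
 proof (rule that[of "%x. inverse (LBINT x. k x) * k x"])
  show "smooth_on UNIV (%x. inverse (LBINT x. k x) * k x)" by (rule smooth_on_cmult[OF s])
 qed (use k pos int in auto)
qed

text \<open>Differentiation under the integral over a compact box puts all derivatives on
  \<open>g\<close>. It is used in two ways: with a mollifier as \<open>g\<close> and a merely
  continuous \<open>k\<close>, to get smooth approximations, and with smooth data as
  \<open>g\<close> and the mollifier as \<open>k\<close>, to get bounds independent of the
  mollifier.\<close>

lemma smooth_convolution:
 fixes g k :: "'a::euclidean_space => real"
 assumes g: "smooth_on S g" and k: "continuous_on (cbox a c) k"
  and U: "open U" and US: "!!x z. x \<in> U ==> z \<in> cbox a c ==> x - z \<in> S"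
 shows "smooth_on U (%x. integral (cbox a c) (%z. g (x - z) * k z))"
  and "set bs \<subseteq> Basis ==> x \<in> U ==> iter_partial bs (%x. integral (cbox a c) (%z. g (x - z) * k z)) x =
   integral (cbox a c) (%z. iter_partial bs g (x - z) * k z)"
proof -
 define F where "F g x = integral (cbox a c) (%z. g (x - z) * k z)" for g x
 have step: "(F g has_derivative (%v. F (pd v g) x0)) (at x0)" if g: "smooth_on S g" and x0: "x0 \<in> U" for g x0
 proof -
  obtain r where r: "r > 0" "ball x0 r \<subseteq> U" using U x0 open_contains_ball by blast
  have BS: "x - z \<in> S" if "x \<in> ball x0 r" "z \<in> cbox a c" for x z using that r US by blast
  have D: "(g has_derivative (%v. pd v g y)) (at y)" if "y \<in> S" for y
   by (rule differentiable_has_derivative_pd[OF smooth_on_differentiable[OF g that]])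
  define fx where "fx x z = Blinfun (%v. pd v g (x - z) * k z)" for x z
  have fx: "blinfun_apply (fx x z) = (%v. pd v g (x - z) * k z)" if "x - z \<in> S" for x z
   unfolding fx_def using has_derivative_bounded_linear[OF D[OF that]]
   by (intro bounded_linear_Blinfun_apply bounded_linear_mult_const)
  have cg: "continuous_on (ball x0 r \<times> cbox a c) (%(x, z). f (x - z) * k z)" if "continuous_on S f" for f
  proof -
   have "continuous_on (ball x0 r \<times> cbox a c) (%p. f (fst p - snd p) * k (snd p))"
    by (intro continuous_intros continuous_on_compose2[OF that] continuous_on_compose2[OF k]) (use BS in auto)
   then show ?thesis by (simp add: case_prod_unfold)
  qed
  have cz: "continuous_on (cbox a c) (%z. f (x - z) * k z)" if "continuous_on S f" "x \<in> ball x0 r" for f x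
   by (intro continuous_intros continuous_on_compose2[OF that(1)] k) (use BS that in auto)
  have "((%x. integral (cbox a c) (%z. g (x - z) * k z)) has_derivative blinfun_apply (integral (cbox a c) (fx x0))) (at x0 within ball x0 r)"
  proof (rule leibniz_rule)
   fix x z assume x: "x \<in> ball x0 r" "z \<in> cbox a c"
   have "((%x. x - z) has_derivative (%h. h)) (at x)" by (auto intro!: derivative_eq_intros)
   from has_derivative_compose[OF this D[OF BS[OF x]]]
   have "((%x. g (x - z) * k z) has_derivative (%v. pd v g (x - z) * k z)) (at x)"
    by (rule has_derivative_mult_left)
   then show "((%x. g (x - z) * k z) has_derivative blinfun_apply (fx x z)) (at x within ball x0 r)"
    unfolding fx[OF BS[OF x]] by (rule has_derivative_at_withinI)
  next
   show "(%z. g (x - z) * k z) integrable_on cbox a c" if "x \<in> ball x0 r" for x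
    by (intro integrable_continuous cz smooth_on_continuous[OF g] that)
   show "continuous_on (ball x0 r \<times> cbox a c) (%(x, z). fx x z)"
   proof (rule continuous_on_blinfun_componentwise)
    fix i :: 'a
    show "continuous_on (ball x0 r \<times> cbox a c) (%p. blinfun_apply (case p of (x, z) => fx x z) i)"
     by (rule continuous_on_eq[OF cg[OF smooth_on_continuous[OF smooth_on_pd[OF g, of i]]]]) (auto simp: fx BS)
   qed
  qed (use r in auto)
  then have D1: "(F g has_derivative blinfun_apply (integral (cbox a c) (fx x0))) (at x0)"
   using r at_within_open[of x0 "ball x0 r"] unfolding F_def by simp
  have x0r: "x0 \<in> ball x0 r" using r by simp
  have "fx x0 integrable_on cbox a c"
  proof (intro integrable_continuous continuous_on_blinfun_componentwise)
   show "continuous_on (cbox a c) (%z. blinfun_apply (fx x0 z) i)" for i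
    by (rule continuous_on_eq[OF cz[OF smooth_on_continuous[OF smooth_on_pd[OF g, of i]] x0r]]) (use fx BS[OF x0r] in auto)
  qed
  then have "blinfun_apply (integral (cbox a c) (fx x0)) v = integral (cbox a c) (%z. blinfun_apply (fx x0 z) v)" for v
   by (rule blinfun_apply_integral)
  also have "integral (cbox a c) (%z. blinfun_apply (fx x0 z) v) = F (pd v g) x0" for v
   unfolding F_def by (rule integral_cong) (simp add: fx BS[OF x0r])
  finally have "blinfun_apply (integral (cbox a c) (fx x0)) = (%v. F (pd v g) x0)" by (rule ext)
  with D1 show ?thesis by simp
 qed
 have pdF: "pd v (F g) x = F (pd v g) x" if "smooth_on S g" "x \<in> U" for g x v
  using pd_eqI[OF step[OF that]] .
 have sm: "smooth_on U (F g)"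
 proof (rule smooth_on_coinduct[OF U, where P = "%f. \<exists>g. smooth_on S g & f = F g"])
  show "\<exists>h. smooth_on S h & F g = F h" using g by blast
  show "f differentiable at x" if "\<exists>g. smooth_on S g & f = F g" "x \<in> U" for f x
   using that step differentiable_def by blast
  fix f b assume "\<exists>g. smooth_on S g & f = F g"
  then obtain g where "smooth_on S g" "f = F g" by blast
  then have "\<forall>x\<in>U. pd b f x = F (pd b g) x" "smooth_on S (pd b g)" using pdF smooth_on_pd by auto
  then show "\<exists>h. (\<exists>g. smooth_on S g & h = F g) & (\<forall>x\<in>U. pd b f x = h x)" by blast
 qed
 have it: "set bs \<subseteq> Basis ==> \<forall>x\<in>U. iter_partial bs (F g) x = F (iter_partial bs g) x"
 proof (induction bs)
  case (Cons b bs)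
  show ?case
  proof
   fix x assume x: "x \<in> U"
   have "iter_partial (b # bs) (F g) x = pd b (F (iter_partial bs g)) x"
    unfolding iter_partial_pd by (rule pd_cong_open[OF U x]) (use Cons in auto)
   then show "iter_partial (b # bs) (F g) x = F (iter_partial (b # bs) g) x"
    using pdF[OF smooth_on_iter_partial[OF g] x, of bs b] Cons.prems by simp
  qed
 qed simp
 show "smooth_on U (%x. integral (cbox a c) (%z. g (x - z) * k z))" using sm unfolding F_def .
 show "set bs \<subseteq> Basis ==> x \<in> U ==> iter_partial bs (%x. integral (cbox a c) (%z. g (x - z) * k z)) x =
   integral (cbox a c) (%z. iter_partial bs g (x - z) * k z)" using it unfolding F_def by blast
qed

lemma lborel_integral_eq_cbox:
 fixes f :: "'a::euclidean_space => real"
 assumes "integrable lborel f" "!!x. x \<notin> cbox a c ==> f x = 0"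
 shows "(LBINT x. f x) = integral (cbox a c) f"
proof -
 have "integral UNIV f = (LBINT x. f x)" using integral_lborel[OF assms(1)] .
 moreover have "integral UNIV (%x. if x \<in> cbox a c then f x else 0) = integral (cbox a c) f"
  by (rule integral_restrict_UNIV)
 moreover have "(%x. if x \<in> cbox a c then f x else 0) = f" using assms(2) by auto
 ultimately show ?thesis by simp
qed


section \<open>The linear Dirichlet problem\<close>

subsection \<open>The discrete Laplacian\<close>

text \<open>\<open>avg e u - u\<close>, divided by e^2 / (2N), is the usual difference approximation
  of the Laplacian. It acts at every point of space and not on one fixed lattice, so a discrete
  solution can be compared with its own translates.\<close>

definition avg :: "real => ('a::euclidean_space => real) => 'a => real" where
 "avg e u x = (\<Sum>b\<in>Basis. u (x + e *\<^sub>R b) + u (x - e *\<^sub>R b)) / (2 * real DIM('a))"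

lemma avg_mono:
 assumes "!!b. b \<in> Basis ==> u (x + e *\<^sub>R b) <= v (x + e *\<^sub>R b)" "!!b. b \<in> Basis ==> u (x - e *\<^sub>R b) <= v (x - e *\<^sub>R b)"
 shows "avg e u x <= avg e v x"
 unfolding avg_def using assms by (intro divide_right_mono sum_mono add_mono) auto

lemma avg_add: "avg e (%x. u x + v x) x = avg e u x + avg e v x"
 by (simp add: avg_def sum.distrib add_divide_distrib)

lemma avg_diff: "avg e (%x. u x - v x) x = avg e u x - avg e v x"
 by (simp add: avg_def sum.distrib sum_subtractf add_divide_distrib diff_divide_distrib)

lemma avg_cmult: "avg e (%x. c * u x) x = c * avg e u x"
 by (simp add: avg_def sum.distrib sum_distrib_left distrib_left add_divide_distrib)

lemma avg_const: "avg e (%x. c) x = c"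
 by (simp add: avg_def)

lemma avg_shift: "avg e (%x. u (x + y)) x = avg e u (x + y)"
 by (simp add: avg_def algebra_simps)

lemma avg_norm_sq:
 fixes x :: "'a::euclidean_space"
 shows "avg e (%y. y \<bullet> y) x = x \<bullet> x + e\<^sup>2"
proof -
 have "(x + e *\<^sub>R b) \<bullet> (x + e *\<^sub>R b) + (x - e *\<^sub>R b) \<bullet> (x - e *\<^sub>R b) = 2 * (x \<bullet> x + e\<^sup>2)" if "b \<in> Basis" for b :: 'a
  using that by (simp add: algebra_simps inner_commute power2_eq_square)
 then have "avg e (%y. y \<bullet> y) x = (\<Sum>b\<in>(Basis::'a set). 2 * (x \<bullet> x + e\<^sup>2)) / (2 * real DIM('a))"
  unfolding avg_def by (intro arg_cong2[where f = "(/)"] sum.cong) auto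
 also have "... = x \<bullet> x + e\<^sup>2" by simp
 finally show ?thesis .
qed

lemma second_difference:
 fixes g :: "'a::euclidean_space => real"
 assumes g: "smooth_on S g" and e: "e > 0" and S: "!!t. \<bar>t\<bar> <= e ==> x + t *\<^sub>R b \<in> S"
  and w: "!!t. \<bar>t\<bar> <= e ==> \<bar>pd b (pd b g) (x + t *\<^sub>R b) - c\<bar> <= w"
 shows "\<bar>g (x + e *\<^sub>R b) + g (x - e *\<^sub>R b) - 2 * g x - e\<^sup>2 * c\<bar> <= e\<^sup>2 * w"
proof -
 define diff where "diff m t = (if m = 0 then g (x + t *\<^sub>R b) else if m = 1 then pd b g (x + t *\<^sub>R b) else pd b (pd b g) (x + t *\<^sub>R b))" for m :: nat and t
 have D: "\<forall>m t. m < 2 & - e <= t & t <= e --> DERIV (diff m) t :> diff (Suc m) t"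
 proof (intro allI impI)
  fix m :: nat and t assume *: "m < 2 & - e <= t & t <= e"
  then have "x + t *\<^sub>R b \<in> S" using S[of t] by (auto simp: abs_le_iff)
  then have "DERIV (%t. g (x + t *\<^sub>R b)) t :> pd b g (x + t *\<^sub>R b)"
   "DERIV (%t. pd b g (x + t *\<^sub>R b)) t :> pd b (pd b g) (x + t *\<^sub>R b)"
   by (auto intro!: pd_line_DERIV smooth_on_differentiable[OF g] smooth_on_differentiable[OF smooth_on_pd[OF g]])
  moreover have "m = 0 \<or> m = 1" using * by auto
  ultimately show "DERIV (diff m) t :> diff (Suc m) t" unfolding diff_def by auto
 qed
 have T: "\<exists>t. \<bar>t\<bar> <= e & diff 0 y = diff 0 0 + diff 1 0 * y + diff 2 t / 2 * y\<^sup>2" if "y = e \<or> y = - e" for y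
 proof -
  have "\<exists>t. (if y < 0 then y < t & t < 0 else 0 < t & t < y) \<and>
   diff 0 y = (\<Sum>m<2. diff m 0 / fact m * (y - 0) ^ m) + diff 2 t / fact 2 * (y - 0)\<^sup>2"
   by (rule Taylor[OF _ _ D]) (use that e in auto)
  then obtain t where t: "if y < 0 then y < t & t < 0 else 0 < t & t < y"
   "diff 0 y = (\<Sum>m<2. diff m 0 / fact m * (y - 0) ^ m) + diff 2 t / fact 2 * (y - 0)\<^sup>2" by blast
  have "\<bar>t\<bar> <= e" using t(1) that e by (auto split: if_splits)
  moreover have "{..<2::nat} = {0, 1}" by auto
  ultimately show ?thesis using t(2) by (intro exI[of _ t]) (simp add: fact_numeral)
 qed
 obtain t1 where t1: "\<bar>t1\<bar> <= e" "diff 0 e = diff 0 0 + diff 1 0 * e + diff 2 t1 / 2 * e\<^sup>2" using T[of e] by auto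
 obtain t2 where t2: "\<bar>t2\<bar> <= e" "diff 0 (-e) = diff 0 0 + diff 1 0 * (-e) + diff 2 t2 / 2 * (-e)\<^sup>2" using T[of "-e"] by blast
 have "g (x + e *\<^sub>R b) + g (x - e *\<^sub>R b) - 2 * g x - e\<^sup>2 * c = e\<^sup>2 * ((diff 2 t1 - c) / 2 + (diff 2 t2 - c) / 2)"
  using t1(2) t2(2) by (simp add: diff_def field_simps)
 also have "\<bar>...\<bar> <= e\<^sup>2 * w"
 proof -
  have half: "\<bar>(p - c) / 2 + (q - c) / 2\<bar> <= w" if "\<bar>p - c\<bar> <= w" "\<bar>q - c\<bar> <= w" for p q :: real
   using that abs_triangle_ineq[of "(p - c) / 2" "(q - c) / 2"] unfolding abs_divide by simp
  have "\<bar>(diff 2 t1 - c) / 2 + (diff 2 t2 - c) / 2\<bar> <= w"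
   by (rule half) (use w[OF t1(1)] w[OF t2(1)] in \<open>simp_all add: diff_def\<close>)
  then show ?thesis unfolding abs_mult by (intro mult_mono) auto
 qed
 finally show ?thesis .
qed

text \<open>The error is expressed by the oscillation \<open>w\<close> of the pure second
  derivatives, so that uniform continuity of the second derivatives is enough to make it small
  compared with e^2.\<close>

lemma avg_consistency:
 fixes g :: "'a::euclidean_space => real"
 assumes g: "smooth_on S g" and e: "e > 0" and S: "cball x e \<subseteq> S"
  and w: "!!b y. b \<in> Basis ==> y \<in> cball x e ==> \<bar>pd b (pd b g) y - pd b (pd b g) x\<bar> <= w"
 shows "\<bar>avg e g x - g x - e\<^sup>2 / (2 * DIM('a)) * laplacian g x\<bar> <= e\<^sup>2 * w / 2"
proof -
 let ?d = "%b. g (x + e *\<^sub>R b) + g (x - e *\<^sub>R b) - 2 * g x - e\<^sup>2 * pd b (pd b g) x"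
 have "\<bar>?d b\<bar> <= e\<^sup>2 * w" if b: "b \<in> Basis" for b
 proof (rule second_difference[OF g e])
  fix t :: real assume "\<bar>t\<bar> <= e"
  then have "x + t *\<^sub>R b \<in> cball x e" using b by (simp add: dist_norm)
  then show "x + t *\<^sub>R b \<in> S" "\<bar>pd b (pd b g) (x + t *\<^sub>R b) - pd b (pd b g) x\<bar> <= w" using S w[OF b] by auto
 qed
 then have "\<bar>\<Sum>b\<in>Basis. ?d b\<bar> <= (\<Sum>b\<in>(Basis::'a set). e\<^sup>2 * w)"
  by (intro order.trans[OF sum_abs] sum_mono)
 moreover have "(\<Sum>b\<in>Basis. ?d b) = (2 * DIM('a)) * (avg e g x - g x - e\<^sup>2 / (2 * DIM('a)) * laplacian g x)"
  by (simp add: avg_def laplacian_pd sum.distrib sum_subtractf sum_distrib_left right_diff_distrib)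
 ultimately have "2 * DIM('a) * \<bar>avg e g x - g x - e\<^sup>2 / (2 * DIM('a)) * laplacian g x\<bar> <= DIM('a) * (e\<^sup>2 * w)"
  by (simp add: abs_mult)
 then have "DIM('a) * (2 * \<bar>avg e g x - g x - e\<^sup>2 / (2 * DIM('a)) * laplacian g x\<bar>) <= DIM('a) * (e\<^sup>2 * w)"
  by (simp add: mult.assoc mult.left_commute)
 then show ?thesis by (subst (asm) mult_le_cancel_left_pos) auto
qed

text \<open>Iterating the scheme from zero gives an increasing sequence that stays below the
  supersolution \<open>W\<close>. The set \<open>V\<close> contains \<open>A\<close> with all mesh
  neighbours, which closes the induction. Pointwise limits stay Borel measurable, as the later
  integration requires.\<close>

lemma lattice_solution:
 fixes h W :: "'a::euclidean_space => real"
 assumes A: "A \<in> sets borel" and h: "h \<in> borel_measurable borel" "!!x. x \<in> A ==> h x >= 0"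
  and V: "A \<subseteq> V" "!!x b. x \<in> A ==> b \<in> Basis ==> x + e *\<^sub>R b \<in> V & x - e *\<^sub>R b \<in> V"
  and W: "!!x. x \<in> A ==> avg e W x + e\<^sup>2 / (2 * DIM('a)) * h x <= W x" "!!x. x \<in> V ==> 0 <= W x"
 obtains u where "u \<in> borel_measurable borel" "!!x. x \<in> A ==> u x = avg e u x + e\<^sup>2 / (2 * DIM('a)) * h x"
  "!!x. x \<notin> A ==> u x = 0" "!!x. x \<in> V ==> u x <= W x" "!!x. 0 <= u x"
proof -
 define T where "T u x = (if x \<in> A then avg e u x + e\<^sup>2 / (2 * DIM('a)) * h x else 0)" for u x
 define U where "U n = (T ^^ n) (%x. 0)" for n
 have U0: "U 0 = (%x. 0)" and US: "U (Suc n) = T (U n)" for n by (auto simp: U_def)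
 have nn: "0 <= U n x" for n x
 proof (induction n arbitrary: x)
  case (Suc n)
  have "0 <= avg e (U n) x" unfolding avg_def by (intro divide_nonneg_nonneg sum_nonneg add_nonneg_nonneg Suc) auto
  then show ?case using h(2)[of x] by (auto simp: US T_def)
 qed (simp add: U0)
 have mono: "U n x <= U (Suc n) x" for n x
 proof (induction n arbitrary: x)
  case 0 show ?case using nn[of 1] by (simp add: U0)
 next
  case (Suc n)
  have "avg e (U n) x <= avg e (U (Suc n)) x" by (intro avg_mono Suc)
  then show ?case unfolding US[of n] US[of "Suc n"] by (simp add: T_def US)
 qed
 have le: "x \<in> V ==> U n x <= W x" for n x
 proof (induction n arbitrary: x)
  case (Suc n)
  show ?case
  proof (cases "x \<in> A")
   case True
   have "avg e (U n) x <= avg e W x" by (intro avg_mono Suc.IH) (use V(2)[OF True] in auto)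
   then show ?thesis using W(1)[OF True] True by (simp add: US T_def)
  qed (use W(2) Suc.prems in \<open>simp add: US T_def\<close>)
 qed (use W in \<open>simp add: U0\<close>)
 have meas: "U n \<in> borel_measurable borel" for n
 proof (induction n)
  case (Suc n)
  have "(%x. U n (x + e *\<^sub>R b) + U n (x - e *\<^sub>R b)) \<in> borel_measurable borel" for b
   by (intro borel_measurable_add measurable_compose[OF _ Suc]) auto
  then have "avg e (U n) \<in> borel_measurable borel" unfolding avg_def[abs_def]
   by (intro borel_measurable_divide borel_measurable_sum borel_measurable_const)
  then have "(%x. avg e (U n) x + e\<^sup>2 / (2 * DIM('a)) * h x) \<in> borel_measurable borel"
   using h(1) by (intro borel_measurable_add borel_measurable_times borel_measurable_const)
  then show ?case unfolding US T_def[abs_def] using A by (intro measurable_If_set) auto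
 qed (simp add: U0)
 define u where "u x = lim (%n. U n x)" for x
 have out: "U n x = 0" if "x \<notin> A" for n x using that by (cases n) (auto simp: U0 US T_def)
 have lim: "(%n. U n x) \<longlonglongrightarrow> u x" for x
 proof (cases "x \<in> A")
  case True
  have "convergent (%n. U n x)"
  proof (rule Bseq_mono_convergent)
   show "Bseq (%n. U n x)"         by (rule BseqI'[of _ "W x"]) (use le[of x] nn V True in auto)
   show "\<forall>m. \<forall>n\<ge>m. U m x <= U n x" using lift_Suc_mono_le[of "%n. U n x"] mono by blast
  qed
  then show ?thesis unfolding u_def by (simp add: convergent_LIMSEQ_iff)
 next
  case False
  then have "(%n. U n x) = (%n. 0)" using out by auto
  then show ?thesis by (simp add: u_def limI)
 qed
 have lim_avg: "(%n. avg e (U n) x) \<longlonglongrightarrow> avg e u x" for x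
  unfolding avg_def by (intro tendsto_intros lim) auto
 show ?thesis
 proof (rule that)
  show "u \<in> borel_measurable borel" by (rule borel_measurable_LIMSEQ_real[OF lim meas])
  show "0 <= u x" for x by (rule LIMSEQ_le_const[OF lim]) (use nn in auto)
  show "u x = 0" if "x \<notin> A" for x using lim[of x] out[OF that] by (simp add: LIMSEQ_const_iff)
  show "u x <= W x" if "x \<in> V" for x by (rule LIMSEQ_le_const2[OF lim]) (use le that in auto)
  fix x assume x: "x \<in> A"
  have "(%n. U (Suc n) x) \<longlonglongrightarrow> avg e u x + e\<^sup>2 / (2 * DIM('a)) * h x"
   unfolding US T_def using x by (simp add: tendsto_add lim_avg)
  moreover have "(%n. U (Suc n) x) \<longlonglongrightarrow> u x" using lim by (rule LIMSEQ_Suc)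
  ultimately show "u x = avg e u x + e\<^sup>2 / (2 * DIM('a)) * h x" using LIMSEQ_unique by blast
 qed
qed

text \<open>Adding \<open>s * (x \<bullet> x)\<close> gains \<open>s * e^2\<close> under averaging,
  which beats the defect \<open>c * e^2\<close> because \<open>c < s\<close>. The price is the term
  with \<open>(R + 1)^2\<close>; the extra 1 accounts for neighbours at distance at most e <=
  1.\<close>

lemma lattice_comparison:
 fixes D :: "'a::euclidean_space => real"
 assumes K: "!!x. D x <= K" and A: "A \<subseteq> ball 0 R" and e: "0 < e" "e <= 1"
  and D: "!!x. x \<in> A ==> D x <= avg e D x + e\<^sup>2 * c" and m: "!!x. x \<notin> A ==> D x <= m"
  and s: "c < s" "0 <= s" and x: "x \<in> A"
 shows "D x <= m + s * (R + 1)\<^sup>2"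
proof -
 define D' where "D' x = D x + s * (x \<bullet> x)" for x
 have R: "R > 0" using x A by (smt (verit) mem_ball dist_not_less_zero in_mono)
 have sq: "y \<bullet> y <= (R + 1)\<^sup>2" if "norm y <= R + 1" for y :: 'a
  using power_mono[OF that, of 2] by (simp add: power2_norm_eq_inner)
 have bdd: "bdd_above (D' ` A)"
 proof (rule bdd_aboveI2)
  fix y assume "y \<in> A"
  then have "norm y <= R + 1" using A by force
  then show "D' y <= K + s * (R + 1)\<^sup>2" unfolding D'_def using K s sq by (intro add_mono mult_left_mono) auto
 qed
 define S where "S = (SUP x\<in>A. D' x)"
 have S: "D' y <= S" if "y \<in> A" for y unfolding S_def by (rule cSUP_upper[OF that bdd])
 define M where "M = max S (m + s * (R + 1)\<^sup>2)"
 have nb: "D' z <= M" if "y \<in> A" "norm (z - y) <= e" for y z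
 proof (cases "z \<in> A")
  case True then show ?thesis using S by (simp add: M_def le_max_iff_disj)
 next
  case False
  have "norm z <= R + 1" using that A e norm_triangle_ineq[of "z - y" y] by (auto simp: subset_iff)
  then have "D' z <= m + s * (R + 1)\<^sup>2" unfolding D'_def using m[OF False] s sq by (intro add_mono mult_left_mono) auto
  then show ?thesis by (simp add: M_def)
 qed
 have step: "D' y <= M - e\<^sup>2 * (s - c)" if y: "y \<in> A" for y
 proof -
  have "avg e D' y = avg e D y + s * (y \<bullet> y + e\<^sup>2)"
   unfolding D'_def by (simp add: avg_add avg_cmult avg_norm_sq)
  moreover have "avg e D' y <= avg e (%_. M) y"
   by (rule avg_mono) (use nb[OF y] e in auto)
  moreover have "D' y <= avg e D y + e\<^sup>2 * c + s * (y \<bullet> y)" using D[OF y] by (simp add: D'_def)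
  ultimately show ?thesis by (simp add: avg_const algebra_simps)
 qed
 \<comment> \<open>The supremum \<open>S\<close> need not be attained, but the gain is uniform on
   \<open>A\<close>. So \<open>S < M\<close>, and \<open>M\<close> must be the bound that comes from
   outside \<open>A\<close>.\<close>
 have "S <= M - e\<^sup>2 * (s - c)" unfolding S_def by (rule cSUP_least) (use step x in auto)
 moreover have "e\<^sup>2 * (s - c) > 0" using e s by simp
 ultimately have "S <= m + s * (R + 1)\<^sup>2" by (simp add: M_def max_def split: if_splits)
 then have "D' x <= m + s * (R + 1)\<^sup>2" using S[OF x] by simp
 moreover have "D x <= D' x" using s by (simp add: D'_def)
 ultimately show ?thesis by simp
qed

lemma continuous_zero_extension:
 assumes "open S" "continuous_on (closure S) f" "!!x. x \<in> frontier S ==> f x = 0"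
 shows "continuous_on UNIV (%x. if x \<in> S then f x else 0)"
proof -
 have "continuous_on (closure S \<union> - S) (%x. if x \<in> S then f x else 0)"
  by (rule continuous_on_cases) (use assms in \<open>auto simp: frontier_def interior_open\<close>)
 moreover have "closure S \<union> - S = UNIV" using closure_subset by auto
 ultimately show ?thesis by simp
qed

lemma uniformly_continuous_bounded_support:
 fixes f :: "'a::euclidean_space => real"
 assumes f: "continuous_on UNIV f" and K: "bounded K" "!!x. x \<notin> K ==> f x = 0"
 shows "uniformly_continuous_on UNIV f"
 unfolding uniformly_continuous_on_def
proof (intro allI impI)
 fix E :: real assume "E > 0"
 obtain r where r: "r > 0" "K \<subseteq> ball 0 r" using bounded_subset_ballD[OF K(1), of 0] by blast
 have "uniformly_continuous_on (cball 0 (r + 1)) f"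
  by (intro compact_uniformly_continuous continuous_on_subset[OF f]) auto
 then obtain d where d: "d > 0" "!!x y. x \<in> cball 0 (r+1) ==> y \<in> cball 0 (r+1) ==> dist y x < d ==> dist (f y) (f x) < E"
  unfolding uniformly_continuous_on_def using \<open>E > 0\<close> by metis
 have "dist (f y) (f x) < E" if "dist y x < min d 1" for x y
 proof (cases "x \<in> K \<or> y \<in> K")
  case True
  then have "norm x <= r + 1" "norm y <= r + 1"
   using r that norm_triangle_ineq[of x "y - x"] norm_triangle_ineq[of y "x - y"]
   by (auto simp: subset_iff dist_norm norm_minus_commute)
  then show ?thesis using d(2) that by simp
 next
  case False then show ?thesis using K(2) \<open>E > 0\<close> by simp
 qed
 then show "\<exists>d>0. \<forall>x\<in>UNIV. \<forall>x'\<in>UNIV. dist x' x < d --> dist (f x') (f x) < E"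
  using d(1) by (intro exI[of _ "min d 1"]) auto
qed

text \<open>Comparison of a lattice solution with its translates yields equicontinuity up to the mesh size:
 no estimate on the discrete gradient is needed.\<close>

lemma lattice_translation:
 fixes u :: "'a::euclidean_space => real"
 assumes \<Omega>: "\<Omega> \<noteq> UNIV" "open \<Omega>" "\<Omega> \<subseteq> ball 0 R" and e: "0 < e" "e <= 1"
  and u: "!!x. infdist x (- \<Omega>) > e ==> u x = avg e u x + e\<^sup>2 / (2 * DIM('a)) * h x"
   "!!x. infdist x (- \<Omega>) <= e ==> u x = 0" "!!x. 0 <= u x" "!!x. u x <= Be x + k" "!!x. u x <= K"
  and Be: "!!x y. dist x y <= d + e ==> \<bar>Be x - Be y\<bar> <= wB" "!!x. x \<notin> \<Omega> ==> Be x = 0"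
  and h: "!!x y. x \<in> \<Omega> ==> y \<in> \<Omega> ==> dist x y <= d ==> \<bar>h x - h y\<bar> <= wh"
  and y: "norm y <= d" and s: "wh < s" and pos: "wh >= 0" "wB >= 0" "k >= 0"
 shows "u (x + y) - u x <= wB + k + s * (R + 1)\<^sup>2"
proof -
 \<comment> \<open>The points where the scheme holds both at \<open>x\<close> and at its translate;
   the difference of the two is a discrete subsolution there with right side
   \<open>h (x + y) - h x\<close>.\<close>
 define A where "A = {x. infdist x (- \<Omega>) > e & infdist (x + y) (- \<Omega>) > e}"
 have in\<Omega>: "x \<in> \<Omega>" if "infdist x (- \<Omega>) > e" for x using that e by (metis ComplI infdist_zero less_asym)
 have N: "real DIM('a) >= 1" using DIM_positive[where 'a='a] by linarith
 \<comment> \<open>If the scheme holds at \<open>x\<close>, the translated value is 0. Otherwise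
   \<open>x\<close> is within \<open>e\<close> of the complement, so \<open>x + y\<close> is within
   \<open>d + e\<close> of it, where the upper bound \<open>Be + k\<close> is small.\<close>
 have out: "u (x + y) - u x <= wB + k" if "x \<notin> A" for x
 proof (cases "infdist x (- \<Omega>) > e")
  case True
  then have "u (x + y) = 0" using that u(2) by (auto simp: A_def)
  then show ?thesis using u(3)[of x] pos by simp
 next
  case False
  have "closed (- \<Omega>)" "- \<Omega> \<noteq> {}" using \<Omega> by auto
  then obtain z where "z \<in> - \<Omega>" "infdist x (- \<Omega>) = dist x z" by (rule infdist_attains_inf)
  then have z: "z \<notin> \<Omega>" "dist x z <= e" using False by auto
  have "dist (x + y) z <= d + e" using dist_triangle[of "x + y" z x] z y by (simp add: dist_norm)
  then have "\<bar>Be (x + y)\<bar> <= wB" using Be(1)[of "x + y" z] Be(2)[OF z(1)] by simp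
  then show ?thesis using u(4)[of "x + y"] u(3)[of x] by simp
 qed
 show ?thesis
 proof (cases "x \<in> A")
  case True
  show ?thesis
  proof (rule lattice_comparison[where D = "%x. u (x + y) - u x" and A = A and e = e and c = wh and K = K])
   show "u (x + y) - u x <= K" for x using u(5)[of "x + y"] u(3)[of x] by simp
   show "A \<subseteq> ball 0 R" using in\<Omega> \<Omega>(3) by (auto simp: A_def)
   fix x assume x: "x \<in> A"
   have "dist (x + y) x <= d" using y by (simp add: dist_norm)
   then have "h (x + y) - h x <= wh" using h[of "x + y" x] in\<Omega> x by (auto simp: A_def)
   then have "e\<^sup>2 / (2 * DIM('a)) * (h (x + y) - h x) <= e\<^sup>2 / (2 * DIM('a)) * wh" by (intro mult_left_mono) auto
   also have "... <= e\<^sup>2 * wh"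
   proof (rule mult_right_mono)
    have p: "1 <= real (2 * DIM('a))" using N by linarith
    have "e\<^sup>2 / real (2 * DIM('a)) <= e\<^sup>2 / 1" by (rule divide_left_mono[OF p]) auto
    then show "e\<^sup>2 / real (2 * DIM('a)) <= e\<^sup>2" by simp
   qed (use pos in auto)
   finally show "u (x + y) - u x <= avg e (%x. u (x + y) - u x) x + e\<^sup>2 * wh"
    using x u(1)[of x] u(1)[of "x + y"] by (simp add: A_def avg_diff avg_shift right_diff_distrib)
  qed (use out e True s pos in auto)
 next
  case False
  have "s * (R + 1)\<^sup>2 >= 0" using s pos by simp
  then show ?thesis using out[OF False] by linarith
 qed
qed

text \<open>The lattice solutions are in general discontinuous; their oscillation is small only from
  an index on that depends on the tolerance. This is still enough: convergence on a countable dense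
  set spreads to all points and the limit is continuous.\<close>

lemma asymptotic_Arzela_Ascoli:
 fixes u :: "nat => 'a::euclidean_space => real"
 assumes K: "!!n x. \<bar>u n x\<bar> <= K"
  and eq: "!!E. E > 0 ==> \<exists>d>0. \<exists>N. \<forall>n\<ge>N. \<forall>x y. dist x y <= d --> \<bar>u n x - u n y\<bar> <= E"
 obtains g k where "strict_mono (k :: nat => nat)" "!!x. (%n. u (k n) x) \<longlonglongrightarrow> g x" "continuous_on UNIV g"
proof -
 obtain C :: "'a set" where C: "countable C" "!!X. open X ==> X \<noteq> {} ==> \<exists>d\<in>C. d \<in> X"
  using countable_dense_exists[where 'a='a] by metis
 obtain k where k: "strict_mono (k :: nat => nat)" "!!x. x \<in> C ==> \<exists>l. (%n. u (k n) x) \<longlonglongrightarrow> l"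
  using function_convergent_subsequence[OF C(1), of u K] K by auto
 have kn: "n <= k n" for n using k(1) by (rule seq_suble)
 have "Cauchy (%n. u (k n) x)" for x
 proof (rule metric_CauchyI)
  fix E :: real assume "E > 0"
  then have "E / 4 > 0" by simp
  then obtain d N where d: "d > 0" "!!n x y. n >= N ==> dist x y <= d ==> \<bar>u n x - u n y\<bar> <= E / 4"
   using eq by meson
  obtain c where c: "c \<in> C" "dist x c < d" using C(2)[of "ball x d"] d(1) by auto
  have "Cauchy (%n. u (k n) c)" using k(2)[OF c(1)] LIMSEQ_imp_Cauchy by blast
  then obtain M where M: "!!m n. m >= M ==> n >= M ==> dist (u (k m) c) (u (k n) c) < E / 4"
   using \<open>E > 0\<close> unfolding Cauchy_def by (metis divide_pos_pos zero_less_numeral)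
  have "dist (u (k m) x) (u (k n) x) < E" if "m >= max M N" "n >= max M N" for m n
  proof -
   have "k m >= N" "k n >= N" using that kn[of m] kn[of n] by auto
   then have "\<bar>u (k m) x - u (k m) c\<bar> <= E / 4" "\<bar>u (k n) x - u (k n) c\<bar> <= E / 4" using d(2) c(2) by auto
   moreover have "\<bar>u (k m) c - u (k n) c\<bar> < E / 4" using M[of m n] that by (simp add: dist_real_def)
   ultimately show ?thesis unfolding dist_real_def using \<open>E > 0\<close> by linarith
  qed
  then show "\<exists>M. \<forall>m\<ge>M. \<forall>n\<ge>M. dist (u (k m) x) (u (k n) x) < E" by blast
 qed
 then have "\<forall>x. \<exists>l. (%n. u (k n) x) \<longlonglongrightarrow> l" using Cauchy_convergent_iff convergent_def by blast
 then obtain g where g: "!!x. (%n. u (k n) x) \<longlonglongrightarrow> g x" by metis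
 have "\<exists>d>0. \<forall>x'. dist x' x < d --> dist (g x') (g x) < E" if "E > 0" for x E
 proof -
  have "E / 2 > 0" using that by simp
  then obtain d N where d: "d > 0" "!!n x y. n >= N ==> dist x y <= d ==> \<bar>u n x - u n y\<bar> <= E / 2"
   using eq by meson
  have "\<bar>g x' - g x\<bar> <= E / 2" if "dist x' x < d" for x'
  proof (rule LIMSEQ_le_const2)
   show "(%n. \<bar>u (k n) x' - u (k n) x\<bar>) \<longlonglongrightarrow> \<bar>g x' - g x\<bar>" by (intro tendsto_intros g)
   show "\<exists>N. \<forall>n\<ge>N. \<bar>u (k n) x' - u (k n) x\<bar> <= E / 2"
    using d(2) that kn by (meson less_imp_le order_trans)
  qed
  then have "dist (g x') (g x) < E" if "dist x' x < d" for x'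
   using that \<open>E > 0\<close> by (fastforce simp: dist_real_def)
  then show ?thesis using d(1) by blast
 qed
 then have "continuous_on UNIV g" by (auto simp: continuous_on_iff)
 with k(1) g show ?thesis using that by blast
qed


subsection \<open>Passage to the limit\<close>

text \<open>By consistency \<open>B\<close> plus a vanishing correction is a supersolution of the
  scheme, which traps the lattice solutions between 0 and roughly \<open>B\<close>. The
  approximations are returned along with the limit because the equation is recovered only
  afterwards, by testing.\<close>

lemma lattice_limit:
 fixes h B :: "'a::euclidean_space => real"
 assumes \<Omega>: "open \<Omega>" "bounded \<Omega>"
  and h: "continuous_on (closure \<Omega>) h" "!!x. x \<in> \<Omega> ==> 0 <= h x"
  and B: "smooth_on \<Omega> B" "continuous_on (closure \<Omega>) B" "!!x. x \<in> frontier \<Omega> ==> B x = 0"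
   "!!b. b \<in> Basis ==> uniformly_continuous_on \<Omega> (pd b (pd b B))" "!!x. x \<in> \<Omega> ==> h x <= - laplacian B x"
 obtains g us es K where "continuous_on UNIV g" "!!x. 0 <= g x" "!!x. x \<in> \<Omega> ==> g x <= B x" "!!x. x \<notin> \<Omega> ==> g x = 0"
  "!!n::nat. es n > (0::real)" "es \<longlonglongrightarrow> 0" "!!n. us n \<in> borel_measurable borel" "!!n x. \<bar>us n x\<bar> <= K"
  "!!n x. x \<notin> \<Omega> ==> us n x = 0"
  "!!n x. infdist x (- \<Omega>) > es n ==> us n x = avg (es n) (us n) x + (es n)\<^sup>2 / (2 * DIM('a)) * h x"
  "!!x. (%n. us n x) \<longlonglongrightarrow> g x"
proof -
 have N: "real DIM('a) >= 1" using DIM_positive[where 'a='a] by linarith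
 have ne: "\<Omega> \<noteq> UNIV" using \<Omega>(2) not_bounded_UNIV by metis
 obtain R where R: "R > 0" "\<Omega> \<subseteq> ball 0 R" using bounded_subset_ballD[OF \<Omega>(2), of 0] by blast
 have cpt: "compact (closure \<Omega>)" using \<Omega>(2) by (simp add: compact_closure)
 have sub: "\<Omega> \<subseteq> closure \<Omega>" by (rule closure_subset)
 have B0: "0 <= B x" if "x \<in> \<Omega>" for x
 proof (rule maximum_principle[OF cpt sub B(2,1)])
  show "laplacian B x <= 0" if "x \<in> \<Omega>" for x using B(5)[OF that] h(2)[OF that] by linarith
  show "0 <= B x" if "x \<in> closure \<Omega> - \<Omega>" for x using that B(3)[of x] \<Omega>(1) by (simp add: frontier_def interior_open)
  show "x \<in> closure \<Omega>" using that sub by blast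
 qed
 define Be where "Be x = (if x \<in> \<Omega> then B x else 0)" for x
 have Be: "continuous_on UNIV Be" unfolding Be_def by (rule continuous_zero_extension[OF \<Omega>(1) B(2,3)])
 have ucBe: "uniformly_continuous_on UNIV Be"
  by (rule uniformly_continuous_bounded_support[OF Be \<Omega>(2)]) (simp add: Be_def)
 have Be0: "0 <= Be x" for x using B0 by (simp add: Be_def)
 obtain KB where k: "KB >= 0" "!!x. x \<in> closure \<Omega> ==> \<bar>B x\<bar> <= KB" by (rule compact_bound[OF cpt B(2)]) blast
 have KB: "Be x <= KB" for x using k(1) k(2)[of x] sub by (auto simp: Be_def)
 define in\<Omega> where "in\<Omega> e = {x. infdist x (- \<Omega>) > e}" for e
 have cball\<Omega>: "cball x e \<subseteq> \<Omega>" if "x \<in> in\<Omega> e" for x e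
 proof
  fix y assume y: "y \<in> cball x e"
  show "y \<in> \<Omega>"
  proof (rule ccontr)
   assume "y \<notin> \<Omega>"
   then have "infdist x (- \<Omega>) <= dist x y" by (intro infdist_le) simp
   then show False using that y by (simp add: in\<Omega>_def)
  qed
 qed
 have open_in: "open (in\<Omega> e)" for e
  unfolding in\<Omega>_def by (intro open_Collect_less continuous_intros)
 define h0 where "h0 x = (if x \<in> \<Omega> then h x else 0)" for x
 have h0m: "h0 \<in> borel_measurable borel" unfolding h0_def[abs_def]
  by (rule borel_measurable_continuous_on_if) (use \<Omega> continuous_on_subset[OF h(1) sub] in auto)
 have "\<exists>e u. 0 < e & e <= 1 / real (Suc n) & u \<in> borel_measurable borel \<and>
   (\<forall>x\<in>in\<Omega> e. u x = avg e u x + e\<^sup>2 / (2 * DIM('a)) * h x) & (\<forall>x. x \<notin> in\<Omega> e --> u x = 0) \<and>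
   (\<forall>x. 0 <= u x) & (\<forall>x. u x <= Be x + 1 / real (Suc n) * R\<^sup>2)" for n
 proof -
  define k where "k = 1 / real (Suc n)"
  have k: "k > 0" by (simp add: k_def)
  have "\<forall>b\<in>Basis. \<exists>d>0. \<forall>x\<in>\<Omega>. \<forall>y\<in>\<Omega>. dist y x < d --> dist (pd b (pd b B) y) (pd b (pd b B) x) < k"
   using B(4) k unfolding uniformly_continuous_on_def by blast
  then obtain d where d: "!!b. b \<in> (Basis::'a set) ==> d b > (0::real)"
   "!!b x y. b \<in> (Basis::'a set) ==> x \<in> \<Omega> ==> y \<in> \<Omega> ==> dist y x < d b ==> dist (pd b (pd b B) y) (pd b (pd b B) x) < k"
   by metis
  define dm where "dm = Min (d ` (Basis::'a set))"
  have dm: "dm > 0" "!!b. b \<in> (Basis::'a set) ==> dm <= d b" using d(1) by (auto simp: dm_def)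
  \<comment> \<open>Below \<open>dm\<close> the pure second derivatives of \<open>B\<close> vary by
    less than \<open>k\<close> over \<open>cball x e\<close>; the bound by \<open>k\<close> makes
    the mesh width tend to zero.\<close>
  define e where "e = min k (dm / 2)"
  have e: "0 < e" "e <= k" "e < dm" using dm k by (auto simp: e_def)
  \<comment> \<open>The paraboloid loses \<open>k * e^2\<close> under averaging while the
    consistency error is at most half of that, so \<open>W\<close> is a supersolution; it is
    nonnegative on \<Omega> because \<Omega> lies in the ball of radius \<open>R\<close>.\<close>
  define W where "W x = Be x + k * (R\<^sup>2 - x \<bullet> x)" for x
  have xx: "x \<bullet> x <= R\<^sup>2" if "x \<in> \<Omega>" for x
  proof -
   have "norm x <= R" using that R(2) by force
   from power_mono[OF this, of 2] show ?thesis by (simp add: power2_norm_eq_inner)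
  qed
  have W: "avg e W x + e\<^sup>2 / (2 * DIM('a)) * h0 x <= W x" if x: "x \<in> in\<Omega> e" for x
  proof -
   have c: "cball x e \<subseteq> \<Omega>" by (rule cball\<Omega>[OF x])
   then have x\<Omega>: "x \<in> \<Omega>" using e by auto
   have nb: "x + e *\<^sub>R b \<in> \<Omega>" "x - e *\<^sub>R b \<in> \<Omega>" if "b \<in> Basis" for b
    using that c e by (auto simp: subset_iff dist_norm)
   have 1: "avg e Be x = avg e B x" unfolding avg_def using nb by (intro arg_cong2[where f = "(/)"] sum.cong refl) (simp add: Be_def)
   have "\<bar>avg e B x - B x - e\<^sup>2 / (2 * DIM('a)) * laplacian B x\<bar> <= e\<^sup>2 * k / 2"
   proof (rule avg_consistency[OF B(1) e(1) c])
    fix b y assume "b \<in> (Basis::'a set)" "y \<in> cball x e"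
    then have "dist (pd b (pd b B) y) (pd b (pd b B) x) < k"
     using d(2)[of b x y] dm(2)[of b] e c x\<Omega> by (auto simp: dist_commute)
    then show "\<bar>pd b (pd b B) y - pd b (pd b B) x\<bar> <= k" by (simp add: dist_real_def)
   qed
   then have 2: "avg e B x <= B x + e\<^sup>2 / (2 * DIM('a)) * laplacian B x + e\<^sup>2 * k / 2" by linarith
   have "e\<^sup>2 / (2 * DIM('a)) * h x <= e\<^sup>2 / (2 * DIM('a)) * (- laplacian B x)"
    by (intro mult_left_mono B(5)[OF x\<Omega>]) simp
   then have 3: "avg e B x + e\<^sup>2 / (2 * DIM('a)) * h x <= B x + e\<^sup>2 * k / 2" using 2 by simp
   have "avg e W x = avg e Be x + k * (R\<^sup>2 - (x \<bullet> x + e\<^sup>2))"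
    unfolding W_def by (simp add: avg_add avg_cmult avg_diff avg_const avg_norm_sq)
   then have "avg e W x + e\<^sup>2 / (2 * DIM('a)) * h0 x <= B x + e\<^sup>2 * k / 2 + k * (R\<^sup>2 - (x \<bullet> x + e\<^sup>2))"
    using 1 3 x\<Omega> by (simp add: h0_def)
   also have "... <= W x" using x\<Omega> k by (simp add: W_def Be_def algebra_simps)
   finally show ?thesis .
  qed
  obtain u where u: "u \<in> borel_measurable borel" "!!x. x \<in> in\<Omega> e ==> u x = avg e u x + e\<^sup>2 / (2 * DIM('a)) * h0 x"
   "!!x. x \<notin> in\<Omega> e ==> u x = 0" "!!x. x \<in> \<Omega> ==> u x <= W x" "!!x. 0 <= u x"
  proof (rule lattice_solution[of "in\<Omega> e" h0 \<Omega> e W])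
   show "in\<Omega> e \<subseteq> \<Omega>" using cball\<Omega> e by force
   then show "0 <= h0 x" if "x \<in> in\<Omega> e" for x using h(2)[of x] by (simp add: h0_def)
   show "x + e *\<^sub>R b \<in> \<Omega> & x - e *\<^sub>R b \<in> \<Omega>" if "x \<in> in\<Omega> e" "b \<in> Basis" for x b
    using cball\<Omega>[OF that(1)] that(2) e by (auto simp: subset_iff dist_norm)
   show "0 <= W x" if "x \<in> \<Omega>" for x unfolding W_def using Be0[of x] xx[OF that] k by simp
  qed (use open_in h0m W in auto)
  have "u x <= Be x + k * R\<^sup>2" for x
  proof (cases "x \<in> \<Omega>")
   case True
   have "k * (R\<^sup>2 - x \<bullet> x) <= k * R\<^sup>2" using k by (intro mult_left_mono) auto
   then show ?thesis using u(4)[OF True] by (simp add: W_def)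
  next
   case False
   then have "x \<notin> in\<Omega> e" using cball\<Omega> e by force
   then show ?thesis using u(3) Be0[of x] k by simp
  qed
  moreover have "u x = avg e u x + e\<^sup>2 / (2 * DIM('a)) * h x" if "x \<in> in\<Omega> e" for x
  proof -
   have "x \<in> \<Omega>" using cball\<Omega>[OF that] e by auto
   then show ?thesis using u(2)[OF that] by (simp add: h0_def)
  qed
  ultimately show ?thesis using u e unfolding k_def by (intro exI[of _ e] exI[of _ u]) simp
 qed
 then obtain es us where es: "!!n. 0 < es n" "!!n. es n <= 1 / real (Suc n)"
  and us: "!!n. us n \<in> borel_measurable borel" "!!n x. x \<in> in\<Omega> (es n) ==> us n x = avg (es n) (us n) x + (es n)\<^sup>2 / (2 * DIM('a)) * h x"
   "!!n x. x \<notin> in\<Omega> (es n) ==> us n x = 0" "!!n x. 0 <= us n x" "!!n x. us n x <= Be x + 1 / real (Suc n) * R\<^sup>2"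
  by metis
 define K where "K = KB + R\<^sup>2"
 have usK: "us n x <= K" for n x
 proof -
  have "1 / real (Suc n) * R\<^sup>2 <= 1 * R\<^sup>2" by (intro mult_right_mono) auto
  then show ?thesis using us(5)[of n x] KB[of x] by (simp add: K_def)
 qed
 have us0: "us n x = 0" if "x \<notin> \<Omega>" for n x
  by (rule us(3)) (use that cball\<Omega>[of x "es n"] es(1)[of n] in force)
 have eq: "\<exists>d>0. \<exists>M. \<forall>n\<ge>M. \<forall>x y. dist x y <= d --> \<bar>us n x - us n y\<bar> <= E" if E: "E > 0" for E
 proof -
  \<comment> \<open>The tolerance is spent as follows: a quarter on the modulus of continuity of
    \<open>Be\<close>, a quarter on the excess of \<open>us n\<close> over \<open>Be\<close>, and
    \<open>2 * wh * (R + 1)^2\<close>, which is one half, on the comparison.\<close>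
  define wh where "wh = E / (4 * (R + 1)\<^sup>2)"
  have wh: "wh > 0" "wh * (R + 1)\<^sup>2 = E / 4" using E R by (auto simp: wh_def)
  have "uniformly_continuous_on (closure \<Omega>) h" using h(1) cpt by (rule compact_uniformly_continuous)
  then obtain d1 where d1: "d1 > 0" "!!x y. x \<in> closure \<Omega> ==> y \<in> closure \<Omega> ==> dist y x < d1 ==> dist (h y) (h x) < wh"
   using wh(1) unfolding uniformly_continuous_on_def by metis
  obtain d2 where d2: "d2 > 0" "!!x y. dist y x < d2 ==> dist (Be y) (Be x) < E / 4"
   using ucBe E unfolding uniformly_continuous_on_def by (metis UNIV_I zero_less_divide_iff zero_less_numeral)
  define d where "d = min d1 d2 / 3"
  have d: "d > 0" "d < d1" "2 * d < d2" using d1 d2 by (auto simp: d_def)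
  obtain M1 where M1: "1 / real (Suc M1) < d" using d(1) nat_approx_posE by blast
  obtain M2 where M2: "1 / real (Suc M2) < E / (4 * R\<^sup>2)" using nat_approx_posE[of "E / (4 * R\<^sup>2)"] E R by auto
  have "us n y - us n x <= E" if n: "n >= max M1 M2" and xy: "dist x y <= d" for n x y
  proof -
   have "es n <= d"
   proof -
    have "1 / real (Suc n) <= 1 / real (Suc M1)" using n by (intro divide_left_mono) auto
    then show ?thesis using es(2)[of n] M1 by linarith
   qed
   have es1: "es n <= 1"
   proof -
    have "1 / real (Suc n) <= 1" by simp
    then show ?thesis using es(2)[of n] by linarith
   qed
   have "1 / real (Suc n) <= 1 / real (Suc M2)" using n by (intro divide_left_mono) auto
   then have "1 / real (Suc n) * R\<^sup>2 <= E / (4 * R\<^sup>2) * R\<^sup>2" using M2 by (intro mult_right_mono) auto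
   then have k4: "1 / real (Suc n) * R\<^sup>2 <= E / 4" using R by simp
   have "us n (x + (y - x)) - us n x <= E / 4 + E / 4 + 2 * wh * (R + 1)\<^sup>2"
   proof (rule lattice_translation[OF ne \<Omega>(1) R(2), where e = "es n" and h = h and K = K and Be = Be and d = d and wh = wh])
    show "us n x = avg (es n) (us n) x + (es n)\<^sup>2 / real (2 * DIM('a)) * h x" if "es n < infdist x (- \<Omega>)" for x
     using us(2)[of x n] that by (simp add: in\<Omega>_def)
    show "us n x = 0" if "infdist x (- \<Omega>) <= es n" for x using us(3)[of x n] that by (simp add: in\<Omega>_def)
    show "us n x <= Be x + E / 4" for x using us(5)[of n x] k4 by linarith
    show "\<bar>Be x - Be y\<bar> <= E / 4" if "dist x y <= d + es n" for x y
     using d2(2)[of x y] that d \<open>es n <= d\<close> by (simp add: dist_real_def)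
    show "\<bar>h x - h y\<bar> <= wh" if "x \<in> \<Omega>" "y \<in> \<Omega>" "dist x y <= d" for x y
     using d1(2)[of y x] that d(2) subsetD[OF sub that(1)] subsetD[OF sub that(2)] by (simp add: dist_real_def)
    show "norm (y - x) <= d" using xy by (simp add: dist_norm norm_minus_commute)
   qed (use es es1 us(4) usK wh E in \<open>auto simp: Be_def\<close>)
   also have "... = E" using wh(2) by simp
   finally show ?thesis by simp
  qed
  then have "\<bar>us n x - us n y\<bar> <= E" if "n >= max M1 M2" "dist x y <= d" for n x y
   using that by (simp add: abs_le_iff dist_commute)
  then show ?thesis using d(1) by blast
 qed
 have absK: "\<bar>us n x\<bar> <= K" for n x using usK us(4) by (simp add: abs_of_nonneg)
 obtain k g where k: "strict_mono (k :: nat => nat)" "!!x. (%n. us (k n) x) \<longlonglongrightarrow> g x" "continuous_on UNIV g"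
 proof (rule asymptotic_Arzela_Ascoli[OF absK eq])
  fix g and k :: "nat => nat"
  assume "strict_mono k" "!!x. (%n. us (k n) x) \<longlonglongrightarrow> g x" "continuous_on UNIV g"
  then show thesis by (rule that)
 qed
 have lim0: "(%n. 1 / real (Suc (k n))) \<longlonglongrightarrow> 0"
  using LIMSEQ_subseq_LIMSEQ[OF LIMSEQ_inverse_real_of_nat k(1)] by (simp add: o_def inverse_eq_divide)
 show ?thesis
 proof (rule that[of g "%n. es (k n)" "%n. us (k n)" K])
  show "0 <= g x" for x by (rule LIMSEQ_le_const[OF k(2)]) (use us(4) in auto)
  show "g x = 0" if "x \<notin> \<Omega>" for x using k(2)[of x] us0[OF that] by (simp add: LIMSEQ_const_iff)
  show "g x <= B x" if "x \<in> \<Omega>" for x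
  proof (rule LIMSEQ_le[OF k(2)])
   have "(%n. Be x + 1 / real (Suc (k n)) * R\<^sup>2) \<longlonglongrightarrow> Be x + 0 * R\<^sup>2"
    by (intro tendsto_intros lim0)
   then show "(%n. Be x + 1 / real (Suc (k n)) * R\<^sup>2) \<longlonglongrightarrow> B x" using that by (simp add: Be_def)
   show "\<exists>N. \<forall>n\<ge>N. us (k n) x <= Be x + 1 / real (Suc (k n)) * R\<^sup>2" using us(5) by blast
  qed
  show "(%n. es (k n)) \<longlonglongrightarrow> 0"
   by (rule real_tendsto_sandwich[OF _ _ tendsto_const lim0]) (use es less_imp_le[OF es(1)] in simp_all)
  show "us (k n) x = avg (es (k n)) (us (k n)) x + (es (k n))\<^sup>2 / real (2 * DIM('a)) * h x" if "es (k n) < infdist x (- \<Omega>)" for n x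
   using us(2)[of x "k n"] that by (simp add: in\<Omega>_def)
 qed (use k es us absK us0 in auto)
qed

section \<open>From the lattice limit to a smooth solution of the Poisson equation\<close>

lemma iter_partial_zero: "iter_partial bs (%x. 0) x = 0"
proof -
 have "iter_partial bs (%x. 0) = (%x::'a. 0)"
 proof (induction bs)
  case (Cons b bs)
  then show ?case by (auto simp: pd_const)
 qed simp
 then show ?thesis by simp
qed

lemma iter_partial_bounded_support:
 fixes \<eta> :: "'a::euclidean_space => real"
 assumes \<eta>: "smooth_on UNIV \<eta>" "!!z. norm z >= \<delta> ==> \<eta> z = 0" and bs: "set bs \<subseteq> Basis"
 shows "\<exists>M. \<forall>z. \<bar>iter_partial bs \<eta> z\<bar> <= M"
proof -
 have "continuous_on (cball 0 \<delta>) (iter_partial bs \<eta>)"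
  using smooth_on_continuous[OF smooth_on_iter_partial[OF \<eta>(1) bs]] continuous_on_subset by blast
 then have "bounded (iter_partial bs \<eta> ` cball 0 \<delta>)" by (intro compact_imp_bounded compact_continuous_image) auto
 then obtain M where M: "\<forall>y\<in>iter_partial bs \<eta> ` cball 0 \<delta>. norm y <= M" unfolding bounded_iff by blast
 have "\<bar>iter_partial bs \<eta> z\<bar> <= max M 0" for z
 proof (cases "norm z <= \<delta>")
  case True
  then have "norm (iter_partial bs \<eta> z) <= M" using M by simp
  then show ?thesis by simp
 next
  case False
  have "iter_partial bs \<eta> z = iter_partial bs (%x. 0) z"
   by (rule iter_partial_cong_open[of "- cball 0 \<delta>"]) (use False \<eta>(2) in auto)
  then show ?thesis by (simp add: iter_partial_zero)
 qed
 then show ?thesis by blast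
qed

text \<open>Translation invariance of Lebesgue measure moves \<open>avg\<close> from the lattice
  solution to the test function, in place of summation by parts; dominated convergence does the
  rest. The distance condition keeps the support of the test function in the region where the scheme
  eventually holds.\<close>

lemma weak_limit_equation:
 fixes h \<eta> g :: "'a::euclidean_space => real"
 assumes \<Omega>: "open \<Omega>" "bounded \<Omega>"
  and es: "!!n::nat. es n > (0::real)" "es \<longlonglongrightarrow> 0"
  and us: "!!n. us n \<in> borel_measurable borel" "!!n x. \<bar>us n x\<bar> <= K" "!!n x. x \<notin> \<Omega> ==> us n x = 0"
   "!!n x. infdist x (- \<Omega>) > es n ==> us n x = avg (es n) (us n) x + (es n)\<^sup>2 / (2 * DIM('a)) * h x"
   "!!x. (%n. us n x) \<longlonglongrightarrow> g x"
  and \<eta>: "smooth_on UNIV \<eta>" "!!z. norm z >= \<delta> ==> \<eta> z = 0"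
  and x: "infdist x (- \<Omega>) > \<delta>"
 shows "(LBINT y. g y * laplacian \<eta> (x - y)) = - (LBINT y. (if y \<in> \<Omega> then h y else 0) * \<eta> (x - y))"
proof -
 let ?N = "real DIM('a)"
 have N: "?N >= 1" using DIM_positive[where 'a='a] by linarith
 define h0 where "h0 y = (if y \<in> \<Omega> then h y else 0)" for y
 have c\<eta>: "continuous_on UNIV \<eta>" by (rule smooth_on_continuous[OF \<eta>(1)])
 have \<eta>m: "\<eta> \<in> borel_measurable borel" using c\<eta> by (rule borel_measurable_continuous_onI)
 obtain M0 where M0: "!!z. \<bar>\<eta> z\<bar> <= M0" using iter_partial_bounded_support[OF \<eta>, where bs = "[]"] by auto
 have "\<forall>b\<in>Basis. \<exists>M. \<forall>z. \<bar>pd b (pd b \<eta>) z\<bar> <= M"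
  using iter_partial_bounded_support[OF \<eta>, where bs = "[b, b]" for b] by simp
 then obtain Mb where Mb: "!!b z. b \<in> Basis ==> \<bar>pd b (pd b \<eta>) z\<bar> <= Mb b" by metis
 define M where "M = Max (Mb ` (Basis::'a set))"
 have M: "\<bar>pd b (pd b \<eta>) z\<bar> <= M" if "b \<in> Basis" for b z
 proof -
  have "Mb b <= M" unfolding M_def using that by (intro Max_ge) auto
  then show ?thesis using Mb[OF that, of z] by linarith
 qed
 have K0: "K >= 0" using us(2)[of 0 0] by linarith
 have M00: "M0 >= 0" using M0[of 0] by linarith
 have Mnn: "M >= 0" using M[of "SOME b. b \<in> Basis" 0] SOME_Basis by force
 \<comment> \<open>The discrete Laplacian of \<open>\<eta>\<close> at \<open>x - y\<close> with mesh
   \<open>es n\<close>. Consistency makes it converge to the Laplacian and keeps it bounded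
   independently of \<open>n\<close>.\<close>
 define L where "L n y = 2 * ?N / (es n)\<^sup>2 * (avg (es n) \<eta> (x - y) - \<eta> (x - y))" for n y
 have Lest: "\<bar>L n y - laplacian \<eta> (x - y)\<bar> <= ?N * w"
  if w: "!!b z. b \<in> Basis ==> z \<in> cball (x - y) (es n) ==> \<bar>pd b (pd b \<eta>) z - pd b (pd b \<eta>) (x - y)\<bar> <= w" for n y w
 proof -
  have c: "\<bar>avg (es n) \<eta> (x - y) - \<eta> (x - y) - (es n)\<^sup>2 / (2 * DIM('a)) * laplacian \<eta> (x - y)\<bar> <= (es n)\<^sup>2 * w / 2"
   by (rule avg_consistency[OF \<eta>(1) es(1) _ w]) auto
  have "L n y - laplacian \<eta> (x - y) = 2 * ?N / (es n)\<^sup>2 * (avg (es n) \<eta> (x - y) - \<eta> (x - y) - (es n)\<^sup>2 / (2 * DIM('a)) * laplacian \<eta> (x - y))"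
   using es(1)[of n] N by (simp add: L_def field_simps)
  then have "\<bar>L n y - laplacian \<eta> (x - y)\<bar> = 2 * ?N / (es n)\<^sup>2 * \<bar>avg (es n) \<eta> (x - y) - \<eta> (x - y) - (es n)\<^sup>2 / (2 * DIM('a)) * laplacian \<eta> (x - y)\<bar>"
   by (simp only: abs_mult) simp
  also have "... <= 2 * ?N / (es n)\<^sup>2 * ((es n)\<^sup>2 * w / 2)" by (intro mult_left_mono c) simp
  also have "... = ?N * w" using es(1)[of n] by simp
  finally show ?thesis .
 qed
 have lapM: "\<bar>laplacian \<eta> z\<bar> <= ?N * M" for z
 proof -
  have "\<bar>laplacian \<eta> z\<bar> <= (\<Sum>b\<in>(Basis::'a set). M)"
   unfolding laplacian_pd by (intro order.trans[OF sum_abs] sum_mono M)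
  then show ?thesis by simp
 qed
 have Lb: "\<bar>L n y\<bar> <= 3 * ?N * M" for n y
 proof -
  have "\<bar>L n y - laplacian \<eta> (x - y)\<bar> <= ?N * (2 * M)"
  proof (rule Lest)
   fix b z assume "b \<in> (Basis::'a set)"
   then show "\<bar>pd b (pd b \<eta>) z - pd b (pd b \<eta>) (x - y)\<bar> <= 2 * M"
    using M[of b z] M[of b "x - y"] by linarith
  qed
  then show ?thesis using lapM[of "x - y"] by linarith
 qed
 have Llim: "(%n. L n y) \<longlonglongrightarrow> laplacian \<eta> (x - y)" for y
 proof (rule LIMSEQ_I)
  fix E :: real assume E: "E > 0"
  define w where "w = E / (2 * ?N)"
  have w: "w > 0" "?N * w < E" using E N by (auto simp: w_def field_simps)
  have "\<forall>b\<in>Basis. \<exists>d>0. \<forall>z. dist z (x - y) < d --> dist (pd b (pd b \<eta>) z) (pd b (pd b \<eta>) (x - y)) < w"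
  proof
   fix b :: 'a assume "b \<in> Basis"
   have "continuous_on UNIV (pd b (pd b \<eta>))" by (intro smooth_on_continuous smooth_on_pd \<eta>)
   then show "\<exists>d>0. \<forall>z. dist z (x - y) < d --> dist (pd b (pd b \<eta>) z) (pd b (pd b \<eta>) (x - y)) < w"
    using w(1) by (auto simp: continuous_on_iff)
  qed
  then obtain d where d: "!!b. b \<in> (Basis::'a set) ==> d b > (0::real)"
   "!!b z. b \<in> (Basis::'a set) ==> dist z (x - y) < d b ==> dist (pd b (pd b \<eta>) z) (pd b (pd b \<eta>) (x - y)) < w"
   by metis
  define dm where "dm = Min (d ` (Basis::'a set))"
  have dm: "dm > 0" "!!b. b \<in> (Basis::'a set) ==> dm <= d b" using d(1) by (auto simp: dm_def)
  obtain n0 where n0: "!!n. n >= n0 ==> es n < dm"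
   using LIMSEQ_D[OF es(2) dm(1)] es(1) by (auto simp: abs_of_pos)
  have "norm (L n y - laplacian \<eta> (x - y)) < E" if "n >= n0" for n
  proof -
   have "\<bar>L n y - laplacian \<eta> (x - y)\<bar> <= ?N * w"
   proof (rule Lest)
    fix b z assume b: "b \<in> (Basis::'a set)" and z: "z \<in> cball (x - y) (es n)"
    have "dist z (x - y) < d b" using z n0[OF that] dm(2)[OF b] by (simp add: dist_commute)
    then show "\<bar>pd b (pd b \<eta>) z - pd b (pd b \<eta>) (x - y)\<bar> <= w" using d(2)[OF b] by (simp add: dist_real_def less_imp_le)
   qed
   then show ?thesis using w(2) by simp
  qed
  then show "\<exists>no. \<forall>n\<ge>no. norm (L n y - laplacian \<eta> (x - y)) < E" by blast
 qed
 have av: "avg e \<eta> \<in> borel_measurable borel" for e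
  unfolding avg_def[abs_def]
  by (intro borel_measurable_divide borel_measurable_sum borel_measurable_const borel_measurable_add measurable_compose[OF _ \<eta>m]) auto
 have Lm: "L n \<in> borel_measurable borel" for n
  unfolding L_def[abs_def]
  by (intro borel_measurable_times borel_measurable_const borel_measurable_diff measurable_compose[OF _ av] measurable_compose[OF _ \<eta>m]) auto
 have lapm: "(%y. laplacian \<eta> (x - y)) \<in> borel_measurable borel"
  by (rule borel_measurable_LIMSEQ_real[OF Llim Lm])
 have gm: "g \<in> borel_measurable borel" by (rule borel_measurable_LIMSEQ_real[OF us(5) us(1)])
 have lim: "(%n. LBINT y. us n y * L n y) \<longlonglongrightarrow> (LBINT y. g y * laplacian \<eta> (x - y))"
 proof (rule integral_dominated_convergence)
  show "(%y. g y * laplacian \<eta> (x - y)) \<in> borel_measurable lborel" using gm lapm by simp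
  show "(%y. us n y * L n y) \<in> borel_measurable lborel" for n using us(1)[of n] Lm[of n] by simp
  show "integrable lborel (%y. K * (3 * ?N * M) * indicator \<Omega> y)"
  proof (rule integrable_bounded_support[OF _ _ \<Omega>(2)])
   show "(%y. K * (3 * ?N * M) * indicator \<Omega> y) \<in> borel_measurable borel" using \<Omega>(1) by simp
   show "\<bar>K * (3 * ?N * M) * indicator \<Omega> y\<bar> <= K * (3 * ?N * M)" for y
    using K0 Mnn by (simp add: indicator_def)
  qed simp
  show "AE y in lborel. (%n. us n y * L n y) \<longlonglongrightarrow> g y * laplacian \<eta> (x - y)"
   by (intro AE_I2 tendsto_mult us(5) Llim)
  have "norm (us n y * L n y) <= K * (3 * ?N * M) * indicator \<Omega> y" for n y
  proof (cases "y \<in> \<Omega>")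
   case True
   then show ?thesis unfolding real_norm_def abs_mult using us(2) Lb K0 by (auto intro!: mult_mono)
  qed (simp add: us(3))
  then show "AE y in lborel. norm (us n y * L n y) <= K * (3 * ?N * M) * indicator \<Omega> y" for n by (intro AE_I2)
 qed
 have eq: "(LBINT y. us n y * L n y) = - (LBINT y. h0 y * \<eta> (x - y))" if n: "\<delta> + es n < infdist x (- \<Omega>)" for n
 proof -
  define e where "e = es n"
  define u where "u = us n"
  have e: "e > 0" using es(1) by (simp add: e_def)
  have um: "u \<in> borel_measurable borel" and uK: "!!y. \<bar>u y\<bar> <= K" and u0: "!!y. y \<notin> \<Omega> ==> u y = 0"
   using us by (auto simp: u_def)
  have int: "integrable lborel (%y. u (y + c) * \<eta> (x - y + d))" for c d
  proof (rule integrable_bounded_support)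
   show "(%y. u (y + c) * \<eta> (x - y + d)) \<in> borel_measurable borel"
    by (intro borel_measurable_times measurable_compose[OF _ um] measurable_compose[OF _ \<eta>m]) auto
   show "\<bar>u (y + c) * \<eta> (x - y + d)\<bar> <= K * M0" for y
    unfolding abs_mult by (intro mult_mono uK M0 K0) auto
   show "bounded ((%y. y - c) ` \<Omega>)" using bounded_translation[OF \<Omega>(2), of "- c"] by (simp add: add.commute)
   show "u (y + c) * \<eta> (x - y + d) = 0" if "y \<notin> (%y. y - c) ` \<Omega>" for y
    using u0[of "y + c"] that by (auto simp: image_iff) (metis add_diff_cancel)
  qed
  have shift: "(LBINT y. u y * \<eta> (x - y + d)) = (LBINT y. u (y + d) * \<eta> (x - y))" for d
  proof -
   have "(LBINT y. u (y + d) * \<eta> (x - (y + d) + d)) = (LBINT y. u y * \<eta> (x - y + d))"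
    by (rule lborel_integral_shift[where f = "%y. u y * \<eta> (x - y + d)"])
     (intro borel_measurable_times um measurable_compose[OF _ \<eta>m], simp)
   then show ?thesis by simp
  qed
  have i1: "integrable lborel (%y. u y * \<eta> (x - y + d))" for d using int[of 0 d] by simp
  have i2: "integrable lborel (%y. u (y + d) * \<eta> (x - y))" for d using int[of d 0] by simp
  have i0: "integrable lborel (%y. u y * \<eta> (x - y))" using int[of 0 0] by simp
  have "(LBINT y. u y * avg e \<eta> (x - y))
   = (LBINT y. (\<Sum>b\<in>Basis. u y * \<eta> (x - y + e *\<^sub>R b) + u y * \<eta> (x - y + (- e) *\<^sub>R b)) / (2 * ?N))"
   by (intro Bochner_Integration.integral_cong) (auto simp: avg_def sum_distrib_left distrib_left)
  also have "... = (\<Sum>b\<in>Basis. (LBINT y. u y * \<eta> (x - y + e *\<^sub>R b)) + (LBINT y. u y * \<eta> (x - y + (- e) *\<^sub>R b))) / (2 * ?N)"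
   by (simp add: Bochner_Integration.integral_sum Bochner_Integration.integral_add i1 del: scaleR_minus_left)
  also have "... = (\<Sum>b\<in>Basis. (LBINT y. u (y + e *\<^sub>R b) * \<eta> (x - y)) + (LBINT y. u (y + (- e) *\<^sub>R b) * \<eta> (x - y))) / (2 * ?N)"
   by (simp only: shift)
  also have "... = (LBINT y. (\<Sum>b\<in>Basis. u (y + e *\<^sub>R b) * \<eta> (x - y) + u (y + (- e) *\<^sub>R b) * \<eta> (x - y)) / (2 * ?N))"
   by (simp add: Bochner_Integration.integral_sum Bochner_Integration.integral_add i2 del: scaleR_minus_left)
  also have "... = (LBINT y. avg e u y * \<eta> (x - y))"
   by (intro Bochner_Integration.integral_cong) (auto simp: avg_def sum_distrib_right distrib_right)
  finally have A: "(LBINT y. u y * avg e \<eta> (x - y)) = (LBINT y. avg e u y * \<eta> (x - y))" .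
  have ia: "integrable lborel (%y. u y * avg e \<eta> (x - y))"
  proof -
   have "integrable lborel (%y. (\<Sum>b\<in>Basis. u y * \<eta> (x - y + e *\<^sub>R b) + u y * \<eta> (x - y + (- e) *\<^sub>R b)) / (2 * ?N))"
    by (intro Bochner_Integration.integrable_divide_zero Bochner_Integration.integrable_sum Bochner_Integration.integrable_add i1)
   then show ?thesis by (simp add: avg_def sum_distrib_left distrib_left)
  qed
  have ib: "integrable lborel (%y. avg e u y * \<eta> (x - y))"
  proof -
   have "integrable lborel (%y. (\<Sum>b\<in>Basis. u (y + e *\<^sub>R b) * \<eta> (x - y) + u (y + (- e) *\<^sub>R b) * \<eta> (x - y)) / (2 * ?N))"
    by (intro Bochner_Integration.integrable_divide_zero Bochner_Integration.integrable_sum Bochner_Integration.integrable_add i2)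
   then show ?thesis by (simp add: avg_def sum_distrib_right distrib_right)
  qed
  have "(LBINT y. us n y * L n y) = 2 * ?N / e\<^sup>2 * (LBINT y. u y * avg e \<eta> (x - y) - u y * \<eta> (x - y))"
  proof -
   have "(%y. us n y * L n y) = (%y. 2 * ?N / e\<^sup>2 * (u y * avg e \<eta> (x - y) - u y * \<eta> (x - y)))"
   proof
    have "p * (c * (a - b)) = c * (p * a - p * b)" for p c a b :: real by (simp add: algebra_simps)
    then show "us n y * L n y = 2 * ?N / e\<^sup>2 * (u y * avg e \<eta> (x - y) - u y * \<eta> (x - y))" for y
     unfolding L_def u_def e_def .
   qed
   then show ?thesis by simp
  qed
  also have "(LBINT y. u y * avg e \<eta> (x - y) - u y * \<eta> (x - y)) = (LBINT y. avg e u y * \<eta> (x - y) - u y * \<eta> (x - y))"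
   using A by (simp add: Bochner_Integration.integral_diff ia ib i0)
  also have "... = (LBINT y. - (e\<^sup>2 / (2 * ?N)) * (h0 y * \<eta> (x - y)))"
  proof (rule Bochner_Integration.integral_cong[OF refl])
   fix y
   show "avg e u y * \<eta> (x - y) - u y * \<eta> (x - y) = - (e\<^sup>2 / (2 * ?N)) * (h0 y * \<eta> (x - y))"
   proof (cases "norm (x - y) < \<delta>")
    case True
    have "infdist x (- \<Omega>) <= infdist y (- \<Omega>) + dist x y" by (rule infdist_triangle)
    then have i: "infdist y (- \<Omega>) > e" using True n by (simp add: dist_norm e_def)
    then have "y \<in> \<Omega>" using e by (metis ComplI infdist_zero less_asym)
    then have "avg e u y - u y = - (e\<^sup>2 / (2 * ?N)) * h0 y"
     using us(4)[of n y] i by (simp add: e_def u_def h0_def)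
    then have "(avg e u y - u y) * \<eta> (x - y) = - (e\<^sup>2 / (2 * ?N)) * h0 y * \<eta> (x - y)" by simp
    then show ?thesis by (simp add: algebra_simps)
   next
    case False
    then show ?thesis using \<eta>(2)[of "x - y"] by simp
   qed
  qed
  also have "... = - (e\<^sup>2 / (2 * ?N)) * (LBINT y. h0 y * \<eta> (x - y))"
   by (rule integral_mult_right_zero)
  finally show ?thesis using e N by (simp add: field_simps)
 qed
 have "\<forall>\<^sub>F n in sequentially. es n < infdist x (- \<Omega>) - \<delta>"
  using order_tendstoD(2)[OF es(2), of "infdist x (- \<Omega>) - \<delta>"] x by simp
 then have "\<forall>\<^sub>F n in sequentially. - (LBINT y. h0 y * \<eta> (x - y)) = (LBINT y. us n y * L n y)"
  by eventually_elim (use eq in simp)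
 then have "(%n. LBINT y. us n y * L n y) \<longlonglongrightarrow> - (LBINT y. h0 y * \<eta> (x - y))"
  by (rule Lim_transform_eventually[OF tendsto_const])
 with lim show ?thesis unfolding h0_def using LIMSEQ_unique by blast
qed

lemma approximate_identity:
 fixes f :: "'a::euclidean_space => real"
 assumes f: "f \<in> borel_measurable borel" "!!x. \<bar>f x\<bar> <= K" "isCont f x"
  and \<delta>: "\<delta> \<longlonglongrightarrow> 0"
  and \<eta>: "!!n. \<eta> n \<in> borel_measurable borel" "!!n z. \<eta> n z >= 0" "!!n z. norm z >= \<delta> n ==> \<eta> n z = 0"
   "!!n. integrable lborel (\<eta> n)" "!!n. (LBINT z. \<eta> n z) = 1"
 shows "(%n::nat. LBINT z. f (x - z) * \<eta> n z) \<longlonglongrightarrow> f x"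
proof (rule LIMSEQ_I)
 fix E :: real assume E: "E > 0"
 obtain d where d: "d > 0" "!!y. dist y x < d ==> dist (f y) (f x) < E / 2"
  using f(3) E unfolding continuous_at_eps_delta by (metis half_gt_zero)
 obtain n0 where n0: "!!n. n >= n0 ==> \<bar>\<delta> n\<bar> < d" using LIMSEQ_D[OF \<delta> d(1)] by auto
 have "norm ((LBINT z. f (x - z) * \<eta> n z) - f x) < E" if n: "n >= n0" for n
 proof -
  have i: "integrable lborel (%z. f (x - z) * \<eta> n z)"
  proof (rule Bochner_Integration.integrable_bound[OF integrable_mult_right[OF \<eta>(4)[of n], of K]])
   have "(%z. f (x - z) * \<eta> n z) \<in> borel_measurable borel"
    by (intro borel_measurable_times measurable_compose[OF _ f(1)] \<eta>(1)) auto
   then show "(%z. f (x - z) * \<eta> n z) \<in> borel_measurable lborel" by simp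
   have "norm (f (x - z) * \<eta> n z) <= norm (K * \<eta> n z)" for z
    using f(2)[of "x - z"] \<eta>(2)[of n z] by (simp add: abs_mult mult_right_mono)
   then show "AE z in lborel. norm (f (x - z) * \<eta> n z) <= norm (K * \<eta> n z)" by (intro AE_I2)
  qed
  have "(LBINT z. f (x - z) * \<eta> n z) - f x = (LBINT z. f (x - z) * \<eta> n z) - (LBINT z. f x * \<eta> n z)"
   using \<eta>(5) by simp
  also have "... = (LBINT z. f (x - z) * \<eta> n z - f x * \<eta> n z)"
   by (rule Bochner_Integration.integral_diff[symmetric, OF i integrable_mult_right[OF \<eta>(4)]])
  also have "\<bar>...\<bar> <= (LBINT z. E / 2 * \<eta> n z)"
  proof (rule integral_abs_bound_integral)
   show "integrable lborel (%z. f (x - z) * \<eta> n z - f x * \<eta> n z)"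
    by (rule Bochner_Integration.integrable_diff[OF i integrable_mult_right[OF \<eta>(4)]])
   show "integrable lborel (%z. E / 2 * \<eta> n z)" by (rule integrable_mult_right[OF \<eta>(4)])
   show "\<bar>f (x - z) * \<eta> n z - f x * \<eta> n z\<bar> <= E / 2 * \<eta> n z" for z
   proof (cases "norm z < \<delta> n")
    case True
    then have "dist (x - z) x < d" using n0[OF n] by (simp add: dist_norm)
    then have "\<bar>f (x - z) - f x\<bar> <= E / 2" using d(2) by (simp add: dist_real_def less_imp_le)
    then have "\<bar>f (x - z) - f x\<bar> * \<eta> n z <= E / 2 * \<eta> n z" using \<eta>(2) by (intro mult_right_mono)
    then show ?thesis using \<eta>(2)[of n z] by (simp add: abs_mult flip: left_diff_distrib)
   qed (use \<eta>(3)[of n z] in simp)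
  qed
  also have "... < E" using \<eta>(5) E by simp
  finally show ?thesis by simp
 qed
 then show "\<exists>no. \<forall>n\<ge>no. norm ((LBINT z. f (x - z) * \<eta> n z) - f x) < E" by blast
qed


lemma Basis_box_norm:
 fixes z :: "'a::euclidean_space" and d :: real
 assumes "z \<in> cbox (- (d *\<^sub>R One)) (d *\<^sub>R One)"
 shows "norm z <= DIM('a) * d"
proof -
 have *: "- d <= z \<bullet> b & z \<bullet> b <= d" if "b \<in> Basis" for b
  using assms that by (simp add: mem_box inner_simps)
 have "norm z <= (\<Sum>b\<in>Basis. \<bar>z \<bullet> b\<bar>)" by (rule norm_le_l1)
 also have "... <= (\<Sum>b\<in>(Basis::'a set). d)"
  using * by (intro sum_mono) (simp add: abs_le_iff minus_le_iff)
 finally show ?thesis by simp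
qed

text \<open>Testing with translated mollifiers shows that, away from the boundary, the Laplacian of
  the mollified limit is minus the mollified \<open>h\<close>. Its derivatives are then locally
  bounded, and \<open>limit_smooth\<close> carries smoothness and the equation over to
  \<open>g\<close>. The boundary values come from 0 <= g <= B alone.\<close>

theorem linear_dirichlet:
 fixes h B :: "'a::euclidean_space => real"
 assumes \<Omega>: "open \<Omega>" "bounded \<Omega>"
  and h: "smooth_on \<Omega> h" "continuous_on (closure \<Omega>) h" "!!x. x \<in> \<Omega> ==> 0 <= h x"
  and B: "smooth_on \<Omega> B" "continuous_on (closure \<Omega>) B" "!!x. x \<in> frontier \<Omega> ==> B x = 0"
   "!!b. b \<in> Basis ==> uniformly_continuous_on \<Omega> (pd b (pd b B))" "!!x. x \<in> \<Omega> ==> h x <= - laplacian B x"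
 obtains g where "smooth_on \<Omega> g" "continuous_on UNIV g" "!!x. 0 <= g x" "!!x. x \<in> \<Omega> ==> g x <= B x"
  "!!x. x \<notin> \<Omega> ==> g x = 0" "!!x. x \<in> \<Omega> ==> laplacian g x = - h x"
proof -
 let ?N = "real DIM('a)"
 have N: "?N >= 1" using DIM_positive[where 'a='a] by linarith
 obtain g us es K where g: "continuous_on UNIV g" "!!x. 0 <= g x" "!!x. x \<in> \<Omega> ==> g x <= B x" "!!x. x \<notin> \<Omega> ==> g x = 0"
  and es: "!!n::nat. es n > (0::real)" "es \<longlonglongrightarrow> 0"
  and us: "!!n. us n \<in> borel_measurable borel" "!!n x. \<bar>us n x\<bar> <= K" "!!n x. x \<notin> \<Omega> ==> us n x = 0"
  "!!n x. infdist x (- \<Omega>) > es n ==> us n x = avg (es n) (us n) x + (es n)\<^sup>2 / (2 * DIM('a)) * h x"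
  "!!x. (%n. us n x) \<longlonglongrightarrow> g x"
  by (rule lattice_limit[OF \<Omega> h(2,3) B]) (assumption | rule that)+
 have cpt: "compact (closure \<Omega>)" using \<Omega>(2) by (simp add: compact_closure)
 have sub: "\<Omega> \<subseteq> closure \<Omega>" by (rule closure_subset)
 have "\<Omega> \<noteq> UNIV" using \<Omega>(2) not_bounded_UNIV by metis
 then have cl\<Omega>: "closed (- \<Omega>)" "- \<Omega> \<noteq> {}" using \<Omega>(1) by auto
 have gK: "\<bar>g x\<bar> <= K" for x
  by (rule LIMSEQ_le_const2[OF tendsto_rabs[OF us(5)]]) (use us(2) in auto)
 define \<delta> where "\<delta> n = 1 / real (Suc n)" for n
 have \<delta>: "\<delta> n > 0" "\<delta> \<longlonglongrightarrow> 0" for n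
  using LIMSEQ_inverse_real_of_nat unfolding \<delta>_def[abs_def] inverse_eq_divide by simp_all
 have "\<exists>\<eta> :: 'a => real. smooth_on UNIV \<eta> & (\<forall>x. \<eta> x >= 0) & (\<forall>x. norm x >= \<delta> n --> \<eta> x = 0) & integrable lborel \<eta> & (LBINT x. \<eta> x) = 1" for n
  by (rule mollifier_exists[OF \<delta>(1)[of n]]) blast
 then obtain \<eta> :: "nat => 'a => real" where \<eta>: "!!n. smooth_on UNIV (\<eta> n)" "!!n x. \<eta> n x >= 0" "!!n x. norm x >= \<delta> n ==> \<eta> n x = 0"
  "!!n. integrable lborel (\<eta> n)" "!!n. (LBINT x. \<eta> n x) = 1" by metis
 have c\<eta>: "continuous_on UNIV (\<eta> n)" for n by (rule smooth_on_continuous[OF \<eta>(1)])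
 have \<eta>m: "\<eta> n \<in> borel_measurable borel" for n using c\<eta> by (rule borel_measurable_continuous_onI)
 have gm: "g \<in> borel_measurable borel" using g(1) by (rule borel_measurable_continuous_onI)
 define h0 where "h0 x = (if x \<in> \<Omega> then h x else 0)" for x
 have h0m: "h0 \<in> borel_measurable borel" unfolding h0_def[abs_def]
  by (rule borel_measurable_continuous_on_if) (use \<Omega> continuous_on_subset[OF h(2) sub] in auto)
 obtain Kh where k: "Kh >= 0" "!!x. x \<in> closure \<Omega> ==> \<bar>h x\<bar> <= Kh" by (rule compact_bound[OF cpt h(2)]) blast
 have Kh: "\<bar>h0 x\<bar> <= Kh" for x using k(1) k(2)[of x] sub by (auto simp: h0_def)
 obtain a c where ac: "\<Omega> \<subseteq> cbox a (c::'a)" using bounded_subset_cbox_symmetric[OF \<Omega>(2)] by blast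
 \<comment> \<open>In this form all derivatives fall on the mollifier; at this point
   \<open>g\<close> is only known to be continuous.\<close>
 define w where "w n x = integral (cbox a c) (%z. \<eta> n (x - z) * g z)" for n x
 have w_smooth: "smooth_on UNIV (w n)" and w_it: "!!bs x. set bs \<subseteq> Basis ==> iter_partial bs (w n) x = integral (cbox a c) (%z. iter_partial bs (\<eta> n) (x - z) * g z)" for n
  unfolding w_def[abs_def] using smooth_convolution[OF \<eta>(1)[of n] continuous_on_subset[OF g(1)] open_UNIV] by auto
 have int_g: "(LBINT z. f (x - z) * g z) = integral (cbox a c) (%z. f (x - z) * g z)"
  "integrable lborel (%z. f (x - z) * g z)" if "continuous_on UNIV f" for f x
 proof -
  show i: "integrable lborel (%z. f (x - z) * g z)"
  proof (rule integrable_compact_support[OF _ \<Omega>(2)])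
   show "continuous_on UNIV (%z. f (x - z) * g z)"
    by (intro continuous_intros g(1) continuous_on_compose2[OF that]) auto
  qed (simp add: g(4))
  show "(LBINT z. f (x - z) * g z) = integral (cbox a c) (%z. f (x - z) * g z)"
   by (rule lborel_integral_eq_cbox[OF i]) (use g(4) ac in auto)
 qed
 have reflect: "(LBINT y. f y * \<eta> n (x - y)) = (LBINT z. f (x - z) * \<eta> n z)" if "f \<in> borel_measurable borel" for f n x
 proof -
  have "(LBINT z. f (x - z) * \<eta> n (x - (x - z))) = (LBINT y. f y * \<eta> n (x - y))"
   by (rule lborel_integral_reflect[where f = "%y. f y * \<eta> n (x - y)"])
    (intro borel_measurable_times that measurable_compose[OF _ \<eta>m], simp)
  then show ?thesis by simp
 qed
 have reflect_int: "integrable lborel (%z. f (x - z) * \<eta> n z)" if "f \<in> borel_measurable borel" "!!x. \<bar>f x\<bar> <= C" for f C x n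
 proof (rule Bochner_Integration.integrable_bound[OF integrable_mult_right[OF \<eta>(4)[of n], of C]])
  have "(%z. f (x - z) * \<eta> n z) \<in> borel_measurable borel"
   by (intro borel_measurable_times measurable_compose[OF _ that(1)] \<eta>m) auto
  then show "(%z. f (x - z) * \<eta> n z) \<in> borel_measurable lborel" by simp
  have "norm (f (x - z) * \<eta> n z) <= norm (C * \<eta> n z)" for z
   using that(2)[of "x - z"] \<eta>(2)[of n z] by (simp add: abs_mult mult_right_mono)
  then show "AE z in lborel. norm (f (x - z) * \<eta> n z) <= norm (C * \<eta> n z)" by (intro AE_I2)
 qed
 have w_alt: "w n x = (LBINT z. g (x - z) * \<eta> n z)" for n x
  unfolding w_def int_g(1)[OF c\<eta>, symmetric] using reflect[OF gm, of n x] by (simp add: mult.commute)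
 have w_lim: "(%n. w n x) \<longlonglongrightarrow> g x" for x
  unfolding w_alt
  by (rule approximate_identity[OF gm gK _ \<delta>(2) \<eta>m \<eta>(2,3,4,5)]) (use g(1) in \<open>simp add: continuous_on_eq_continuous_at\<close>)
 have lap_w: "laplacian (w n) x = - (LBINT z. h0 (x - z) * \<eta> n z)" if x: "infdist x (- \<Omega>) > \<delta> n" for n x
 proof -
  have "laplacian (w n) x = (\<Sum>b\<in>Basis. iter_partial [b, b] (w n) x)" by (simp add: laplacian_def)
  also have "... = (\<Sum>b\<in>Basis. LBINT z. pd b (pd b (\<eta> n)) (x - z) * g z)"
  proof (intro sum.cong refl)
   fix b :: 'a assume "b \<in> Basis"
   then have "iter_partial [b, b] (w n) x = integral (cbox a c) (%z. iter_partial [b, b] (\<eta> n) (x - z) * g z)" by (intro w_it) auto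
   also have "... = integral (cbox a c) (%z. pd b (pd b (\<eta> n)) (x - z) * g z)" by simp
   also have "... = (LBINT z. pd b (pd b (\<eta> n)) (x - z) * g z)"
    by (rule int_g(1)[symmetric]) (intro smooth_on_continuous smooth_on_pd \<eta>)
   finally show "iter_partial [b, b] (w n) x = (LBINT z. pd b (pd b (\<eta> n)) (x - z) * g z)" .
  qed
  also have "... = (LBINT z. (\<Sum>b\<in>Basis. pd b (pd b (\<eta> n)) (x - z) * g z))"
   by (rule Bochner_Integration.integral_sum[symmetric]) (intro int_g(2) smooth_on_continuous smooth_on_pd \<eta>)
  also have "... = (LBINT z. g z * laplacian (\<eta> n) (x - z))"
   by (simp add: laplacian_pd sum_distrib_left mult.commute)
  also have "... = - (LBINT y. h0 y * \<eta> n (x - y))"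
   unfolding h0_def by (rule weak_limit_equation[OF \<Omega> es us \<eta>(1) \<eta>(3) x])
  also have "... = - (LBINT z. h0 (x - z) * \<eta> n z)" using reflect[OF h0m, of n x] by simp
  finally show ?thesis .
 qed
 have ev: "\<forall>\<^sub>F n in sequentially. \<delta> n < d" if "d > 0" for d using order_tendstoD(2)[OF \<delta>(2) that] .
 \<comment> \<open>Near an interior point and for large \<open>n\<close> the Laplacian of
   \<open>w n\<close> is the mollification of \<open>- h\<close>, so its derivatives can be put on
   \<open>h\<close> and are bounded by those of \<open>h\<close> on a slightly larger ball.\<close>
 have lb_lap: "loc_bounded \<Omega> (%n. iter_partial bs (laplacian (w n)))" if bs: "set bs \<subseteq> Basis" for bs
  unfolding loc_bounded_def
 proof
  fix x0 assume "x0 \<in> \<Omega>"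
  then obtain r where r: "r > 0" "ball x0 r \<subseteq> \<Omega>" using \<Omega>(1) open_contains_ball by blast
  define d where "d = r / 3"
  have d: "d > 0" using r by (simp add: d_def)
  have sh: "smooth_on \<Omega> (%x. - h x)" by (rule smooth_on_minus[OF h(1)])
  have sub2: "cball x0 (2 * d) \<subseteq> \<Omega>" using r by (auto simp: d_def)
  have "continuous_on (cball x0 (2 * d)) (iter_partial bs (%x. - h x))"
   by (rule continuous_on_subset[OF smooth_on_continuous[OF smooth_on_iter_partial[OF sh bs]] sub2])
  then obtain M where M: "M >= 0" "!!y. y \<in> cball x0 (2 * d) ==> \<bar>iter_partial bs (%x. - h x) y\<bar> <= M"
   by (rule compact_bound[OF compact_cball]) blast
  obtain n0 where n0: "!!n. n >= n0 ==> \<delta> n < d / ?N" using ev[of "d / ?N"] d N unfolding eventually_sequentially by auto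
  have "\<bar>iter_partial bs (laplacian (w n)) x\<bar> <= M" if n: "n >= n0" and x: "x \<in> ball x0 d" for n x
  proof -
   define cb where "cb = cbox (- (\<delta> n *\<^sub>R One)) (\<delta> n *\<^sub>R One :: 'a)"
   have \<delta>d: "?N * \<delta> n <= d" "\<delta> n <= d"
   proof -
    show *: "?N * \<delta> n <= d" using n0[OF n] N by (simp add: field_simps)
    have "1 * \<delta> n <= ?N * \<delta> n" using N \<delta>(1)[of n] by (intro mult_right_mono) auto
    then show "\<delta> n <= d" using * by simp
   qed
   have cb: "norm z <= d" if "z \<in> cb" for z using Basis_box_norm[of z "\<delta> n"] that \<delta>d by (simp add: cb_def)
   have ncb: "\<eta> n z = 0" if zcb: "z \<notin> cb" for z
   proof -
    have "\<exists>b\<in>Basis. \<delta> n < \<bar>z \<bullet> b\<bar>"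
    proof (rule ccontr)
     assume "\<not> ?thesis"
     then have "\<forall>b\<in>Basis. \<bar>z \<bullet> b\<bar> <= \<delta> n" by (simp add: not_less)
     then have "\<forall>b\<in>Basis. - \<delta> n <= z \<bullet> b & z \<bullet> b <= \<delta> n" by (simp add: abs_le_iff minus_le_iff)
     then show False using zcb by (simp add: cb_def mem_box inner_simps)
    qed
    then obtain b where b: "b \<in> Basis" "\<delta> n < \<bar>z \<bullet> b\<bar>" by blast
    then have "norm z >= \<delta> n" using Basis_le_norm[OF b(1), of z] by linarith
    then show ?thesis by (rule \<eta>(3))
   qed
   have in2: "x - z \<in> cball x0 (2 * d)" if "x \<in> ball x0 d" "z \<in> cb" for x z
    using that(1) cb[OF that(2)] dist_triangle[of x0 "x - z" x] by (simp add: dist_norm)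
   have eq: "laplacian (w n) y = integral cb (%z. - h (y - z) * \<eta> n z)" if y: "y \<in> ball x0 d" for y
   proof -
    have "infdist y (- \<Omega>) >= 2 * d"
    proof -
     obtain z where z: "z \<in> - \<Omega>" "infdist y (- \<Omega>) = dist y z"
      using infdist_attains_inf[OF cl\<Omega>] by blast
     then have "dist x0 z >= r" using r(2) by (meson ComplD mem_ball not_le subsetD)
     then show ?thesis using z(2) y dist_triangle[of x0 z y] by (simp add: d_def)
    qed
    then have "laplacian (w n) y = - (LBINT z. h0 (y - z) * \<eta> n z)" using \<delta>d d by (intro lap_w) linarith
    also have "... = (LBINT z. - h0 (y - z) * \<eta> n z)" by simp
    also have "... = integral cb (%z. - h0 (y - z) * \<eta> n z)"
     unfolding cb_def
    proof (rule lborel_integral_eq_cbox)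
     show "integrable lborel (%z. - h0 (y - z) * \<eta> n z)"
      using reflect_int[OF h0m Kh, of y n] by simp
     show "- h0 (y - z) * \<eta> n z = 0" if "z \<notin> cbox (- (\<delta> n *\<^sub>R One)) (\<delta> n *\<^sub>R One)" for z
      using ncb[of z] that by (simp add: cb_def)
    qed
    also have "... = integral cb (%z. - h (y - z) * \<eta> n z)"
     by (rule integral_cong) (use subsetD[OF sub2 in2[OF y]] in \<open>simp add: h0_def\<close>)
    finally show ?thesis .
   qed
   have "iter_partial bs (laplacian (w n)) x = iter_partial bs (%y. integral cb (%z. - h (y - z) * \<eta> n z)) x"
    by (rule iter_partial_cong_open[OF open_ball x eq])
   also have "... = integral cb (%z. iter_partial bs (%x. - h x) (x - z) * \<eta> n z)"
    unfolding cb_def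
    by (rule smooth_convolution(2)[OF sh continuous_on_subset[OF c\<eta>] open_ball _ bs x]) (use subsetD[OF sub2 in2] in \<open>simp_all add: cb_def\<close>)
   also have "norm ... <= integral cb (%z. M * \<eta> n z)"
    unfolding cb_def
   proof (rule Henstock_Kurzweil_Integration.integral_norm_bound_integral)
    have c1: "continuous_on cb (%z. iter_partial bs (%x. - h x) (x - z))"
     by (rule continuous_on_compose2[OF smooth_on_continuous[OF smooth_on_iter_partial[OF sh bs]]])
      (use subsetD[OF sub2 in2[OF x]] in \<open>auto intro!: continuous_intros\<close>)
    have c2: "continuous_on cb (\<eta> n)" by (rule continuous_on_subset[OF c\<eta>]) simp
    show "(%z. iter_partial bs (%x. - h x) (x - z) * \<eta> n z) integrable_on cbox (- (\<delta> n *\<^sub>R One)) (\<delta> n *\<^sub>R One)"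
     by (intro integrable_continuous continuous_on_mult c1[unfolded cb_def] c2[unfolded cb_def])
    show "(%z. M * \<eta> n z) integrable_on cbox (- (\<delta> n *\<^sub>R One)) (\<delta> n *\<^sub>R One)"
     by (intro integrable_continuous continuous_on_mult continuous_on_const c2[unfolded cb_def])
    fix z assume "z \<in> cbox (- (\<delta> n *\<^sub>R One)) (\<delta> n *\<^sub>R One :: 'a)"
    then have "norm (iter_partial bs (%x. - h x) (x - z)) <= M" using M(2)[OF in2[OF x]] by (simp add: cb_def)
    then show "norm (iter_partial bs (%x. - h x) (x - z) * \<eta> n z) <= M * \<eta> n z"
     using \<eta>(2)[of n z] by (simp add: abs_mult mult_right_mono)
   qed
   also have "... = M"
    using lborel_integral_eq_cbox[OF \<eta>(4)[of n], of "- (\<delta> n *\<^sub>R One)" "\<delta> n *\<^sub>R One"] ncb \<eta>(5)[of n] by (simp add: cb_def)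
   finally have "norm (iter_partial bs (laplacian (w n)) x) <= M" .
   then show ?thesis by simp
  qed
  then show "\<exists>d>0. \<exists>M n0. ball x0 d \<subseteq> \<Omega> & (\<forall>n\<ge>n0. \<forall>y\<in>ball x0 d. \<bar>iter_partial bs (laplacian (w n)) y\<bar> <= M)"
   using d sub2 by (intro exI[of _ d] conjI exI[of _ M] exI[of _ n0]) (auto simp: subset_iff)
 qed
 have "\<bar>w n x\<bar> <= K" for n x
 proof -
  have "\<bar>w n x\<bar> <= (LBINT z. K * \<eta> n z)"
   unfolding w_alt using reflect_int[OF gm gK] integrable_mult_right[OF \<eta>(4)]
  proof (rule integral_abs_bound_integral)
   show "\<bar>g (x - z) * \<eta> n z\<bar> <= K * \<eta> n z" for z
    using gK[of "x - z"] \<eta>(2)[of n z] by (simp add: abs_mult mult_right_mono)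
  qed
  then show ?thesis using \<eta>(5) by simp
 qed
 then have lb_w: "loc_bounded \<Omega> w"
  unfolding loc_bounded_def using \<Omega>(1) open_contains_ball by meson
 have s\<Omega>: "smooth_on \<Omega> (w n)" for n by (rule smooth_on_subset[OF w_smooth \<Omega>(1)]) simp
 have lb: "loc_bounded \<Omega> (%n. iter_partial bs (w n))" if "set bs \<subseteq> Basis" for bs
  by (rule loc_bounded_iter_partial[OF s\<Omega> lb_w lb_lap, of "length bs"]) (use that in auto)
 have L1: "smooth_on \<Omega> g" by (rule limit_smooth(1)[OF s\<Omega> lb w_lim])
 have L2: "(%n. iter_partial bs (w n) x) \<longlonglongrightarrow> iter_partial bs g x" if "x \<in> \<Omega>" "set bs \<subseteq> Basis" for bs x
  by (rule limit_smooth(2)[OF s\<Omega> lb w_lim that(1)]) (use that in auto)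
 have "laplacian g x = - h x" if x: "x \<in> \<Omega>" for x
 proof -
  have "(%n. laplacian (w n) x) \<longlonglongrightarrow> laplacian g x"
   unfolding laplacian_def by (intro tendsto_sum L2[OF x]) simp
  moreover have "(%n. laplacian (w n) x) \<longlonglongrightarrow> - h x"
  proof -
   have "isCont h x" using smooth_on_continuous[OF h(1)] x \<Omega>(1) continuous_on_eq_continuous_at by blast
   moreover have "\<forall>\<^sub>F y in nhds x. h0 y = h y"
    using eventually_nhds_in_open[OF \<Omega>(1) x] by eventually_elim (simp add: h0_def)
   ultimately have "isCont h0 x" using isCont_cong by blast
   from approximate_identity[OF h0m Kh this \<delta>(2) \<eta>m \<eta>(2,3,4,5)]
   have "(%n. - (LBINT z. h0 (x - z) * \<eta> n z)) \<longlonglongrightarrow> - h0 x" by (rule tendsto_minus)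
   moreover have "\<forall>\<^sub>F n in sequentially. - (LBINT z. h0 (x - z) * \<eta> n z) = laplacian (w n) x"
   proof -
    have "infdist x (- \<Omega>) > 0" using infdist_pos_not_in_closed[OF cl\<Omega>] x by simp
    from ev[OF this] show ?thesis by eventually_elim (simp add: lap_w)
   qed
   ultimately show ?thesis using x by (simp add: h0_def Lim_transform_eventually)
  qed
  ultimately show ?thesis using LIMSEQ_unique by blast
 qed
 with L1 g show ?thesis by (intro that[of g])
qed


section \<open>The semilinear problem\<close>

subsection \<open>Graded classes of smooth functions\<close>

definition vd :: "('a::euclidean_space => 'a) => ('a => real) => 'a => real" where
 "vd X g = (%x. pd (X x) g x)"

lemma vd_const [simp]: "vd (%x. v) g = pd v g"
 by (simp add: vd_def)

lemma smooth_on_vd: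
 assumes "smooth_on S g" "!!b. b \<in> Basis ==> smooth_on S (%x. X x \<bullet> b)"
 shows "smooth_on S (vd X g)"
proof -
 have "smooth_on S (%x. \<Sum>b\<in>Basis. (X x \<bullet> b) * pd b g x)"
  using assms by (intro smooth_on_sum finite_Basis smooth_on_mult smooth_on_pd) (auto dest: smooth_on_open)
 then show ?thesis
  by (rule smooth_on_cong) (simp add: vd_def pd_lincomb[OF smooth_on_differentiable[OF assms(1)], of _ "X _"])
qed

text \<open>\<open>P a\<close> is a class of sequences of functions on \<open>S\<close> of weight \<open>a\<close>; \<open>tow k a\<close> asks for \<open>k\<close>
 derivatives along the fields \<open>X i\<close>, each of which lowers the weight by \<open>c\<close>.\<close>

locale tower =
 fixes S :: "'a::euclidean_space set" and P :: "real => (nat => 'a => real) => bool"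
  and X :: "'i => 'a => 'a" and I :: "'i set" and c :: real
 assumes open_S: "open S"
  and X_smooth: "i \<in> I ==> b \<in> Basis ==> smooth_on S (%x. X i x \<bullet> b)"
  and P_cong: "P a w ==> (!!n x. x \<in> S ==> w n x = v n x) ==> P a v"
  and P_add: "P a w ==> P a v ==> P a (%n x. w n x + v n x)"
  and P_mult: "P a w ==> P a' v ==> P (a + a') (%n x. w n x * v n x)"
  and P_const: "P 0 (%n x. q)"
  and P_zero: "P a (%n x. 0)"
begin

primrec tow :: "nat => real => (nat => 'a => real) => bool" where
 "tow 0 a w = P a w"
| "tow (Suc k) a w = (P a w & (\<forall>i\<in>I. tow k (a - c) (%n. vd (X i) (w n))))"

lemma smooth_vd: "smooth_on S w ==> i \<in> I ==> smooth_on S (vd (X i) w)"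
 using smooth_on_vd[of S w "X i"] X_smooth by blast

lemma tow_P: "tow k a w ==> P a w"
 by (cases k) auto

lemma tow_cong:
 assumes "tow k a w" "!!n x. x \<in> S ==> w n x = v n x"
 shows "tow k a v"
 using assms
proof (induction k arbitrary: a w v)
 case 0 then show ?case using P_cong[of a w v] by simp
next
 case (Suc k)
 have "tow k (a - c) (%n. vd (X i) (v n))" if "i \<in> I" for i
 proof (rule Suc.IH)
  show "tow k (a - c) (%n. vd (X i) (w n))" using Suc.prems(1) that by simp
  show "vd (X i) (w n) x = vd (X i) (v n) x" if "x \<in> S" for n x
   unfolding vd_def using Suc.prems(2) by (intro pd_cong_open[OF open_S that]) auto
 qed
 then show ?case using Suc.prems P_cong[of a w v] by simp
qed

lemma tow_Suc: "tow (Suc k) a w ==> tow k a w"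
 by (induction k arbitrary: a w) auto

lemma tow_add:
 assumes "tow k a w" "tow k a v" "!!n. smooth_on S (w n)" "!!n. smooth_on S (v n)"
 shows "tow k a (%n x. w n x + v n x)"
 using assms
proof (induction k arbitrary: a w v)
 case 0 then show ?case using P_add by simp
next
 case (Suc k)
 have "tow k (a - c) (%n. vd (X i) (%x. w n x + v n x))" if i: "i \<in> I" for i
 proof (rule tow_cong)
  show "tow k (a - c) (%n x. vd (X i) (w n) x + vd (X i) (v n) x)"
   by (rule Suc.IH) (use Suc.prems(1,2) smooth_vd[OF Suc.prems(3) i] smooth_vd[OF Suc.prems(4) i] i in auto)
  show "vd (X i) (w n) x + vd (X i) (v n) x = vd (X i) (%x. w n x + v n x) x" if "x \<in> S" for n x
   unfolding vd_def by (rule pd_add[symmetric]) (use Suc.prems smooth_on_differentiable that in blast)+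
 qed
 then show ?case using Suc.prems P_add by simp
qed

lemma tow_mult:
 assumes "tow k a w" "tow k a' v" "!!n. smooth_on S (w n)" "!!n. smooth_on S (v n)"
 shows "tow k (a + a') (%n x. w n x * v n x)"
 using assms
proof (induction k arbitrary: a a' w v)
 case 0 then show ?case using P_mult by simp
next
 case (Suc k)
 have "tow k (a + a' - c) (%n. vd (X i) (%x. w n x * v n x))" if i: "i \<in> I" for i
 proof (rule tow_cong)
  have s: "smooth_on S (vd (X i) (w n))" "smooth_on S (vd (X i) (v n))" for n
   using Suc.prems i smooth_vd by auto
  have "tow k ((a - c) + a') (%n x. vd (X i) (w n) x * v n x)"
   by (rule Suc.IH) (use Suc.prems i s tow_Suc in auto)
  moreover have "tow k (a + (a' - c)) (%n x. w n x * vd (X i) (v n) x)"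
   by (rule Suc.IH) (use Suc.prems i s tow_Suc in auto)
  ultimately show "tow k (a + a' - c) (%n x. vd (X i) (w n) x * v n x + w n x * vd (X i) (v n) x)"
   using Suc.prems s by (intro tow_add smooth_on_mult) (auto simp: algebra_simps)
  show "vd (X i) (w n) x * v n x + w n x * vd (X i) (v n) x = vd (X i) (%x. w n x * v n x) x" if "x \<in> S" for n x
   unfolding vd_def by (rule pd_mult[symmetric]) (use Suc.prems smooth_on_differentiable that in blast)+
 qed
 then show ?case using Suc.prems P_mult by simp
qed

lemma tow_zero: "tow k a (%n x. 0)"
proof (induction k arbitrary: a)
 case (Suc k)
 have "vd X (%x. 0) = (%x. 0)" for X :: "'a => 'a" by (simp add: vd_def)
 then show ?case using Suc P_zero by simp
qed (simp add: P_zero)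

lemma tow_const: "tow k 0 (%n x. q)"
proof (cases k)
 case (Suc k)
 have "vd X (%x. q) = (%x. 0)" for X :: "'a => 'a" by (simp add: vd_def)
 then show ?thesis using Suc tow_zero P_const by simp
qed (simp add: P_const)

lemma tow_cmult: "tow k a w ==> (!!n. smooth_on S (w n)) ==> tow k a (%n x. q * w n x)"
 using tow_mult[OF tow_const _ smooth_on_const[OF open_S]] by force

lemma tow_sum:
 assumes "finite J" "!!j. j \<in> J ==> tow k a (w j)" "!!j n. j \<in> J ==> smooth_on S (w j n)"
 shows "tow k a (%n x. \<Sum>j\<in>J. w j n x)"
 using assms
proof (induction J rule: finite_induct)
 case (insert j J)
 have "tow k a (%n x. w j n x + (\<Sum>j\<in>J. w j n x))"
  by (rule tow_add) (use insert in \<open>auto intro!: smooth_on_sum open_S\<close>)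
 then show ?case using insert by simp
qed (simp add: tow_zero)

lemma tow_weight:
 assumes mono: "!!a a' w. P a w ==> a' <= a ==> P a' w"
 shows "tow k a w ==> a' <= a ==> tow k a' w"
proof (induction k arbitrary: a a' w)
 case (Suc k)
 have "tow k (a' - c) (%n. vd (X i) (w n))" if "i \<in> I" for i
  by (rule Suc.IH[of "a - c"]) (use Suc.prems that in auto)
 then show ?case using Suc.prems mono[of a w a'] by simp
next
 case 0
 then show ?case using mono[of a w a'] by simp
qed

lemma tow_coef:
 assumes "c = 0" "!!g. smooth_on UNIV g ==> P 0 (%n. g)" "!!g i. i \<in> I ==> smooth_on UNIV g ==> smooth_on UNIV (vd (X i) g)"
 shows "smooth_on UNIV g ==> tow k 0 (%n. g)"
proof (induction k arbitrary: g)
 case (Suc k)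
 have "tow k 0 (%n. vd (X i) g)" if "i \<in> I" for i by (rule Suc.IH[OF assms(3)[OF that Suc.prems]])
 moreover have "0 - c = 0" using assms(1) by simp
 ultimately show ?case using assms(2)[OF Suc.prems] by (simp only: tow.simps) blast
next
 case 0
 show ?case using assms(2)[OF 0] by simp
qed

text \<open>Smoothness together with bounds of every order. Such classes satisfy the tower axioms
  again (\<open>full_tower\<close>), so that derivatives along another family of fields can be
  stacked on top.\<close>

definition full :: "real => (nat => 'a => real) => bool" where
 "full a w \<longleftrightarrow> (\<forall>n. smooth_on S (w n)) & (\<forall>k. tow k a w)"

lemma full_cong: "full a w ==> (!!n x. x \<in> S ==> w n x = v n x) ==> full a v"
 unfolding full_def using tow_cong[of _ a w v] smooth_on_cong[of S "w _" "v _"] by blast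

lemma full_tower:
 assumes "!!i b. i \<in> I' ==> b \<in> Basis ==> smooth_on S (%x. X' i x \<bullet> b)"
 shows "tower S full X' I'"
proof
 show "full a v" if "full a w" "!!n x. x \<in> S ==> w n x = v n x" for a w v by (rule full_cong[OF that])
 show "full a (%n x. w n x + v n x)" if "full a w" "full a v" for a w v
  using that by (simp add: full_def tow_add smooth_on_add)
 show "full (a + a') (%n x. w n x * v n x)" if "full a w" "full a' v" for a a' w v
  using that by (simp add: full_def tow_mult smooth_on_mult)
qed (simp_all add: assms open_S full_def tow_const tow_zero smooth_on_const)

lemma full_vd: "full a w ==> i \<in> I ==> full (a - c) (%n. vd (X i) (w n))"
 unfolding full_def
proof (intro conjI allI)
 fix n k assume a: "(\<forall>n. smooth_on S (w n)) & (\<forall>k. tow k a w)" and i: "i \<in> I"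
 show "smooth_on S (vd (X i) (w n))" using a i smooth_vd by blast
 have "tow (Suc k) a w" using a by blast
 then show "tow k (a - c) (%n. vd (X i) (w n))" using i by simp
qed

lemma full_weight:
 assumes mono: "!!a a' w. P a w ==> a' <= a ==> P a' w"
 shows "full a w ==> a' <= a ==> full a' w"
 unfolding full_def
proof (intro conjI allI)
 fix n k assume a: "(\<forall>n. smooth_on S (w n)) & (\<forall>k. tow k a w)" "a' <= a"
 show "smooth_on S (w n)" using a by blast
 have "tow k a w" using a by blast
 then show "tow k a' w" by (rule tow_weight[rotated]) (fact a(2), fact mono)
qed

text \<open>The derivative is \<open>- q\<close> times the power with exponent \<open>q - 1\<close>
  times the derivative of \<open>v\<close>. The exponent changes in the induction, which is why
  \<open>P\<close> is assumed for all powers at once.\<close>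

lemma tow_powr:
 assumes v: "tow k 0 v" "!!n. smooth_on S (v n)" "!!n x. x \<in> S ==> v n x < 1"
  and P: "!!q. P 0 (%n x. (1 - v n x) powr q)"
 shows "tow k 0 (%n x. (1 - v n x) powr q)"
 using v(1)
proof (induction k arbitrary: q)
 case 0 then show ?case using P by simp
next
 case (Suc k)
 have s: "smooth_on S (%x. (1 - v n x) powr q)" for n q
  by (rule smooth_on_real_comp[OF smooth_on_powr]) (use v open_S in \<open>auto intro!: smooth_on_diff smooth_on_const\<close>)
 have "tow k (0 - c) (%n. vd (X i) (%x. (1 - v n x) powr q))" if i: "i \<in> I" for i
 proof (rule tow_cong)
  have sv: "smooth_on S (vd (X i) (v n))" for n using smooth_vd v(2) i by blast
  have "tow k (0 + (0 - c)) (%n x. (1 - v n x) powr (q - 1) * vd (X i) (v n) x)"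
   by (rule tow_mult) (use Suc i s sv tow_Suc in auto)
  then show "tow k (0 - c) (%n x. (- q) * ((1 - v n x) powr (q - 1) * vd (X i) (v n) x))"
   using s sv by (intro tow_cmult smooth_on_mult) auto
  fix n x assume x: "x \<in> S"
  have "((%t. (1 - t) powr q) has_real_derivative (- q) * (1 - v n x) powr (q - 1)) (at (v n x))"
   using v(3)[OF x, of n] by (auto intro!: derivative_eq_intros)
  from pd_real_comp(2)[where f = "v n", OF this smooth_on_differentiable[OF v(2) x]]
  show "(- q) * ((1 - v n x) powr (q - 1) * vd (X i) (v n) x) = vd (X i) (%x. (1 - v n x) powr q) x"
   by (simp add: vd_def)
 qed
 then show ?case using P by simp
qed

end

subsection \<open>Monotone iteration\<close>

lemma nonlinearity_powr: "nonlinearity p t = (1 - t) powr (- p)"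
 by (simp add: nonlinearity_def powr_minus_divide)

lemma nonlinearity_mono: "p >= 0 ==> s <= t ==> t < 1 ==> nonlinearity p s <= nonlinearity p t"
 unfolding nonlinearity_def by (intro divide_left_mono powr_mono2 mult_pos_pos) auto

lemma nonlinearity_nonneg: "nonlinearity p t >= 0"
 by (simp add: nonlinearity_def)

lemma smooth_on_nonlinearity:
 assumes "smooth_on S v" "!!x. x \<in> S ==> v x < 1"
 shows "smooth_on S (%x. nonlinearity p (v x))"
 unfolding nonlinearity_powr
 by (rule smooth_on_real_comp[OF smooth_on_powr])
  (use assms in \<open>auto intro!: smooth_on_diff smooth_on_const dest: smooth_on_open\<close>)

lemma loc_bounded_add:
 "loc_bounded S w ==> loc_bounded S v ==> loc_bounded S (%n x. w n x + v n x)"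
 and loc_bounded_mult:
 "loc_bounded S w ==> loc_bounded S v ==> loc_bounded S (%n x. w n x * v n x)"
proof -
 assume a: "loc_bounded S w" "loc_bounded S v"
 have "\<exists>d>0. \<exists>M n0. M >= 0 & ball x d \<subseteq> S & (\<forall>n\<ge>n0. \<forall>y\<in>ball x d. \<bar>w n y\<bar> <= M & \<bar>v n y\<bar> <= M)" if x: "x \<in> S" for x
 proof -
  obtain d1 M1 n1 where 1: "d1 > 0" "ball x d1 \<subseteq> S" "!!n y. n >= n1 ==> y \<in> ball x d1 ==> \<bar>w n y\<bar> <= M1"
   using a(1) x unfolding loc_bounded_def by blast
  obtain d2 M2 n2 where 2: "d2 > 0" "!!n y. n >= n2 ==> y \<in> ball x d2 ==> \<bar>v n y\<bar> <= M2"
   using a(2) x unfolding loc_bounded_def by blast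
  have "\<bar>w n y\<bar> <= max M1 (max M2 0) & \<bar>v n y\<bar> <= max M1 (max M2 0)" if "n >= max n1 n2" "y \<in> ball x (min d1 d2)" for n y
   using 1(3)[of n y] 2(2)[of n y] that by auto
  moreover have "ball x (min d1 d2) \<subseteq> S" using 1(2) by auto
  ultimately show ?thesis using 1(1) 2(1)
   by (intro exI[of _ "min d1 d2"] conjI exI[of _ "max M1 (max M2 0)"] exI[of _ "max n1 n2"]) auto
 qed
 note * = this
 show "loc_bounded S (%n x. w n x + v n x)" unfolding loc_bounded_def
 proof
  fix x assume "x \<in> S"
  then obtain d M n0 where d: "d > 0" "ball x d \<subseteq> S" "\<forall>n\<ge>n0. \<forall>y\<in>ball x d. \<bar>w n y\<bar> <= M & \<bar>v n y\<bar> <= M" using * by blast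
  have "\<forall>n\<ge>n0. \<forall>y\<in>ball x d. \<bar>w n y + v n y\<bar> <= M + M"
   using d(3) by (meson abs_triangle_ineq add_mono order_trans)
  with d show "\<exists>d>0. \<exists>M n0. ball x d \<subseteq> S & (\<forall>n\<ge>n0. \<forall>y\<in>ball x d. \<bar>w n y + v n y\<bar> <= M)" by blast
 qed
 show "loc_bounded S (%n x. w n x * v n x)" unfolding loc_bounded_def
 proof
  fix x assume "x \<in> S"
  then obtain d M n0 where d: "d > 0" "ball x d \<subseteq> S" "M >= 0" "\<forall>n\<ge>n0. \<forall>y\<in>ball x d. \<bar>w n y\<bar> <= M & \<bar>v n y\<bar> <= M" using * by blast
  have "\<forall>n\<ge>n0. \<forall>y\<in>ball x d. \<bar>w n y * v n y\<bar> <= M * M"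
   unfolding abs_mult using d(3,4) by (simp add: mult_mono)
  with d show "\<exists>d>0. \<exists>M n0. ball x d \<subseteq> S & (\<forall>n\<ge>n0. \<forall>y\<in>ball x d. \<bar>w n y * v n y\<bar> <= M)" by blast
 qed
qed

lemma loc_bounded_const: "open S ==> loc_bounded S (%n x. q)"
 unfolding loc_bounded_def using open_contains_ball by (metis order_refl)

lemma loc_bounded_shift: "loc_bounded S (%n. w (Suc n)) ==> loc_bounded S w"
 unfolding loc_bounded_def
proof
 fix x assume a: "\<forall>x\<in>S. \<exists>d>0. \<exists>M n0. ball x d \<subseteq> S & (\<forall>n\<ge>n0. \<forall>y\<in>ball x d. \<bar>w (Suc n) y\<bar> <= M)" and "x \<in> S"
 then obtain d M n0 where d: "d > 0" "ball x d \<subseteq> S" "!!n y. n >= n0 ==> y \<in> ball x d ==> \<bar>w (Suc n) y\<bar> <= M" by blast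
 have "\<bar>w n y\<bar> <= M" if "n >= Suc n0" "y \<in> ball x d" for n y
  using d(3)[of "n - 1" y] that by (cases n) auto
 with d show "\<exists>d>0. \<exists>M n0. ball x d \<subseteq> S & (\<forall>n\<ge>n0. \<forall>y\<in>ball x d. \<bar>w n y\<bar> <= M)" by blast
qed

lemma loc_bounded_tower: "open S ==> tower S (%a. loc_bounded S) (%b x. b) Basis"
 by standard (auto intro: loc_bounded_cong loc_bounded_add loc_bounded_mult loc_bounded_const smooth_on_const)

text \<open>\<open>tow\<close> applies the innermost derivative first and
  \<open>iter_partial\<close> conses the outermost one, so lists are split at their end.\<close>

lemma loc_bounded_tow_iff:
 assumes "open S"
 shows "tower.tow (%a. loc_bounded S) (%b x. b) Basis 0 k a w \<longleftrightarrow>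
   (\<forall>bs. set bs \<subseteq> Basis & length bs <= k --> loc_bounded S (%n. iter_partial bs (w n)))"
proof (induction k arbitrary: a w)
 interpret tower S "%a. loc_bounded S" "%b x. b" Basis 0 by (rule loc_bounded_tower[OF assms])
 case 0 show ?case by simp
 case (Suc k)
 show ?case (is "?L = ?R")
 proof
  assume ?L
  then have L: "loc_bounded S w" "!!b bs. b \<in> Basis ==> set bs \<subseteq> Basis ==> length bs <= k ==> loc_bounded S (%n. iter_partial bs (pd b (w n)))"
   using Suc.IH by auto
  show ?R
  proof (intro allI impI)
   fix bs assume bs: "set bs \<subseteq> (Basis :: 'a set) & length bs <= Suc k"
   show "loc_bounded S (%n. iter_partial bs (w n))"
   proof (cases bs rule: rev_cases)
    case (snoc cs b)
    then show ?thesis using L(2)[of b cs] bs by (simp add: iter_partial_append)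
   qed (use L(1) in simp)
  qed
 next
  assume R: ?R
  have "loc_bounded S (%n. iter_partial bs (pd b (w n)))" if "b \<in> Basis" "set bs \<subseteq> Basis" "length bs <= k" for b bs
   using R[rule_format, of "bs @ [b]"] that by (simp add: iter_partial_append)
  then show ?L using R[rule_format, of "[]"] Suc.IH by simp
 qed
qed

text \<open>\<open>U\<close> and \<open>V\<close> are themselves the barriers of the two linear
  problems of each step: v <= U gives lam f(v) <= \<mu> f(U) = - laplacian V, and z <= V = -
  laplacian U. The maximum principle makes the iterates increase.\<close>

theorem semilinear_solution:
 fixes U V :: "'a::euclidean_space => real"
 assumes \<Omega>: "open \<Omega>" "bounded \<Omega>"
  and U: "smooth_on \<Omega> U" "continuous_on (closure \<Omega>) U" "!!x. x \<in> frontier \<Omega> ==> U x = 0"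
   "!!b. b \<in> Basis ==> uniformly_continuous_on \<Omega> (pd b (pd b U))" "!!x. x \<in> \<Omega> ==> laplacian U x = - V x"
  and V: "smooth_on \<Omega> V" "continuous_on (closure \<Omega>) V" "!!x. x \<in> frontier \<Omega> ==> V x = 0"
   "!!b. b \<in> Basis ==> uniformly_continuous_on \<Omega> (pd b (pd b V))"
   "!!x. x \<in> \<Omega> ==> laplacian V x = - (\<mu> * nonlinearity p (U x))"
  and U1: "!!x. x \<in> closure \<Omega> ==> U x < 1" and lam: "0 <= lam" "lam <= \<mu>" and p: "p > 0"
 obtains v z where "smooth_on \<Omega> v" "smooth_on \<Omega> z" "!!x. x \<in> \<Omega> ==> laplacian v x = - z x"
  "!!x. x \<in> \<Omega> ==> laplacian z x = - (lam * nonlinearity p (v x))"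
  "!!x. x \<in> \<Omega> ==> 0 <= v x & v x <= U x" "!!x. x \<in> \<Omega> ==> 0 <= z x & z x <= V x"
  "!!x. x \<notin> \<Omega> ==> v x = 0 & z x = 0"
proof -
 have sub: "\<Omega> \<subseteq> closure \<Omega>" by (rule closure_subset)
 have cpt: "compact (closure \<Omega>)" using \<Omega>(2) by (simp add: compact_closure)
 \<comment> \<open>The outcome of \<open>linear_dirichlet\<close> with barrier \<open>B\<close>; it
   is the invariant kept by both components of the iteration.\<close>
 define G where "G B g \<longleftrightarrow> smooth_on \<Omega> g & continuous_on UNIV g & (\<forall>x. 0 <= g x) & (\<forall>x\<in>\<Omega>. g x <= B x) & (\<forall>x. x \<notin> \<Omega> --> g x = 0)"
  for B g :: "'a => real"
 have fr: "x \<notin> \<Omega>" if "x \<in> frontier \<Omega>" for x using that \<Omega>(1) by (simp add: frontier_def interior_open)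
 have cl: "x \<in> \<Omega> \<or> x \<in> frontier \<Omega>" if "x \<in> closure \<Omega>" for x using that \<Omega>(1) by (auto simp: frontier_def interior_open)
 have G1: "v x < 1" if "G U v" for v x
 proof (cases "x \<in> \<Omega>")
  case True
  then have "v x <= U x" using that by (simp add: G_def)
  then show ?thesis using U1[of x] sub True by force
 qed (use that in \<open>simp add: G_def\<close>)
 have stepz: "\<exists>z. G V z & (\<forall>x\<in>\<Omega>. laplacian z x = - (lam * nonlinearity p (v x)))" if v: "G U v" for v
 proof (rule linear_dirichlet[OF \<Omega> _ _ _ V(1,2,3,4), where h = "%x. lam * nonlinearity p (v x)"])
  show "smooth_on \<Omega> (%x. lam * nonlinearity p (v x))"
   using v G1[OF v] by (intro smooth_on_cmult smooth_on_nonlinearity) (auto simp: G_def)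
  have "continuous_on UNIV v" using v by (simp add: G_def)
  then have "continuous_on UNIV (%x. lam * nonlinearity p (v x))"
   unfolding nonlinearity_powr using G1[OF v] by (auto intro!: continuous_intros simp: less_imp_neq[OF G1[OF v]])
  then show "continuous_on (closure \<Omega>) (%x. lam * nonlinearity p (v x))" by (rule continuous_on_subset) simp
  show "0 <= lam * nonlinearity p (v x)" for x using lam nonlinearity_nonneg by simp
  fix x assume x: "x \<in> \<Omega>"
  have "nonlinearity p (v x) <= nonlinearity p (U x)"
   by (rule nonlinearity_mono) (use v x U1 sub p in \<open>auto simp: G_def\<close>)
  then have "lam * nonlinearity p (v x) <= \<mu> * nonlinearity p (U x)"
   using lam nonlinearity_nonneg by (intro mult_mono) auto
  then show "lam * nonlinearity p (v x) <= - laplacian V x" using V(5)[OF x] by simp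
 next
  fix z assume "smooth_on \<Omega> z" "continuous_on UNIV z" "!!x. 0 <= z x" "!!x. x \<in> \<Omega> ==> z x <= V x"
    "!!x. x \<notin> \<Omega> ==> z x = 0" "!!x. x \<in> \<Omega> ==> laplacian z x = - (lam * nonlinearity p (v x))"
  then show ?thesis unfolding G_def by blast
 qed
 have stepv: "\<exists>v. G U v & (\<forall>x\<in>\<Omega>. laplacian v x = - z x)" if z: "G V z" for z
 proof (rule linear_dirichlet[OF \<Omega> _ _ _ U(1,2,3,4), where h = z])
  show "continuous_on (closure \<Omega>) z" using z continuous_on_subset[of UNIV z] by (auto simp: G_def)
  show "z x <= - laplacian U x" if "x \<in> \<Omega>" for x using z U(5)[OF that] that by (simp add: G_def)
 next
  fix v assume "smooth_on \<Omega> v" "continuous_on UNIV v" "!!x. 0 <= v x" "!!x. x \<in> \<Omega> ==> v x <= U x"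
    "!!x. x \<notin> \<Omega> ==> v x = 0" "!!x. x \<in> \<Omega> ==> laplacian v x = - z x"
  then show ?thesis unfolding G_def by blast
 qed (use z in \<open>auto simp: G_def\<close>)
 have lU: "laplacian U x <= 0" if "x \<in> \<Omega>" "!!x. x \<in> \<Omega> ==> V x >= 0" for x using U(5)[OF that(1)] that by simp
 have V0: "V x >= 0" if "x \<in> \<Omega>" for x
 proof (rule maximum_principle[OF cpt sub V(2,1)])
  show "laplacian V x <= 0" if "x \<in> \<Omega>" for x using V(5)[OF that] lam nonlinearity_nonneg[of p "U x"] by simp
  show "0 <= V x" if "x \<in> closure \<Omega> - \<Omega>" for x using cl[of x] V(3)[of x] that by auto
  show "x \<in> closure \<Omega>" using that sub by blast
 qed
 have U0: "U x >= 0" if "x \<in> \<Omega>" for x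
 proof (rule maximum_principle[OF cpt sub U(2,1)])
  show "laplacian U x <= 0" if "x \<in> \<Omega>" for x using U(5)[OF that] V0[OF that] by simp
  show "0 <= U x" if "x \<in> closure \<Omega> - \<Omega>" for x using cl[of x] U(3)[of x] that by auto
  show "x \<in> closure \<Omega>" using that sub by blast
 qed
 define Q where "Q vz \<longleftrightarrow> G U (fst vz) & G V (snd vz) & (\<forall>x\<in>\<Omega>. laplacian (snd vz) x = - (lam * nonlinearity p (fst vz x)))"
  for vz :: "('a => real) \<times> ('a => real)"
 define st where "st vz vz' \<longleftrightarrow> (\<forall>x\<in>\<Omega>. laplacian (fst vz') x = - snd vz x)"
  for vz vz' :: "('a => real) \<times> ('a => real)"
 have G0: "G U (%x. 0)" using U0 \<Omega> by (simp add: G_def smooth_on_const)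
 then obtain z0 where z0: "Q (%x. 0, z0)" using stepz[OF G0] by (auto simp: Q_def)
 \<comment> \<open>The two components are staggered: \<open>z n\<close> has its right side from
   \<open>v n\<close>, and \<open>v (Suc n)\<close> has right side \<open>z n\<close>.\<close>
 have "\<exists>f. \<forall>n::nat. (Q (f n) & (n = 0 --> fst (f n) = (%x. 0))) & st (f n) (f (Suc n))"
 proof (rule dependent_nat_choice)
  show "\<exists>x. Q x & (0 = (0::nat) --> fst x = (%x. 0))" using z0 by (intro exI[of _ "(%x. 0, z0)"]) simp
  fix vz :: "('a => real) \<times> ('a => real)" and n :: nat assume "Q vz & (n = 0 --> fst vz = (%x. 0))"
  then obtain v where v: "G U v" "\<forall>x\<in>\<Omega>. laplacian v x = - snd vz x" using stepv[of "snd vz"] by (auto simp: Q_def)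
  obtain z where "G V z" "\<forall>x\<in>\<Omega>. laplacian z x = - (lam * nonlinearity p (v x))" using stepz[OF v(1)] by blast
  then show "\<exists>y. (Q y & (Suc n = 0 --> fst y = (%x. 0))) & st vz y"
   using v by (intro exI[of _ "(v, z)"]) (simp add: Q_def st_def)
 qed
 then obtain f where f: "!!n. Q (f n)" "fst (f 0) = (%x. 0)" "!!n. st (f n) (f (Suc n))" by blast
 define v where "v n = fst (f n)" for n
 define z where "z n = snd (f n)" for n
 have Gv: "G U (v n)" and Gz: "G V (z n)" and lz: "!!x. x \<in> \<Omega> ==> laplacian (z n) x = - (lam * nonlinearity p (v n x))" for n
  using f(1)[of n] by (auto simp: Q_def v_def z_def)
 have lv: "laplacian (v (Suc n)) x = - z n x" if "x \<in> \<Omega>" for n x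
  using f(3)[of n] that by (simp add: st_def v_def z_def)
 have v0: "v 0 = (%x. 0)" using f(2) by (simp add: v_def)
 have sv: "smooth_on \<Omega> (v n)" and sz: "smooth_on \<Omega> (z n)" for n using Gv Gz by (auto simp: G_def)
 have cmp: "w x <= w' x" if w: "G B w" "G B' w'" "!!x. x \<in> \<Omega> ==> laplacian w' x <= laplacian w x" for B B' w w' x
 proof (cases "x \<in> \<Omega>")
  case True
  have sw: "smooth_on \<Omega> w" "smooth_on \<Omega> w'" using w by (auto simp: G_def)
  have "0 <= w' x - w x"
  proof (rule maximum_principle[OF cpt sub, where Z = "%x. w' x - w x"])
   show "continuous_on (closure \<Omega>) (%x. w' x - w x)"
    using w by (intro continuous_intros) (auto simp: G_def intro: continuous_on_subset)
   show "smooth_on \<Omega> (%x. w' x - w x)" by (intro smooth_on_diff sw)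
   show "laplacian (%x. w' x - w x) y <= 0" if "y \<in> \<Omega>" for y
    using laplacian_diff[OF sw(2,1) that] w(3)[OF that] by simp
   show "0 <= w' y - w y" if "y \<in> closure \<Omega> - \<Omega>" for y using that w by (simp add: G_def)
   show "x \<in> closure \<Omega>" using True sub by blast
  qed
  then show ?thesis by simp
 qed (use w in \<open>simp add: G_def\<close>)
 have fz: "z n x <= z (Suc n) x" if "!!x. v n x <= v (Suc n) x" for n x
 proof (rule cmp[OF Gz Gz])
  fix y assume y: "y \<in> \<Omega>"
  have "lam * nonlinearity p (v n y) <= lam * nonlinearity p (v (Suc n) y)"
   using lam p G1[OF Gv] that by (intro mult_left_mono nonlinearity_mono) auto
  then show "laplacian (z (Suc n)) y <= laplacian (z n) y" using lz[OF y] by simp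
 qed
 have mono: "v n x <= v (Suc n) x" for n x
 proof (induction n arbitrary: x)
  case 0 show ?case using Gv[of "Suc 0"] by (simp add: v0 G_def)
 next
  case (Suc n)
  show ?case by (rule cmp[OF Gv Gv]) (use fz[OF Suc] lv in simp)
 qed
 have conv: "\<exists>l. (%n. w n x) \<longlonglongrightarrow> l" if w: "!!n. G B (w n)" "!!n x. w n x <= w (Suc n) x" for B and w :: "nat => 'a => real" and x
 proof -
  have "Bseq (%n. w n x)"
  proof (rule BseqI')
   show "norm (w n x) <= max (B x) 0" for n using w(1)[of n] by (cases "x \<in> \<Omega>") (auto simp: G_def)
  qed
  moreover have "\<forall>m. \<forall>n\<ge>m. w m x <= w n x" using lift_Suc_mono_le[of "%n. w n x"] w(2) by blast
  ultimately have "convergent (%n. w n x)" by (rule Bseq_mono_convergent)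
  then show ?thesis by (simp add: convergent_def)
 qed
 obtain v' where v': "!!x. (%n. v n x) \<longlonglongrightarrow> v' x" using conv[where w = v, OF Gv mono] by metis
 obtain z' where z': "!!x. (%n. z n x) \<longlonglongrightarrow> z' x" using conv[where w = z, OF Gz fz[OF mono]] by metis
 have bdB: "loc_bounded \<Omega> w" if w: "!!n. G B (w n)" "continuous_on (closure \<Omega>) B" for B w
 proof -
  obtain k where k: "k >= 0" "!!x. x \<in> closure \<Omega> ==> \<bar>B x\<bar> <= k" by (rule compact_bound[OF cpt w(2)]) blast
  have "\<bar>w n x\<bar> <= k" if "x \<in> \<Omega>" for n x using k(2)[OF subsetD[OF sub that]] w(1)[of n] that by (force simp: G_def)
  then show ?thesis unfolding loc_bounded_def using \<Omega>(1) open_contains_ball by (meson subsetD)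
 qed
 interpret tower \<Omega> "%a. loc_bounded \<Omega>" "%b x. b" Basis 0 by (rule loc_bounded_tower[OF \<Omega>(1)])
 have iff: "tow k a w \<longleftrightarrow> (\<forall>bs. set bs \<subseteq> Basis & length bs <= k --> loc_bounded \<Omega> (%n. iter_partial bs (w n)))" for k a w
  by (rule loc_bounded_tow_iff[OF \<Omega>(1)])
 obtain u1 where u1: "u1 < 1" "!!x. x \<in> \<Omega> ==> U x <= u1"
 proof (cases "\<Omega> = {}")
  case False
  then obtain y where "y \<in> closure \<Omega>" "!!x. x \<in> closure \<Omega> ==> U x <= U y"
   using continuous_attains_sup[OF cpt _ U(2)] sub by blast
  then show ?thesis using that[of "U y"] U1 sub by blast
 qed (use that[of 0] in auto)
 \<comment> \<open>All iterates lie between 0 and the maximum \<open>u1 < 1\<close> of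
   \<open>U\<close>, so powers of \<open>1 - v n\<close> are bounded for exponents of either
   sign.\<close>
 have Pq: "loc_bounded \<Omega> (%n x. (1 - v n x) powr q)" for q
 proof -
  have "\<bar>(1 - v n x) powr q\<bar> <= max 1 ((1 - u1) powr q)" if "x \<in> \<Omega>" for n x
  proof -
   have "0 <= v n x" "v n x <= u1" using Gv[of n] u1(2)[OF that] that by (force simp: G_def)+
   then have "(1 - v n x) powr q <= 1 powr q \<or> (1 - v n x) powr q <= (1 - u1) powr q"
    using u1(1) powr_mono2[of q "1 - v n x" 1] powr_mono2'[of q "1 - u1" "1 - v n x"] by (cases "q >= 0") auto
   then show ?thesis by auto
  qed
  then show ?thesis unfolding loc_bounded_def using \<Omega>(1) open_contains_ball by (meson subsetD)
 qed
 \<comment> \<open>Each order of \<open>v\<close> controls the same order of the right side for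
   \<open>z\<close>, hence one order more of \<open>z\<close>, and conversely. The equation for
   \<open>v\<close> links consecutive indices, so that gain is proved for \<open>v (Suc n)\<close>
   and then shifted.\<close>
 have tow_vz: "tow k 0 v & tow k 0 z" for k
 proof (induction k)
  case 0 then show ?case using bdB[OF Gv U(2)] bdB[OF Gz V(2)] by simp
 next
  case (Suc k)
  have "tow k 0 (%n x. (1 - v n x) powr (- p))"
   by (rule tow_powr) (use Suc sv G1[OF Gv] Pq in auto)
  then have "tow k 0 (%n x. (- lam) * (1 - v n x) powr (- p))"
   by (rule tow_cmult) (use smooth_on_nonlinearity[OF sv G1[OF Gv], unfolded nonlinearity_powr] in auto)
  then have tz: "tow k 0 (%n. laplacian (z n))"
   by (rule tow_cong) (simp add: lz nonlinearity_powr)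
  have "tow (Suc k) 0 z" unfolding iff
  proof (intro allI impI)
   fix bs assume "set bs \<subseteq> (Basis::'a set) & length bs <= Suc k"
   then show "loc_bounded \<Omega> (%n. iter_partial bs (z n))"
    by (intro loc_bounded_iter_partial[where w = z and k = k, OF sz bdB[OF Gz V(2)]]) (use tz[unfolded iff] in auto)
  qed
  moreover have "tow k 0 (%n x. (- 1) * z n x)" by (rule tow_cmult) (use Suc sz in auto)
  then have tv: "tow k 0 (%n. laplacian (v (Suc n)))"
   by (rule tow_cong) (simp add: lv)
  have "loc_bounded \<Omega> (%n. iter_partial bs (v (Suc n)))" if "set bs \<subseteq> Basis" "length bs <= Suc k" for bs
   by (rule loc_bounded_iter_partial[where w = "%n. v (Suc n)" and k = k, OF sv bdB[OF Gv U(2)]])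
    (use tv[unfolded iff] that in auto)
  then have "tow (Suc k) 0 v" unfolding iff using loc_bounded_shift[of \<Omega> "%n. iter_partial bs (v n)" for bs] by blast
  ultimately show ?case by blast
 qed
 have lbv: "loc_bounded \<Omega> (%n. iter_partial bs (v n))" and lbz: "loc_bounded \<Omega> (%n. iter_partial bs (z n))" if "set bs \<subseteq> Basis" for bs
  using tow_vz[of "length bs"] that unfolding iff by auto
 have limlap: "(%n. laplacian (w n) x) \<longlonglongrightarrow> laplacian w' x"
  if "!!n. smooth_on \<Omega> (w n)" "!!bs. set bs \<subseteq> Basis ==> loc_bounded \<Omega> (%n. iter_partial bs (w n))" "!!x. (%n. w n x) \<longlonglongrightarrow> w' x" "x \<in> \<Omega>" for w w' x
  unfolding laplacian_def by (intro tendsto_sum limit_smooth(2)[OF that(1,2) that(3) that(4)]) auto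
 show ?thesis
 proof (rule that[of v' z'])
  show "smooth_on \<Omega> v'" by (rule limit_smooth(1)[OF sv lbv v'])
  show "smooth_on \<Omega> z'" by (rule limit_smooth(1)[OF sz lbz z'])
  show "v' x = 0 & z' x = 0" if "x \<notin> \<Omega>" for x
   using v'[of x] z'[of x] Gv Gz that by (simp add: G_def LIMSEQ_const_iff)
  fix x assume x: "x \<in> \<Omega>"
  show b: "0 <= v' x & v' x <= U x"
   using LIMSEQ_le_const[OF v', of 0 x] LIMSEQ_le_const2[OF v', of x "U x"] Gv x by (auto simp: G_def)
  show "0 <= z' x & z' x <= V x"
   using LIMSEQ_le_const[OF z', of 0 x] LIMSEQ_le_const2[OF z', of x "V x"] Gz x by (auto simp: G_def)
  have "(%n. laplacian (v (Suc n)) x) \<longlonglongrightarrow> laplacian v' x" by (rule LIMSEQ_Suc[OF limlap[OF sv lbv v' x]])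
  moreover have "(%n. laplacian (v (Suc n)) x) \<longlonglongrightarrow> - z' x" using tendsto_minus[OF z'[of x]] by (simp add: lv x)
  ultimately show "laplacian v' x = - z' x" by (rule LIMSEQ_unique)
  have "(%n. laplacian (z n) x) \<longlonglongrightarrow> laplacian z' x" by (rule limlap[OF sz lbz z' x])
  moreover have "(%n. laplacian (z n) x) \<longlonglongrightarrow> - (lam * nonlinearity p (v' x))"
  proof -
   have "1 - v' x \<noteq> 0" using b U1[of x] sub x by force
   then have "(%n. - (lam * (1 - v n x) powr (- p))) \<longlonglongrightarrow> - (lam * (1 - v' x) powr (- p))"
    by (auto intro!: tendsto_intros v')
   then show ?thesis by (simp add: lz x nonlinearity_powr)
  qed
  ultimately show "laplacian z' x = - (lam * nonlinearity p (v' x))" by (rule LIMSEQ_unique)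
 qed
qed


section \<open>Regularity up to the boundary\<close>

lemma pd_bound_norm:
 fixes g :: "'a::euclidean_space => real"
 assumes "g differentiable at x" "!!b. b \<in> Basis ==> \<bar>pd b g x\<bar> <= M"
 shows "\<bar>pd v g x\<bar> <= real DIM('a) * M * norm v"
proof -
 have "\<bar>pd v g x\<bar> <= (\<Sum>b\<in>(Basis::'a set). norm v * M)"
  unfolding pd_lincomb[OF assms(1), of v]
  by (rule order.trans[OF sum_abs], rule sum_mono) (auto simp: abs_mult intro!: mult_mono assms(2) Basis_le_norm)
 then show ?thesis by (simp add: mult.commute mult.left_commute)
qed

lemma smooth_lipschitz_on_cball:
 fixes g :: "'a::euclidean_space => real"
 assumes g: "smooth_on UNIV g"
 shows "\<exists>L\<ge>0. (\<forall>x\<in>cball x0 r. \<forall>y\<in>cball x0 r. \<bar>g x - g y\<bar> <= L * norm (x - y)) \<and>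
  (\<forall>x\<in>cball x0 r. \<forall>v. \<bar>pd v g x\<bar> <= L * norm v)"
proof -
 have "\<exists>M. \<forall>x\<in>cball x0 r. \<bar>pd b g x\<bar> <= M" for b
  by (rule compact_bound[OF compact_cball[of x0 r] continuous_on_subset[OF smooth_on_continuous[OF smooth_on_pd[OF g]] subset_UNIV]]) blast
 then obtain Mb where Mb: "!!b x. x \<in> cball x0 r ==> \<bar>pd b g x\<bar> <= Mb b" by metis
 define M where "M = (\<Sum>b\<in>(Basis::'a set). \<bar>Mb b\<bar>)"
 have M: "\<bar>pd b g x\<bar> <= M" if "b \<in> Basis" "x \<in> cball x0 r" for b x
  using Mb[OF that(2), of b] member_le_sum[OF that(1), of "%b. \<bar>Mb b\<bar>"] by (simp add: M_def)
 define L where "L = DIM('a) * M"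
 have L0: "L >= 0" by (simp add: L_def M_def sum_nonneg)
 have pdL: "\<bar>pd v g x\<bar> <= L * norm v" if "x \<in> cball x0 r" for x v
  unfolding L_def by (rule pd_bound_norm[OF smooth_on_differentiable[OF g]]) (use M that in auto)
 have "\<bar>g x - g y\<bar> <= L * norm (x - y)" if "x \<in> cball x0 r" "y \<in> cball x0 r" for x y
 proof -
  define v where "v = x - y"
  have "\<exists>s>0. s < 1 & g (y + 1 *\<^sub>R v) - g (y + 0 *\<^sub>R v) = (1 - 0) * pd v g (y + s *\<^sub>R v)"
   by (rule MVT2) (auto intro!: pd_line_DERIV smooth_on_differentiable[OF g])
  then obtain s where s: "0 < s" "s < 1" "g x - g y = pd v g (y + s *\<^sub>R v)" by (auto simp: v_def)
  have "y + s *\<^sub>R v = (1 - s) *\<^sub>R y + s *\<^sub>R x" by (simp add: v_def algebra_simps)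
  then have "y + s *\<^sub>R v \<in> cball x0 r" using convexD_alt[OF convex_cball that(2,1), of s] s by simp
  then show ?thesis using pdL[of "y + s *\<^sub>R v" v] s(3) by (simp add: v_def)
 qed
 then show ?thesis using L0 pdL by blast
qed

lemma powr_comparable:
 fixes s t :: real
 assumes "t > 0" "t / 2 <= s" "s <= 2 * t"
 shows "s powr a <= 2 powr \<bar>a\<bar> * t powr a"
proof (cases "a >= 0")
 case True
 have "s powr a <= (2 * t) powr a" using assms True by (intro powr_mono2) auto
 then show ?thesis using True assms by (simp add: powr_mult)
next
 case False
 have "s powr a <= (t / 2) powr a" using assms False by (intro powr_mono2') auto
 also have "... = 2 powr (- a) * t powr a" using assms by (simp add: powr_divide powr_minus field_simps)
 finally show ?thesis using False by simp
qed

text \<open>\<open>\<psi>\<close> is the height above the boundary in the direction \<open>e\<close>; it is a defining function with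
 \<open>pd e \<psi> = 1\<close>.\<close>

locale chart =
 fixes \<psi> :: "'a::euclidean_space => real" and e x0 :: 'a
 assumes smooth_\<psi>: "smooth_on UNIV \<psi>" and norm_e: "norm e = 1" and \<psi>_shift: "\<psi> (x + c *\<^sub>R e) = \<psi> x + c"
begin

definition D where "D r = {x \<in> ball x0 r. \<psi> x > 0}"

text \<open>A bound by a power of the distance-like function \<open>\<psi>\<close>, uniform in
  \<open>n\<close> and required on every smaller radius. The quantifier over \<open>\<rho>\<close>
  absorbs the loss of radius in each local estimate, so estimates can be chained without tracking
  radii.\<close>

definition Wt :: "real => real => (nat => 'a => real) => bool" where
 "Wt r a w \<longleftrightarrow> (\<forall>\<rho><r. \<exists>C. \<forall>n. \<forall>x\<in>D \<rho>. \<bar>w n x\<bar> <= C * \<psi> x powr a)"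

lemma diff_\<psi>: "\<psi> differentiable at x"
 using smooth_on_differentiable[OF smooth_\<psi>] by simp

lemma shift_invariant_pd:
 assumes "!!x c. g (x + c *\<^sub>R e) = g x + k * c" "g differentiable at x"
 shows "pd e g x = k"
proof -
 have "((%s. g (x + s *\<^sub>R e)) has_real_derivative pd e g (x + 0 *\<^sub>R e)) (at 0)"
  by (rule pd_line_DERIV) (use assms in simp)
 moreover have "((%s. g (x + s *\<^sub>R e)) has_real_derivative k) (at 0)"
  unfolding assms(1) by (auto intro!: derivative_eq_intros)
 ultimately show ?thesis using DERIV_unique by force
qed

lemma pd_e_\<psi>: "pd e \<psi> x = 1"
 by (rule shift_invariant_pd[OF _ diff_\<psi>]) (simp add: \<psi>_shift)

lemma pd_\<psi>_shift: "pd v \<psi> (x + c *\<^sub>R e) = pd v \<psi> x"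
proof -
 have "((%x. x + c *\<^sub>R e) has_derivative (%h. h)) (at x)" by (auto intro!: derivative_eq_intros)
 from pd_comp(2)[OF this diff_\<psi>] have "pd v (%x. \<psi> (x + c *\<^sub>R e)) x = pd v \<psi> (x + c *\<^sub>R e)" .
 moreover have "pd v (%x. \<psi> (x + c *\<^sub>R e)) x = pd v \<psi> x"
  unfolding \<psi>_shift by (subst pd_add[OF diff_\<psi>]) auto
 ultimately show ?thesis by simp
qed

lemma pd_e_pd_\<psi>: "pd e (pd v \<psi>) x = 0"
 by (rule shift_invariant_pd) (use smooth_on_differentiable[OF smooth_on_pd[OF smooth_\<psi>]] in \<open>simp_all add: pd_\<psi>_shift\<close>)

lemma cont_\<psi>: "continuous_on A \<psi>"
 using smooth_on_continuous[OF smooth_\<psi>] continuous_on_subset by blast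

lemma open_D: "open (D r)"
proof -
 have "D r = ball x0 r \<inter> {x. 0 < \<psi> x}" by (auto simp: D_def)
 then show ?thesis by (simp only:) (intro open_Int open_ball open_Collect_less continuous_intros cont_\<psi>)
qed

lemma D_mono: "\<rho> <= r ==> D \<rho> \<subseteq> D r"
 by (auto simp: D_def)

lemma D_pos: "x \<in> D r ==> \<psi> x > 0"
 by (simp add: D_def)

lemma \<psi>_bounded: "\<exists>B\<ge>1. \<forall>x\<in>D r. \<psi> x <= B"
proof -
 obtain B where B: "B >= 0" "!!x. x \<in> cball x0 r ==> \<bar>\<psi> x\<bar> <= B" by (rule compact_bound[OF compact_cball[of x0 r] cont_\<psi>]) blast
 have "\<psi> x <= B + 1" if "x \<in> D r" for x using B(2)[of x] that by (auto simp: D_def)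
 then show ?thesis using B(1) by (intro exI[of _ "B + 1"]) simp
qed

lemma Wt_ex:
 assumes "Wt r a w" "\<rho> < r"
 shows "\<exists>C\<ge>0. \<forall>n. \<forall>x\<in>D \<rho>. \<bar>w n x\<bar> <= C * \<psi> x powr a"
proof -
 obtain C where C: "\<forall>n. \<forall>x\<in>D \<rho>. \<bar>w n x\<bar> <= C * \<psi> x powr a" using assms unfolding Wt_def by blast
 have "\<bar>w n x\<bar> <= max C 0 * \<psi> x powr a" if "x \<in> D \<rho>" for n x
 proof -
  have "C * \<psi> x powr a <= max C 0 * \<psi> x powr a" by (intro mult_right_mono) auto
  then show ?thesis using bspec[OF spec[OF C, of n] that] by linarith
 qed
 then show ?thesis by (intro exI[of _ "max C 0"]) simp
qed

lemma WtI: "(!!\<rho>. 0 < \<rho> ==> \<rho> < r ==> \<exists>C. \<forall>n. \<forall>x\<in>D \<rho>. \<bar>w n x\<bar> <= C * \<psi> x powr a) ==> Wt r a w"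
 unfolding Wt_def
proof (intro allI impI)
 fix \<rho> assume *: "!!\<rho>. 0 < \<rho> ==> \<rho> < r ==> \<exists>C. \<forall>n. \<forall>x\<in>D \<rho>. \<bar>w n x\<bar> <= C * \<psi> x powr a" and "\<rho> < r"
 show "\<exists>C. \<forall>n. \<forall>x\<in>D \<rho>. \<bar>w n x\<bar> <= C * \<psi> x powr a"
 proof (cases "\<rho> > 0")
  case False
  have "x \<notin> D \<rho>" for x
  proof
   assume "x \<in> D \<rho>"
   then have "dist x0 x < \<rho>" by (simp add: D_def)
   then show False using False zero_le_dist[of x0 x] by linarith
  qed
  then show ?thesis by blast
 qed (use * \<open>\<rho> < r\<close> in blast)
qed

lemma Wt_mono: "Wt r a w ==> a' <= a ==> Wt r a' w"
proof (rule WtI)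
 fix \<rho> assume a: "Wt r a w" "a' <= a" and \<rho>: "0 < \<rho>" "\<rho> < r"
 obtain C where C: "C >= 0" "!!n x. x \<in> D \<rho> ==> \<bar>w n x\<bar> <= C * \<psi> x powr a" using Wt_ex[OF a(1) \<rho>(2)] by blast
 obtain B where B: "B >= 1" "!!x. x \<in> D \<rho> ==> \<psi> x <= B" using \<psi>_bounded by blast
 have "\<bar>w n x\<bar> <= (C * B powr (a - a')) * \<psi> x powr a'" if x: "x \<in> D \<rho>" for n x
 proof -
  have "\<psi> x powr a = \<psi> x powr (a - a') * \<psi> x powr a'" by (simp flip: powr_add)
  also have "... <= B powr (a - a') * \<psi> x powr a'"
   using B(2)[OF x] D_pos[OF x] a(2) by (intro mult_right_mono powr_mono2) auto
  finally have "C * \<psi> x powr a <= C * (B powr (a - a') * \<psi> x powr a')" using C(1) by (intro mult_left_mono)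
  then show ?thesis using C(2)[OF x, of n] by (simp add: mult.assoc)
 qed
 then show "\<exists>C. \<forall>n. \<forall>x\<in>D \<rho>. \<bar>w n x\<bar> <= C * \<psi> x powr a'" by blast
qed

lemma Wt_cong: "Wt r a w ==> (!!n x. x \<in> D r ==> w n x = v n x) ==> Wt r a v"
proof (rule WtI)
 fix \<rho> assume a: "Wt r a w" "!!n x. x \<in> D r ==> w n x = v n x" and \<rho>: "0 < \<rho>" "\<rho> < r"
 obtain C where C: "C >= 0" "!!n x. x \<in> D \<rho> ==> \<bar>w n x\<bar> <= C * \<psi> x powr a" using Wt_ex[OF a(1) \<rho>(2)] by blast
 have "\<bar>v n x\<bar> <= C * \<psi> x powr a" if "x \<in> D \<rho>" for n x
  using C(2)[OF that, of n] a(2)[of x n] subsetD[OF D_mono that, of r] \<rho> by simp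
 then show "\<exists>C. \<forall>n. \<forall>x\<in>D \<rho>. \<bar>v n x\<bar> <= C * \<psi> x powr a" by blast
qed

lemma Wt_add: "Wt r a w ==> Wt r a v ==> Wt r a (%n x. w n x + v n x)"
proof (rule WtI)
 fix \<rho> assume a: "Wt r a w" "Wt r a v" and \<rho>: "0 < \<rho>" "\<rho> < r"
 obtain C where C: "C >= 0" "!!n x. x \<in> D \<rho> ==> \<bar>w n x\<bar> <= C * \<psi> x powr a" using Wt_ex[OF a(1) \<rho>(2)] by blast
 obtain C' where C': "C' >= 0" "!!n x. x \<in> D \<rho> ==> \<bar>v n x\<bar> <= C' * \<psi> x powr a" using Wt_ex[OF a(2) \<rho>(2)] by blast
 have "\<bar>w n x + v n x\<bar> <= (C + C') * \<psi> x powr a" if "x \<in> D \<rho>" for n x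
  using C(2)[OF that, of n] C'(2)[OF that, of n] by (simp add: distrib_right)
 then show "\<exists>C. \<forall>n. \<forall>x\<in>D \<rho>. \<bar>w n x + v n x\<bar> <= C * \<psi> x powr a" by blast
qed

lemma Wt_mult: "Wt r a w ==> Wt r a' v ==> Wt r (a + a') (%n x. w n x * v n x)"
proof (rule WtI)
 fix \<rho> assume a: "Wt r a w" "Wt r a' v" and \<rho>: "0 < \<rho>" "\<rho> < r"
 obtain C where C: "C >= 0" "!!n x. x \<in> D \<rho> ==> \<bar>w n x\<bar> <= C * \<psi> x powr a" using Wt_ex[OF a(1) \<rho>(2)] by blast
 obtain C' where C': "C' >= 0" "!!n x. x \<in> D \<rho> ==> \<bar>v n x\<bar> <= C' * \<psi> x powr a'" using Wt_ex[OF a(2) \<rho>(2)] by blast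
 have "\<bar>w n x * v n x\<bar> <= (C * C') * \<psi> x powr (a + a')" if "x \<in> D \<rho>" for n x
  using mult_mono[OF C(2)[OF that, of n] C'(2)[OF that, of n]] C(1) by (simp add: abs_mult powr_add mult.assoc mult.left_commute)
 then show "\<exists>C. \<forall>n. \<forall>x\<in>D \<rho>. \<bar>w n x * v n x\<bar> <= C * \<psi> x powr (a + a')" by blast
qed

lemma Wt_0I: "(!!\<rho>. \<rho> < r ==> \<exists>C. \<forall>n. \<forall>x\<in>D \<rho>. \<bar>w n x\<bar> <= C) ==> Wt r 0 w"
proof (rule WtI)
 fix \<rho> assume "!!\<rho>. \<rho> < r ==> \<exists>C. \<forall>n. \<forall>x\<in>D \<rho>. \<bar>w n x\<bar> <= C" "\<rho> < r"
 then obtain C where "!!n x. x \<in> D \<rho> ==> \<bar>w n x\<bar> <= C" by blast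
 then have "\<bar>w n x\<bar> <= C * \<psi> x powr 0" if "x \<in> D \<rho>" for n x using that D_pos[OF that] by simp
 then show "\<exists>C. \<forall>n. \<forall>x\<in>D \<rho>. \<bar>w n x\<bar> <= C * \<psi> x powr 0" by blast
qed

lemma Wt_0D: "Wt r 0 w ==> \<rho> < r ==> \<exists>C. \<forall>n. \<forall>x\<in>D \<rho>. \<bar>w n x\<bar> <= C"
proof -
 assume "Wt r 0 w" "\<rho> < r"
 then obtain C where "!!n x. x \<in> D \<rho> ==> \<bar>w n x\<bar> <= C * \<psi> x powr 0" unfolding Wt_def by blast
 then have "\<bar>w n x\<bar> <= C" if "x \<in> D \<rho>" for n x using that D_pos[OF that] by force
 then show ?thesis by blast
qed

lemma Wt_smooth:
 assumes "continuous_on UNIV g" shows "Wt r 0 (%n. g)"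
proof (rule Wt_0I)
 fix \<rho>
 obtain B where B: "B >= 0" "!!x. x \<in> cball x0 \<rho> ==> \<bar>g x\<bar> <= B" by (rule compact_bound[OF compact_cball[of x0 \<rho>] continuous_on_subset[OF assms subset_UNIV]]) blast
 have "\<forall>n::nat. \<forall>x\<in>D \<rho>. \<bar>g x\<bar> <= B" by (intro allI ballI B(2)) (simp add: D_def)
 then show "\<exists>C. \<forall>n::nat. \<forall>x\<in>D \<rho>. \<bar>g x\<bar> <= C" by blast
qed

lemma Wt_const: "Wt r 0 (%n x. q)"
 by (rule Wt_smooth) simp

lemma Wt_zero: "Wt r a (%n x. 0)"
 unfolding Wt_def by (auto intro!: exI[of _ 0])

lemma Wt_cmult: "Wt r a w ==> Wt r a (%n x. q * w n x)"
 using Wt_mult[OF Wt_const[of r q]] by force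

lemma Wt_sum: "finite J ==> (!!j. j \<in> J ==> Wt r a (w j)) ==> Wt r a (%n x. \<Sum>j\<in>J. w j n x)"
 by (induction J rule: finite_induct) (simp_all add: Wt_zero Wt_add)

lemma W_tower: "tower (D r) (Wt r) (%b x. b) Basis"
 by standard (auto intro: open_D smooth_on_const Wt_add Wt_mult Wt_const Wt_cong Wt_zero)

abbreviation wtow where "wtow r \<equiv> tower.tow (Wt r) (%b x. b) Basis 1"

lemma wtow_simps: "wtow r 0 a w = Wt r a w"
 "wtow r (Suc k) a w = (Wt r a w & (\<forall>b\<in>Basis. wtow r k (a - 1) (%n. pd b (w n))))"
 by (simp_all add: tower.tow.simps[OF W_tower])

lemma wtow_weight: "wtow r k a w ==> a' <= a ==> wtow r k a' w"
proof (rule tower.tow_weight[OF W_tower])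
 show "Wt r a' w" if "Wt r a w" "a' <= a" for a a' w by (rule Wt_mono[OF that])
qed

lemma wtow_smooth: "smooth_on UNIV g ==> wtow r k 0 (%n. g)"
proof (induction k arbitrary: g)
 case (Suc k)
 have "wtow r k (0 - 1) (%n. pd b g)" for b
  by (rule wtow_weight[OF Suc.IH[OF smooth_on_pd[OF Suc.prems]]]) simp
 then show ?case using Wt_smooth[OF smooth_on_continuous[OF Suc.prems]] by (simp add: wtow_simps)
next
 case 0
 then show ?case using Wt_smooth[OF smooth_on_continuous[OF 0]] by (simp add: wtow_simps)
qed

subsection \<open>Weighted interior estimates\<close>

text \<open>The interior estimate is applied on a ball whose radius is a fixed multiple of
  \<open>\<psi> x\<close>. There \<open>\<psi>\<close> is comparable to \<open>\<psi> x\<close>, and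
  the scaling of the estimate turns into the loss of one power.\<close>

lemma weighted_gradient:
 assumes w: "smooth_on (D r) w" "Wt r a (%n. w)" "Wt r (a - 2) (%n. laplacian w)" and b: "b \<in> Basis"
 shows "Wt r (a - 1) (%n. pd b w)"
proof (rule WtI)
 fix \<rho> assume \<rho>: "0 < \<rho>" "\<rho> < r"
 define \<rho>' where "\<rho>' = (\<rho> + r) / 2"
 have \<rho>': "\<rho> < \<rho>'" "\<rho>' < r" using \<rho> by (auto simp: \<rho>'_def)
 obtain C1 where C1: "C1 >= 0" "!!x. x \<in> D \<rho>' ==> \<bar>w x\<bar> <= C1 * \<psi> x powr a" using Wt_ex[OF w(2) \<rho>'(2)] by blast
 obtain C2 where C2: "C2 >= 0" "!!x. x \<in> D \<rho>' ==> \<bar>laplacian w x\<bar> <= C2 * \<psi> x powr (a - 2)" using Wt_ex[OF w(3) \<rho>'(2)] by blast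
 obtain B where B: "B >= 1" "!!x. x \<in> D r ==> \<psi> x <= B" using \<psi>_bounded by blast
 obtain L where L: "L >= 0" "!!x y. x \<in> cball x0 r ==> y \<in> cball x0 r ==> \<bar>\<psi> x - \<psi> y\<bar> <= L * norm (x - y)"
  using smooth_lipschitz_on_cball[OF smooth_\<psi>, of x0 r] by blast
 \<comment> \<open>The first bound keeps the ball of radius \<open>c * \<psi> x\<close> within the
   radius \<open>\<rho>'\<close>, the second one limits the change of \<open>\<psi>\<close> on it to
   half its value.\<close>
 define c where "c = min ((\<rho>' - \<rho>) / (2 * B)) (1 / (2 * (L + 1)))"
 have c: "c > 0" using \<rho>' B L by (simp add: c_def)
 have cB: "c * B < \<rho>' - \<rho>"
 proof -
  have "c * B <= (\<rho>' - \<rho>) / (2 * B) * B" using B by (intro mult_right_mono) (auto simp: c_def)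
  also have "... < \<rho>' - \<rho>" using B \<rho>' by simp
  finally show ?thesis .
 qed
 have cL: "L * c <= 1 / 2"
 proof -
  have "L * c <= (L + 1) * (1 / (2 * (L + 1)))" using L(1) c by (intro mult_mono) (auto simp: c_def)
  also have "(L + 1) * (1 / (2 * (L + 1))) = 1 / 2" using L(1) by (simp add: field_simps)
  finally show ?thesis .
 qed
 let ?N2 = "(real DIM('a))\<^sup>2"
 define C where "C = ?N2 * (C1 * 2 powr \<bar>a\<bar>) / c + (C2 * 2 powr \<bar>a - 2\<bar>) * c"
 have "\<bar>pd b w x\<bar> <= C * \<psi> x powr (a - 1)" if x: "x \<in> D \<rho>" for x
 proof -
  define d where "d = c * \<psi> x"
  have xr: "x \<in> D r" using x \<rho> D_mono[of \<rho> r] by auto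
  have p: "\<psi> x > 0" by (rule D_pos[OF x])
  have d: "d > 0" "d <= c * B" using p c B(2)[OF xr] by (auto simp: d_def)
  have near: "y \<in> D \<rho>'" "\<psi> x / 2 <= \<psi> y" "\<psi> y <= 2 * \<psi> x" if y: "y \<in> cball x d" for y
  proof -
   have "dist x0 y < \<rho>'" using dist_triangle[of x0 y x] y x d(2) cB by (auto simp: D_def)
   then have yb: "y \<in> ball x0 \<rho>'" by simp
   have "\<bar>\<psi> x - \<psi> y\<bar> <= L * norm (x - y)" using L(2)[of x y] xr yb \<rho>' by (auto simp: D_def)
   also have "... <= L * (c * \<psi> x)" using y L(1) by (intro mult_left_mono) (auto simp: d_def dist_norm)
   also have "... = (L * c) * \<psi> x" by simp
   also have "... <= 1 / 2 * \<psi> x" using cL p by (intro mult_right_mono) auto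
   finally have *: "\<bar>\<psi> x - \<psi> y\<bar> <= \<psi> x / 2" by simp
   then show "\<psi> x / 2 <= \<psi> y" "\<psi> y <= 2 * \<psi> x" using p by linarith+
   then show "y \<in> D \<rho>'" using yb p by (simp add: D_def)
  qed
  have "\<bar>pd b w x\<bar> <= ?N2 * (C1 * (2 powr \<bar>a\<bar> * \<psi> x powr a)) / d + (C2 * (2 powr \<bar>a - 2\<bar> * \<psi> x powr (a - 2))) * d"
  proof (rule interior_gradient[OF w(1) b d(1)])
   show "cball x d \<subseteq> D r" using near(1) D_mono[of \<rho>' r] \<rho>' by auto
   fix y assume y: "y \<in> cball x d"
   have "\<bar>w y\<bar> <= C1 * \<psi> y powr a" by (rule C1(2)[OF near(1)[OF y]])
   also have "... <= C1 * (2 powr \<bar>a\<bar> * \<psi> x powr a)"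
    by (intro mult_left_mono powr_comparable C1(1) p near[OF y])
   finally show "\<bar>w y\<bar> <= C1 * (2 powr \<bar>a\<bar> * \<psi> x powr a)" .
   have "\<bar>laplacian w y\<bar> <= C2 * \<psi> y powr (a - 2)" by (rule C2(2)[OF near(1)[OF y]])
   also have "... <= C2 * (2 powr \<bar>a - 2\<bar> * \<psi> x powr (a - 2))"
    by (intro mult_left_mono powr_comparable C2(1) p near[OF y])
   finally show "\<bar>laplacian w y\<bar> <= C2 * (2 powr \<bar>a - 2\<bar> * \<psi> x powr (a - 2))" .
  qed
  also have "... = C * \<psi> x powr (a - 1)"
  proof -
   have "\<psi> x powr a = \<psi> x powr (a - 1) * \<psi> x" "\<psi> x powr (a - 1) = \<psi> x powr (a - 2) * \<psi> x"
    using p powr_add[of "\<psi> x" "a - 1" 1] powr_add[of "\<psi> x" "a - 2" 1] by simp_all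
   then show ?thesis unfolding C_def d_def using c p by (simp add: field_simps)
  qed
  finally show ?thesis .
 qed
 then show "\<exists>C. \<forall>n::nat. \<forall>x\<in>D \<rho>. \<bar>pd b w x\<bar> <= C * \<psi> x powr (a - 1)" by blast
qed

lemma weighted_regularity:
 assumes "smooth_on (D r) w" "Wt r a (%n. w)" "wtow r k (a - 2) (%n. laplacian w)"
 shows "wtow r (Suc k) a (%n. w)"
 using assms
proof (induction k arbitrary: a w)
 case 0
 then show ?case using weighted_gradient[of r w a] by (simp add: wtow_simps)
next
 case (Suc k)
 have "wtow r (Suc k) (a - 1) (%n. pd b w)" if b: "b \<in> Basis" for b
 proof (rule Suc.IH)
  show "smooth_on (D r) (pd b w)" by (rule smooth_on_pd[OF Suc.prems(1)])
  show "Wt r (a - 1) (%n. pd b w)"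
   by (rule weighted_gradient[OF Suc.prems(1,2) _ b]) (use Suc.prems(3) in \<open>simp add: wtow_simps\<close>)
  have "wtow r k (a - 2 - 1) (%n. pd b (laplacian w))" using Suc.prems(3) b by (simp add: wtow_simps)
  then have "wtow r k (a - 2 - 1) (%n. laplacian (pd b w))"
   by (rule tower.tow_cong[OF W_tower]) (rule laplacian_pd_commute[OF Suc.prems(1), symmetric])
  then show "wtow r k (a - 1 - 2) (%n. laplacian (pd b w))" by (simp add: algebra_simps)
 qed
 then show ?case using Suc.prems(2) by (simp add: wtow_simps(2)[of r "Suc k"])
qed

subsection \<open>The barrier\<close>

lemma laplacian_mult:
 fixes f g :: "'b::euclidean_space => real"
 assumes f: "smooth_on S f" and g: "smooth_on S g" and x: "x \<in> S"
 shows "laplacian (%x. f x * g x) x = f x * laplacian g x + 2 * (\<Sum>b\<in>Basis. pd b f x * pd b g x) + g x * laplacian f x"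
proof -
 have d: "f differentiable at y" "g differentiable at y" "pd b f differentiable at y" "pd b g differentiable at y" if "y \<in> S" for y b
  using f g that by (auto intro!: smooth_on_differentiable[OF _ that] smooth_on_pd)
 have "pd b (pd b (%x. f x * g x)) x = f x * pd b (pd b g) x + 2 * (pd b f x * pd b g x) + g x * pd b (pd b f) x" for b
 proof -
  have "pd b (pd b (%x. f x * g x)) x = pd b (%x. pd b f x * g x + f x * pd b g x) x"
   by (rule pd_cong_open[OF smooth_on_open[OF f] x]) (rule pd_mult, use d in auto)
  also have "... = pd b (%x. pd b f x * g x) x + pd b (%x. f x * pd b g x) x"
   by (rule pd_add) (use d[OF x] in \<open>auto intro!: differentiable_mult\<close>)
  also have "... = f x * pd b (pd b g) x + 2 * (pd b f x * pd b g x) + g x * pd b (pd b f) x"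
   using d[OF x] by (simp add: pd_mult)
  finally show ?thesis .
 qed
 then show ?thesis by (simp add: laplacian_pd sum.distrib sum_distrib_left)
qed

text \<open>The derivative along the unit vector \<open>e\<close> is 1, so the gradient has norm at
  least 1 by the Cauchy-Schwarz inequality.\<close>

lemma gradient_\<psi>: "(\<Sum>b\<in>Basis. (pd b \<psi> x)\<^sup>2) >= 1"
proof -
 define G where "G = (\<Sum>b\<in>Basis. pd b \<psi> x *\<^sub>R b)"
 have "e \<bullet> G = 1" using pd_e_\<psi>[of x] pd_lincomb[OF diff_\<psi>, of e x] by (simp add: G_def inner_sum_right mult.commute)
 then have "1 <= norm e * norm G" using Cauchy_Schwarz_ineq2[of e G] by simp
 then have "1 <= (norm G)\<^sup>2" using norm_e power_mono[of 1 "norm G" 2] by simp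
 also have "(norm G)\<^sup>2 = (\<Sum>b\<in>Basis. (pd b \<psi> x)\<^sup>2)"
  unfolding power2_norm_eq_inner by (subst euclidean_inner) (simp add: G_def power2_eq_square)
 finally show ?thesis .
qed

text \<open>An exponent strictly between 0 and 1 makes the power strictly superharmonic near the
  boundary: the gradient term contributes at most -1/4 times the power -3/2, and \<open>t0\<close>
  is so small that the term with the Laplacian of \<open>\<psi>\<close> uses up at most half of
  it.\<close>

lemma laplacian_sqrt_\<psi>:
 obtains t0 where "t0 > 0" "!!x. x \<in> D r ==> \<psi> x <= t0 ==> laplacian (%x. \<psi> x powr (1/2)) x <= - (1/8) * \<psi> x powr (-3/2)"
proof -
 obtain K where K: "K >= 0" "!!y. y \<in> cball x0 r ==> \<bar>laplacian \<psi> y\<bar> <= K"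
  by (rule compact_bound[OF compact_cball[of x0 r] continuous_on_subset[OF smooth_on_continuous[OF smooth_on_laplacian[OF smooth_\<psi>]] subset_UNIV]]) blast
 define t0 where "t0 = 1 / (4 * (\<bar>K\<bar> + 1))"
 have t0: "t0 > 0" "(\<bar>K\<bar> + 1) * t0 = 1/4" by (auto simp: t0_def field_simps)
 have "laplacian (%x. \<psi> x powr (1/2)) x <= - (1/8) * \<psi> x powr (-3/2)" if x: "x \<in> D r" "\<psi> x <= t0" for x
 proof -
  let ?p = "\<psi> x"
  have p: "?p > 0" by (rule D_pos[OF x(1)])
  have lap: "laplacian (%x. \<psi> x powr (1/2)) x = 1/2 * ?p powr (-1/2) * laplacian \<psi> x + (-1/4) * ?p powr (-3/2) * (\<Sum>b\<in>Basis. (pd b \<psi> x)\<^sup>2)"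
   by (rule laplacian_real_comp[where T = "{0<..}" and F = "%t. t powr (1/2)" and ?F1.0 = "%t. 1/2 * t powr (-1/2)" and ?F2.0 = "%t. (-1/4) * t powr (-3/2)",
      OF smooth_on_subset[OF smooth_\<psi> open_D] x(1)])
    (auto simp: D_def intro!: derivative_eq_intros)
  have q: "?p powr (-1/2) = ?p powr (-3/2) * ?p" using p powr_add[of ?p "-3/2" 1] by simp
  have "\<bar>laplacian \<psi> x\<bar> <= K" by (rule K(2)) (use x(1) in \<open>auto simp: D_def\<close>)
  then have "laplacian \<psi> x <= \<bar>K\<bar> + 1" by simp
  then have "laplacian \<psi> x * ?p <= (\<bar>K\<bar> + 1) * t0" using x(2) p by (intro mult_mono) auto
  then have "laplacian \<psi> x * ?p <= 1/4" using t0 by simp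
  then have "1/2 * (laplacian \<psi> x * ?p) - 1/4 * (\<Sum>b\<in>Basis. (pd b \<psi> x)\<^sup>2) <= - (1/8)" using gradient_\<psi>[of x] by simp
  from mult_left_mono[OF this, of "?p powr (-3/2)"] show ?thesis
   unfolding lap q by (simp add: algebra_simps)
 qed
 with t0(1) show ?thesis using that by blast
qed

text \<open>A crude bound that blows up at the boundary improves to one that vanishes there, once
  each function is known to vanish continuously. The cutoff \<open>\<zeta>\<close> removes the
  lateral boundary at the cost of commutator terms of weight -3/2, and this is the weight of the
  Laplacian of the square root of \<open>\<psi>\<close>.\<close>

lemma barrier:
 assumes w: "!!n. smooth_on (D r) (w n)"
  and cw: "!!n. continuous_on (ball x0 r) (%x. if \<psi> x > 0 then w n x else 0)"
  and b: "Wt r (-1/2) w" "!!b. b \<in> Basis ==> Wt r (-3/2) (%n. pd b (w n))" "Wt r (-3/2) (%n. laplacian (w n))"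
 shows "Wt r (1/2) w"
proof (rule WtI)
 fix \<rho> assume \<rho>: "0 < \<rho>" "\<rho> < r"
 define \<rho>1 where "\<rho>1 = (\<rho> + r) / 2"
 define \<rho>2 where "\<rho>2 = (\<rho>1 + r) / 2"
 have \<rho>12: "\<rho> < \<rho>1" "\<rho>1 < \<rho>2" "\<rho>2 < r" using \<rho> by (auto simp: \<rho>1_def \<rho>2_def)
 define \<zeta> where "\<zeta> x = exp_bump 0 (\<rho>1\<^sup>2 - (x - x0) \<bullet> (x - x0))" for x
 have s\<zeta>: "smooth_on UNIV \<zeta>" unfolding \<zeta>_def
  by (rule smooth_on_real_comp[OF smooth_on_exp_bump]) (intro smooth_on_diff smooth_on_const smooth_on_norm_sq open_UNIV, simp)
 have s\<zeta>D: "smooth_on (D r) \<zeta>" by (rule smooth_on_subset[OF s\<zeta> open_D]) simp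
 have \<zeta>0: "\<zeta> x = 0" if "dist x0 x >= \<rho>1" for x
 proof -
  have "\<rho>1\<^sup>2 <= (norm (x - x0))\<^sup>2" using that \<rho> \<rho>12 by (intro power_mono) (auto simp: dist_norm norm_minus_commute)
  then show ?thesis by (simp add: \<zeta>_def exp_bump_def power2_norm_eq_inner)
 qed
 define m where "m = exp_bump 0 (\<rho>1\<^sup>2 - \<rho>\<^sup>2)"
 have m: "m > 0" using \<rho> \<rho>12 by (simp add: m_def exp_bump_def power_strict_mono)
 have \<zeta>m: "\<zeta> x >= m" if "x \<in> D \<rho>" for x
 proof -
  have "(norm (x - x0))\<^sup>2 <= \<rho>\<^sup>2" using that by (intro power_mono) (auto simp: D_def dist_norm norm_minus_commute)
  moreover have "\<rho>\<^sup>2 < \<rho>1\<^sup>2" using \<rho> \<rho>12 by (simp add: power_strict_mono)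
  ultimately show ?thesis unfolding m_def \<zeta>_def exp_bump_def
   by (auto simp: power2_norm_eq_inner intro!: le_imp_inverse_le)
 qed
 define W where "W n x = \<zeta> x * w n x" for n x
 have sW: "smooth_on (D r) (W n)" for n unfolding W_def by (rule smooth_on_mult[OF s\<zeta>D w])
 have "Wt r (0 + -3/2) (%n x. \<zeta> x * laplacian (w n) x)"
  using Wt_mult[OF Wt_smooth[OF smooth_on_continuous[OF s\<zeta>]] b(3)] by simp
 moreover have "Wt r (0 + -3/2) (%n x. pd b \<zeta> x * pd b (w n) x)" if "b \<in> Basis" for b
  using Wt_mult[OF Wt_smooth[OF smooth_on_continuous[OF smooth_on_pd[OF s\<zeta>]]] b(2)[OF that]] by simp
 then have "Wt r (0 + -3/2) (%n x. 2 * (\<Sum>b\<in>Basis. pd b \<zeta> x * pd b (w n) x))"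
  by (intro Wt_cmult Wt_sum finite_Basis)
 moreover have "Wt r (0 + -3/2) (%n x. w n x * laplacian \<zeta> x)"
  using Wt_mono[OF Wt_mult[OF b(1) Wt_smooth[OF smooth_on_continuous[OF smooth_on_laplacian[OF s\<zeta>]]]], of "0 + -3/2"] by simp
 ultimately have "Wt r (0 + -3/2) (%n x. \<zeta> x * laplacian (w n) x + 2 * (\<Sum>b\<in>Basis. pd b \<zeta> x * pd b (w n) x) + w n x * laplacian \<zeta> x)"
  by (intro Wt_add)
 then have lapW: "Wt r (-3/2) (%n. laplacian (W n))"
  unfolding W_def add_0 by (rule Wt_cong) (rule laplacian_mult[OF s\<zeta>D w, symmetric])
 have WW: "Wt r (-1/2) W" unfolding W_def
  using Wt_mult[OF Wt_smooth[OF smooth_on_continuous[OF s\<zeta>]] b(1)] by simp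
 obtain K1 where K1: "K1 >= 0" "!!n x. x \<in> D \<rho>2 ==> \<bar>laplacian (W n) x\<bar> <= K1 * \<psi> x powr (-3/2)" using Wt_ex[OF lapW \<rho>12(3)] by blast
 obtain K2 where K2: "K2 >= 0" "!!n x. x \<in> D \<rho>2 ==> \<bar>W n x\<bar> <= K2 * \<psi> x powr (-1/2)" using Wt_ex[OF WW \<rho>12(3)] by blast
 obtain t0 where t0: "t0 > 0" "!!x. x \<in> D r ==> \<psi> x <= t0 ==> laplacian (%x. \<psi> x powr (1/2)) x <= - (1/8) * \<psi> x powr (-3/2)"
  using laplacian_sqrt_\<psi>[of r] by metis
 \<comment> \<open>The first summand dominates the Laplacian, in view of the factor 1/8 in
   \<open>laplacian_sqrt_\<psi>\<close>; the second one dominates the values of \<open>W\<close>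
   where \<open>\<psi>\<close> is at least \<open>t0\<close>.\<close>
 define A where "A = 8 * K1 + K2 / t0"
 have A: "A >= 0" "A >= 8 * K1" "A >= K2 / t0" using K1 K2 t0 by (auto simp: A_def)
 have big: "K2 * t powr (-1/2) <= A * t powr (1/2)" if "t >= t0" for t
 proof -
  have t: "t > 0" using that t0 by linarith
  have "K2 * t powr (-1/2) = (K2 / t) * t powr (1/2)"
   using t powr_add[of t "-1/2" 1] by (simp add: field_simps)
  also have "K2 / t <= K2 / t0" using K2 t t0 that by (intro divide_left_mono) auto
  also have "... <= A" by (rule A)
  finally show ?thesis using t by (simp add: mult_right_mono)
 qed
 define Wx where "Wx n x = (if \<psi> x > 0 then W n x else 0)" for n x
 define R where "R = {x \<in> ball x0 \<rho>2. 0 < \<psi> x & \<psi> x < t0}"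
 define Kc where "Kc = {x \<in> cball x0 \<rho>2. 0 <= \<psi> x & \<psi> x <= t0}"
 have RD: "x \<in> D \<rho>2" "x \<in> D r" if "x \<in> R" for x using that \<rho>12 by (auto simp: R_def D_def)
 have oR: "open R"
 proof -
  have "open (ball x0 \<rho>2 \<inter> {x. 0 < \<psi> x} \<inter> {x. \<psi> x < t0})" by (intro open_Int open_ball open_Collect_less continuous_intros cont_\<psi>)
  moreover have "R = ball x0 \<rho>2 \<inter> {x. 0 < \<psi> x} \<inter> {x. \<psi> x < t0}" by (auto simp: R_def)
  ultimately show ?thesis by simp
 qed
 have cK: "compact Kc"
 proof -
  have "closed ({x. 0 <= \<psi> x} \<inter> {x. \<psi> x <= t0})" by (intro closed_Int closed_Collect_le continuous_intros cont_\<psi>)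
  then have "compact (cball x0 \<rho>2 \<inter> ({x. 0 <= \<psi> x} \<inter> {x. \<psi> x <= t0}))" by (intro compact_Int_closed compact_cball)
  moreover have "Kc = cball x0 \<rho>2 \<inter> ({x. 0 <= \<psi> x} \<inter> {x. \<psi> x <= t0})" by (auto simp: Kc_def)
  ultimately show ?thesis by simp
 qed
 have RK: "R \<subseteq> Kc" by (auto simp: R_def Kc_def)
 have cWx: "continuous_on Kc (Wx n)" for n
 proof -
  have "continuous_on Kc (%x. \<zeta> x * (if \<psi> x > 0 then w n x else 0))"
   by (intro continuous_on_mult continuous_on_subset[OF smooth_on_continuous[OF s\<zeta>]] continuous_on_subset[OF cw])
    (use \<rho>12 in \<open>auto simp: Kc_def\<close>)
  moreover have eq: "(%x. \<zeta> x * (if \<psi> x > 0 then w n x else 0)) = Wx n" by (auto simp: Wx_def W_def)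
  ultimately show ?thesis by (simp only:)
 qed
 have sR: "smooth_on R (Wx n)" for n
  by (rule smooth_on_cong[OF smooth_on_subset[OF sW oR]]) (use RD in \<open>auto simp: Wx_def R_def\<close>)
 have spR: "smooth_on R (%x. A * \<psi> x powr (1/2))"
  by (intro smooth_on_cmult smooth_on_real_comp[OF smooth_on_powr] smooth_on_subset[OF smooth_\<psi> oR]) (auto simp: R_def)
 have sp1: "smooth_on R (%x. \<psi> x powr (1/2))"
  by (intro smooth_on_real_comp[OF smooth_on_powr] smooth_on_subset[OF smooth_\<psi> oR]) (auto simp: R_def)
 have lapR: "laplacian (%x. A * \<psi> x powr (1/2)) x <= - K1 * \<psi> x powr (-3/2)" if x: "x \<in> R" for x
 proof -
  have "laplacian (%x. A * \<psi> x powr (1/2)) x = A * laplacian (%x. \<psi> x powr (1/2)) x" by (rule laplacian_cmult[OF sp1 x])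
  also have "... <= A * (- (1/8) * \<psi> x powr (-3/2))" using t0(2)[of x] RD[OF x] x A by (intro mult_left_mono) (auto simp: R_def)
  also have "... <= - K1 * \<psi> x powr (-3/2)" using A(2) mult_right_mono[of "8 * K1" A "\<psi> x powr (-3/2)"] by simp
  finally show ?thesis .
 qed
 have lapWx: "\<bar>laplacian (Wx n) x\<bar> <= K1 * \<psi> x powr (-3/2)" if x: "x \<in> R" for n x
 proof -
  have "laplacian (Wx n) x = laplacian (W n) x"
   by (rule laplacian_cong_open[OF oR x]) (auto simp: Wx_def R_def)
  then show ?thesis using K1(2)[OF RD(1)[OF x]] by simp
 qed
 have bd: "\<bar>Wx n x\<bar> <= A * \<psi> x powr (1/2)" if x: "x \<in> Kc - R" for n x
 proof (cases "dist x0 x < \<rho>2 & \<psi> x > 0")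
  case True
  then have "\<psi> x = t0" "x \<in> D \<rho>2" using x by (auto simp: Kc_def R_def D_def)
  then show ?thesis using K2(2)[of x n] big[of "\<psi> x"] True by (auto simp: Wx_def)
 next
  case False
  then have "Wx n x = 0" using x \<zeta>0[of x] \<rho>12 by (auto simp: Kc_def Wx_def W_def)
  then show ?thesis using A by simp
 qed
 have cp: "continuous_on Kc (%x. A * \<psi> x powr (1/2))"
  by (intro continuous_intros cont_\<psi> continuous_on_powr') (auto simp: Kc_def)
 have main: "\<bar>Wx n x\<bar> <= A * \<psi> x powr (1/2)" if x: "x \<in> Kc" for n x
 proof -
  show ?thesis
   by (rule maximum_principle_abs[OF cK RK cWx cp sR spR _ bd x]) (use lapR lapWx[of _ n] in fastforce)
 qed
 have "\<bar>w n x\<bar> <= (A / m) * \<psi> x powr (1/2)" if x: "x \<in> D \<rho>" for n x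
 proof -
  have x2: "x \<in> D \<rho>2" using x D_mono[of \<rho> \<rho>2] \<rho>12 by auto
  have "\<bar>W n x\<bar> <= A * \<psi> x powr (1/2)"
  proof (cases "\<psi> x <= t0")
   case True
   then have "x \<in> Kc" using x2 by (auto simp: Kc_def D_def)
   then show ?thesis using main[of x n] D_pos[OF x] by (simp add: Wx_def)
  next
   case False
   then show ?thesis using K2(2)[OF x2, of n] big[of "\<psi> x"] by simp
  qed
  moreover have "m * \<bar>w n x\<bar> <= \<bar>W n x\<bar>" using \<zeta>m[OF x] m by (simp add: W_def abs_mult mult_right_mono)
  ultimately show ?thesis using m by (simp add: field_simps)
 qed
 then show "\<exists>C. \<forall>n. \<forall>x\<in>D \<rho>. \<bar>w n x\<bar> <= C * \<psi> x powr (1/2)" by blast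
qed

end


subsection \<open>Tangential derivatives\<close>

context chart
begin

text \<open>Since \<open>pd e \<psi> = 1\<close>, subtracting this multiple of \<open>e\<close>
  makes the field annihilate \<open>\<psi>\<close>; it is tangent to the level sets of
  \<open>\<psi>\<close>.\<close>

definition T :: "'a => 'a => 'a" where
 "T b x = b - pd b \<psi> x *\<^sub>R e"

text \<open>The flow of \<open>T b\<close>; it preserves \<open>\<psi>\<close>.\<close>

definition flow :: "'a => real => 'a => 'a" where
 "flow b s x = x + s *\<^sub>R b + (\<psi> x - \<psi> (x + s *\<^sub>R b)) *\<^sub>R e"

lemma \<psi>_flow: "\<psi> (flow b s x) = \<psi> x"
 by (simp add: flow_def \<psi>_shift)

lemma flow_0 [simp]: "flow b 0 x = x"
 by (simp add: flow_def)

lemma smooth_T: "smooth_on UNIV (%x. T b x \<bullet> c)"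
proof -
 have "smooth_on UNIV (%x. b \<bullet> c - pd b \<psi> x * (e \<bullet> c))"
  by (intro smooth_on_diff smooth_on_mult smooth_on_const smooth_on_pd smooth_\<psi> open_UNIV)
 then show ?thesis by (simp add: T_def inner_diff_left)
qed

lemma vd_T: "f differentiable at x ==> vd (T b) f x = pd b f x - pd b \<psi> x * pd e f x"
 using pd_vadd[of f x b "- pd b \<psi> x *\<^sub>R e"] pd_scaleR[of f x "- pd b \<psi> x" e]
 by (simp add: vd_def T_def)

lemma flow_DERIV:
 assumes f: "f differentiable at (flow b s x)"
 shows "((%s. f (flow b s x)) has_real_derivative vd (T b) f (flow b s x)) (at s)"
proof -
 have "((%s. \<psi> (x + s *\<^sub>R b)) has_real_derivative pd b \<psi> (x + s *\<^sub>R b)) (at s)" by (rule pd_line_DERIV[OF diff_\<psi>])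
 then have D: "((%s. \<psi> (x + s *\<^sub>R b)) has_derivative (%h. h * pd b \<psi> (x + s *\<^sub>R b))) (at s)"
  by (simp add: has_field_derivative_def mult_commute_abs)
 have "(flow b s x) = (x + s *\<^sub>R b) + (\<psi> x - \<psi> (x + s *\<^sub>R b)) *\<^sub>R e" by (simp add: flow_def)
 then have pT: "pd b \<psi> (flow b s x) = pd b \<psi> (x + s *\<^sub>R b)" by (simp add: pd_\<psi>_shift)
 have "((%s. flow b s x) has_derivative (%h. h *\<^sub>R T b (flow b s x))) (at s)"
  unfolding flow_def[abs_def] T_def pT[unfolded flow_def]
  by (auto intro!: derivative_eq_intros D simp: algebra_simps)
 from has_derivative_compose[OF this differentiable_has_derivative_pd[OF f]]
 show ?thesis
  by (simp add: has_field_derivative_def vd_def pd_scaleR[OF f] mult_commute_abs)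
qed

lemma flow_domain:
 assumes "r' < r" "b \<in> Basis"
 shows "\<exists>s0>0. s0 <= r - r' & (\<forall>s x. 0 <= s --> s <= s0 --> x \<in> D r' --> flow b s x \<in> D ((r' + r) / 2))"
proof -
 obtain L where L: "L >= 0" "!!x y. x \<in> cball x0 r ==> y \<in> cball x0 r ==> \<bar>\<psi> x - \<psi> y\<bar> <= L * norm (x - y)"
  using smooth_lipschitz_on_cball[OF smooth_\<psi>, of x0 r] by blast
 define s0 where "s0 = (r - r') / (4 * (L + 1))"
 have s0: "s0 > 0" using assms L by (simp add: s0_def)
 have s0L: "s0 * (1 + L) = (r - r') / 4" using L by (simp add: s0_def field_simps)
 have "s0 * 1 <= s0 * (1 + L)" using s0 L by (intro mult_left_mono) auto
 then have s0r: "s0 <= r - r'" using s0L assms by simp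
 have "flow b s x \<in> D ((r' + r) / 2)" if s: "0 <= s" "s <= s0" and x: "x \<in> D r'" for s x
 proof -
  have nb: "norm (s *\<^sub>R b) = s" using s assms by simp
  have "dist x0 (x + s *\<^sub>R b) <= r" using dist_triangle[of x0 "x + s *\<^sub>R b" x] x s s0r nb by (simp add: D_def dist_norm del: norm_scaleR)
  then have "\<bar>\<psi> x - \<psi> (x + s *\<^sub>R b)\<bar> <= L * s" using L(2)[of x "x + s *\<^sub>R b"] x assms(1) nb by (simp add: D_def)
  then have "norm (flow b s x - x) <= s + L * s"
   using norm_triangle_ineq[of "s *\<^sub>R b" "(\<psi> x - \<psi> (x + s *\<^sub>R b)) *\<^sub>R e"] nb norm_e by (simp add: flow_def add.assoc)
  also have "... <= s0 * (1 + L)" using s L mult_right_mono[of s s0 "1 + L"] by (simp add: algebra_simps)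
  finally have "norm (flow b s x - x) < (r - r') / 2" using s0L assms by simp
  then have "dist x0 (flow b s x) < (r' + r) / 2"
   using dist_triangle[of x0 "flow b s x" x] x by (simp add: D_def dist_norm norm_minus_commute field_simps)
  then show ?thesis using \<psi>_flow[of b s x] x by (simp add: D_def)
 qed
 then show ?thesis using s0 s0r by blast
qed

text \<open>The weight depends on \<open>\<psi>\<close> only, which the flow preserves, so moving
  the argument along the flow leaves it unchanged. The parameter may depend on the point, as a mean
  value theorem requires.\<close>

lemma flow_Wt:
 assumes "Wt r a (%n. f)" "r' < r" "!!n x. x \<in> D r' ==> flow b (\<xi> n x) x \<in> D ((r' + r) / 2)"
 shows "Wt r' a (%n x. f (flow b (\<xi> n x) x))"
proof -
 obtain C where C: "\<forall>n::nat. \<forall>x\<in>D ((r' + r) / 2). \<bar>f x\<bar> <= C * \<psi> x powr a"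
  using Wt_ex[OF assms(1), of "(r' + r) / 2"] assms(2) by auto
 have "\<bar>f (flow b (\<xi> n x) x)\<bar> <= C * \<psi> x powr a" if "x \<in> D r'" for n x
  using C assms(3)[OF that, of n] \<psi>_flow[of b "\<xi> n x" x] by metis
 then show ?thesis unfolding Wt_def using D_mono by (meson less_imp_le subsetD)
qed

lemma flow_quotient_Wt:
 assumes f: "smooth_on (D r) f" and Tf: "Wt r a (%n. vd (T b) f)" and "r' < r"
  and s: "!!n. 0 < s n" "!!n t x. 0 <= t ==> t <= s n ==> x \<in> D r' ==> flow b t x \<in> D ((r' + r) / 2)"
 shows "Wt r' a (%n x. (f (flow b (s n) x) - f x) / s n)"
proof -
 have "\<exists>\<xi>. 0 < \<xi> & \<xi> < s n & (f (flow b (s n) x) - f x) / s n = vd (T b) f (flow b \<xi> x)" if x: "x \<in> D r'" for n x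
 proof -
  have "\<exists>\<xi>>0. \<xi> < s n & f (flow b (s n) x) - f (flow b 0 x) = (s n - 0) * vd (T b) f (flow b \<xi> x)"
  proof (rule MVT2[OF s(1)])
   fix t assume "0 <= t" "t <= s n"
   then have "flow b t x \<in> D r" using s(2)[of t n x] x D_mono[of "(r' + r) / 2" r] \<open>r' < r\<close> by auto
   then show "((%s. f (flow b s x)) has_real_derivative vd (T b) f (flow b t x)) (at t)"
    by (intro flow_DERIV smooth_on_differentiable[OF f])
  qed
  then show ?thesis using s(1)[of n] by auto
 qed
 then obtain \<xi> where \<xi>: "!!n x. x \<in> D r' ==> 0 < \<xi> n x & \<xi> n x < s n & (f (flow b (s n) x) - f x) / s n = vd (T b) f (flow b (\<xi> n x) x)"
 proof -
  show thesis
   by (rule that[of "%n x. SOME \<xi>. 0 < \<xi> & \<xi> < s n & (f (flow b (s n) x) - f x) / s n = vd (T b) f (flow b \<xi> x)"])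
    (rule someI_ex, fact)
 qed
 have "Wt r' a (%n x. vd (T b) f (flow b (\<xi> n x) x))"
  by (rule flow_Wt[OF Tf \<open>r' < r\<close>]) (use s(2) \<xi> less_imp_le in blast)
 then show ?thesis by (rule Wt_cong) (use \<xi> in simp)
qed

lemma smooth_quotient_Wt:
 assumes q: "smooth_on UNIV q" and b: "b \<in> Basis" and "r' < r" and s: "!!n. 0 < s n" "!!n. s n <= r - r'"
 shows "Wt r' 0 (%n x. (q x - q (x + s n *\<^sub>R b)) / s n)"
proof (rule Wt_0I)
 fix \<rho> assume "\<rho> < r'"
 obtain L where L: "L >= 0" "!!x y. x \<in> cball x0 r ==> y \<in> cball x0 r ==> \<bar>q x - q y\<bar> <= L * norm (x - y)"
  using smooth_lipschitz_on_cball[OF q, of x0 r] by blast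
 have "\<bar>(q x - q (x + s n *\<^sub>R b)) / s n\<bar> <= L" if "x \<in> D \<rho>" for n x
 proof -
  have nb: "norm (s n *\<^sub>R b) = s n" using s(1)[of n] b by simp
  have "dist x0 (x + s n *\<^sub>R b) <= r"
   using dist_triangle[of x0 "x + s n *\<^sub>R b" x] that s(2)[of n] nb \<open>\<rho> < r'\<close> by (simp add: D_def dist_norm)
  then have "\<bar>q x - q (x + s n *\<^sub>R b)\<bar> <= L * s n"
   using L(2)[of x "x + s n *\<^sub>R b"] that nb \<open>\<rho> < r'\<close> \<open>r' < r\<close> by (simp add: D_def)
  then show ?thesis using s(1)[of n] by (simp add: abs_divide divide_le_eq)
 qed
 then show "\<exists>C. \<forall>n. \<forall>x\<in>D \<rho>. \<bar>(q x - q (x + s n *\<^sub>R b)) / s n\<bar> <= C" by blast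
qed

lemma ext_continuous:
 assumes f: "smooth_on (D r) f" and C: "!!x. x \<in> D r ==> \<bar>f x\<bar> <= C * \<psi> x powr (1/2)"
 shows "continuous_on (ball x0 r) (%x. if \<psi> x > 0 then f x else 0)"
proof (rule continuous_at_imp_continuous_on, rule ballI)
 fix x assume x: "x \<in> ball x0 r"
 show "isCont (%x. if \<psi> x > 0 then f x else 0) x"
 proof (cases "\<psi> x > 0")
  case True
  then have xD: "x \<in> D r" using x by (simp add: D_def)
  have ev: "\<forall>\<^sub>F y in nhds x. (if \<psi> y > 0 then f y else 0) = f y"
   using eventually_nhds_in_open[OF open_D xD] by eventually_elim (simp add: D_def)
  moreover have "isCont f x" using smooth_on_continuous[OF f] xD open_D continuous_on_eq_continuous_at by blast
  ultimately show ?thesis using isCont_cong[OF ev] by simp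
 next
  case False
  have "isCont \<psi> x" using cont_\<psi>[of UNIV] continuous_on_eq_continuous_at by blast
  then have "((%y. \<psi> y) \<longlongrightarrow> \<psi> x) (at x)" by (simp add: isCont_def)
  then have "((%y. C * (max (\<psi> y) 0) powr (1/2)) \<longlongrightarrow> C * (max (\<psi> x) 0) powr (1/2)) (at x)"
   by (intro tendsto_intros tendsto_powr') auto
  then have lim: "((%y. C * (max (\<psi> y) 0) powr (1/2)) \<longlongrightarrow> 0) (at x)" using False by (simp add: max_def)
  have "\<forall>\<^sub>F y in at x. y \<in> ball x0 r" using x eventually_at_topological[of "%y. y \<in> ball x0 r" x UNIV] by (metis open_ball)
  then have "\<forall>\<^sub>F y in at x. norm (if \<psi> y > 0 then f y else 0) <= C * (max (\<psi> y) 0) powr (1/2)"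
   by eventually_elim (use C in \<open>auto simp: D_def max_def\<close>)
  from Lim_null_comparison[OF this lim] show ?thesis using False by (simp add: isCont_def)
 qed
qed

lemma flow_pd:
 assumes w: "smooth_on (D r) w" and F: "!!x. x \<in> D r' ==> flow b s x \<in> D r" and x: "x \<in> D r'"
 defines "G \<equiv> %x. \<psi> x - \<psi> (x + s *\<^sub>R b)"
 shows "smooth_on (D r') (%x. w (flow b s x))"
  and "pd k (%x. w (flow b s x)) x = pd k w (flow b s x) + pd k G x * pd e w (flow b s x)"
  and "pd k G x = pd k \<psi> x - pd k \<psi> (x + s *\<^sub>R b)"
proof -
 have tr: "((%x. x + s *\<^sub>R b) has_derivative (%h. h)) (at x)" for x by (auto intro!: derivative_eq_intros)
 have s1: "smooth_on UNIV (%x. \<psi> (x + s *\<^sub>R b))"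
 proof (rule smooth_on_vec_comp[OF open_UNIV smooth_\<psi>])
  show "smooth_on UNIV (%x. (x + s *\<^sub>R b) \<bullet> c)" for c
   unfolding inner_add_left by (intro smooth_on_add smooth_on_coord smooth_on_const open_UNIV)
 qed simp
 have sG: "smooth_on UNIV G" unfolding G_def by (rule smooth_on_diff[OF smooth_\<psi> s1])
 have dG: "G differentiable at x" for x using smooth_on_differentiable[OF sG] by simp
 show "pd k G x = pd k \<psi> x - pd k \<psi> (x + s *\<^sub>R b)"
  unfolding G_def using smooth_on_differentiable[OF s1] pd_comp(2)[OF tr diff_\<psi>] by (subst pd_diff[OF diff_\<psi>]) auto
 show "smooth_on (D r') (%x. w (flow b s x))"
 proof (rule smooth_on_vec_comp[OF open_D w _ F])
  fix c :: 'a
  have "smooth_on UNIV (%x. x \<bullet> c + (s *\<^sub>R b) \<bullet> c + G x * (e \<bullet> c))"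
   by (intro smooth_on_add smooth_on_mult smooth_on_coord smooth_on_const sG open_UNIV)
  then have "smooth_on UNIV (%x. flow b s x \<bullet> c)" by (simp add: flow_def G_def inner_add_left)
  then show "smooth_on (D r') (%x. flow b s x \<bullet> c)" by (rule smooth_on_subset[OF _ open_D]) simp
 qed
 have d: "w differentiable at (flow b s x)" by (rule smooth_on_differentiable[OF w F[OF x]])
 have "((%x. flow b s x) has_derivative (%v. v + pd v G x *\<^sub>R e)) (at x)"
 proof -
  have "(G has_derivative (%v. pd v G x)) (at x)" by (rule differentiable_has_derivative_pd[OF dG])
  from has_derivative_add[OF tr has_derivative_scaleR_left[OF this, of e]]
  show ?thesis unfolding flow_def G_def .
 qed
 from pd_comp(2)[OF this d, of k]
 show "pd k (%x. w (flow b s x)) x = pd k w (flow b s x) + pd k G x * pd e w (flow b s x)"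
  by (simp add: pd_vadd[OF d] pd_scaleR[OF d])
qed

text \<open>The flow is a translation followed by a displacement along \<open>e\<close>, and the
  derivatives of the displacement are differences of derivatives of \<open>\<psi>\<close> over the
  distance \<open>s\<close>. Every term beyond the transported second derivative therefore carries a
  factor of order \<open>s\<close>.\<close>

lemma flow_pd_pd:
 assumes w: "smooth_on (D r) w" and F: "!!x. x \<in> D r' ==> flow b s x \<in> D r" and x: "x \<in> D r'"
 defines "g \<equiv> %k x. pd k \<psi> x - pd k \<psi> (x + s *\<^sub>R b)"
 shows "pd k (pd k (%x. w (flow b s x))) x = pd k (pd k w) (flow b s x)
  + g k x * (pd e (pd k w) (flow b s x) + pd k (pd e w) (flow b s x) + g k x * pd e (pd e w) (flow b s x))
  + (pd k (pd k \<psi>) x - pd k (pd k \<psi>) (x + s *\<^sub>R b)) * pd e w (flow b s x)"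
proof -
 have g: "pd k (%x. \<psi> x - \<psi> (x + s *\<^sub>R b)) y = g k y" if "y \<in> D r'" for y
  unfolding g_def by (rule flow_pd(3)[OF w F that])
 have p: "pd k (%x. f (flow b s x)) y = pd k f (flow b s y) + g k y * pd e f (flow b s y)"
   "(%x. f (flow b s x)) differentiable at y" if "smooth_on (D r) f" "y \<in> D r'" for f y
  using flow_pd(2)[OF that(1) F that(2)] g[OF that(2)] smooth_on_differentiable[OF flow_pd(1)[OF that(1) F that(2)] that(2)] by auto
 have sk: "smooth_on (D r) (pd k w)" "smooth_on (D r) (pd e w)" by (rule smooth_on_pd[OF w])+
 have tr: "((%x. x + s *\<^sub>R b) has_derivative (%h. h)) (at x)" by (auto intro!: derivative_eq_intros)
 have dk: "pd k \<psi> differentiable at y" for y using smooth_on_differentiable[OF smooth_on_pd[OF smooth_\<psi>]] by simp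
 have gk: "g k differentiable at x" "pd k (g k) x = pd k (pd k \<psi>) x - pd k (pd k \<psi>) (x + s *\<^sub>R b)"
  unfolding g_def using pd_comp[OF tr dk] pd_diff[OF dk] dk by (auto intro!: differentiable_diff)
 have "pd k (pd k (%x. w (flow b s x))) x = pd k (%y. pd k w (flow b s y) + g k y * pd e w (flow b s y)) x"
  by (rule pd_cong_open[OF open_D x]) (rule p(1)[OF w])
 also have "... = pd k (%y. pd k w (flow b s y)) x + pd k (%y. g k y * pd e w (flow b s y)) x"
  by (intro pd_add differentiable_mult p(2)[OF sk(1) x] p(2)[OF sk(2) x] gk(1))
 also have "pd k (%y. g k y * pd e w (flow b s y)) x = pd k (g k) x * pd e w (flow b s x) + g k x * pd k (%y. pd e w (flow b s y)) x"
  by (rule pd_mult[OF gk(1) p(2)[OF sk(2) x]])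
 finally show ?thesis unfolding p(1)[OF sk(1) x] p(1)[OF sk(2) x] gk(2) by (simp add: algebra_simps)
qed

text \<open>The difference quotients along the flow vanish on the boundary, so the barrier applies to them,
 uniformly in the step.\<close>

lemma tangential_step:
 assumes w: "smooth_on (D r) w" "Wt r (1/2) (%n. w)" and b: "b \<in> Basis"
  and w1: "!!v. Wt r (-1/2) (%n. pd v w)" and w2: "!!u v. Wt r (-3/2) (%n. pd u (pd v w))"
  and h: "Wt r (-3/2) (%n. vd (T b) (laplacian w))"
 shows "Wt r (1/2) (%n. vd (T b) w)"
proof (rule WtI)
 fix \<rho> assume \<rho>: "0 < \<rho>" "\<rho> < r"
 define r' where "r' = (\<rho> + r) / 2"
 have r': "\<rho> < r'" "r' < r" using \<rho> by (auto simp: r'_def)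
 obtain s0 where s0: "s0 > 0" "s0 <= r - r'" "!!s x. 0 <= s ==> s <= s0 ==> x \<in> D r' ==> flow b s x \<in> D ((r' + r) / 2)"
  using flow_domain[OF r'(2) b] by blast
 define s where "s n = s0 / real (Suc n)" for n
 have s: "0 < s n" "s n <= s0" for n using s0(1) by (auto simp: s_def field_simps)
 have sr: "s n <= r - r'" for n using s(2)[of n] s0(2) by linarith
 have slim: "s \<longlonglongrightarrow> 0"
  using tendsto_mult_left[OF LIMSEQ_inverse_real_of_nat, of s0] unfolding s_def[abs_def] by (simp add: divide_inverse)
 have dom: "flow b t x \<in> D ((r' + r) / 2)" if "0 <= t" "t <= s n" "x \<in> D r'" for n t x
  using s0(3)[of t x] that s(2)[of n] by linarith
 have dom1: "flow b (s n) x \<in> D ((r' + r) / 2)" if "x \<in> D r'" for n x using dom[of "s n" n x] s(1)[of n] that by simp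
 have mid: "(r' + r) / 2 < r" using r' by simp
 have dom2: "flow b (s n) x \<in> D r" if "x \<in> D r'" for n x using dom1[OF that, of n] D_mono[of "(r' + r) / 2" r] mid by auto
 have inD: "x \<in> D r" if "x \<in> D r'" for x using D_mono[of r' r] r' that by auto
 define W where "W n x = inverse (s n) * (w (flow b (s n) x) - w x)" for n x
 have sw': "smooth_on (D r') w" by (rule smooth_on_subset[OF w(1) open_D]) (use inD in blast)
 have swf: "smooth_on (D r') (%x. w (flow b (s n) x))" for n
 proof (cases "D r' = {}")
  case False
  then obtain x where "x \<in> D r'" by blast
  show ?thesis by (rule flow_pd(1)[OF w(1) _ \<open>x \<in> D r'\<close>]) (rule dom2)
 qed (use open_D[of r'] in \<open>simp add: smooth_on_def\<close>)
 have sd: "smooth_on (D r') (%x. w (flow b (s n) x) - w x)" for n by (rule smooth_on_diff[OF swf sw'])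
 have sW: "smooth_on (D r') (W n)" for n unfolding W_def by (rule smooth_on_cmult[OF sd])
 have quot: "Wt r' a (%n x. inverse (s n) * (f (flow b (s n) x) - f x))" if "smooth_on (D r) f" "Wt r a (%n. vd (T b) f)" for f a
  using flow_quotient_Wt[OF that r'(2) s(1) dom] by (simp add: divide_inverse mult.commute)
 have Tpd: "Wt r a (%n. vd (T b) f)" if "smooth_on (D r) f" "Wt r a (%n. pd b f)" "Wt r a (%n. pd e f)" for f a
 proof (rule Wt_cong)
  have "Wt r (0 + a) (%n x. (- pd b \<psi> x) * pd e f x)"
   by (rule Wt_mult[OF Wt_smooth that(3)]) (intro smooth_on_continuous smooth_on_minus smooth_on_pd smooth_\<psi>)
  then show "Wt r a (%n x. pd b f x + (- pd b \<psi> x) * pd e f x)" by (intro Wt_add that) simp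
  show "pd b f x + (- pd b \<psi> x) * pd e f x = vd (T b) f x" if "x \<in> D r" for x
   using vd_T[OF smooth_on_differentiable[OF \<open>smooth_on (D r) f\<close> that]] by simp
 qed
 have fl: "Wt r' a (%n x. f (flow b (s n) x))" if "Wt r a (%n. f)" for f a
  by (rule flow_Wt[OF that r'(2) dom1])
 have gq: "Wt r' 0 (%n x. inverse (s n) * (q x - q (x + s n *\<^sub>R b)))" if "smooth_on UNIV q" for q
  using smooth_quotient_Wt[OF that b r'(2) s(1) sr] by (simp add: divide_inverse mult.commute)
 have g0: "Wt r' 0 (%n x. q x - q (x + s n *\<^sub>R b))" if "smooth_on UNIV q" for q
 proof -
  have "Wt r' 0 (%n x. s n)"
   by (rule Wt_0I) (use s in \<open>auto intro!: exI[of _ s0] simp: abs_of_pos\<close>)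
  from Wt_mult[OF this gq[OF that]] have "Wt r' 0 (%n x. s n * (inverse (s n) * (q x - q (x + s n *\<^sub>R b))))" by simp
  then show ?thesis by (rule Wt_cong) (use s(1) in \<open>simp add: less_imp_neq[THEN not_sym]\<close>)
 qed
 have Wb: "Wt r' (-1/2) W" unfolding W_def by (rule quot[OF w(1) Tpd[OF w(1) w1 w1]])
 have Wpd: "Wt r' (-3/2) (%n. pd k (W n))" for k
 proof (rule Wt_cong)
  have "Wt r' (-3/2) (%n x. inverse (s n) * (pd k w (flow b (s n) x) - pd k w x))"
   by (rule quot[OF smooth_on_pd[OF w(1)] Tpd[OF smooth_on_pd[OF w(1)] w2 w2]])
  moreover have "Wt r' (0 + -1/2) (%n x. inverse (s n) * (pd k \<psi> x - pd k \<psi> (x + s n *\<^sub>R b)) * pd e w (flow b (s n) x))"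
   by (rule Wt_mult[OF gq[OF smooth_on_pd[OF smooth_\<psi>]] fl[OF w1, unfolded]])
  then have "Wt r' (-3/2) (%n x. inverse (s n) * (pd k \<psi> x - pd k \<psi> (x + s n *\<^sub>R b)) * pd e w (flow b (s n) x))"
   by (rule Wt_mono) simp
  ultimately show "Wt r' (-3/2) (%n x. inverse (s n) * (pd k w (flow b (s n) x) - pd k w x)
    + inverse (s n) * (pd k \<psi> x - pd k \<psi> (x + s n *\<^sub>R b)) * pd e w (flow b (s n) x))" by (rule Wt_add)
  fix n x assume x: "x \<in> D r'"
  have "pd k (W n) x = inverse (s n) * (pd k (%x. w (flow b (s n) x)) x - pd k w x)"
   unfolding W_def using pd_cmult[OF smooth_on_differentiable[OF sd x], of k "inverse (s n)" n]
    pd_diff[OF smooth_on_differentiable[OF swf x] smooth_on_differentiable[OF sw' x], of k n] by simp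
  then show "inverse (s n) * (pd k w (flow b (s n) x) - pd k w x)
    + inverse (s n) * (pd k \<psi> x - pd k \<psi> (x + s n *\<^sub>R b)) * pd e w (flow b (s n) x) = pd k (W n) x"
   using flow_pd(2,3)[OF w(1) dom2 x, of k n] by (simp add: algebra_simps)
 qed
 have Wl: "Wt r' (-3/2) (%n. laplacian (W n))"
 proof (rule Wt_cong)
  define q where "q k n x = inverse (s n) * (pd k \<psi> x - pd k \<psi> (x + s n *\<^sub>R b))" for k n x
  define q2 where "q2 k n x = inverse (s n) * (pd k (pd k \<psi>) x - pd k (pd k \<psi>) (x + s n *\<^sub>R b))" for k n x
  \<comment> \<open>The part of the commutator of the Laplacian with the flow that belongs to
    direction \<open>k\<close>, already divided by the step.\<close>
  define R where "R k n x = q k n x * (pd e (pd k w) (flow b (s n) x) + pd k (pd e w) (flow b (s n) x)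
   + (pd k \<psi> x - pd k \<psi> (x + s n *\<^sub>R b)) * pd e (pd e w) (flow b (s n) x)) + q2 k n x * pd e w (flow b (s n) x)" for k n x
  have "Wt r' (0 + -3/2) (%n x. q k n x * (pd e (pd k w) (flow b (s n) x) + pd k (pd e w) (flow b (s n) x)
   + (pd k \<psi> x - pd k \<psi> (x + s n *\<^sub>R b)) * pd e (pd e w) (flow b (s n) x)))" for k
   unfolding q_def
  proof (rule Wt_mult[OF gq[OF smooth_on_pd[OF smooth_\<psi>]]])
   have "Wt r' (0 + -3/2) (%n x. (pd k \<psi> x - pd k \<psi> (x + s n *\<^sub>R b)) * pd e (pd e w) (flow b (s n) x))"
    by (rule Wt_mult[OF g0[OF smooth_on_pd[OF smooth_\<psi>]] fl[OF w2]])
   then show "Wt r' (-3/2) (%n x. pd e (pd k w) (flow b (s n) x) + pd k (pd e w) (flow b (s n) x)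
    + (pd k \<psi> x - pd k \<psi> (x + s n *\<^sub>R b)) * pd e (pd e w) (flow b (s n) x))"
    by (intro Wt_add fl w2) simp
  qed
  moreover have "Wt r' (-3/2) (%n x. q2 k n x * pd e w (flow b (s n) x))" for k
  proof -
   have "Wt r' (0 + -1/2) (%n x. q2 k n x * pd e w (flow b (s n) x))"
    unfolding q2_def by (rule Wt_mult[OF gq[OF smooth_on_pd[OF smooth_on_pd[OF smooth_\<psi>]]] fl[OF w1]])
   then show ?thesis by (rule Wt_mono) simp
  qed
  ultimately have "Wt r' (-3/2) (R k)" for k unfolding R_def by (intro Wt_add) auto
  then have "Wt r' (-3/2) (%n x. \<Sum>k\<in>Basis. R k n x)" by (intro Wt_sum finite_Basis)
  moreover have "Wt r' (-3/2) (%n x. inverse (s n) * (laplacian w (flow b (s n) x) - laplacian w x))"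
   by (rule quot[OF smooth_on_laplacian[OF w(1)] h])
  ultimately show "Wt r' (-3/2) (%n x. inverse (s n) * (laplacian w (flow b (s n) x) - laplacian w x) + (\<Sum>k\<in>Basis. R k n x))"
   by (intro Wt_add)
  fix n x assume x: "x \<in> D r'"
  have "laplacian (W n) x = inverse (s n) * (laplacian (%x. w (flow b (s n) x)) x - laplacian w x)"
   unfolding W_def using laplacian_cmult[OF sd x, of "inverse (s n)" n] laplacian_diff[OF swf sw' x, of n] by simp
  also have "laplacian (%x. w (flow b (s n) x)) x = laplacian w (flow b (s n) x) + (\<Sum>k\<in>Basis. s n * R k n x)"
   unfolding laplacian_pd sum.distrib[symmetric]
  proof (rule sum.cong[OF refl])
   fix k :: 'a
   show "pd k (pd k (%x. w (flow b (s n) x))) x = pd k (pd k w) (flow b (s n) x) + s n * R k n x"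
   proof -
    have "s n * R k n x = (s n * q k n x) * (pd e (pd k w) (flow b (s n) x) + pd k (pd e w) (flow b (s n) x)
     + (pd k \<psi> x - pd k \<psi> (x + s n *\<^sub>R b)) * pd e (pd e w) (flow b (s n) x)) + (s n * q2 k n x) * pd e w (flow b (s n) x)"
     unfolding R_def by (simp only: distrib_left mult.assoc)
    moreover have "s n * q k n x = pd k \<psi> x - pd k \<psi> (x + s n *\<^sub>R b)"
     "s n * q2 k n x = pd k (pd k \<psi>) x - pd k (pd k \<psi>) (x + s n *\<^sub>R b)"
     using s(1)[of n] by (simp_all add: q_def q2_def)
    ultimately show ?thesis using flow_pd_pd[OF w(1) dom2 x, of k n] by simp
   qed
  qed
  finally show "inverse (s n) * (laplacian w (flow b (s n) x) - laplacian w x) + (\<Sum>k\<in>Basis. R k n x) = laplacian (W n) x"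
   using s(1)[of n] by (simp add: sum_distrib_left[symmetric] algebra_simps)
 qed
 \<comment> \<open>This bound degenerates as the step tends to zero. That is harmless:
   \<open>barrier\<close> uses only the continuity of each member, and its constant comes from the
   uniform bounds \<open>Wb\<close>, \<open>Wpd\<close> and \<open>Wl\<close>.\<close>
 have cW: "continuous_on (ball x0 r') (%x. if \<psi> x > 0 then W n x else 0)" for n
 proof -
  obtain C where C: "\<forall>n::nat. \<forall>x\<in>D ((r' + r) / 2). \<bar>w x\<bar> <= C * \<psi> x powr (1/2)" using Wt_ex[OF w(2) mid] by blast
  show ?thesis
  proof (rule ext_continuous[OF sW, where C = "2 * C * inverse (s n)"])
   fix x assume x: "x \<in> D r'"
   have "x \<in> D ((r' + r) / 2)" using x D_mono[of r' "(r' + r) / 2"] r' by auto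
   then have "\<bar>w x\<bar> <= C * \<psi> x powr (1/2)" "\<bar>w (flow b (s n) x)\<bar> <= C * \<psi> x powr (1/2)"
    using C dom1[OF x, of n] \<psi>_flow[of b "s n" x] by metis+
   then have "\<bar>w (flow b (s n) x) - w x\<bar> <= 2 * C * \<psi> x powr (1/2)" by linarith
   then have "inverse (s n) * \<bar>w (flow b (s n) x) - w x\<bar> <= inverse (s n) * (2 * C * \<psi> x powr (1/2))"
    using s(1)[of n] by (intro mult_left_mono) auto
   then show "\<bar>W n x\<bar> <= 2 * C * inverse (s n) * \<psi> x powr (1/2)"
    using s(1)[of n] by (simp only: W_def abs_mult abs_inverse abs_of_pos mult_ac)
  qed
 qed
 have "Wt r' (1/2) W" by (rule barrier[OF sW cW Wb Wpd Wl])
 then obtain C where C: "\<forall>n. \<forall>x\<in>D \<rho>. \<bar>W n x\<bar> <= C * \<psi> x powr (1/2)" using Wt_ex r'(1) by blast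
 have "\<bar>vd (T b) w x\<bar> <= C * \<psi> x powr (1/2)" if x: "x \<in> D \<rho>" for x
 proof -
  have xr: "x \<in> D r" using x D_mono[of \<rho> r] \<rho> by auto
  have "((%t. w (flow b t x)) has_real_derivative vd (T b) w (flow b 0 x)) (at 0)"
   by (rule flow_DERIV) (simp add: smooth_on_differentiable[OF w(1) xr])
  then have "((%h. (w (flow b h x) - w x) / h) \<longlongrightarrow> vd (T b) w x) (at 0)" by (simp add: DERIV_def)
  moreover have "filterlim s (at 0) sequentially"
   using slim s(1) by (auto simp: filterlim_at less_imp_neq[THEN not_sym])
  ultimately have "(%n. (w (flow b (s n) x) - w x) / s n) \<longlonglongrightarrow> vd (T b) w x" by (rule filterlim_compose)
  then have "(%n. \<bar>W n x\<bar>) \<longlonglongrightarrow> \<bar>vd (T b) w x\<bar>" unfolding W_def by (intro tendsto_rabs) (simp add: divide_inverse mult.commute)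
  then show ?thesis by (rule LIMSEQ_le_const2) (use C x in blast)
 qed
 then show "\<exists>C. \<forall>n::nat. \<forall>x\<in>D \<rho>. \<bar>vd (T b) w x\<bar> <= C * \<psi> x powr (1/2)" by blast
qed

end


subsection \<open>Bootstrapping\<close>

locale smooth_tower = tower S P X I 0
 for S :: "'a::euclidean_space set" and P and X :: "'i => 'a => 'a" and I +
 assumes P_smooth: "P a w ==> smooth_on S (w n)"
  and P_coef: "smooth_on UNIV g ==> P 0 (%n. g)"
  and X_coef: "i \<in> I ==> smooth_on UNIV g ==> smooth_on UNIV (vd (X i) g)"
begin

lemma tow_smooth: "tow k a w ==> smooth_on S (w n)"
 by (rule P_smooth[OF tow_P])

lemma stow_add: "tow k a w ==> tow k a v ==> tow k a (%n x. w n x + v n x)"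
 by (rule tow_add) (assumption | rule tow_smooth)+

lemma stow_cmult: "tow k a w ==> tow k a (%n x. q * w n x)"
 by (rule tow_cmult) (assumption | rule tow_smooth)+

lemma stow_diff: "tow k a w ==> tow k a v ==> tow k a (%n x. w n x - v n x)"
 using stow_add[OF _ stow_cmult[of k a v "-1"], of w] by simp

lemma stow_sum: "finite J ==> (!!j. j \<in> J ==> tow k a (w j)) ==> tow k a (%n x. \<Sum>j\<in>J. w j n x)"
 by (rule tow_sum) (assumption | rule tow_smooth)+

lemma stow_coef_mult:
 assumes "smooth_on UNIV g" "tow k a w" shows "tow k a (%n x. g x * w n x)"
proof -
 have "tow k 0 (%n. g)" by (rule tow_coef[OF refl P_coef X_coef assms(1)])
 from tow_mult[OF this assms(2) tow_smooth[OF this] tow_smooth[OF assms(2)]] show ?thesis by simp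
qed

end

text \<open>Four towers are set up on the same half ball. \<open>W\<close> takes all derivatives and
  pays one unit of weight for each; \<open>TW\<close> adds tangential derivatives at no cost on top
  of \<open>W\<close>; \<open>TS\<close> keeps only tangential derivatives of weighted bounds;
  \<open>ES\<close> puts normal derivatives on top of \<open>TS\<close>.\<close>

locale chart_at = chart \<psi> e x0 for \<psi> :: "'a::euclidean_space => real" and e x0 +
 fixes r :: real
begin

sublocale W: tower "D r" "Wt r" "%b x. b" "Basis :: 'a set" 1
 by (rule W_tower)

lemma smooth_T_D: "smooth_on (D r) (%x. T b x \<bullet> c)"
 by (rule smooth_on_subset[OF smooth_T open_D]) simp

lemma T_coef: "smooth_on UNIV g ==> smooth_on UNIV (vd (T b) g)"
 by (rule smooth_on_vd[OF _ smooth_T])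

lemma W_full_smooth: "W.full a w ==> smooth_on (D r) (w n)"
 unfolding W.full_def by blast

lemma W_full_Wt: "W.full a w ==> Wt r a w"
 unfolding W.full_def using W.tow_P by blast

lemma W_full_coef: "smooth_on UNIV g ==> W.full 0 (%n. g)"
 unfolding W.full_def by (blast intro: wtow_smooth smooth_on_subset open_D)

lemma W_full_weight: "W.full a w ==> a' <= a ==> W.full a' w"
 by (rule W.full_weight[rotated]) (assumption | rule Wt_mono)+

sublocale TW: smooth_tower "D r" W.full T "Basis :: 'a set"
proof (rule smooth_tower.intro)
 show "tower (D r) W.full T Basis" by (rule W.full_tower) (rule smooth_T_D)
 show "smooth_tower_axioms (D r) W.full T Basis"
  by standard (auto intro: W_full_smooth W_full_coef T_coef)
qed

sublocale TS: tower "D r" "Wt r" T "Basis :: 'a set" 0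
proof
 show "Wt r a v" if "Wt r a w" "!!n x. x \<in> D r ==> w n x = v n x" for a w v by (rule Wt_cong[OF that])
qed (rule open_D smooth_T_D Wt_add Wt_mult Wt_const Wt_zero; assumption)+

lemma TS_coef: "smooth_on UNIV g ==> TS.tow k 0 (%n. g)"
 by (rule TS.tow_coef[OF refl _ T_coef]) (rule Wt_smooth[OF smooth_on_continuous])

lemma TS_full_smooth: "TS.full a w ==> smooth_on (D r) (w n)"
 unfolding TS.full_def by blast

lemma TS_full_coef: "smooth_on UNIV g ==> TS.full 0 (%n. g)"
 unfolding TS.full_def by (blast intro: TS_coef smooth_on_subset open_D)

sublocale ES: smooth_tower "D r" TS.full "%_ x. e" "UNIV :: unit set"
proof (rule smooth_tower.intro)
 show "tower (D r) TS.full (%_ x. e) (UNIV :: unit set)" by (rule TS.full_tower) (rule smooth_on_const[OF open_D])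
 show "smooth_tower_axioms (D r) TS.full (%_ x. e) (UNIV :: unit set)"
  by standard (auto intro: TS_full_smooth TS_full_coef smooth_on_pd)
qed

lemma TS_weight: "TS.tow k a w ==> a' <= a ==> TS.tow k a' w"
 by (rule TS.tow_weight[rotated]) (assumption | rule Wt_mono)+

lemma TW_weight: "TW.tow k a w ==> a' <= a ==> TW.tow k a' w"
 by (rule TW.tow_weight[rotated]) (assumption | rule W_full_weight)+

lemma TW_TS: "TW.tow k a w ==> TS.tow k a w"
 by (induction k arbitrary: w) (simp_all add: W_full_Wt)

lemma smooth_pd_\<psi>: "smooth_on UNIV (pd b \<psi>)"
 by (rule smooth_on_pd[OF smooth_\<psi>])

lemma vd_T_D: "smooth_on (D r) f ==> x \<in> D r ==> vd (T b) f x = pd b f x - pd b \<psi> x * pd e f x"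
 by (rule vd_T[OF smooth_on_differentiable])

lemma W_full_pd:
 assumes "W.full a w" shows "W.full (a - 1) (%n. pd v (w n))"
proof -
 have "W.full (a - 1) (%n. pd b (w n))" if "b \<in> Basis" for b using W.full_vd[OF assms that] by simp
 then have "TW.tow 0 (a - 1) (%n x. \<Sum>b\<in>Basis. (v \<bullet> b) * pd b (w n) x)"
  by (intro TW.stow_sum TW.stow_cmult) auto
 then have "W.full (a - 1) (%n x. \<Sum>b\<in>Basis. (v \<bullet> b) * pd b (w n) x)" by simp
 then show ?thesis
  by (rule W.full_cong) (rule pd_lincomb[OF smooth_on_differentiable[OF W_full_smooth[OF assms]], symmetric])
qed

text \<open>The commutator of \<open>T b\<close> with a constant direction is a smooth multiple of
  the normal derivative. It vanishes for the direction \<open>e\<close>, along which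
  \<open>pd b \<psi>\<close> is constant.\<close>

lemma vd_T_pd:
 assumes w: "smooth_on (D r) w" and x: "x \<in> D r"
 shows "vd (T b) (pd v w) x = pd v (vd (T b) w) x + pd v (pd b \<psi>) x * pd e w x"
proof -
 have d: "pd b w differentiable at x" "pd e w differentiable at x" "pd b \<psi> differentiable at x"
  using smooth_on_differentiable[OF smooth_on_pd[OF w] x] smooth_on_differentiable[OF smooth_pd_\<psi>] by auto
 have "pd v (vd (T b) w) x = pd v (%x. pd b w x - pd b \<psi> x * pd e w x) x"
  by (rule pd_cong_open[OF open_D x]) (rule vd_T_D[OF w])
 also have "... = pd v (pd b w) x - pd v (%x. pd b \<psi> x * pd e w x) x"
  by (rule pd_diff[OF d(1) differentiable_mult[OF d(3,2)]])
 also have "... = pd v (pd b w) x - (pd v (pd b \<psi>) x * pd e w x + pd b \<psi> x * pd v (pd e w) x)"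
  by (simp add: pd_mult[OF d(3,2)])
 finally show ?thesis
  using vd_T_D[OF smooth_on_pd[OF w, of v] x, of b] pd_commute[OF w x, of b v] pd_commute[OF w x, of e v] by simp
qed

lemma vd_T_pd_e: "smooth_on (D r) w ==> x \<in> D r ==> vd (T b) (pd e w) x = pd e (vd (T b) w) x"
 using vd_T_pd[of w x b e] by (simp add: pd_e_pd_\<psi>)

lemma TW_pd: "TW.tow j a w ==> TW.tow j (a - 1) (%n. pd v (w n))"
proof (induction j arbitrary: w v)
 case 0 then show ?case by (simp add: W_full_pd)
next
 case (Suc j)
 have "TW.tow j (a - 1) (%n. vd (T b) (pd v (w n)))" if b: "b \<in> Basis" for b
 proof (rule TW.tow_cong)
  have "TW.tow j a (%n. vd (T b) (w n))" using Suc.prems b by simp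
  then show "TW.tow j (a - 1) (%n x. pd v (vd (T b) (w n)) x + pd v (pd b \<psi>) x * pd e (w n) x)"
   by (intro TW.stow_add TW.stow_coef_mult Suc.IH TW.tow_Suc[OF Suc.prems] smooth_on_pd smooth_pd_\<psi>)
  show "pd v (vd (T b) (w n)) x + pd v (pd b \<psi>) x * pd e (w n) x = vd (T b) (pd v (w n)) x" if "x \<in> D r" for n x
   by (rule vd_T_pd[OF TW.tow_smooth[OF Suc.prems] that, symmetric])
 qed
 moreover have "W.full (a - 1) (%n. pd v (w n))" by (rule W_full_pd[OF TW.tow_P[OF Suc.prems]])
 ultimately show ?case by simp
qed

text \<open>\<open>T b\<close> is a combination of ordinary derivatives, each of which costs one
  unit of weight in \<open>W\<close>. So one unit of weight can be exchanged for one tangential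
  derivative.\<close>

lemma TW_gain:
 assumes "TW.tow j a w" shows "TW.tow (Suc j) (a - 1) w"
proof -
 have "TW.tow j (a - 1) (%n. vd (T b) (w n))" for b
 proof (rule TW.tow_cong)
  show "TW.tow j (a - 1) (%n x. pd b (w n) x - pd b \<psi> x * pd e (w n) x)"
   by (intro TW.stow_diff TW.stow_coef_mult TW_pd assms smooth_pd_\<psi>)
  show "pd b (w n) x - pd b \<psi> x * pd e (w n) x = vd (T b) (w n) x" if "x \<in> D r" for n x
   by (rule vd_T_D[OF TW.tow_smooth[OF assms] that, symmetric])
 qed
 moreover have "W.full (a - 1) w" by (rule W_full_weight[OF TW.tow_P[OF assms]]) simp
 ultimately show ?thesis by simp
qed

lemma laplacian_vd_T:
 assumes w: "smooth_on (D r) w" and x: "x \<in> D r"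
 shows "laplacian (vd (T b) w) x = vd (T b) (laplacian w) x
  - (2 * (\<Sum>k\<in>Basis. pd k (pd b \<psi>) x * pd k (pd e w) x) + laplacian (pd b \<psi>) x * pd e w x)"
proof -
 have s: "smooth_on (D r) (pd b \<psi>)" by (rule smooth_on_subset[OF smooth_pd_\<psi> open_D]) simp
 have se: "smooth_on (D r) (pd e w)" by (rule smooth_on_pd[OF w])
 have "laplacian (vd (T b) w) x = laplacian (%x. pd b w x - pd b \<psi> x * pd e w x) x"
  by (rule laplacian_cong_open[OF open_D x]) (rule vd_T_D[OF w])
 also have "... = laplacian (pd b w) x - laplacian (%x. pd b \<psi> x * pd e w x) x"
  by (rule laplacian_diff[OF smooth_on_pd[OF w] smooth_on_mult[OF s se] x])
 finally show ?thesis
  using laplacian_mult[OF s se x] laplacian_pd_commute[OF w x] vd_T_D[OF smooth_on_laplacian[OF w] x, of b]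
  by (simp add: algebra_simps)
qed

lemma W_full_regularity:
 assumes w: "smooth_on (D r) w" "Wt r a (%n. w)" and l: "!!k. W.tow k (a - 2) (%n. laplacian w)"
 shows "W.full a (%n. w)"
 unfolding W.full_def using w(1) W.tow_Suc[OF weighted_regularity[OF w l]] by blast

text \<open>The induction hypothesis is applied to the tangential derivative of \<open>w\<close>.
  Its Laplacian is the tangential derivative of \<open>laplacian w\<close> plus commutator terms of
  second order in \<open>w\<close>, and these have weight -3/2 when \<open>w\<close> has weight
  1/2.\<close>

lemma tangential_regularity:
 "W.full (1/2) (%n. w) ==> TW.tow j (-3/2) (%n. laplacian w) ==> TW.tow j (1/2) (%n. w)"
proof (induction j arbitrary: w)
 case 0 then show ?case by simp
next
 case (Suc j)
 have s: "smooth_on (D r) w" by (rule W_full_smooth[OF Suc.prems(1)])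
 have IHw: "TW.tow j (1/2) (%n. w)" by (rule Suc.IH[OF Suc.prems(1) TW.tow_Suc[OF Suc.prems(2)]])
 have p1: "TW.tow j (-1/2) (%n. pd v w)" for v using TW_pd[OF IHw, of v] by simp
 have p2: "TW.tow j (-3/2) (%n. pd u (pd v w))" for u v using TW_pd[OF p1[of v], of u] by simp
 have "TW.tow j (1/2) (%n. vd (T b) w)" if b: "b \<in> Basis" for b
 proof (rule Suc.IH)
  have h: "TW.tow j (-3/2) (%n. vd (T b) (laplacian w))" using Suc.prems(2) b by simp
  show lap: "TW.tow j (-3/2) (%n. laplacian (vd (T b) w))"
  proof (rule TW.tow_cong)
   have "TW.tow j (-3/2) (%n. pd e w)" by (rule TW_weight[OF p1]) simp
   then show "TW.tow j (-3/2) (%n x. vd (T b) (laplacian w) x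
     - (2 * (\<Sum>k\<in>Basis. pd k (pd b \<psi>) x * pd k (pd e w) x) + laplacian (pd b \<psi>) x * pd e w x))"
    by (intro TW.stow_diff TW.stow_add TW.stow_cmult TW.stow_sum TW.stow_coef_mult h p2 finite_Basis
      smooth_on_pd smooth_pd_\<psi> smooth_on_laplacian)
   show "vd (T b) (laplacian w) x - (2 * (\<Sum>k\<in>Basis. pd k (pd b \<psi>) x * pd k (pd e w) x) + laplacian (pd b \<psi>) x * pd e w x)
     = laplacian (vd (T b) w) x" if "x \<in> D r" for n :: nat and x
    by (rule laplacian_vd_T[OF s that, symmetric])
  qed
  show "W.full (1/2) (%n. vd (T b) w)"
  proof (rule W_full_regularity)
   show "smooth_on (D r) (vd (T b) w)" by (rule smooth_on_vd[OF s smooth_T_D])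
   show "Wt r (1/2) (%n. vd (T b) w)"
    by (rule tangential_step[OF s _ b])
     (use W_full_Wt[OF Suc.prems(1)] W_full_Wt[OF TW.tow_P[OF p1]] W_full_Wt[OF TW.tow_P[OF p2]] W_full_Wt[OF TW.tow_P[OF h]] in auto)
   show "W.tow k (1/2 - 2) (%n. laplacian (vd (T b) w))" for k
    using TW.tow_P[OF lap] unfolding W.full_def by simp
  qed
 qed
 then show ?case using Suc.prems(1) by simp
qed

text \<open>The integration in the normal direction turns the weight \<open>-1/2\<close> of the normal derivative into a bound.\<close>

lemma Wt_integrate:
 assumes g: "smooth_on (D r) g" "Wt r a (%n. g)" "Wt r (-1/2) (%n. pd e g)"
 shows "Wt r 0 (%n. g)"
proof (rule Wt_0I)
 fix \<rho> assume \<rho>: "\<rho> < r"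
 define \<tau> where "\<tau> = (r - \<rho>) / 2"
 define \<rho>' where "\<rho>' = \<rho> + \<tau>"
 have \<tau>: "\<tau> > 0" "\<rho>' < r" using \<rho> by (auto simp: \<tau>_def \<rho>'_def field_simps)
 have in': "x + t *\<^sub>R e \<in> D \<rho>'" if "x \<in> D \<rho>" "0 <= t" "t <= \<tau>" for x t
  using dist_triangle[of x0 "x + t *\<^sub>R e" x] that by (simp add: D_def dist_norm \<psi>_shift \<rho>'_def norm_e)
 obtain C1 where C1: "C1 >= 0" "!!x. x \<in> D \<rho>' ==> \<bar>g x\<bar> <= C1 * \<psi> x powr a" using Wt_ex[OF g(2) \<tau>(2)] by blast
 obtain C2 where C2: "C2 >= 0" "!!x. x \<in> D \<rho>' ==> \<bar>pd e g x\<bar> <= C2 * \<psi> x powr (-1/2)" using Wt_ex[OF g(3) \<tau>(2)] by blast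
 obtain B where B: "B >= 1" "!!x. x \<in> D \<rho>' ==> \<psi> x <= B" using \<psi>_bounded by blast
 define C where "C = C1 * (B powr \<bar>a\<bar> + \<tau> powr (-\<bar>a\<bar>)) + 2 * C2 * sqrt B"
 have "\<bar>g x\<bar> <= C" if x: "x \<in> D \<rho>" for x
 proof -
  let ?y = "x + \<tau> *\<^sub>R e"
  have y: "?y \<in> D \<rho>'" using in'[OF x, of \<tau>] \<tau> by simp
  have px: "\<psi> x > 0" by (rule D_pos[OF x])
  have py: "\<tau> <= \<psi> ?y" "\<psi> ?y <= B" using px B(2)[OF y] by (auto simp: \<psi>_shift)
  have "\<psi> ?y powr a <= B powr \<bar>a\<bar> + \<tau> powr (-\<bar>a\<bar>)"
  proof (cases "a >= 0")
   case True
   have "\<psi> ?y powr a <= B powr a" using py \<tau> True by (intro powr_mono2) auto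
   then show ?thesis using True powr_ge_zero[of \<tau> "-a"] by (simp add: add_increasing2)
  next
   case False
   have "\<psi> ?y powr a <= \<tau> powr a" using py \<tau> False by (intro powr_mono2') auto
   then show ?thesis using False powr_ge_zero[of B "-a"] by (simp add: add_increasing)
  qed
  then have gy: "\<bar>g ?y\<bar> <= C1 * (B powr \<bar>a\<bar> + \<tau> powr (-\<bar>a\<bar>))" using C1(2)[OF y] mult_left_mono[OF _ C1(1)] by (meson order_trans)
  \<comment> \<open>For both signs this function of \<open>t\<close> is nonincreasing, because the
    singular bound on the normal derivative is the derivative of a multiple of the square root. The
    two signs bound the increment of \<open>g\<close> from both sides.\<close>
  have d: "((%t. \<sigma> * g (x + t *\<^sub>R e) - 2 * C2 * sqrt (\<psi> x + t)) has_real_derivative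
    \<sigma> * pd e g (x + t *\<^sub>R e) - C2 / sqrt (\<psi> x + t)) (at t)" if t: "0 <= t" "t <= \<tau>" for t \<sigma>
  proof -
   have 1: "((%t. g (x + t *\<^sub>R e)) has_real_derivative pd e g (x + t *\<^sub>R e)) (at t)"
    by (rule pd_line_DERIV, rule smooth_on_differentiable[OF g(1)]) (use in'[OF x t] D_mono[of \<rho>' r] \<tau> in auto)
   have 2: "((%t. sqrt (\<psi> x + t)) has_real_derivative inverse (sqrt (\<psi> x + t)) / 2) (at t)"
    using px t by (auto intro!: derivative_eq_intros)
   show ?thesis
    by (rule DERIV_cong[OF DERIV_diff[OF DERIV_cmult[OF 1, of \<sigma>] DERIV_cmult[OF 2, of "2 * C2"]]]) (simp add: inverse_eq_divide)
  qed
  have "\<sigma> * g ?y - 2 * C2 * sqrt (\<psi> x + \<tau>) <= \<sigma> * g (x + 0 *\<^sub>R e) - 2 * C2 * sqrt (\<psi> x + 0)" if \<sigma>: "\<bar>\<sigma>\<bar> = 1" for \<sigma>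
  proof (rule DERIV_nonpos_imp_nonincreasing[of 0 \<tau>])
   show "\<exists>y. ((%t. \<sigma> * g (x + t *\<^sub>R e) - 2 * C2 * sqrt (\<psi> x + t)) has_real_derivative y) (at t) & y <= 0"
    if t: "0 <= t" "t <= \<tau>" for t
   proof (intro exI conjI, rule d[OF t])
    have "\<bar>\<sigma> * pd e g (x + t *\<^sub>R e)\<bar> <= C2 * (\<psi> x + t) powr (-1/2)"
     using C2(2)[OF in'[OF x t]] \<sigma> by (simp add: abs_mult \<psi>_shift)
    also have "(\<psi> x + t) powr (-1/2) = 1 / sqrt (\<psi> x + t)"
     using px t by (simp add: powr_minus_divide powr_half_sqrt)
    finally show "\<sigma> * pd e g (x + t *\<^sub>R e) - C2 / sqrt (\<psi> x + t) <= 0" by simp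
   qed
  qed (use \<tau> in simp)
  from this[of 1] this[of "-1"] have "\<bar>g ?y - g x\<bar> <= 2 * C2 * (sqrt (\<psi> ?y) - sqrt (\<psi> x))" by (simp add: \<psi>_shift algebra_simps)
  also have "... <= 2 * C2 * sqrt B"
   using C2(1) px real_sqrt_le_mono[OF py(2)] by (intro mult_left_mono) (auto intro: order_trans[of _ "sqrt (\<psi> ?y)"])
  finally show ?thesis using gy unfolding C_def by linarith
 qed
 then show "\<exists>C. \<forall>n::nat. \<forall>x\<in>D \<rho>. \<bar>g x\<bar> <= C" by blast
qed

lemma TS_integrate:
 "smooth_on (D r) g ==> TS.tow j a (%n. g) ==> TS.tow j (-1/2) (%n. pd e g) ==> TS.tow j 0 (%n. g)"
proof (induction j arbitrary: g)
 case 0 then show ?case by (simp add: Wt_integrate)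
next
 case (Suc j)
 have "TS.tow j 0 (%n. vd (T b) g)" if b: "b \<in> Basis" for b
 proof (rule Suc.IH)
  show "smooth_on (D r) (vd (T b) g)" by (rule smooth_on_vd[OF Suc.prems(1) smooth_T_D])
  show "TS.tow j a (%n. vd (T b) g)" using Suc.prems(2) b by simp
  have "TS.tow j (-1/2) (%n. vd (T b) (pd e g))" using Suc.prems(3) b by simp
  then show "TS.tow j (-1/2) (%n. pd e (vd (T b) g))" by (rule TS.tow_cong) (rule vd_T_pd_e[OF Suc.prems(1)])
 qed
 moreover have "Wt r 0 (%n. g)"
  by (rule Wt_integrate[OF Suc.prems(1) TS.tow_P[OF Suc.prems(2)] TS.tow_P[OF Suc.prems(3)]])
 ultimately show ?case by simp
qed

definition \<kappa> where "\<kappa> x = 1 / (\<Sum>b\<in>Basis. (pd b \<psi> x)\<^sup>2)"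

lemma smooth_\<kappa>: "smooth_on UNIV \<kappa>"
proof -
 have "smooth_on UNIV (%x. \<Sum>b\<in>Basis. (pd b \<psi> x)\<^sup>2)"
  by (intro smooth_on_sum finite_Basis open_UNIV smooth_on_power smooth_pd_\<psi>)
 then have "smooth_on UNIV (%x. (\<Sum>b\<in>Basis. (pd b \<psi> x)\<^sup>2) powr (-1))"
  by (rule smooth_on_real_comp[OF smooth_on_powr]) (use gradient_\<psi> in \<open>auto intro: less_le_trans[OF zero_less_one]\<close>)
 then show ?thesis
  by (rule smooth_on_cong) (use gradient_\<psi> in \<open>simp add: \<kappa>_def powr_minus_divide order.trans[OF zero_le_one]\<close>)
qed

lemma pd_decompose: "smooth_on (D r) w ==> x \<in> D r ==> pd b w x = vd (T b) w x + pd b \<psi> x * pd e w x"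
 using vd_T_D by simp

text \<open>Each partial derivative splits into \<open>T b\<close> and a multiple of
  \<open>pd e\<close>. In the Laplacian the second normal derivative then has the squared gradient
  of \<open>\<psi>\<close> as coefficient, which is at least 1, so the equation can be solved for
  it.\<close>

lemma pd_e_pd_e:
 assumes w: "smooth_on (D r) w" and x: "x \<in> D r"
 shows "pd e (pd e w) x = \<kappa> x * (laplacian w x - (\<Sum>b\<in>Basis. vd (T b) (vd (T b) w) x
  + vd (T b) (pd b \<psi>) x * pd e w x + 2 * (pd b \<psi> x * vd (T b) (pd e w) x)))"
proof -
 have s: "smooth_on (D r) (pd b \<psi>)" for b by (rule smooth_on_subset[OF smooth_pd_\<psi> open_D]) simp
 have sT: "smooth_on (D r) (vd (T b) w)" for b by (rule smooth_on_vd[OF w smooth_T_D])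
 have se: "smooth_on (D r) (pd e w)" by (rule smooth_on_pd[OF w])
 have "pd b (pd b w) x = vd (T b) (vd (T b) w) x + vd (T b) (pd b \<psi>) x * pd e w x + 2 * (pd b \<psi> x * vd (T b) (pd e w) x)
   + (pd b \<psi> x)\<^sup>2 * pd e (pd e w) x" for b
 proof -
  have pf: "pd v (pd b w) x = pd v (vd (T b) w) x + (pd v (pd b \<psi>) x * pd e w x + pd b \<psi> x * pd v (pd e w) x)" for v
  proof -
   have "pd v (pd b w) x = pd v (%x. vd (T b) w x + pd b \<psi> x * pd e w x) x"
    by (rule pd_cong_open[OF open_D x]) (rule pd_decompose[OF w])
   also have "... = pd v (vd (T b) w) x + pd v (%x. pd b \<psi> x * pd e w x) x"
    by (rule pd_add[OF smooth_on_differentiable[OF sT x] smooth_on_differentiable[OF smooth_on_mult[OF s se] x]])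
   finally show ?thesis using pd_mult[OF smooth_on_differentiable[OF s x] smooth_on_differentiable[OF se x], of v b] by simp
  qed
  have "vd (T b) (pd b w) x = vd (T b) (vd (T b) w) x + (vd (T b) (pd b \<psi>) x * pd e w x + pd b \<psi> x * vd (T b) (pd e w) x)"
   unfolding vd_def[of "T b" "pd b w"] pf by (simp add: vd_def)
  moreover have "pd e (pd b w) x = vd (T b) (pd e w) x + pd b \<psi> x * pd e (pd e w) x"
   unfolding pf vd_T_pd_e[OF w x] by (simp add: pd_e_pd_\<psi>)
  ultimately show ?thesis using pd_decompose[OF smooth_on_pd[OF w, of b] x, of b] by (simp add: power2_eq_square algebra_simps)
 qed
 then have "laplacian w x = (\<Sum>b\<in>Basis. vd (T b) (vd (T b) w) x + vd (T b) (pd b \<psi>) x * pd e w x + 2 * (pd b \<psi> x * vd (T b) (pd e w) x)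
   + (pd b \<psi> x)\<^sup>2 * pd e (pd e w) x)"
  unfolding laplacian_pd by (intro sum.cong refl)
 then have "laplacian w x = (\<Sum>b\<in>Basis. vd (T b) (vd (T b) w) x + vd (T b) (pd b \<psi>) x * pd e w x + 2 * (pd b \<psi> x * vd (T b) (pd e w) x))
   + (\<Sum>b\<in>Basis. (pd b \<psi> x)\<^sup>2) * pd e (pd e w) x"
  by (simp add: sum.distrib sum_distrib_right)
 moreover have "(\<Sum>b\<in>Basis. (pd b \<psi> x)\<^sup>2) \<noteq> 0" using gradient_\<psi>[of x] by linarith
 ultimately show ?thesis by (simp add: \<kappa>_def)
qed

lemma TS_full_vd: "TS.full a w ==> b \<in> Basis ==> TS.full a (%n. vd (T b) (w n))"
 using TS.full_vd[of a w b] by simp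

lemma ES_vd: "ES.tow k a w ==> b \<in> Basis ==> ES.tow k a (%n. vd (T b) (w n))"
proof (induction k arbitrary: w)
 case 0 then show ?case by (simp add: TS_full_vd)
next
 case (Suc k)
 have "ES.tow k a (%n. vd (T b) (pd e (w n)))" using Suc by simp
 then have "ES.tow k a (%n. pd e (vd (T b) (w n)))"
  by (rule ES.tow_cong) (rule vd_T_pd_e[OF ES.tow_smooth[OF Suc.prems(1)]])
 then show ?case using TS_full_vd[OF ES.tow_P[OF Suc.prems(1)] Suc.prems(2)] by simp
qed

lemma ES_second:
 assumes w: "ES.tow k a (%n. w)" "ES.tow k a (%n. pd e w)" "ES.tow k a (%n. laplacian w)"
 shows "ES.tow k a (%n. pd e (pd e w))"
proof (rule ES.tow_cong)
 show "ES.tow k a (%n x. \<kappa> x * (laplacian w x - (\<Sum>b\<in>Basis. vd (T b) (vd (T b) w) x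
  + vd (T b) (pd b \<psi>) x * pd e w x + 2 * (pd b \<psi> x * vd (T b) (pd e w) x))))"
  by (intro ES.stow_coef_mult ES.stow_diff ES.stow_add ES.stow_sum ES.stow_cmult ES_vd w finite_Basis smooth_\<kappa> T_coef smooth_pd_\<psi>)
qed (rule pd_e_pd_e[OF ES.tow_smooth[OF w(1)], symmetric])

lemma ES_pd:
 assumes "ES.full a w" "b \<in> Basis" shows "ES.full a (%n. pd b (w n))"
proof -
 have k: "ES.tow k a w" for k using assms(1) unfolding ES.full_def by blast
 have "ES.tow k a (%n. pd e (w n))" for k using k[of "Suc k"] by simp
 then have "ES.tow k a (%n x. vd (T b) (w n) x + pd b \<psi> x * pd e (w n) x)" for k
  by (intro ES.stow_add ES.stow_coef_mult ES_vd k assms(2) smooth_pd_\<psi>)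
 then have "ES.tow k a (%n. pd b (w n))" for k
  by (rule ES.tow_cong) (rule pd_decompose[OF ES.tow_smooth[OF k[of 0]], symmetric])
 then show ?thesis unfolding ES.full_def using ES.tow_smooth by blast
qed

end


section \<open>Regularity of the solution in a chart and extension to the closure\<close>

context chart_at
begin

lemma half_weight:
 assumes f: "smooth_on (D r) f" "continuous_on (ball x0 r) (%x. if \<psi> x > 0 then f x else 0)"
  and b: "Wt r 0 (%n. f)" "Wt r 0 (%n. laplacian f)"
 shows "Wt r (1/2) (%n. f)"
proof (rule barrier[OF f])
 show "Wt r (-1/2) (%n. f)" "Wt r (-3/2) (%n. laplacian f)" by (rule Wt_mono[OF b(1)], simp, rule Wt_mono[OF b(2)], simp)
 have l: "Wt r (0 - 2) (%n. laplacian f)" by (rule Wt_mono[OF b(2)]) simp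
 show "Wt r (-3/2) (%n. pd k f)" if k: "k \<in> Basis" for k
  by (rule Wt_mono[OF weighted_gradient[OF f(1) b(1) l k]]) simp
qed

text \<open>The two equations feed each other: the right side for one function is as regular as the
  other function, and the regularity result of the current tower gains one order. Each tower starts
  from what the previous one has established in all orders.\<close>

lemma chart_regularity:
 assumes s: "smooth_on (D r) v" "smooth_on (D r) z"
  and c: "continuous_on (ball x0 r) (%x. if \<psi> x > 0 then v x else 0)"
   "continuous_on (ball x0 r) (%x. if \<psi> x > 0 then z x else 0)"
  and l: "!!x. x \<in> D r ==> laplacian v x = - z x" "!!x. x \<in> D r ==> laplacian z x = - (lam * nonlinearity p (v x))"
  and bd: "\<delta> > 0" "!!x. x \<in> D r ==> 0 <= v x & v x <= 1 - \<delta>" "!!x. x \<in> D r ==> \<bar>z x\<bar> <= M"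
 shows "ES.full 0 (%n. v)"
proof -
 have v1: "v x < 1" if "x \<in> D r" for x using bd(1) bd(2)[OF that] by linarith
 have l': "- 1 * z x = laplacian v x" "- lam * (1 - v x) powr (- p) = laplacian z x" if "x \<in> D r" for x
  using l[OF that] by (simp_all add: nonlinearity_powr)
 have sq: "smooth_on (D r) (%x. (1 - v x) powr q)" for q
  by (rule smooth_on_real_comp[OF smooth_on_powr smooth_on_diff[OF smooth_on_const[OF open_D] s(1)]]) (use v1 in auto)
 have pw: "Wt r 0 (%n x. (1 - v x) powr q)" for q
 proof (rule Wt_0I)
  fix \<rho> assume "\<rho> < r"
  have "\<bar>(1 - v x) powr q\<bar> <= 1 + \<delta> powr q" if "x \<in> D \<rho>" for x
  proof -
   have *: "\<delta> <= 1 - v x" "1 - v x <= 1" using bd(2)[of x] that D_mono[of \<rho> r] \<open>\<rho> < r\<close> by auto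
   show ?thesis
   proof (cases "q >= 0")
    case True
    then show ?thesis using * bd(1) powr_le1[of q "1 - v x"] by (simp add: add_increasing2)
   next
    case False
    then show ?thesis using * bd(1) powr_mono2'[of q \<delta> "1 - v x"] by simp
   qed
  qed
  then show "\<exists>C. \<forall>n::nat. \<forall>x\<in>D \<rho>. \<bar>(1 - v x) powr q\<bar> <= C" by blast
 qed
 have b0: "Wt r 0 (%n. v)" "Wt r 0 (%n. z)"
 proof -
  have "\<bar>v x\<bar> <= 1 & \<bar>z x\<bar> <= M" if "\<rho> < r" "x \<in> D \<rho>" for x \<rho>
   using bd(2,3)[of x] bd(1) D_mono[of \<rho> r] that by auto
  then show "Wt r 0 (%n. v)" "Wt r 0 (%n. z)" by (blast intro: Wt_0I)+
 qed
 have "Wt r 0 (%n. laplacian v)" by (rule Wt_cong[OF Wt_cmult[OF b0(2)] l'(1)])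
 from half_weight[OF s(1) c(1) b0(1) this] have hv: "Wt r (1/2) (%n. v)" .
 have "Wt r 0 (%n. laplacian z)" by (rule Wt_cong[OF Wt_cmult[OF pw] l'(2)])
 from half_weight[OF s(2) c(2) b0(2) this] have hz: "Wt r (1/2) (%n. z)" .
 have "W.tow k (1/2) (%n. v) & W.tow k (1/2) (%n. z)" for k
 proof (induction k)
  case 0 then show ?case using hv hz by simp
 next
  case (Suc k)
  have "W.tow k (1/2 - 2) (%n. laplacian v)"
   by (rule wtow_weight[OF W.tow_cong[OF W.tow_cmult[OF conjunct2[OF Suc] s(2)] l'(1)]]) simp_all
  then have 1: "W.tow (Suc k) (1/2) (%n. v)" by (rule weighted_regularity[OF s(1) hv])
  have "W.tow k 0 (%n. v)" by (rule wtow_weight[OF conjunct1[OF Suc]]) simp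
  then have pk: "W.tow k 0 (%n x. (1 - v x) powr q)" for q by (rule W.tow_powr) (use s(1) v1 pw in auto)
  have "W.tow k (1/2 - 2) (%n. laplacian z)"
   by (rule wtow_weight[OF W.tow_cong[OF W.tow_cmult[OF pk sq] l'(2)]]) simp_all
  then have "W.tow (Suc k) (1/2) (%n. z)" by (rule weighted_regularity[OF s(2) hz])
  with 1 show ?case by blast
 qed
 then have Wf: "W.full (1/2) (%n. v)" "W.full (1/2) (%n. z)" unfolding W.full_def using s by blast+
 have pW: "W.full 0 (%n x. (1 - v x) powr q)" for q
 proof -
  have "W.tow k 0 (%n. v)" for k
   using W_full_weight[OF Wf(1), of 0] unfolding W.full_def by simp
  then have "W.tow k 0 (%n x. (1 - v x) powr q)" for k by (rule W.tow_powr) (use s(1) v1 pw in auto)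
  then show ?thesis unfolding W.full_def using sq by blast
 qed
 \<comment> \<open>The right side \<open>- z\<close> of the first equation gets its next tangential
   derivative from \<open>TW_gain\<close>: this lowers the weight 1/2 to -1/2, still above the -3/2
   that \<open>tangential_regularity\<close> asks for.\<close>
 have TWj: "TW.tow j (1/2) (%n. v) & TW.tow j (1/2) (%n. z)" for j
 proof (induction j)
  case 0 then show ?case using Wf by simp
 next
  case (Suc j)
  have "TW.tow (Suc j) (-3/2) (%n. laplacian v)"
   by (rule TW_weight[OF TW.tow_cong[OF TW.stow_cmult[OF TW_gain[OF conjunct2[OF Suc]]] l'(1)]]) simp_all
  then have 1: "TW.tow (Suc j) (1/2) (%n. v)" by (rule tangential_regularity[OF Wf(1)])
  have "TW.tow (Suc j) 0 (%n. v)" by (rule TW_weight[OF 1]) simp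
  then have pk: "TW.tow (Suc j) 0 (%n x. (1 - v x) powr q)" for q by (rule TW.tow_powr) (use s(1) v1 pW in auto)
  have "TW.tow (Suc j) (-3/2) (%n. laplacian z)"
   by (rule TW_weight[OF TW.tow_cong[OF TW.stow_cmult[OF pk] l'(2)]]) simp_all
  then have "TW.tow (Suc j) (1/2) (%n. z)" by (rule tangential_regularity[OF Wf(2)])
  with 1 show ?case by blast
 qed
 have TSf: "TS.full a (%n. f)" if "!!k. TW.tow k a' (%n. f)" "a <= a'" for a a' f
  unfolding TS.full_def using TS_weight[OF TW_TS[OF that(1)] that(2)] TW.tow_smooth[OF that(1)] by blast
 have pT: "TS.full 0 (%n x. (1 - v x) powr q)" for q
 proof -
  have "TS.tow k 0 (%n. v)" for k using TSf[of "1/2" v 0] TWj unfolding TS.full_def by simp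
  then have "TS.tow k 0 (%n x. (1 - v x) powr q)" for k by (rule TS.tow_powr) (use s(1) v1 pw in auto)
  then show ?thesis unfolding TS.full_def using sq by blast
 qed
 have neg: "TS.full a (%n. laplacian f)" if "TS.full a (%n. g)" "!!x. x \<in> D r ==> q * g x = laplacian f x" for a f g q
  using ES.tow_cong[OF ES.stow_cmult[of 0 a "%n. g"] that(2)] that(1) by simp
 have TSw: "TS.full a' f" if "TS.full a f" "a' <= a" for a a' f
  using that TS_weight unfolding TS.full_def by blast
 \<comment> \<open>The first normal derivative has weight -1/2 by \<open>TW_pd\<close>, and through
   the equation so does the second one. Since this singularity is integrable along \<open>e\<close>,
   the first one is bounded.\<close>
 have E1: "TS.full 0 (%n. pd e f)" if f: "!!k. TW.tow k (1/2) (%n. f)" "TS.full (-1/2) (%n. laplacian f)" for f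
 proof -
  have e: "TS.full (-1/2) (%n. pd e f)" by (rule TSf[OF TW_pd[OF f(1)]]) simp
  have "TS.full (-1/2) (%n. f)" by (rule TSf[OF f(1)]) simp
  then have "TS.full (-1/2) (%n. pd e (pd e f))" using ES_second[of 0 "-1/2" f] e f(2) by simp
  then have "TS.tow k 0 (%n. pd e f)" for k
   by (intro TS_integrate[OF TS_full_smooth[OF e]]) (use e in \<open>auto simp: TS.full_def\<close>)
  then show ?thesis unfolding TS.full_def using TS_full_smooth[OF e] by blast
 qed
 have z0: "TS.full 0 (%n. z)" "TS.full (-1/2) (%n. z)" "TS.full 0 (%n. v)" by (rule TSf[of "1/2"]; use TWj in simp)+
 have "ES.tow (Suc k) 0 (%n. v) & ES.tow (Suc k) 0 (%n. z)" for k
 proof (induction k)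
  case 0
  have "TS.full 0 (%n. pd e v)" by (rule E1[OF conjunct1[OF TWj] neg[OF z0(2) l'(1)]])
  moreover have "TS.full 0 (%n. pd e z)" by (rule E1[OF conjunct2[OF TWj] neg[OF TSw[OF pT] l'(2)]]) simp_all
  ultimately show ?case using z0 by simp
 next
  case (Suc k)
  note v = ES.tow_Suc[OF conjunct1[OF Suc]] and z = ES.tow_Suc[OF conjunct2[OF Suc]]
  have e: "ES.tow k 0 (%n. pd e v)" "ES.tow k 0 (%n. pd e z)" using Suc by simp_all
  have 1: "ES.tow k 0 (%n. pd e (pd e v))"
   by (rule ES_second[OF v e(1) ES.tow_cong[OF ES.stow_cmult[OF z] l'(1)]])
  have pk: "ES.tow k 0 (%n x. (1 - v x) powr q)" for q by (rule ES.tow_powr[OF v]) (use s(1) v1 pT in auto)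
  have 2: "ES.tow k 0 (%n. pd e (pd e z))"
   by (rule ES_second[OF z e(2) ES.tow_cong[OF ES.stow_cmult[OF pk] l'(2)]])
  show ?case using 1 2 Suc ES.tow_P[OF e(1)] ES.tow_P[OF e(2)] by simp
 qed
 then have "ES.tow k 0 (%n. v)" for k using ES.tow_Suc by blast
 then show ?thesis unfolding ES.full_def using s by blast
qed

text \<open>The half ball need not be convex, so a segment between two points may leave it. Nearby
  points are joined by moving up along \<open>e\<close>, straight across, and down again, a path of
  length comparable to their distance.\<close>

lemma uniformly_continuous_chart:
 assumes g: "smooth_on (D r) g" "!!b. b \<in> Basis ==> Wt r 0 (%n. pd b g)" and \<rho>: "\<rho> < r"
 shows "uniformly_continuous_on (D \<rho>) g"
proof -
 define \<rho>1 where "\<rho>1 = (\<rho> + r) / 2"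
 have \<rho>1: "\<rho> < \<rho>1" "\<rho>1 < r" using \<rho> by (auto simp: \<rho>1_def)
 have "\<exists>C. \<forall>x\<in>D \<rho>1. \<bar>pd b g x\<bar> <= C" if "b \<in> Basis" for b using Wt_0D[OF g(2)[OF that] \<rho>1(2)] by blast
 then obtain C where C: "!!b x. b \<in> Basis ==> x \<in> D \<rho>1 ==> \<bar>pd b g x\<bar> <= C b" by metis
 define K where "K = real DIM('a) * (\<Sum>b\<in>(Basis::'a set). \<bar>C b\<bar>)"
 have K0: "K >= 0" by (simp add: K_def sum_nonneg)
 have dg: "g differentiable at x" if "x \<in> D \<rho>1" for x
  using smooth_on_differentiable[OF g(1)] D_mono[of \<rho>1 r] \<rho>1 that by auto
 have K: "\<bar>pd v g x\<bar> <= K * norm v" if x: "x \<in> D \<rho>1" for x v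
  unfolding K_def
 proof (rule pd_bound_norm[OF dg[OF x]])
  fix b :: 'a assume b: "b \<in> Basis"
  show "\<bar>pd b g x\<bar> <= (\<Sum>b\<in>(Basis::'a set). \<bar>C b\<bar>)"
   using C[OF b x] member_le_sum[OF b, of "%b. \<bar>C b\<bar>"] by auto
 qed
 have seg: "\<bar>g (x + v) - g x\<bar> <= K * norm v" if "!!t. 0 <= t ==> t <= 1 ==> x + t *\<^sub>R v \<in> D \<rho>1" for x v
 proof -
  have "\<exists>t>0. t < 1 & g (x + 1 *\<^sub>R v) - g (x + 0 *\<^sub>R v) = (1 - 0) * pd v g (x + t *\<^sub>R v)"
   by (rule MVT2) (auto intro!: pd_line_DERIV dg that)
  then obtain t where "0 < t" "t < 1" "g (x + v) - g x = pd v g (x + t *\<^sub>R v)" by auto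
  then show ?thesis using K[OF that[of t], of v] by simp
 qed
 obtain L where L: "L >= 0" "!!x y. x \<in> cball x0 r ==> y \<in> cball x0 r ==> \<bar>\<psi> x - \<psi> y\<bar> <= L * norm (x - y)"
  using smooth_lipschitz_on_cball[OF smooth_\<psi>, of x0 r] by blast
 have lip: "\<bar>g y - g x\<bar> <= (K * (1 + 2 * L)) * norm (y - x)"
  if x: "x \<in> D \<rho>" and y: "y \<in> D \<rho>" and small: "L * norm (y - x) < \<rho>1 - \<rho>" for x y
 proof -
  \<comment> \<open>Along the segment \<open>\<psi>\<close> drops by at most this amount, so raising
    the segment by \<open>d\<close> keeps it where \<open>\<psi>\<close> is positive.\<close>
  define d where "d = L * norm (y - x)"
  have d: "0 <= d" "d < \<rho>1 - \<rho>" using L small by (auto simp: d_def)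
  have near: "z + s *\<^sub>R e \<in> D \<rho>1" if z: "z \<in> ball x0 \<rho>" "0 < \<psi> z + s" "0 <= s" "s <= d" for z s
   using dist_triangle[of x0 "z + s *\<^sub>R e" z] that d norm_e by (simp add: D_def \<psi>_shift dist_norm)
  have up: "\<bar>g (z + d *\<^sub>R e) - g z\<bar> <= K * d" if z: "z \<in> D \<rho>" for z
  proof -
   have "z + t *\<^sub>R (d *\<^sub>R e) \<in> D \<rho>1" if "0 <= t" "t <= 1" for t
    unfolding scaleR_scaleR using z that d by (intro near) (auto simp: D_def mult_left_le_one_le intro: add_pos_nonneg)
   from seg[OF this] show ?thesis using d norm_e by simp
  qed
  have "x + d *\<^sub>R e + t *\<^sub>R (y - x) \<in> D \<rho>1" if t: "0 <= t" "t <= 1" for t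
  proof -
   have z: "x + t *\<^sub>R (y - x) \<in> ball x0 \<rho>"
    using convexD_alt[OF convex_ball, of x x0 \<rho> y t] x y that by (simp add: D_def algebra_simps)
   have "\<bar>\<psi> x - \<psi> (x + t *\<^sub>R (y - x))\<bar> <= L * (t * norm (y - x))"
    using L(2)[of x "x + t *\<^sub>R (y - x)"] z x \<rho> t by (simp add: D_def)
   also have "... <= d" unfolding d_def using t L(1) by (intro mult_left_mono) (auto simp: mult_left_le_one_le)
   finally have "x + t *\<^sub>R (y - x) + d *\<^sub>R e \<in> D \<rho>1" using D_pos[OF x] d by (intro near z) auto
   then show ?thesis by (simp only: ac_simps)
  qed
  from seg[OF this] have "\<bar>g (y + d *\<^sub>R e) - g (x + d *\<^sub>R e)\<bar> <= K * norm (y - x)" by (simp add: add.commute)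
  then have "\<bar>g y - g x\<bar> <= K * norm (y - x) + K * d + K * d" using up[OF x] up[OF y] by linarith
  then show ?thesis by (simp add: d_def algebra_simps)
 qed
 show ?thesis unfolding uniformly_continuous_on_def
 proof (intro allI impI)
  fix \<epsilon> :: real assume \<epsilon>: "\<epsilon> > 0"
  define d where "d = min ((\<rho>1 - \<rho>) / (L + 1)) (\<epsilon> / (K * (1 + 2 * L) + 1))"
  have KL: "K * (1 + 2 * L) >= 0" using K0 L(1) by simp
  have "d > 0" using \<rho>1 L(1) KL \<epsilon> by (simp add: d_def add_nonneg_pos)
  moreover have "dist (g y) (g x) < \<epsilon>" if x: "x \<in> D \<rho>" "y \<in> D \<rho>" "dist y x < d" for x y
  proof -
   have n: "norm (y - x) < (\<rho>1 - \<rho>) / (L + 1)" "norm (y - x) < \<epsilon> / (K * (1 + 2 * L) + 1)" using that by (auto simp: d_def dist_norm)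
   have "L * norm (y - x) <= (L + 1) * norm (y - x)" by (simp add: mult_right_mono)
   also have "... < \<rho>1 - \<rho>" using n(1) L(1) by (simp add: field_simps)
   finally have "\<bar>g y - g x\<bar> <= K * (1 + 2 * L) * norm (y - x)" by (rule lip[OF x(1,2)])
   also have "... <= (K * (1 + 2 * L) + 1) * norm (y - x)" by (simp add: mult_right_mono)
   also have "... < \<epsilon>" using n(2) KL by (simp add: pos_less_divide_eq add_nonneg_pos mult.commute)
   finally show ?thesis by (simp add: dist_norm)
  qed
  ultimately show "\<exists>d>0. \<forall>x\<in>D \<rho>. \<forall>y\<in>D \<rho>. dist y x < d --> dist (g y) (g x) < \<epsilon>" by blast
 qed
qed

lemma ES_iter_partial: "ES.full a (%n. v) ==> set bs \<subseteq> Basis ==> ES.full a (%n. iter_partial bs v)"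
 by (induction bs) (auto intro: ES_pd)

lemma ES_uniformly_continuous:
 assumes "ES.full 0 (%n. v)" "set bs \<subseteq> Basis" "\<rho> < r"
 shows "uniformly_continuous_on (D \<rho>) (iter_partial bs v)"
proof (rule uniformly_continuous_chart[OF _ _ assms(3)])
 note f = ES_iter_partial[OF assms(1,2)]
 show "smooth_on (D r) (iter_partial bs v)" using f unfolding ES.full_def by blast
 fix b :: 'a assume "b \<in> Basis"
 from ES_pd[OF f this] have "TS.full 0 (%n. pd b (iter_partial bs v))" unfolding ES.full_def using ES.tow_P by blast
 then show "Wt r 0 (%n. pd b (iter_partial bs v))" unfolding TS.full_def using TS.tow_P by blast
qed

end

text \<open>A Lebesgue number of the cover of the compact closure by small balls serves as common
  modulus.\<close>

lemma uniformly_continuous_on_local: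
 fixes g :: "'a::euclidean_space => real"
 assumes "compact (closure S)" "!!x. x \<in> closure S ==> \<exists>\<rho>>0. uniformly_continuous_on (S \<inter> ball x \<rho>) g"
 shows "uniformly_continuous_on S g"
 unfolding uniformly_continuous_on_def
proof (intro allI impI)
 fix \<epsilon> :: real assume \<epsilon>: "\<epsilon> > 0"
 have "\<exists>d>0. \<forall>y\<in>S \<inter> ball x d. \<forall>y'\<in>S \<inter> ball x d. dist (g y') (g y) < \<epsilon>" if x: "x \<in> closure S" for x
 proof -
  obtain \<rho> where \<rho>: "\<rho> > 0" "uniformly_continuous_on (S \<inter> ball x \<rho>) g" using assms(2)[OF x] by blast
  obtain d where d: "d > 0" "!!y y'. y \<in> S \<inter> ball x \<rho> ==> y' \<in> S \<inter> ball x \<rho> ==> dist y' y < d ==> dist (g y') (g y) < \<epsilon>"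
   using \<rho>(2) \<epsilon> unfolding uniformly_continuous_on_def by blast
  have "dist (g y') (g y) < \<epsilon>" if "y \<in> S \<inter> ball x (min \<rho> (d/2))" "y' \<in> S \<inter> ball x (min \<rho> (d/2))" for y y'
   using that dist_triangle[of y' y x] by (intro d(2)) (auto simp: dist_commute)
  then show ?thesis using \<rho>(1) d(1) by (intro exI[of _ "min \<rho> (d/2)"]) auto
 qed
 then obtain d where d: "!!x. x \<in> closure S ==> d x > 0"
  "!!x y y'. x \<in> closure S ==> y \<in> S \<inter> ball x (d x) ==> y' \<in> S \<inter> ball x (d x) ==> dist (g y') (g y) < \<epsilon>" by metis
 have "closure S \<subseteq> \<Union> ((%x. ball x (d x)) ` closure S)" using d(1) by force
 then obtain \<eta> where \<eta>: "\<eta> > 0" "!!x. x \<in> closure S ==> \<exists>G\<in>(%x. ball x (d x)) ` closure S. ball x \<eta> \<subseteq> G"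
 proof -
  have o: "open G" if "G \<in> (%x. ball x (d x)) ` closure S" for G using that by auto
  assume that: "!!\<eta>. 0 < \<eta> ==> (!!x. x \<in> closure S ==> \<exists>G\<in>(%x. ball x (d x)) ` closure S. ball x \<eta> \<subseteq> G) ==> thesis"
  show thesis by (rule Heine_Borel_lemma[OF assms(1) \<open>closure S \<subseteq> _\<close> o]) (assumption, erule that, blast)
 qed
 have "dist (g y') (g y) < \<epsilon>" if "y \<in> S" "y' \<in> S" "dist y' y < \<eta>" for y y'
 proof -
  have "y \<in> closure S" using that(1) closure_subset[of S] by blast
  then obtain x where x: "x \<in> closure S" "ball y \<eta> \<subseteq> ball x (d x)" using \<eta>(2)[of y] by blast
  have "y \<in> ball y \<eta>" "y' \<in> ball y \<eta>" using that(3) \<eta>(1) by (auto simp: dist_commute)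
  then show ?thesis using d(2)[OF x(1), of y y'] that x(2) by blast
 qed
 then show "\<exists>d>0. \<forall>x\<in>S. \<forall>x'\<in>S. dist x' x < d --> dist (g x') (g x) < \<epsilon>" using \<eta>(1) by blast
qed

theorem semilinear_boundary_regularity:
 fixes v z :: "'a::euclidean_space => real"
 assumes \<Omega>: "open \<Omega>" "bounded \<Omega>" "smooth_boundary \<Omega>"
  and s: "smooth_on \<Omega> v" "smooth_on \<Omega> z" and c: "continuous_on UNIV v" "continuous_on UNIV z"
  and off: "!!x. x \<notin> \<Omega> ==> v x = 0 & z x = 0"
  and l: "!!x. x \<in> \<Omega> ==> laplacian v x = - z x" "!!x. x \<in> \<Omega> ==> laplacian z x = - (lam * nonlinearity p (v x))"
  and bd: "\<delta> > 0" "!!x. x \<in> \<Omega> ==> 0 <= v x & v x <= 1 - \<delta>" "!!x. x \<in> \<Omega> ==> \<bar>z x\<bar> <= M"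
 shows "smooth_up_to_boundary \<Omega> v"
proof -
 have uc: "uniformly_continuous_on \<Omega> (iter_partial bs v)" if bs: "set bs \<subseteq> Basis" for bs
 proof (rule uniformly_continuous_on_local)
  show "compact (closure \<Omega>)" using \<Omega>(2) by (simp add: compact_closure)
  fix x0 assume x0: "x0 \<in> closure \<Omega>"
  show "\<exists>\<rho>>0. uniformly_continuous_on (\<Omega> \<inter> ball x0 \<rho>) (iter_partial bs v)"
  proof (cases "x0 \<in> \<Omega>")
   case True
   then obtain \<rho> where \<rho>: "\<rho> > 0" "cball x0 \<rho> \<subseteq> \<Omega>" using \<Omega>(1) open_contains_cball by blast
   have "uniformly_continuous_on (cball x0 \<rho>) (iter_partial bs v)"
    by (intro compact_uniformly_continuous compact_cball continuous_on_subset[OF smooth_on_continuous[OF smooth_on_iter_partial[OF s(1) bs]] \<rho>(2)])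
   then show ?thesis using \<rho>(1) ball_subset_cball[of x0 \<rho>] unfolding uniformly_continuous_on_def by (intro exI[of _ \<rho>]) (meson IntD2 subsetD)
  next
   case False
   then have "x0 \<in> frontier \<Omega>" using x0 \<Omega>(1) by (simp add: frontier_def interior_open)
   then obtain r e \<gamma> where r: "r > 0" "norm e = 1" "smooth_on UNIV \<gamma>"
    "\<Omega> \<inter> ball x0 r = {x \<in> ball x0 r. x \<bullet> e > \<gamma> (x - (x \<bullet> e) *\<^sub>R e)}"
    using \<Omega>(3) unfolding smooth_boundary_def by blast
   have ee: "e \<bullet> e = 1" using r(2) by (simp add: norm_eq_1)
   \<comment> \<open>The argument of \<open>\<gamma>\<close> is the component orthogonal to
     \<open>e\<close>, hence unchanged by shifts along \<open>e\<close>; this is what gives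
     \<open>\<psi>\<close> its shift property.\<close>
   define \<psi> where "\<psi> x = x \<bullet> e - \<gamma> (x - (x \<bullet> e) *\<^sub>R e)" for x
   interpret chart_at \<psi> e x0 r
   proof
    have "smooth_on UNIV (%x. (x - (x \<bullet> e) *\<^sub>R e) \<bullet> b)" for b
     unfolding inner_diff_left inner_scaleR_left
     by (intro smooth_on_diff smooth_on_mult smooth_on_coord smooth_on_const open_UNIV)
    then have "smooth_on UNIV (%x. \<gamma> (x - (x \<bullet> e) *\<^sub>R e))" by (intro smooth_on_vec_comp[OF open_UNIV r(3)]) auto
    then show "smooth_on UNIV \<psi>" unfolding \<psi>_def[abs_def] by (intro smooth_on_diff smooth_on_coord open_UNIV)
    show "\<psi> (x + c *\<^sub>R e) = \<psi> x + c" for x c by (simp add: \<psi>_def inner_add_left ee algebra_simps)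
   qed (rule r(2))
   have iff: "\<psi> x > 0 \<longleftrightarrow> x \<in> \<Omega>" if "x \<in> ball x0 r" for x
    using r(4) that unfolding \<psi>_def by fastforce
   have Dr: "D r \<subseteq> \<Omega>" using iff by (auto simp: D_def)
   have D2: "\<Omega> \<inter> ball x0 (r/2) = D (r/2)" using iff r(1) by (auto simp: D_def)
   have cf: "continuous_on (ball x0 r) (%x. if \<psi> x > 0 then f x else 0)"
    if "continuous_on UNIV f" "!!x. x \<notin> \<Omega> ==> f x = 0" for f :: "'a => real"
    by (rule continuous_on_eq[OF continuous_on_subset[OF that(1) subset_UNIV]]) (use iff that(2) in auto)
   have "ES.full 0 (%n. v)"
    by (rule chart_regularity[OF smooth_on_subset[OF s(1) open_D Dr] smooth_on_subset[OF s(2) open_D Dr] cf[OF c(1)] cf[OF c(2)]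
       l(1)[OF subsetD[OF Dr]] l(2)[OF subsetD[OF Dr]] bd(1) bd(2)[OF subsetD[OF Dr]] bd(3)[OF subsetD[OF Dr]]])
     (use off in auto)
   then show ?thesis using ES_uniformly_continuous[OF _ bs, of v "r/2"] r(1) D2 by (intro exI[of _ "r/2"]) simp
  qed
 qed
 show ?thesis unfolding smooth_up_to_boundary_def
 proof (intro conjI allI impI s(1) continuous_on_subset[OF c(1) subset_UNIV])
  fix bs :: "'a list" assume "set bs \<subseteq> Basis"
  from uc[OF this] obtain g where "uniformly_continuous_on (closure \<Omega>) g" "!!x. x \<in> \<Omega> ==> iter_partial bs v x = g x"
   by (rule uniformly_continuous_on_extension_on_closure) blast
  then show "\<exists>g. continuous_on (closure \<Omega>) g & (\<forall>x\<in>\<Omega>. g x = iter_partial bs v x)"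
   using uniformly_continuous_imp_continuous by metis
 qed
qed


section \<open>Comparison with the minimal solution\<close>

text \<open>\<open>V\<close> is minus the Laplacian of \<open>u\<close>; both functions are extended by zero.\<close>

locale navier =
 fixes \<Omega> :: "'a::euclidean_space set" and p lam :: real and u V :: "'a => real"
 assumes open_\<Omega>: "open \<Omega>" and bounded_\<Omega>: "bounded \<Omega>"
  and smooth: "smooth_on \<Omega> u" "smooth_on \<Omega> V" and cont: "continuous_on UNIV u" "continuous_on UNIV V"
  and off: "x \<notin> \<Omega> ==> u x = 0" "x \<notin> \<Omega> ==> V x = 0"
  and laplacian_u: "x \<in> \<Omega> ==> laplacian u x = - V x"
  and laplacian_V: "x \<in> \<Omega> ==> laplacian V x = - (lam * nonlinearity p (u x))"
  and less_1: "u x < 1"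
begin

lemma bound_below_1: "\<exists>\<delta>>0. \<forall>x. u x <= 1 - \<delta>"
proof (cases "\<Omega> = {}")
 case False
 then obtain x where x: "x \<in> closure \<Omega>" "\<forall>y\<in>closure \<Omega>. u y <= u x"
  using continuous_attains_sup[of "closure \<Omega>" u] continuous_on_subset[OF cont(1)] bounded_\<Omega> by (auto simp: compact_closure)
 have "u y <= max (u x) 0" for y
  using x(2) off(1)[of y] closure_subset[of \<Omega>] by (cases "y \<in> \<Omega>") (auto simp: le_max_iff_disj)
 then show ?thesis using less_1[of x] by (intro exI[of _ "1 - max (u x) 0"]) auto
qed (use off in \<open>auto intro!: exI[of _ 1]\<close>)

end

lemma continuous_zero_extension_limit:
 fixes f :: "'a::euclidean_space => real"
 assumes S: "open S" "continuous_on S f" and l: "!!x. x \<in> frontier S ==> (f \<longlongrightarrow> 0) (at x within S)"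
 shows "continuous_on UNIV (%x. if x \<in> S then f x else 0)"
proof (rule continuous_at_imp_continuous_on, rule ballI)
 fix x
 show "isCont (%x. if x \<in> S then f x else 0) x"
 proof (cases "x \<in> S")
  case True
  have ev: "\<forall>\<^sub>F y in nhds x. (if y \<in> S then f y else 0) = f y"
   using eventually_nhds_in_open[OF S(1) True] by eventually_elim simp
  show ?thesis using isCont_cong[OF ev] S True continuous_on_eq_continuous_at by blast
 next
  case False
  have "(f \<longlongrightarrow> 0) (at x within S)"
  proof (cases "x \<in> closure S")
   case True
   then show ?thesis using l False S(1) by (simp add: frontier_def interior_open)
  next
   case False
   then have "at x within S = bot" using not_in_closure_trivial_limitI trivial_limit_def by (metis eventually_False)
   then show ?thesis by simp
  qed
  then have "((%x. if x \<in> S then f x else 0) \<longlongrightarrow> 0) (at x)"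
   unfolding Lim_within Lim_at by auto (metis abs_zero)
  then show ?thesis using False by (simp add: isCont_def)
 qed
qed

lemma smooth_up_to_boundary_uc:
 assumes "smooth_up_to_boundary \<Omega> u" "bounded \<Omega>" "set bs \<subseteq> Basis"
 shows "uniformly_continuous_on \<Omega> (iter_partial bs u)"
proof -
 obtain g where g: "continuous_on (closure \<Omega>) g" "\<forall>x\<in>\<Omega>. g x = iter_partial bs u x"
  using assms(1,3) unfolding smooth_up_to_boundary_def by blast
 have "uniformly_continuous_on (closure \<Omega>) g"
  using compact_uniformly_continuous[OF g(1)] assms(2) by (simp add: compact_closure)
 then show ?thesis
  using g(2) closure_subset[of \<Omega>] unfolding uniformly_continuous_on_def by (metis subsetD)
qed

lemma smooth_solution_navier:
 fixes U :: "'a::euclidean_space => real"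
 assumes \<Omega>: "open \<Omega>" "bounded \<Omega>" and sol: "smooth_solution \<Omega> p lam U"
 defines "u \<equiv> %x. if x \<in> \<Omega> then U x else 0" and "V \<equiv> %x. if x \<in> \<Omega> then - laplacian U x else 0"
 shows "navier \<Omega> p lam u V"
  and "!!b. b \<in> Basis ==> uniformly_continuous_on \<Omega> (pd b (pd b u))"
  and "!!b. b \<in> Basis ==> uniformly_continuous_on \<Omega> (pd b (pd b V))"
proof -
 have up: "smooth_up_to_boundary \<Omega> U" and U1: "!!x. x \<in> closure \<Omega> ==> U x < 1"
  and eq: "!!x. x \<in> \<Omega> ==> laplacian (laplacian U) x = lam * nonlinearity p (U x)"
  and U0: "!!x. x \<in> frontier \<Omega> ==> U x = 0" and L0: "!!x. x \<in> frontier \<Omega> ==> (laplacian U \<longlongrightarrow> 0) (at x within \<Omega>)"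
  using sol unfolding smooth_solution_def by blast+
 have sU: "smooth_on \<Omega> U" and cU: "continuous_on (closure \<Omega>) U" using up unfolding smooth_up_to_boundary_def by blast+
 note sL = smooth_on_laplacian[OF sU]
 have uU: "!!x. x \<in> \<Omega> ==> U x = u x" and VL: "!!x. x \<in> \<Omega> ==> - laplacian U x = V x" by (simp_all add: u_def V_def)
 have su: "smooth_on \<Omega> u" by (rule smooth_on_cong[OF sU uU])
 have sV: "smooth_on \<Omega> V" by (rule smooth_on_cong[OF smooth_on_minus[OF sL] VL])
 show "navier \<Omega> p lam u V"
 proof
  show "continuous_on UNIV u" unfolding u_def by (rule continuous_zero_extension[OF \<Omega>(1) cU U0])
  show "continuous_on UNIV V" unfolding V_def
   by (rule continuous_zero_extension_limit[OF \<Omega>(1) continuous_on_minus[OF smooth_on_continuous[OF sL]]])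
    (use tendsto_minus[OF L0] in simp)
  fix x
  show "u x = 0" "V x = 0" if "x \<notin> \<Omega>" using that by (simp_all add: u_def V_def)
  show "u x < 1" using U1[of x] closure_subset[of \<Omega>] by (auto simp: u_def)
  assume x: "x \<in> \<Omega>"
  show "laplacian u x = - V x" using laplacian_cong_open[OF \<Omega>(1) x uU] x by (simp add: V_def)
  show "laplacian V x = - (lam * nonlinearity p (u x))"
   using laplacian_cong_open[OF \<Omega>(1) x VL] laplacian_minus[OF sL x] eq[OF x] x by (simp add: u_def)
 qed (rule \<Omega> su sV)+
 show "uniformly_continuous_on \<Omega> (pd b (pd b u))" if b: "b \<in> Basis" for b
 proof -
  have "uniformly_continuous_on \<Omega> (pd b (pd b U))" using smooth_up_to_boundary_uc[OF up \<Omega>(2), of "[b, b]"] b by simp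
  moreover have "pd b (pd b U) x = pd b (pd b u) x" if "x \<in> \<Omega>" for x
   using iter_partial_cong_open[OF \<Omega>(1) that uU, where bs = "[b, b]"] by simp
  ultimately show ?thesis unfolding uniformly_continuous_on_def by (metis (no_types, lifting))
 qed
 show "uniformly_continuous_on \<Omega> (pd b (pd b V))" if b: "b \<in> Basis" for b
 proof -
  \<comment> \<open>The second derivatives of \<open>V\<close> are fourth derivatives of
    \<open>U\<close>, which extend continuously to the closure because \<open>U\<close> is smooth up
    to the boundary.\<close>
  have "uniformly_continuous_on \<Omega> (%x. - (\<Sum>c\<in>Basis. iter_partial [b, b, c, c] U x))"
   by (intro uniformly_continuous_on_minus uniformly_continuous_on_sum smooth_up_to_boundary_uc[OF up \<Omega>(2)]) (use b in auto)
  moreover have "- (\<Sum>c\<in>Basis. iter_partial [b, b, c, c] U x) = pd b (pd b V) x" if x: "x \<in> \<Omega>" for x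
  proof -
   have d: "iter_partial bs U differentiable at y" if "set bs \<subseteq> Basis" "y \<in> \<Omega>" for bs y
    using smooth_on_differentiable[OF smooth_on_iter_partial[OF sU that(1)] that(2)] .
   have m: "pd b (%y. - (\<Sum>c\<in>Basis. iter_partial (bs @ [c, c]) U y)) y = - (\<Sum>c\<in>Basis. pd b (iter_partial (bs @ [c, c]) U) y)"
    if "set bs \<subseteq> Basis" "y \<in> \<Omega>" for bs y
   proof -
    have "iter_partial (bs @ [c, c]) U differentiable at y" if "c \<in> Basis" for c
     by (rule d) (use that \<open>set bs \<subseteq> Basis\<close> \<open>y \<in> \<Omega>\<close> in auto)
    then show ?thesis by (subst pd_minus) (auto intro!: differentiable_sum simp: pd_sum)
   qed
   have "pd b V y = pd b (%y. - (\<Sum>c\<in>Basis. iter_partial ([] @ [c, c]) U y)) y" if "y \<in> \<Omega>" for y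
    by (rule pd_cong_open[OF \<Omega>(1) that]) (simp add: V_def laplacian_def)
   then have "pd b (pd b V) x = pd b (%y. - (\<Sum>c\<in>Basis. iter_partial ([b] @ [c, c]) U y)) x"
    by (intro pd_cong_open[OF \<Omega>(1) x]) (use m[of "[]"] in simp)
   then show ?thesis using m[of "[b]" x] b x by simp
  qed
  ultimately show ?thesis unfolding uniformly_continuous_on_def by (metis (no_types, lifting))
 qed
qed

lemma continuous_AE_le:
 fixes u v :: "'a::euclidean_space => real"
 assumes S: "open S" and c: "continuous_on S u" "continuous_on S v" and ae: "AE x in lebesgue_on S. u x <= v x" and x: "x \<in> S"
 shows "u x <= v x"
proof (rule ccontr)
 assume *: "\<not> u x <= v x"
 have oN: "open {y \<in> S. v y < u y}"
  using continuous_open_preimage[OF continuous_on_diff[OF c] S open_greaterThan[of 0]] by (simp add: vimage_def Int_def)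
 have "AE y in lebesgue. y \<in> S --> u y <= v y"
  using ae S by (subst (asm) AE_restrict_space_iff) auto
 then obtain N where N: "{y. \<not> (y \<in> S --> u y <= v y)} \<subseteq> N" "N \<in> null_sets lebesgue"
  unfolding eventually_ae_filter by auto
 have "negligible {y \<in> S. v y < u y}"
  by (rule negligible_subset[of N]) (use N in \<open>auto simp: negligible_iff_null_sets\<close>)
 then show False using open_not_negligible[OF oN] x * by force
qed

text \<open>Minimality of \<open>u\<close> speaks only of solutions that are smooth up to the
  boundary and have the same parameter. The iteration below \<open>U\<close> supplies such a
  competitor \<open>v <= U\<close>; continuity turns the almost everywhere inequality into a
  pointwise one.\<close>

theorem minimal_solution_le:
 fixes u U :: "'a::euclidean_space => real"
 assumes \<Omega>: "open \<Omega>" "bounded \<Omega>" "smooth_boundary \<Omega>" and p: "p > 0" and lam: "0 <= lam" "lam <= \<mu>"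
  and u: "minimal_solution \<Omega> p lam u" and U: "smooth_solution \<Omega> p \<mu> U" and x: "x \<in> \<Omega>"
 shows "u x <= U x"
proof -
 define U' where "U' x = (if x \<in> \<Omega> then U x else 0)" for x
 define V where "V x = (if x \<in> \<Omega> then - laplacian U x else 0)" for x
 note n = smooth_solution_navier[OF \<Omega>(1,2) U, folded U'_def[abs_def] V_def[abs_def]]
 interpret navier \<Omega> p \<mu> U' V by (rule n)
 have fr: "y \<notin> \<Omega>" if "y \<in> frontier \<Omega>" for y using that \<Omega>(1) by (simp add: frontier_def interior_open)
 obtain v z where v: "smooth_on \<Omega> v" "smooth_on \<Omega> z" "!!x. x \<in> \<Omega> ==> laplacian v x = - z x"
  "!!x. x \<in> \<Omega> ==> laplacian z x = - (lam * nonlinearity p (v x))"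
  "!!x. x \<in> \<Omega> ==> 0 <= v x & v x <= U' x" "!!x. x \<in> \<Omega> ==> 0 <= z x & z x <= V x"
  "!!x. x \<notin> \<Omega> ==> v x = 0 & z x = 0"
  by (rule semilinear_solution[OF \<Omega>(1,2) smooth(1) continuous_on_subset[OF cont(1) subset_UNIV] off(1)[OF fr] n(2)
     laplacian_u smooth(2) continuous_on_subset[OF cont(2) subset_UNIV] off(2)[OF fr] n(3) laplacian_V less_1 lam p])
   (assumption | rule that)+
 have ext: "continuous_on UNIV f" if "smooth_on \<Omega> f" "!!x. x \<in> \<Omega> ==> 0 <= f x & f x <= F x" "continuous_on UNIV F"
  "!!x. x \<notin> \<Omega> ==> F x = 0" "!!x. x \<notin> \<Omega> ==> f x = 0" for f F :: "'a => real"
 proof -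
  have "(f \<longlongrightarrow> 0) (at y within \<Omega>)" if y: "y \<in> frontier \<Omega>" for y
  proof (rule tendsto_sandwich[of "%x. 0" f _ F])
   have "isCont F y" using \<open>continuous_on UNIV F\<close> continuous_on_eq_continuous_at by blast
   then show "(F \<longlongrightarrow> 0) (at y within \<Omega>)"
    using \<open>!!x. x \<notin> \<Omega> ==> F x = 0\<close>[OF fr[OF y]] tendsto_within_subset[OF _ subset_UNIV] by (force simp: isCont_def)
  qed (use \<open>!!x. x \<in> \<Omega> ==> 0 <= f x & f x <= F x\<close> in \<open>auto simp: eventually_at_filter\<close>)
  from continuous_zero_extension_limit[OF \<Omega>(1) smooth_on_continuous[OF that(1)] this]
  have "continuous_on UNIV (%x. if x \<in> \<Omega> then f x else 0)" by blast
  moreover have "(%x. if x \<in> \<Omega> then f x else 0) = f" using that(5) by auto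
  ultimately show ?thesis by (simp only:)
 qed
 have cv: "continuous_on UNIV v" by (rule ext[OF v(1,5) cont(1) off(1)]) (use v(7) in auto)
 have cz: "continuous_on UNIV z" by (rule ext[OF v(2,6) cont(2) off(2)]) (use v(7) in auto)
 obtain \<delta> where \<delta>: "\<delta> > 0" "!!x. U' x <= 1 - \<delta>" using bound_below_1 by blast
 obtain M where M: "M >= 0" "!!x. x \<in> closure \<Omega> ==> \<bar>V x\<bar> <= M"
  by (rule compact_bound[OF compact_closure[THEN iffD2, OF \<Omega>(2)] continuous_on_subset[OF cont(2) subset_UNIV]]) blast
 have zM: "\<bar>z x\<bar> <= M" if "x \<in> \<Omega>" for x using M(2)[of x] v(6)[OF that] that closure_subset[of \<Omega>] by force
 have up: "smooth_up_to_boundary \<Omega> v"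
  by (rule semilinear_boundary_regularity[OF \<Omega> v(1,2) cv cz v(7,3,4) \<delta>(1) _ zM])
   (use v(5) \<delta>(2) order_trans in \<open>blast+\<close>)
 have v1: "v y < 1" for y using v(5)[of y] less_1[of y] v(7)[of y] by (cases "y \<in> \<Omega>") auto
 have "smooth_solution \<Omega> p lam v" unfolding smooth_solution_def
 proof (intro conjI ballI up v1)
  show "v y = 0" if "y \<in> frontier \<Omega>" for y using v(7) fr[OF that] by simp
  show "laplacian (laplacian v) y = lam * nonlinearity p (v y)" if y: "y \<in> \<Omega>" for y
   using laplacian_cong_open[OF \<Omega>(1) y v(3)] laplacian_minus[OF v(2) y] v(4)[OF y] by simp
  fix y assume y: "y \<in> frontier \<Omega>"
  have "isCont z y" using cz continuous_on_eq_continuous_at by blast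
  then have "((%x. - z x) \<longlongrightarrow> - 0) (at y within \<Omega>)"
   using v(7)[OF fr[OF y]] tendsto_within_subset[OF _ subset_UNIV] by (intro tendsto_minus) (force simp: isCont_def)
  then show "(laplacian v \<longlongrightarrow> 0) (at y within \<Omega>)"
   by (subst tendsto_cong[of _ "%x. - z x"]) (auto simp: eventually_at_filter v(3))
 qed
 then have "AE x in lebesgue_on \<Omega>. u x <= v x" using u unfolding minimal_solution_def by blast
 moreover have "smooth_on \<Omega> u"
  using u unfolding minimal_solution_def smooth_solution_def smooth_up_to_boundary_def by blast
 ultimately have "u x <= v x"
  using continuous_AE_le[OF \<Omega>(1) smooth_on_continuous smooth_on_continuous[OF v(1)] _ x] by blast
 then show ?thesis using v(5)[OF x] x by (simp add: U'_def)
qed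


section \<open>Stability\<close>

text \<open>The test functions are powers of positive parts and are not smooth, but one continuous
  derivative is enough for the integration by parts.\<close>

definition C1_on :: "'a::euclidean_space set => ('a => real) => bool" where
 "C1_on S f \<longleftrightarrow> open S & (\<forall>x\<in>S. f differentiable at x) & (\<forall>v. continuous_on S (pd v f))"

lemma C1_onD:
 assumes "C1_on S f"
 shows "open S" "x \<in> S ==> f differentiable at x" "continuous_on S (pd v f)" "continuous_on S f"
 using assms unfolding C1_on_def
 by (auto intro!: continuous_at_imp_continuous_on differentiable_imp_continuous_within)

lemma smooth_C1: "smooth_on S f ==> C1_on S f"
 unfolding C1_on_def using smooth_on_open smooth_on_differentiable smooth_on_continuous[OF smooth_on_pd] by blast

lemma C1_mult:
 assumes f: "C1_on S f" and g: "C1_on S g" shows "C1_on S (%x. f x * g x)"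
 unfolding C1_on_def
proof (intro conjI allI ballI C1_onD(1)[OF f])
 show "(%x. f x * g x) differentiable at x" if "x \<in> S" for x
  by (intro differentiable_mult C1_onD(2)[OF f that] C1_onD(2)[OF g that])
 have "continuous_on S (%x. pd v f x * g x + f x * pd v g x)" for v
  by (intro continuous_intros C1_onD(3,4)[OF f] C1_onD(3,4)[OF g])
 then show "continuous_on S (pd v (%x. f x * g x))" for v
  by (rule continuous_on_eq) (simp add: pd_mult C1_onD(2)[OF f] C1_onD(2)[OF g])
qed

lemma C1_real_comp:
 assumes f: "C1_on S f" and F: "!!t. (F has_real_derivative F' t) (at t)" "continuous_on UNIV F'"
 shows "C1_on S (%x. F (f x))" "x \<in> S ==> pd v (%x. F (f x)) x = F' (f x) * pd v f x"
proof -
 note c = pd_real_comp[where f = f, OF F(1) C1_onD(2)[OF f]]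
 show "x \<in> S ==> pd v (%x. F (f x)) x = F' (f x) * pd v f x" by (rule c(2))
 have "continuous_on S (%x. F' (f x) * pd v f x)" for v
  by (intro continuous_on_mult continuous_on_compose2[OF F(2)] C1_onD(3,4)[OF f]) auto
 then have "continuous_on S (pd v (%x. F (f x)))" for v by (rule continuous_on_eq) (rule c(2)[symmetric])
 then show "C1_on S (%x. F (f x))" unfolding C1_on_def using C1_onD(1)[OF f] c(1) by blast
qed

lemma continuous_support:
 fixes f :: "'a::euclidean_space => real"
 assumes "compact K" "K \<subseteq> S" "open S" "!!x. x \<notin> K ==> f x = 0" "continuous_on S f"
 shows "continuous_on UNIV f" "integrable lborel f"
proof -
 have "continuous_on (S \<union> - K) f"
  by (rule continuous_on_open_Un)
   (use assms compact_imp_closed in \<open>auto simp: open_Compl intro!: continuous_on_eq[OF continuous_on_const[of _ 0]]\<close>)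
 moreover have "S \<union> - K = UNIV" using assms(2) by auto
 ultimately show c: "continuous_on UNIV f" by simp
 show "integrable lborel f" by (rule integrable_compact_support[OF c compact_imp_bounded[OF assms(1)] assms(4)])
qed

lemma C1_extend:
 fixes f :: "'a::euclidean_space => real"
 assumes K: "compact K" "K \<subseteq> S" and f0: "!!x. x \<notin> K ==> f x = 0" and f: "C1_on S f"
 shows "C1_on UNIV f" "x \<notin> K ==> pd v f x = 0"
proof -
 have oK: "open (- K)" using K(1) by (simp add: open_Compl compact_imp_closed)
 have z: "pd v f x = 0" if "x \<notin> K" for v x
  using pd_cong_open[OF oK, of x f "%x. 0" v] that f0 by simp
 then show "x \<notin> K ==> pd v f x = 0" .
 have "f differentiable at x" for x
 proof (cases "x \<in> S")
  case False
  then have "x \<in> - K" using K(2) by auto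
  have "((%x. 0) has_derivative (%h. 0)) (at x)" by simp
  from has_derivative_transform_within_open[OF this oK \<open>x \<in> - K\<close>, of f] show ?thesis
   using f0 unfolding differentiable_def by auto
 qed (rule C1_onD(2)[OF f])
 then show "C1_on UNIV f"
  unfolding C1_on_def using continuous_support(1)[OF K C1_onD(1)[OF f] z C1_onD(3)[OF f]] by blast
qed

text \<open>The difference quotients of \<open>f\<close> have integral zero by translation invariance.\<close>

lemma integral_pd:
 fixes f :: "'a::euclidean_space => real"
 assumes K: "compact K" "K \<subseteq> S" and f0: "!!x. x \<notin> K ==> f x = 0" and f: "C1_on S f" and b: "b \<in> Basis"
 shows "!!x. x \<notin> K ==> pd b f x = 0" "integrable lborel (pd b f)" "(LBINT x. pd b f x) = 0"
proof -
 show z: "pd b f x = 0" if "x \<notin> K" for x by (rule C1_extend(2)[OF K _ f that]) (rule f0)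
 have "C1_on UNIV f" by (rule C1_extend(1)[OF K _ f]) (rule f0)
 then have d: "f differentiable at x" for x by (rule C1_onD(2)) simp
 note cp = continuous_support[OF K C1_onD(1)[OF f] z C1_onD(3)[OF f]]
 show "integrable lborel (pd b f)" by (rule cp(2))
 have cf: "continuous_on UNIV f" by (rule continuous_support(1)[OF K C1_onD(1)[OF f] f0 C1_onD(4)[OF f]])
 note fi = continuous_support(2)[OF K C1_onD(1)[OF f] f0 C1_onD(4)[OF f]]
 obtain R where R: "K \<subseteq> cball 0 R" using bounded_subset_ballD[OF compact_imp_bounded[OF K(1)], of 0] ball_subset_cball by (meson subset_trans)
 obtain B where B: "B >= 0" "!!x. x \<in> K ==> \<bar>pd b f x\<bar> <= B" by (rule compact_bound[OF K(1) continuous_on_subset[OF cp(1) subset_UNIV]]) blast+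
 have B': "\<bar>pd b f x\<bar> <= B" for x using B z[of x] by (cases "x \<in> K") auto
 define s where "s n = inverse (real (Suc n))" for n
 have s: "0 < s n" "s n <= 1" for n by (auto simp: s_def inverse_le_1_iff)
 have slim: "filterlim s (at 0) sequentially"
  using LIMSEQ_inverse_real_of_nat s(1) by (auto simp: filterlim_at s_def[abs_def])
 define q where "q n x = (f (x + s n *\<^sub>R b) - f x) / s n" for n x
 have "(%n. LBINT x. q n x) \<longlonglongrightarrow> (LBINT x. pd b f x)"
 proof (rule integral_dominated_convergence[where w = "%x. B * indicator (cball 0 (R + 1)) x"])
  have m: "f \<in> borel_measurable borel" by (rule borel_measurable_continuous_onI[OF cf])
  show "pd b f \<in> borel_measurable lborel" using borel_measurable_continuous_onI[OF cp(1)] by simp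
  show "q n \<in> borel_measurable lborel" for n unfolding q_def using m by measurable
  show "integrable lborel (%x. B * indicator (cball (0::'a) (R + 1)) x :: real)"
   by (intro integrable_mult_right integrable_real_indicator emeasure_bounded_finite) auto
  show "AE x in lborel. (%n. q n x) \<longlonglongrightarrow> pd b f x"
  proof (rule AE_I2)
   fix x
   have "((%t. f (x + t *\<^sub>R b)) has_real_derivative pd b f (x + 0 *\<^sub>R b)) (at 0)" by (rule pd_line_DERIV[OF d])
   then have "((%h. (f (x + h *\<^sub>R b) - f x) / h) \<longlongrightarrow> pd b f x) (at 0)" by (simp add: DERIV_def)
   from filterlim_compose[OF this slim] show "(%n. q n x) \<longlonglongrightarrow> pd b f x" by (simp add: q_def)
  qed
  show "AE x in lborel. norm (q n x) <= B * indicator (cball 0 (R + 1)) x" for n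
  proof (rule AE_I2)
   fix x
   show "norm (q n x) <= B * indicator (cball 0 (R + 1)) x"
   proof (cases "x \<in> cball 0 (R + 1)")
    case True
    have "\<exists>t>0. t < s n & f (x + s n *\<^sub>R b) - f (x + 0 *\<^sub>R b) = (s n - 0) * pd b f (x + t *\<^sub>R b)"
     by (rule MVT2[OF s(1)]) (rule pd_line_DERIV[OF d])
    then obtain t where "q n x = pd b f (x + t *\<^sub>R b)" using s(1)[of n] by (auto simp: q_def)
    then show ?thesis using B' True by simp
   next
    case False
    have "norm x <= norm (x + s n *\<^sub>R b) + s n" using norm_triangle_ineq4[of "x + s n *\<^sub>R b" "s n *\<^sub>R b"] s(1)[of n] b by simp
    then have "x + s n *\<^sub>R b \<notin> K" "x \<notin> K" using False s(2)[of n] R by auto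
    then show ?thesis using f0 B(1) by (simp add: q_def)
   qed
  qed
 qed
 moreover have "(LBINT x. q n x) = 0" for n
 proof -
  have "integrable lborel (%x. f (x + s n *\<^sub>R b))"
  proof (rule integrable_compact_support)
   show "continuous_on UNIV (%x. f (x + s n *\<^sub>R b))" by (intro continuous_on_compose2[OF cf] continuous_intros) auto
   show "bounded ((%x. x - s n *\<^sub>R b) ` K)" using bounded_translation_minus[OF compact_imp_bounded[OF K(1)]] .
   show "f (x + s n *\<^sub>R b) = 0" if "x \<notin> (%x. x - s n *\<^sub>R b) ` K" for x
    using that by (intro f0) (metis add_diff_cancel image_eqI)
  qed
  then show ?thesis
   using lborel_integral_shift[OF borel_measurable_continuous_onI[OF cf], of "s n *\<^sub>R b"] fi by (simp add: q_def)
 qed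
 ultimately have "(%n. 0 :: real) \<longlonglongrightarrow> (LBINT x. pd b f x)" by (simp only:)
 then show "(LBINT x. pd b f x) = 0" by (simp add: LIMSEQ_const_iff)
qed

text \<open>The field with components \<phi>^2 (pd b w) / w has divergence |grad \<phi>|^2 +
  \<phi>^2 (laplacian w) / w minus the square of grad \<phi> - \<phi> (grad w) / w. Its integral
  vanishes, and dropping the square gives the inequality.\<close>

lemma picone:
 fixes \<phi> w :: "'a::euclidean_space => real"
 assumes K: "compact K" "K \<subseteq> S" and \<phi>: "C1_on S \<phi>" "!!x. x \<notin> K ==> \<phi> x = 0" and w: "smooth_on S w" "!!x. x \<in> S ==> w x > 0"
 shows "integrable lborel (%x. \<Sum>b\<in>Basis. (pd b \<phi> x)\<^sup>2)" "integrable lborel (%x. (\<phi> x)\<^sup>2 * (laplacian w x / w x))"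
  "0 <= (LBINT x. (\<Sum>b\<in>Basis. (pd b \<phi> x)\<^sup>2)) + (LBINT x. (\<phi> x)\<^sup>2 * (laplacian w x / w x))"
proof -
 note o = C1_onD(1)[OF \<phi>(1)]
 have p0: "pd b \<phi> x = 0" if "b \<in> Basis" "x \<notin> K" for b x by (rule integral_pd(1)[OF K \<phi>(2,1) that])
 show i1: "integrable lborel (%x. \<Sum>b\<in>Basis. (pd b \<phi> x)\<^sup>2)"
  by (rule continuous_support(2)[OF K o]) (use p0 in \<open>auto intro!: continuous_intros C1_onD(3)[OF \<phi>(1)]\<close>)
 show i2: "integrable lborel (%x. (\<phi> x)\<^sup>2 * (laplacian w x / w x))"
  by (rule continuous_support(2)[OF K o])
   (use \<phi>(2) w(2) in \<open>auto intro!: continuous_intros C1_onD(4)[OF \<phi>(1)] smooth_on_continuous[OF w(1)] smooth_on_continuous[OF smooth_on_laplacian[OF w(1)]]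
    simp: less_imp_neq[THEN not_sym]\<close>)
 define v where "v x = w x powr (-1)" for x
 have v: "v x = 1 / w x" if "x \<in> S" for x using w(2)[OF that] by (simp add: v_def powr_minus_divide)
 define g where "g b x = (\<phi> x * \<phi> x) * (pd b w x * v x)" for b x
 have sw: "smooth_on S v" unfolding v_def[abs_def] by (rule smooth_on_real_comp[OF smooth_on_powr w(1)]) (use w(2) in auto)
 have g1: "C1_on S (g b)" for b unfolding g_def
  by (intro C1_mult \<phi>(1) smooth_C1 smooth_on_pd w(1) sw)
 have g0: "g b x = 0" if "x \<notin> K" for b x using \<phi>(2)[OF that] by (simp add: g_def)
 note ig = integral_pd[OF K g0 g1]
 have gx: "(\<Sum>b\<in>Basis. pd b (g b) x) <= (\<Sum>b\<in>Basis. (pd b \<phi> x)\<^sup>2) + (\<phi> x)\<^sup>2 * (laplacian w x / w x)" for x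
 proof (cases "x \<in> K")
  case False
  then show ?thesis using ig(1) p0 \<phi>(2) by simp
 next
  case True
  then have x: "x \<in> S" using K(2) by blast
  note d\<phi> = C1_onD(2)[OF \<phi>(1) x] and dw = smooth_on_differentiable[OF w(1) x]
  have "pd b (g b) x <= (pd b \<phi> x)\<^sup>2 + (\<phi> x)\<^sup>2 * (pd b (pd b w) x / w x)" for b
  proof -
   have "((%t. t powr (-1)) has_real_derivative (-1) * w x powr (-1 - 1)) (at (w x))"
    by (rule has_real_derivative_powr[OF w(2)[OF x]])
   from pd_real_comp(2)[where f = w, OF this dw] have "pd b v x = (-1) * w x powr (-1 - 1) * pd b w x" by (simp only: v_def[abs_def])
   also have "w x powr (-1 - 1) = (v x)\<^sup>2" unfolding power2_eq_square v_def powr_add[symmetric] by simp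
   finally have pv: "pd b v x = - ((v x)\<^sup>2 * pd b w x)" by simp
   have "pd b (g b) x = pd b (%x. \<phi> x * \<phi> x) x * (pd b w x * v x) + (\<phi> x * \<phi> x) * pd b (%x. pd b w x * v x) x"
    unfolding g_def
    by (intro pd_mult differentiable_mult d\<phi> smooth_on_differentiable[OF smooth_on_pd[OF w(1)] x] smooth_on_differentiable[OF sw x])
   also have "... = (pd b \<phi> x)\<^sup>2 + (\<phi> x)\<^sup>2 * (pd b (pd b w) x * v x) - (pd b \<phi> x - \<phi> x * pd b w x * v x)\<^sup>2"
    unfolding pd_mult[OF d\<phi> d\<phi>] pd_mult[OF smooth_on_differentiable[OF smooth_on_pd[OF w(1), of b] x] smooth_on_differentiable[OF sw x]] pv
    by (simp add: power2_eq_square algebra_simps)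
   finally show ?thesis using v[OF x] by simp
  qed
  then show ?thesis
   unfolding laplacian_pd by (simp add: sum_divide_distrib sum_distrib_left flip: sum.distrib) (rule sum_mono)
 qed
 have "0 = (LBINT x. (\<Sum>b\<in>Basis. pd b (g b) x))" using ig(2,3) by simp
 also have "... <= (LBINT x. (\<Sum>b\<in>Basis. (pd b \<phi> x)\<^sup>2) + (\<phi> x)\<^sup>2 * (laplacian w x / w x))"
  by (rule integral_mono) (use ig(2) i1 i2 gx in auto)
 finally show "0 <= (LBINT x. (\<Sum>b\<in>Basis. (pd b \<phi> x)\<^sup>2)) + (LBINT x. (\<phi> x)\<^sup>2 * (laplacian w x / w x))"
  using i1 i2 by simp
qed

text \<open>The tangent line at 1 of the convex function y^(-q). It yields the convexity of the
  nonlinearity and stands in for Jensen's inequality in \<open>gap_estimate\<close>.\<close>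

lemma powr_neg_tangent:
 fixes y q :: real assumes "y > 0" "q >= 0" shows "1 + q * (1 - y) <= y powr (- q)"
proof -
 have "1 + - q * ln y <= exp (- q * ln y)" by (rule exp_ge_add_one_self)
 moreover have "q * ln y <= q * (y - 1)" using assms ln_le_minus_one by (intro mult_left_mono) auto
 ultimately show ?thesis using assms by (simp add: powr_def algebra_simps)
qed

lemma nonlinearity_convex:
 assumes p: "p >= 0" and "u <= v" "v < 1"
 shows "p * (1 - u) powr (- p - 1) * (v - u) <= nonlinearity p v - nonlinearity p u"
proof -
 define s where "s = 1 - u"
 define y where "y = (1 - v) / s"
 have s: "s > 0" "y > 0" "1 - v = s * y" using assms by (auto simp: s_def y_def)
 have "s powr (- p) * (1 + p * (1 - y)) <= s powr (- p) * y powr (- p)"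
  using powr_neg_tangent[OF s(2) p] by (intro mult_left_mono) auto
 also have "... = nonlinearity p v" using s by (simp add: nonlinearity_powr powr_mult)
 finally have "s powr (- p) + p * (s powr (- p) * (1 - y)) <= nonlinearity p v" by (simp add: algebra_simps)
 moreover have "s powr (- p) = s powr (- p - 1) * s" using s(1) powr_add[of s "- p - 1" 1] by simp
 moreover have "s * (1 - y) = v - u" using s by (simp add: s_def algebra_simps)
 moreover have "nonlinearity p u = s powr (- p)" by (simp add: nonlinearity_powr s_def)
 ultimately show ?thesis by (simp add: s_def mult.assoc)
qed

section \<open>Positivity of supersolutions and stability of the smaller solution\<close>

context navier
begin

lemma compact_\<Omega>: "compact (closure \<Omega>)"
 using bounded_\<Omega> by (simp add: compact_closure)

lemma supersolution_nonneg:
 assumes "smooth_on \<Omega> g" "continuous_on UNIV g" "!!x. x \<notin> \<Omega> ==> g x = 0" "!!x. x \<in> \<Omega> ==> laplacian g x <= 0"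
 shows "g x >= 0"
proof (cases "x \<in> \<Omega>")
 case True
 show ?thesis
  by (rule maximum_principle[OF compact_\<Omega> closure_subset continuous_on_subset[OF assms(2)] assms(1,4)])
   (use assms(3) True closure_subset in auto)
qed (use assms(3) in simp)

lemma supersolution_pos:
 assumes "smooth_on \<Omega> g" "continuous_on UNIV g" "!!x. x \<notin> \<Omega> ==> g x = 0" "!!x. x \<in> \<Omega> ==> laplacian g x < 0" "x \<in> \<Omega>"
 shows "g x > 0"
 by (rule strict_maximum_principle(2)[OF compact_\<Omega> closure_subset continuous_on_subset[OF assms(2)] assms(1,4)])
  (use assms(3,5) closure_subset in auto)

text \<open>Picone's inequality for the difference to a larger solution and for its negative Laplacian;
 the two potentials are combined by the inequality of the means.\<close>

lemma stability:
 assumes n2: "navier \<Omega> p \<mu> U W" and lam: "0 <= lam" "lam < \<mu>" and p: "p >= 0" and le: "!!x. u x <= U x"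
  and K: "compact K" "K \<subseteq> \<Omega>" and \<phi>: "C1_on \<Omega> \<phi>" "!!x. x \<notin> K ==> \<phi> x = 0"
 defines "k \<equiv> %x. sqrt (lam * p) * (1 - u x) powr (- (p + 1) / 2)"
 shows "(LBINT x. k x * (\<phi> x)\<^sup>2) <= (LBINT x. (\<Sum>b\<in>Basis. (pd b \<phi> x)\<^sup>2))" "integrable lborel (%x. k x * (\<phi> x)\<^sup>2)"
proof -
 interpret n2: navier \<Omega> p \<mu> U W by (rule n2)
 define w where "w x = U x - u x" for x
 define \<zeta> where "\<zeta> x = W x - V x" for x
 have s: "smooth_on \<Omega> w" "smooth_on \<Omega> \<zeta>" unfolding w_def \<zeta>_def by (intro smooth_on_diff smooth n2.smooth)+
 have c: "continuous_on UNIV w" "continuous_on UNIV \<zeta>" unfolding w_def \<zeta>_def by (intro continuous_on_diff cont n2.cont)+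
 have lw: "laplacian w x = - \<zeta> x" if "x \<in> \<Omega>" for x
  unfolding w_def \<zeta>_def using laplacian_diff[OF n2.smooth(1) smooth(1) that] laplacian_u[OF that] n2.laplacian_u[OF that] by simp
 have l\<zeta>: "laplacian \<zeta> x = lam * nonlinearity p (u x) - \<mu> * nonlinearity p (U x)" if "x \<in> \<Omega>" for x
  unfolding \<zeta>_def using laplacian_diff[OF n2.smooth(2) smooth(2) that] laplacian_V[OF that] n2.laplacian_V[OF that] by simp
 \<comment> \<open>The strict sign comes from \<open>lam < \<mu>\<close>. It makes
   \<open>\<zeta>\<close>, and then \<open>w\<close>, positive inside \<Omega>, as the divisions in
   \<open>picone\<close> require.\<close>
 have l\<zeta>': "laplacian \<zeta> x < - (lam * (nonlinearity p (U x) - nonlinearity p (u x)))" if "x \<in> \<Omega>" for x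
 proof -
  have "nonlinearity p (U x) > 0" using n2.less_1[of x] by (simp add: nonlinearity_def)
  then have "lam * nonlinearity p (U x) < \<mu> * nonlinearity p (U x)" using lam(2) by simp
  then show ?thesis using l\<zeta>[OF that] by (simp add: algebra_simps)
 qed
 have \<zeta>: "\<zeta> x > 0" if "x \<in> \<Omega>" for x
 proof (rule supersolution_pos[OF s(2) c(2) _ _ that])
  show "laplacian \<zeta> x < 0" if "x \<in> \<Omega>" for x
   using l\<zeta>'[OF that] mult_nonneg_nonneg[OF lam(1), of "nonlinearity p (U x) - nonlinearity p (u x)"]
    nonlinearity_mono[OF p le[of x] n2.less_1] by linarith
 qed (simp add: \<zeta>_def off n2.off)
 have w: "w x > 0" if "x \<in> \<Omega>" for x
  by (rule supersolution_pos[OF s(1) c(1) _ _ that]) (use lw \<zeta> in \<open>auto simp: w_def off n2.off\<close>)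
 note P1 = picone[OF K \<phi> s(1) w] and P2 = picone[OF K \<phi> s(2) \<zeta>]
 have ck: "continuous_on UNIV k" unfolding k_def
  by (intro continuous_intros cont) (use less_1 in \<open>auto simp: less_imp_neq[THEN not_sym]\<close>)
 show ik: "integrable lborel (%x. k x * (\<phi> x)\<^sup>2)"
  by (rule continuous_support(2)[OF K open_\<Omega>])
   (use \<phi>(2) in \<open>auto intro!: continuous_intros C1_onD(4)[OF \<phi>(1)] continuous_on_subset[OF ck]\<close>)
 have pt: "(\<phi> x)\<^sup>2 * (laplacian w x / w x) + (\<phi> x)\<^sup>2 * (laplacian \<zeta> x / \<zeta> x) <= - 2 * (k x * (\<phi> x)\<^sup>2)" for x
 proof (cases "x \<in> \<Omega>")
  case True
  \<comment> \<open>\<open>k\<close> is the square root of \<open>lam\<close> times the derivative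
    of the nonlinearity at \<open>u x\<close>; by convexity this derivative times \<open>w\<close>
    bounds the increment of the nonlinearity from below.\<close>
  have k2: "(k x)\<^sup>2 = lam * p * (1 - u x) powr (- p - 1)"
  proof -
   have "((1 - u x) powr (- (p + 1) / 2))\<^sup>2 = (1 - u x) powr (- (p + 1) / 2 + - (p + 1) / 2)" unfolding power2_eq_square powr_add ..
   also have "- (p + 1) / 2 + - (p + 1) / 2 = - p - 1" by simp
   finally show ?thesis using lam p by (simp add: k_def power_mult_distrib)
  qed
  have "lam * (p * (1 - u x) powr (- p - 1) * (U x - u x)) <= lam * (nonlinearity p (U x) - nonlinearity p (u x))"
   by (intro mult_left_mono nonlinearity_convex p le n2.less_1 lam)
  then have "laplacian \<zeta> x <= - ((k x)\<^sup>2 * w x)" using l\<zeta>'[OF True] unfolding k2 w_def by (simp add: algebra_simps)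
  then have "laplacian \<zeta> x / \<zeta> x <= - ((k x)\<^sup>2 * w x) / \<zeta> x" using \<zeta>[OF True] by (intro divide_right_mono) auto
  \<comment> \<open>The ratio of \<open>\<zeta>\<close> to \<open>w\<close>, about which nothing is
    known, drops out: the product of the two terms on the right is the square of
    \<open>k x\<close>.\<close>
  moreover have "2 * k x <= \<zeta> x / w x + (k x)\<^sup>2 * w x / \<zeta> x"
   using zero_le_power2[of "\<zeta> x - k x * w x"] w[OF True] \<zeta>[OF True] by (simp add: power2_eq_square field_simps)
  ultimately have "laplacian w x / w x + laplacian \<zeta> x / \<zeta> x <= - 2 * k x" using lw[OF True] by simp
  from mult_left_mono[OF this zero_le_power2[of "\<phi> x"]] show ?thesis by (simp add: algebra_simps)
 next
  case False
  then have "\<phi> x = 0" using \<phi>(2) K(2) by blast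
  then show ?thesis by simp
 qed
 have "(LBINT x. (\<phi> x)\<^sup>2 * (laplacian w x / w x) + (\<phi> x)\<^sup>2 * (laplacian \<zeta> x / \<zeta> x)) <= (LBINT x. - 2 * (k x * (\<phi> x)\<^sup>2))"
  by (rule integral_mono) (use P1(2) P2(2) ik pt in auto)
 then show "(LBINT x. k x * (\<phi> x)\<^sup>2) <= (LBINT x. (\<Sum>b\<in>Basis. (pd b \<phi> x)\<^sup>2))"
  using P1(2,3) P2(2,3) by simp
qed

end


section \<open>Integral estimate\<close>

text \<open>Power of the positive part. As \<open>0 powr a = 0\<close> for every \<open>a\<close>,
  it vanishes for s <= 0 even when \<open>a = 0\<close>, and the exponents add without
  exceptions.\<close>

definition pp :: "real => real => real" where
 "pp a s = (max s 0) powr a"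

lemma pp_simps: "s <= 0 ==> pp a s = 0" "s > 0 ==> pp a s = s powr a" "pp a s >= 0"
 by (simp_all add: pp_def max_def)

lemma pp_add: "pp a s * pp b s = pp (a + b) s"
 by (simp add: pp_def powr_add)

lemma continuous_on_pp: "a > 0 ==> continuous_on S f ==> continuous_on S (%x. pp a (f x))"
 unfolding pp_def by (intro continuous_on_powr' continuous_intros) auto

lemma pp_DERIV:
 assumes a: "a > 1" shows "(pp a has_real_derivative a * pp (a - 1) s) (at s)"
proof -
 consider "s > 0" | "s < 0" | "s = 0" by linarith
 then show ?thesis
 proof cases
  case 1
  have "((%s. s powr a) has_real_derivative a * s powr (a - 1)) (at s)" by (rule has_real_derivative_powr[OF 1])
  then have "(pp a has_real_derivative a * s powr (a - 1)) (at s)"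
   by (rule has_field_derivative_transform_within_open[of _ _ _ "{0<..}"]) (use 1 in \<open>auto simp: pp_simps\<close>)
  then show ?thesis using 1 by (simp add: pp_simps)
 next
  case 2
  have "((%s. 0) has_real_derivative 0) (at s)" by simp
  then have "(pp a has_real_derivative 0) (at s)"
   by (rule has_field_derivative_transform_within_open[of _ _ _ "{..<0}"]) (use 2 in \<open>auto simp: pp_simps\<close>)
  then show ?thesis using 2 by (simp add: pp_simps)
 next
  case 3
  have "continuous_on UNIV (pp (a - 1))" using continuous_on_pp[OF _ continuous_on_id, of "a - 1"] a by simp
  then have "(pp (a - 1) \<longlongrightarrow> pp (a - 1) 0) (at 0)" unfolding continuous_on_def by blast
  then have lim: "(pp (a - 1) \<longlongrightarrow> 0) (at 0)" by (simp only: pp_simps(1)[OF order_refl])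
  have "\<bar>pp a h / h\<bar> <= pp (a - 1) h" if "h \<noteq> 0" for h
   using that a by (cases "h > 0") (simp_all add: pp_simps powr_diff)
  then have "\<forall>\<^sub>F h in at 0. norm (pp a h / h) <= pp (a - 1) h" unfolding eventually_at_filter by (intro always_eventually) simp
  from Lim_null_comparison[OF this lim] show ?thesis using 3 by (simp add: DERIV_def pp_simps)
 qed
qed

text \<open>For large \<open>V\<close> the hypothesis gives lam s^(-p) <= \<sigma> w (V + k), so
  both terms on the left have leading part \<sigma> w V^(2t), with coefficients \<tau> and a; the
  condition on \<open>t\<close> says \<tau> < a, and a fixed fraction of the negative term remains.
  For bounded \<open>V\<close> the hypothesis keeps \<open>s\<close> away from 0 and everything is
  bounded.\<close>

lemma pointwise_energy_bound:
 fixes p L t :: real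
 assumes p: "p > 1" and L: "L > 0" and t: "t > 1" "t\<^sup>2 < sqrt (2 * p / (p - 1)) * (2 * t - 1)"
 shows "\<exists>c>0. \<exists>C\<ge>0. \<forall>lam s V. L / 2 <= lam --> lam <= L --> 0 < s --> s <= 1 --> 0 <= V -->
  sqrt (lam / ((p - 1) / 2)) * (s powr (- ((p - 1) / 2)) - 1) <= V -->
  t\<^sup>2 / (2 * t - 1) * (lam * s powr (- p)) * pp (2 * t - 1) (V - 1) - sqrt (lam * p) * s powr (- (p + 1) / 2) * pp (2 * t) (V - 1)
   <= C - c * (s powr (- ((p + 1) / 2 + (p - 1) * t)) + V)"
proof -
 define m where "m = (p - 1) / 2"
 define a where "a = sqrt (2 * p / (p - 1))"
 define \<tau> where "\<tau> = t\<^sup>2 / (2 * t - 1)"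
 \<comment> \<open>The surviving term is w X^(2t) with w = s^(-(p+1)/2) and X = s^(-(p-1)/2), that
   is s^(-q).\<close>
 define q where "q = (p + 1) / 2 + (p - 1) * t"
 have m: "m > 0" "p - 1 = 2 * m" using p by (auto simp: m_def)
 have a2: "p = m * a\<^sup>2" "a > 0" using p by (auto simp: a_def m_def)
 have \<tau>: "\<tau> > 0" "\<tau> < a" using t(1) t(2)[folded a_def] by (simp_all add: \<tau>_def pos_divide_less_eq)
 \<comment> \<open>Bounds for \<open>k\<close> and \<open>\<sigma>\<close> over L/2 <= lam <= L;
   they make the final constants independent of \<open>lam\<close>.\<close>
 define c1 k0 k1 \<sigma>0 where "c1 = a - \<tau>" and "k0 = sqrt (L / 2 / m)" and "k1 = sqrt (L / m)" and "\<sigma>0 = sqrt (L / 2 * m)"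
 have pos: "c1 > 0" "k0 > 0" "k1 > 0" "\<sigma>0 > 0" using \<tau> m L by (auto simp: c1_def k0_def k1_def \<sigma>0_def)
 \<comment> \<open>Beyond this threshold half of \<open>c1\<close> absorbs the lower order term
   \<open>\<tau> * (1 + k1)\<close>.\<close>
 define B where "B = 2 * \<tau> * (1 + k1) / c1 + 1"
 have B: "B >= 1" "\<tau> * (1 + k1) <= c1 / 2 * B" using pos \<tau> by (auto simp: B_def field_simps)
 define D where "D = (2 / k0 + 1) powr (2 * t)"
 define c where "c = c1 / 2 * \<sigma>0 / (D + 2)"
 have D: "D >= 0" by (simp add: D_def)
 have "D + 2 > 0" using D by linarith
 then have c: "c > 0" "c * (D + 2) = c1 / 2 * \<sigma>0"
  using pos nonzero_eq_divide_eq[THEN iffD1, OF _ c_def] by (simp add: c_def, simp)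
 define X0 where "X0 = (B + 1) / k0 + 1"
 define C where "C = \<tau> * L * X0 powr (p / m) * B powr (2 * t - 1) + c * (X0 powr (q / m) + B + 1)"
 have C0: "C >= 0" using \<tau> L B c by (auto simp: C_def intro!: add_nonneg_nonneg mult_nonneg_nonneg)
 have "\<tau> * (lam * s powr (- p)) * pp (2 * t - 1) (V - 1) - sqrt (lam * p) * s powr (- (p + 1) / 2) * pp (2 * t) (V - 1)
   <= C - c * (s powr (- q) + V)"
  if lam: "L / 2 <= lam" "lam <= L" and s: "0 < s" "s <= 1" and V: "0 <= V" "sqrt (lam / m) * (s powr (- m) - 1) <= V" for lam s V
 proof -
  define X where "X = s powr (- m)"
  define w where "w = s powr (- (p + 1) / 2)"
  define k where "k = sqrt (lam / m)"
  define \<sigma> where "\<sigma> = sqrt (lam * m)"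
  have lam0: "lam > 0" using lam L by linarith
  have k: "k0 <= k" "k <= k1" "\<sigma>0 <= \<sigma>" "\<sigma> > 0" "k > 0"
  proof -
   have "L / 2 / m <= lam / m" "lam / m <= L / m" "L / 2 * m <= lam * m"
    by (intro divide_right_mono mult_right_mono lam less_imp_le m(1))+
   then show "k0 <= k" "k <= k1" "\<sigma>0 <= \<sigma>" unfolding k0_def k_def k1_def \<sigma>0_def \<sigma>_def by simp_all
   show "\<sigma> > 0" "k > 0" using lam0 m by (simp_all add: \<sigma>_def k_def)
  qed
  have X1: "X >= 1" unfolding X_def using s m powr_mono2'[of "- m" s 1] by simp
  have w1: "w >= 1" unfolding w_def using s p powr_mono2'[of "- (p + 1) / 2" s 1] by simp
  have sl: "lam = \<sigma> * k" using lam0 m by (simp add: \<sigma>_def k_def flip: real_sqrt_mult)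
  have sp: "sqrt (lam * p) = \<sigma> * a" using a2 lam0 m by (simp add: \<sigma>_def real_sqrt_mult)
  have swX: "s powr (- p) = w * X" unfolding w_def X_def by (simp add: m_def field_simps flip: powr_add)
  have sq: "s powr (- q) = w * X powr (2 * t)" unfolding w_def X_def powr_powr powr_add[symmetric] q_def
   by (rule arg_cong[where f = "%x. s powr x"]) (simp add: m_def field_simps)
  have kX: "k * X <= V + k" using V(2) by (simp add: k_def X_def algebra_simps)
  have XV: "X <= V / k0 + 1"
  proof -
   have "k0 * (X - 1) <= k * (X - 1)" using k X1 by (intro mult_right_mono) auto
   also have "... <= V" using kX by (simp add: algebra_simps)
   finally show ?thesis using pos by (simp add: field_simps)
  qed
  show ?thesis
  proof (cases "V - 1 >= B")
   case True
   define A where "A = V - 1"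
   have A: "A >= B" "A >= 1" "A > 0" "V = A + 1" using True B by (auto simp: A_def)
   have At: "A powr (2 * t) = A powr (2 * t - 1) * A" using A(3) powr_add[of A "2 * t - 1" 1] by simp
   define P where "P = A powr (2 * t - 1)"
   have P: "P >= 0" by (simp add: P_def)
   have "lam * s powr (- p) = \<sigma> * w * (k * X)" by (simp add: swX sl mult_ac)
   also have "... <= \<sigma> * w * (A + 1 + k1)" using kX k w1 A by (intro mult_left_mono) auto
   finally have "\<tau> * (lam * s powr (- p)) * P <= \<tau> * (\<sigma> * w * (A + 1 + k1)) * P"
    using \<tau> P by (intro mult_right_mono mult_left_mono) auto
   then have "\<tau> * (lam * s powr (- p)) * P - sqrt (lam * p) * w * (P * A) <= (\<sigma> * w * P) * (\<tau> * (1 + k1) - c1 * A)"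
    by (simp add: sp c1_def algebra_simps)
   also have "... <= (\<sigma> * w * P) * (- (c1 / 2) * A)"
   proof (rule mult_left_mono)
    have "c1 / 2 * B <= c1 / 2 * A" using A pos by (intro mult_left_mono) auto
    then show "\<tau> * (1 + k1) - c1 * A <= - (c1 / 2) * A" using B(2) by simp
   qed (use k w1 P in simp)
   also have "... = - (c1 / 2 * \<sigma>) * (w * (P * A))" by simp
   also have "... <= - (c1 / 2 * \<sigma>0) * (w * (P * A))"
    using k pos w1 P A by (intro mult_right_mono) auto
   also have "... <= - c * (s powr (- q) + V)"
   proof -
    have "X <= A * (2 / k0 + 1)"
    proof -
     have "V / k0 <= 2 * A / k0" using A pos by (intro divide_right_mono) auto
     then show ?thesis using XV A by (simp add: algebra_simps)
    qed
    then have "X powr (2 * t) <= (A * (2 / k0 + 1)) powr (2 * t)" using X1 t by (intro powr_mono2) auto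
    also have "... = A powr (2 * t) * D" using A pos by (simp add: D_def powr_mult)
    also have "... = D * (P * A)" unfolding At P_def by simp
    finally have 1: "s powr (- q) <= w * (D * (P * A))" unfolding sq using w1 by (intro mult_left_mono) auto
    have "A <= P * A" using A t ge_one_powr_ge_zero[of A "2 * t - 1"] by (simp add: P_def)
    then have "V <= 2 * (P * A)" using A by linarith
    also have "... <= w * (2 * (P * A))" using mult_right_mono[OF w1, of "2 * (P * A)"] P A by simp
    finally have "s powr (- q) + V <= (D + 2) * (w * (P * A))" using 1 by (simp add: algebra_simps)
    then have "c * (s powr (- q) + V) <= c * ((D + 2) * (w * (P * A)))" using c by (intro mult_left_mono) auto
    also have "... = (c * (D + 2)) * (w * (P * A))" by (simp only: mult.assoc)
    finally show ?thesis unfolding c(2) by simp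
   qed
   finally show ?thesis using C0 A by (simp add: pp_simps P_def At w_def)
  next
   case False
   then have VB: "V <= B + 1" by simp
   have "V / k0 <= (B + 1) / k0" using VB pos by (intro divide_right_mono) auto
   then have X: "X <= X0" using XV by (simp add: X0_def)
   have "pp (2 * t - 1) (V - 1) <= B powr (2 * t - 1)"
    unfolding pp_def using False B t by (intro powr_mono2) auto
   moreover have "s powr (- p) <= X0 powr (p / m)"
   proof -
    have "s powr (- p) = X powr (p / m)" using m by (simp add: X_def powr_powr)
    then show ?thesis using X X1 p m by (simp add: powr_mono2)
   qed
   moreover have q: "s powr (- q) <= X0 powr (q / m)"
   proof -
    have "s powr (- q) = X powr (q / m)" using m by (simp add: X_def powr_powr)
    then show ?thesis using X X1 p t m by (simp add: powr_mono2 q_def add_nonneg_nonneg)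
   qed
   ultimately have "\<tau> * (lam * s powr (- p)) * pp (2 * t - 1) (V - 1) <= \<tau> * (L * X0 powr (p / m)) * B powr (2 * t - 1)"
    using \<tau> lam lam0 L by (intro mult_mono) (auto simp: pp_simps)
   moreover have "sqrt (lam * p) * s powr (- (p + 1) / 2) * pp (2 * t) (V - 1) >= 0" using lam0 p by (simp add: pp_simps)
   moreover have "c * (s powr (- q) + V) <= c * (X0 powr (q / m) + B + 1)" using q VB c by (intro mult_left_mono) auto
   ultimately show ?thesis by (simp add: C_def mult.assoc)
  qed
 qed
 then show ?thesis using c(1) C0 unfolding \<tau>_def q_def m_def by blast
qed

context navier
begin

lemma nonneg: assumes "lam >= 0" shows "V x >= 0" "u x >= 0"
proof -
 show V: "V x >= 0" for x
  by (rule supersolution_nonneg[OF smooth(2) cont(2) off(2)]) (use laplacian_V assms nonlinearity_nonneg in simp_all)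
 show "u x >= 0" by (rule supersolution_nonneg[OF smooth(1) cont(1) off(1)]) (use laplacian_u V in simp_all)
qed

text \<open>The exponent and the factor k = sqrt (lam / m) are fixed by 2 m + 1 = p and k^2 m = lam.
  Where V < k (g - 1), with g = (1 - u)^(-m), the Laplacian of k g is at least - lam (1 - u)^(-p),
  which is the Laplacian of V.\<close>

lemma V_lower_bound:
 assumes lam: "lam >= 0" and p: "p > 1"
 defines "m \<equiv> (p - 1) / 2"
 shows "sqrt (lam / m) * ((1 - u x) powr (- m) - 1) <= V x"
proof (cases "x \<in> \<Omega>")
 case True
 have m: "m > 0" "p = 2 * m + 1" using p by (auto simp: m_def field_simps)
 define k where "k = sqrt (lam / m)"
 have k: "k >= 0" "k * k * m = lam" using lam m by (auto simp: k_def)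
 define g where "g x = (1 - u x) powr (- m)" for x
 define Z where "Z x = V x - k * (g x - 1)" for x
 have cZ: "continuous_on UNIV Z" unfolding Z_def g_def
  by (intro continuous_intros cont) (use less_1 in \<open>auto simp: less_imp_neq[THEN not_sym]\<close>)
 have sg: "smooth_on \<Omega> g" unfolding g_def
  by (rule smooth_on_real_comp[OF smooth_on_powr smooth_on_diff[OF smooth_on_const[OF open_\<Omega>] smooth(1)]]) (use less_1 in auto)
 have sg1: "smooth_on \<Omega> (%x. g x - 1)" by (rule smooth_on_diff[OF sg smooth_on_const[OF open_\<Omega>]])
 have sZ: "smooth_on \<Omega> Z" unfolding Z_def[abs_def] by (rule smooth_on_diff[OF smooth(2) smooth_on_cmult[OF sg1]])
 \<comment> \<open>Superharmonicity of \<open>Z\<close> is available only where \<open>Z\<close> is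
   negative. Elsewhere the claim holds already, so the maximum principle is applied on this
   set.\<close>
 define R where "R = \<Omega> \<inter> {x. Z x < 0}"
 have oR: "open R" unfolding R_def by (intro open_Int open_\<Omega> open_Collect_less cZ continuous_on_const)
 have "0 <= Z x"
 proof (rule maximum_principle[OF compact_\<Omega> _ continuous_on_subset[OF cZ subset_UNIV] smooth_on_subset[OF sZ oR]])
  show "R \<subseteq> closure \<Omega>" using closure_subset[of \<Omega>] by (auto simp: R_def)
  show "R \<subseteq> \<Omega>" by (auto simp: R_def)
  show "x \<in> closure \<Omega>" using True closure_subset by blast
  show "Z y >= 0" if "y \<in> closure \<Omega> - R" for y
   using that off[of y] by (cases "y \<in> \<Omega>") (auto simp: R_def Z_def g_def)
  fix y assume "y \<in> R"
  then have y: "y \<in> \<Omega>" "Z y < 0" by (auto simp: R_def)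
  define s where "s = 1 - u y"
  have s: "s > 0" using less_1[of y] by (simp add: s_def)
  have "laplacian g y = m * (1 - u y) powr (- m - 1) * laplacian u y + m * (m + 1) * (1 - u y) powr (- m - 1 - 1) * (\<Sum>b\<in>Basis. (pd b u y)\<^sup>2)"
   unfolding g_def
  proof (rule laplacian_real_comp[where T = "{..<1}" and F = "%t. (1 - t) powr (- m)" and ?F1.0 = "%t. m * (1 - t) powr (- m - 1)"
     and ?F2.0 = "%t. m * (m + 1) * (1 - t) powr (- m - 1 - 1)", OF smooth(1) y(1)])
   fix t :: real assume "t \<in> {..<1}"
   then show "((%t. (1 - t) powr (- m)) has_real_derivative m * (1 - t) powr (- m - 1)) (at t)"
    "((%t. m * (1 - t) powr (- m - 1)) has_real_derivative m * (m + 1) * (1 - t) powr (- m - 1 - 1)) (at t)"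
    by (auto intro!: derivative_eq_intros simp: algebra_simps)
  qed (use less_1 in simp)
  then have lg: "laplacian g y >= - (m * s powr (- m - 1) * V y)"
   using m(1) laplacian_u[OF y(1)] by (simp add: s_def sum_nonneg)
  have "k * (m * s powr (- m - 1) * V y) <= k * (m * s powr (- m - 1) * (k * s powr (- m)))"
   using y(2) k(1) m(1) by (intro mult_left_mono) (auto simp: Z_def g_def s_def algebra_simps)
  also have "... = (k * k * m) * (s powr (- m - 1) * s powr (- m))" by simp
  also have "s powr (- m - 1) * s powr (- m) = s powr (- p)" unfolding powr_add[symmetric] using m(2) by simp
  also have "(k * k * m) * s powr (- p) = - laplacian V y" unfolding k(2) using laplacian_V[OF y(1)] by (simp add: nonlinearity_powr s_def)
  finally have "k * (m * s powr (- m - 1) * V y) <= - laplacian V y" .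
  moreover have "laplacian Z y = laplacian V y - k * laplacian g y"
   unfolding Z_def[abs_def] using laplacian_diff[OF smooth(2) smooth_on_cmult[OF sg1] y(1)] laplacian_cmult[OF sg1 y(1)]
    laplacian_diff[OF sg smooth_on_const[OF open_\<Omega>] y(1)] by simp
  moreover have "k * (- (m * s powr (- m - 1) * V y)) <= k * laplacian g y" using lg k(1) by (intro mult_left_mono)
  ultimately show "laplacian Z y <= 0" by simp
 qed
 then show ?thesis by (simp add: Z_def k_def g_def)
qed (simp add: off)

lemma superlevel:
 assumes g: "continuous_on UNIV g" "!!x. x \<notin> \<Omega> ==> g x = 0" and c: "c > 0"
 shows "compact {x. c <= g x}" "{x. c <= (g x :: real)} \<subseteq> \<Omega>"
proof -
 show s: "{x. c <= g x} \<subseteq> \<Omega>" using g(2) c by force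
 have "closed {x. c <= g x}" by (intro closed_Collect_le continuous_on_const g(1))
 then show "compact {x. c <= g x}" using bounded_subset[OF bounded_\<Omega> s] by (simp add: compact_eq_bounded_closed)
qed

text \<open>Multiplying the equation for \<open>V\<close> by (V - 1)_+^(2t-1) expresses the
  Dirichlet integral of (V - 1)_+^t as t^2 / (2t-1) times the integral of lam (1 - u)^(-p) (V -
  1)_+^(2t-1); stability bounds the same Dirichlet integral from below. All supports lie in the
  compact set where V >= 1.\<close>

lemma energy:
 assumes n2: "navier \<Omega> p \<mu> U W" and lam: "0 <= lam" "lam < \<mu>" and p: "p >= 0" and le: "!!x. u x <= U x" and t: "t > 1"
 defines "E \<equiv> %x. t\<^sup>2 / (2 * t - 1) * (lam * (1 - u x) powr (- p)) * pp (2 * t - 1) (V x - 1)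
  - sqrt (lam * p) * (1 - u x) powr (- (p + 1) / 2) * pp (2 * t) (V x - 1)"
 shows "integrable lborel E" "0 <= (LBINT x. E x)"
proof -
 let ?K = "{x. 1 <= V x}"
 note K = superlevel[OF cont(2) off(2) zero_less_one]
 have D: "((%s. pp a (s - 1)) has_real_derivative a * pp (a - 1) (s - 1)) (at s)" if "a > 1" for a s
  by (rule DERIV_cong[OF DERIV_chain2[OF pp_DERIV[OF that]]]) (auto intro!: derivative_eq_intros)
 have C1: "C1_on \<Omega> (%x. pp a (V x - 1))" "!!x v. x \<in> \<Omega> ==> pd v (%x. pp a (V x - 1)) x = a * pp (a - 1) (V x - 1) * pd v V x" if "a > 1" for a
  by (rule C1_real_comp[OF smooth_C1[OF smooth(2)] D[OF that]]; use that in \<open>auto intro!: continuous_on_mult continuous_on_pp continuous_intros\<close>)+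
 define \<phi> where "\<phi> x = pp t (V x - 1)" for x
 have \<phi>: "C1_on \<Omega> \<phi>" "!!x. x \<notin> ?K ==> \<phi> x = 0" unfolding \<phi>_def by (auto intro!: C1(1) t simp: pp_simps)
 define g where "g b x = pp (2 * t - 1) (V x - 1) * pd b V x" for b x
 have t2: "2 * t - 1 > 1" using t by simp
 have g: "C1_on \<Omega> (g b)" "!!x. x \<notin> ?K ==> g b x = 0" for b
  unfolding g_def by (rule C1_mult[OF C1(1)[OF t2] smooth_C1[OF smooth_on_pd[OF smooth(2)]]]) (simp add: pp_simps)
 define k where "k x = sqrt (lam * p) * (1 - u x) powr (- (p + 1) / 2)" for x
 define h where "h x = lam * (1 - u x) powr (- p) * pp (2 * t - 1) (V x - 1)" for x
 note st = stability[OF n2 lam p le K \<phi>, folded k_def]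
 have ih: "integrable lborel h" unfolding h_def
  by (rule continuous_support(2)[OF K open_\<Omega>])
   (use t less_1 in \<open>auto intro!: continuous_intros continuous_on_pp continuous_on_subset[OF cont(1)] continuous_on_subset[OF cont(2)]
    simp: pp_simps less_imp_neq[THEN not_sym]\<close>)
 have E: "E x = t\<^sup>2 / (2 * t - 1) * h x - k x * (\<phi> x)\<^sup>2" for x
  unfolding E_def h_def k_def \<phi>_def power2_eq_square pp_add by (simp add: mult.assoc)
 show "integrable lborel E" unfolding E using ih st(2) by simp
 have pt: "(\<Sum>b\<in>Basis. pd b (g b) x) = (2 * t - 1) / t\<^sup>2 * (\<Sum>b\<in>Basis. (pd b \<phi> x)\<^sup>2) - h x" for x
 proof (cases "x \<in> ?K")
  case True
  then have x: "x \<in> \<Omega>" using K(2) by blast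
  have "pd b (g b) x = (2 * t - 1) / t\<^sup>2 * (pd b \<phi> x)\<^sup>2 + pp (2 * t - 1) (V x - 1) * pd b (pd b V) x" for b
  proof -
   have "pp (2 * t - 1 - 1) (V x - 1) = (pp (t - 1) (V x - 1))\<^sup>2" unfolding power2_eq_square pp_add by simp
   then have "pd b (g b) x = (2 * t - 1) * ((pp (t - 1) (V x - 1))\<^sup>2 * (pd b V x)\<^sup>2) + pp (2 * t - 1) (V x - 1) * pd b (pd b V) x"
    unfolding g_def
    by (subst pd_mult[OF C1_onD(2)[OF C1(1)[OF t2] x] smooth_on_differentiable[OF smooth_on_pd[OF smooth(2)] x]])
     (simp add: C1(2)[OF t2 x] power2_eq_square)
   moreover have "(pd b \<phi> x)\<^sup>2 = t\<^sup>2 * ((pp (t - 1) (V x - 1))\<^sup>2 * (pd b V x)\<^sup>2)"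
    unfolding \<phi>_def C1(2)[OF t x] by (simp add: power_mult_distrib)
   ultimately show ?thesis using t by simp
  qed
  then have "(\<Sum>b\<in>Basis. pd b (g b) x) = (2 * t - 1) / t\<^sup>2 * (\<Sum>b\<in>Basis. (pd b \<phi> x)\<^sup>2) + pp (2 * t - 1) (V x - 1) * laplacian V x"
   by (simp only: sum.distrib sum_distrib_left laplacian_pd)
  then show ?thesis using laplacian_V[OF x] by (simp add: h_def nonlinearity_powr)
 next
  case False
  then show ?thesis using integral_pd(1)[OF K g(2,1)] integral_pd(1)[OF K \<phi>(2,1)] by (simp add: h_def pp_simps)
 qed
 note P = picone(1)[OF K \<phi> smooth_on_const[OF open_\<Omega>, of 1]]
 have "0 = (LBINT x. (\<Sum>b\<in>Basis. pd b (g b) x))" using integral_pd(2,3)[OF K g(2,1)] by simp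
 also have "... = (2 * t - 1) / t\<^sup>2 * (LBINT x. (\<Sum>b\<in>Basis. (pd b \<phi> x)\<^sup>2)) - (LBINT x. h x)"
  unfolding pt using P ih by simp
 finally have "(LBINT x. (\<Sum>b\<in>Basis. (pd b \<phi> x)\<^sup>2)) = t\<^sup>2 / (2 * t - 1) * (LBINT x. h x)"
  using t by (simp add: field_simps)
 then show "0 <= (LBINT x. E x)" unfolding E using st ih by simp
qed

end


section \<open>Mean values\<close>

text \<open>Weighted means replace means over balls, so that integration by parts has no surface
  terms. \<open>Xi\<close> is normalised by 1/6 to have gradient - chi y * y.\<close>

definition chi :: "'a::euclidean_space => real" where "chi y = pp 2 (1 - y \<bullet> y)"
definition Xi :: "'a::euclidean_space => real" where "Xi y = pp 3 (1 - y \<bullet> y) / 6"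

lemma chi_Xi:
 fixes y :: "'a::euclidean_space"
 shows "0 <= chi y" "chi y <= 1" "0 <= Xi y" "Xi y <= 1" "y \<notin> cball 0 1 ==> chi y = 0" "y \<notin> cball 0 1 ==> Xi y = 0"
  and "continuous_on A (chi :: 'a => real)" "continuous_on A (Xi :: 'a => real)"
  and "integrable lborel (chi :: 'a => real)" "integrable lborel (Xi :: 'a => real)"
  and "C1_on UNIV (Xi :: 'a => real)" "pd v Xi y = - (chi y * (y \<bullet> v))"
proof -
 have p1: "pp a (1 - y \<bullet> y) <= 1" if "a > 0" for a and y :: 'a
  unfolding pp_def using that by (intro powr_le1) auto
 show b: "0 <= chi y" "chi y <= 1" "0 <= Xi y" "Xi y <= 1" for y :: 'a
  using p1[of 2 y] p1[of 3 y] by (auto simp: chi_def Xi_def pp_simps)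
 have "1 <= y \<bullet> y" if "y \<notin> cball 0 1" for y :: 'a
  using that power_mono[of 1 "norm y" 2] by (simp add: power2_norm_eq_inner)
 then show z: "y \<notin> cball 0 1 ==> chi y = 0" "y \<notin> cball 0 1 ==> Xi y = 0" for y :: 'a
  by (simp_all add: chi_def Xi_def pp_simps)
 show c: "continuous_on A (chi :: 'a => real)" "continuous_on A (Xi :: 'a => real)" for A
  unfolding chi_def Xi_def by (intro continuous_intros continuous_on_pp; simp)+
 show "integrable lborel (chi :: 'a => real)" "integrable lborel (Xi :: 'a => real)"
  by (rule integrable_compact_support[OF c(1) bounded_cball[of 0 1] z(1)], assumption)
   (rule integrable_compact_support[OF c(2) bounded_cball[of 0 1] z(2)])
 have D: "((%s. pp 3 (1 - s) / 6) has_real_derivative - (pp 2 (1 - s) / 2)) (at s)" for s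
 proof -
  have "((%s. 1 - s) has_real_derivative - 1) (at s)" by (auto intro!: derivative_eq_intros)
  from DERIV_cdivide[OF DERIV_chain2[OF pp_DERIV this, of 3], of 6] show ?thesis by simp
 qed
 have s: "C1_on UNIV (%y::'a. (y - 0) \<bullet> (y - 0))" by (rule smooth_C1[OF smooth_on_norm_sq]) simp
 note C = C1_real_comp[OF s D continuous_on_minus[OF continuous_on_divide[OF continuous_on_pp continuous_on_const]]]
 have "C1_on UNIV (%y::'a. pp 3 (1 - (y - 0) \<bullet> (y - 0)) / 6)" by (rule C(1)) (auto intro!: continuous_intros)
 then show "C1_on UNIV (Xi :: 'a => real)" by (simp add: Xi_def[abs_def])
 have "pd v (%y::'a. pp 3 (1 - (y - 0) \<bullet> (y - 0)) / 6) y = - (pp 2 (1 - (y - 0) \<bullet> (y - 0)) / 2) * pd v (%y. (y - 0) \<bullet> (y - 0)) y"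
  by (rule C(2)) (auto intro!: continuous_intros)
 then show "pd v Xi y = - (chi y * (y \<bullet> v))"
  unfolding pd_norm_sq by (simp add: Xi_def[abs_def] chi_def inner_commute)
qed

lemma integral_chi_pos: "(LBINT y. chi (y :: 'a::euclidean_space)) > 0"
proof (rule ccontr)
 assume "\<not> ?thesis"
 then have "(LBINT y. chi (y :: 'a)) = 0" using Bochner_Integration.integral_nonneg[of lborel "chi :: 'a => real"] chi_Xi(1) by fastforce
 then have "AE y in lborel. chi (y :: 'a) = 0" using integral_nonneg_eq_0_iff_AE[OF chi_Xi(9)] chi_Xi(1) by auto
 then obtain N where N: "{y :: 'a. chi y \<noteq> 0} \<subseteq> N" "N \<in> null_sets lborel" unfolding eventually_ae_filter by auto
 have "ball 0 1 \<subseteq> {y :: 'a. chi y \<noteq> 0}"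
 proof
  fix y :: 'a assume "y \<in> ball 0 1"
  then have "(norm y)\<^sup>2 < 1" by (simp add: power_less_one_iff)
  then show "y \<in> {y. chi y \<noteq> 0}" by (simp add: chi_def pp_simps power2_norm_eq_inner)
 qed
 then have "negligible (ball (0::'a) 1)"
  using N negligible_subset[of N "ball 0 1"] by (auto simp: negligible_iff_null_sets null_sets_completionI)
 then show False using open_not_negligible[of "ball (0::'a) 1"] by simp
qed

lemma lborel_integral_affine:
 fixes f :: "'a::euclidean_space => real"
 assumes f: "integrable lborel f" and \<rho>: "\<rho> > 0"
 shows "integrable lborel (%y. f (x + \<rho> *\<^sub>R y))" "(LBINT y. f (x + \<rho> *\<^sub>R y)) = (LBINT y. f y) / \<rho> ^ DIM('a)"
proof -
 have l: "lborel = density (distr lborel borel (%y. x + \<rho> *\<^sub>R y)) (%_. ennreal (\<rho> ^ DIM('a)))"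
  using lborel_affine[of \<rho> x] \<rho> by simp
 have m: "f \<in> borel_measurable borel" using borel_measurable_integrable[OF f] by simp
 have "integrable (density (distr lborel borel (%y. x + \<rho> *\<^sub>R y)) (%_. ennreal (\<rho> ^ DIM('a)))) f" using f l by simp
 then have i: "integrable lborel (%y. \<rho> ^ DIM('a) * f (x + \<rho> *\<^sub>R y))"
  using m \<rho> by (simp add: integrable_density integrable_distr_eq)
 then show "integrable lborel (%y. f (x + \<rho> *\<^sub>R y))" using \<rho> by simp
 have "(LBINT y. f y) = (\<integral>y. f y \<partial>density (distr lborel borel (%y. x + \<rho> *\<^sub>R y)) (%_. ennreal (\<rho> ^ DIM('a))))" using l by simp
 also have "... = (LBINT y. \<rho> ^ DIM('a) * f (x + \<rho> *\<^sub>R y))"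
  using m \<rho> by (simp add: integral_density integral_distr)
 finally show "(LBINT y. f (x + \<rho> *\<^sub>R y)) = (LBINT y. f y) / \<rho> ^ DIM('a)" using \<rho> by simp
qed

text \<open>Since \<open>Xi\<close> has gradient \<open>- chi y * y\<close>, integration by parts turns the radial derivative into a Laplacian.\<close>

lemma mean_DERIV:
 fixes \<omega> :: "'a::euclidean_space => real"
 assumes \<omega>: "C1_on UNIV \<omega>" "!!b. C1_on UNIV (pd b \<omega>)"
 shows "((%\<rho>. LBINT y. chi y * \<omega> (x + \<rho> *\<^sub>R y)) has_real_derivative \<rho> * (LBINT y. Xi y * laplacian \<omega> (x + \<rho> *\<^sub>R y))) (at \<rho>)"
  and "integrable lborel (%y. Xi y * laplacian \<omega> (x + \<rho> *\<^sub>R y))"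
proof -
 let ?B = "cbox (- One) One :: 'a set"
 have B: "chi y = 0" if y: "y \<notin> ?B" for y :: 'a
 proof -
  obtain b where b: "b \<in> Basis" "\<not> (- 1 <= y \<bullet> b & y \<bullet> b <= 1)" using y by (auto simp: mem_box)
  have "norm y > 1" using Basis_le_norm[OF b(1), of y] b(2) by linarith
  then show ?thesis by (intro chi_Xi(5)) simp
 qed
 have cc: "continuous_on A (%z. f (x + fst z *\<^sub>R snd z))" "continuous_on A' (%y. f (x + \<rho> *\<^sub>R y))"
  if "C1_on UNIV f" for f A A' and \<rho> :: real
  by (intro continuous_on_compose2[OF C1_onD(4)[OF that]] continuous_intros subset_UNIV)+
 have sup: "integrable lborel h" if "continuous_on UNIV h" "!!y. y \<notin> cball 0 1 ==> h y = 0" for h :: "'a => real"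
  by (rule integrable_compact_support[OF that(1) bounded_cball that(2)])
 define fx where "fx \<rho> y = chi y * (\<Sum>b\<in>Basis. (y \<bullet> b) * pd b \<omega> (x + \<rho> *\<^sub>R y))" for \<rho> y
 have iM: "integrable lborel (%y. chi y * \<omega> (x + \<rho> *\<^sub>R y))" for \<rho>
  by (rule sup) (auto intro!: continuous_on_mult cc(2) \<omega> chi_Xi)
 have ifx: "integrable lborel (fx \<rho>)" for \<rho>
  unfolding fx_def by (rule sup) (auto intro!: continuous_on_mult continuous_on_sum cc(2) \<omega> chi_Xi continuous_intros)
 have "((%\<rho>. integral ?B (%y. chi y * \<omega> (x + \<rho> *\<^sub>R y))) has_field_derivative integral ?B (fx \<rho>)) (at \<rho> within UNIV)"
 proof (rule leibniz_rule_field_derivative)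
  show "((%\<rho>. chi y * \<omega> (x + \<rho> *\<^sub>R y)) has_field_derivative fx s y) (at s within UNIV)" for s y
  proof -
   have d: "\<omega> differentiable at z" for z by (rule C1_onD(2)[OF \<omega>(1)]) simp
   show ?thesis unfolding fx_def pd_lincomb[OF d, of y, symmetric] using DERIV_cmult[OF pd_line_DERIV[OF d]] by simp
  qed
  show "(%y. chi y * \<omega> (x + \<rho> *\<^sub>R y)) integrable_on ?B" for \<rho>
   by (intro integrable_continuous continuous_on_mult cc(2) \<omega> chi_Xi)
  have "continuous_on (UNIV \<times> ?B) (%z. fx (fst z) (snd z))" unfolding fx_def
   by (intro continuous_on_mult continuous_on_sum cc(1) \<omega> continuous_intros continuous_on_compose2[OF chi_Xi(7)[where A = UNIV]] subset_UNIV)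
  then show "continuous_on (UNIV \<times> ?B) (%(\<rho>, y). fx \<rho> y)" by (simp add: case_prod_unfold)
 qed auto
 then have D: "((%\<rho>. LBINT y. chi y * \<omega> (x + \<rho> *\<^sub>R y)) has_real_derivative (LBINT y. fx \<rho> y)) (at \<rho>)"
  using lborel_integral_eq_cbox[OF iM, of "- One" One] lborel_integral_eq_cbox[OF ifx, of "- One" One \<rho>] B by (simp add: fx_def)
 \<comment> \<open>The divergence of this field contains the Laplacian weighted by \<open>Xi\<close>
   and, through the gradient of \<open>Xi\<close>, the radial derivative weighted by
   \<open>chi\<close>; its integral is zero.\<close>
 define g where "g b y = Xi y * pd b \<omega> (x + \<rho> *\<^sub>R y)" for b y
 have C: "C1_on UNIV (%y. f (x + \<rho> *\<^sub>R y))" "pd v (%y. f (x + \<rho> *\<^sub>R y)) y = \<rho> * pd v f (x + \<rho> *\<^sub>R y)" if f: "C1_on UNIV f" for f v y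
 proof -
  have h: "((%y. x + \<rho> *\<^sub>R y) has_derivative (%h. \<rho> *\<^sub>R h)) (at y)" for y by (auto intro!: derivative_eq_intros)
  have d: "f differentiable at z" for z by (rule C1_onD(2)[OF f]) simp
  have p: "pd v (%y. f (x + \<rho> *\<^sub>R y)) y = \<rho> * pd v f (x + \<rho> *\<^sub>R y)" for v y using pd_comp(2)[OF h d, of v] pd_scaleR[OF d] by simp
  then show "pd v (%y. f (x + \<rho> *\<^sub>R y)) y = \<rho> * pd v f (x + \<rho> *\<^sub>R y)" .
  have "continuous_on UNIV (pd v (%y. f (x + \<rho> *\<^sub>R y)))" for v
   unfolding p[abs_def] by (intro continuous_intros continuous_on_compose2[OF C1_onD(3)[OF f]] subset_UNIV)
  then show "C1_on UNIV (%y. f (x + \<rho> *\<^sub>R y))" unfolding C1_on_def using pd_comp(1)[OF h d] by simp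
 qed
 have g1: "C1_on UNIV (g b)" for b unfolding g_def by (intro C1_mult chi_Xi C(1) \<omega>)
 have g0: "g b y = 0" if "y \<notin> cball 0 1" for b y using chi_Xi(6)[OF that] by (simp add: g_def)
 have ig: "integrable lborel (pd b (g b))" "(LBINT y. pd b (g b) y) = 0" if "b \<in> Basis" for b
  by (rule integral_pd(2,3)[OF compact_cball[of 0 1] subset_UNIV _ g1 that], rule g0, assumption)+
 have cl: "continuous_on UNIV (%y. laplacian \<omega> (x + \<rho> *\<^sub>R y))"
  unfolding laplacian_pd by (intro continuous_on_sum continuous_on_compose2[OF C1_onD(3)[OF \<omega>(2)]] continuous_intros subset_UNIV)
 show il: "integrable lborel (%y. Xi y * laplacian \<omega> (x + \<rho> *\<^sub>R y))"
  by (rule sup[OF continuous_on_mult[OF chi_Xi(8) cl]]) (simp add: chi_Xi)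
 have "(\<Sum>b\<in>Basis. pd b (g b) y) = \<rho> * (Xi y * laplacian \<omega> (x + \<rho> *\<^sub>R y)) - fx \<rho> y" for y
 proof -
  have "pd b (g b) y = \<rho> * (Xi y * pd b (pd b \<omega>) (x + \<rho> *\<^sub>R y)) - chi y * ((y \<bullet> b) * pd b \<omega> (x + \<rho> *\<^sub>R y))" for b
   unfolding g_def pd_mult[OF C1_onD(2)[OF chi_Xi(11) UNIV_I] C1_onD(2)[OF C(1)[OF \<omega>(2)] UNIV_I]] C(2)[OF \<omega>(2)] chi_Xi(12)
   by simp
  then show ?thesis by (simp add: sum_subtractf fx_def laplacian_pd sum_distrib_left)
 qed
 then have "(LBINT y. \<rho> * (Xi y * laplacian \<omega> (x + \<rho> *\<^sub>R y)) - fx \<rho> y) = (LBINT y. (\<Sum>b\<in>Basis. pd b (g b) y))" by simp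
 also have "... = 0" using ig by simp
 finally have "(LBINT y. fx \<rho> y) = \<rho> * (LBINT y. Xi y * laplacian \<omega> (x + \<rho> *\<^sub>R y))" using il ifx by simp
 with D show "((%\<rho>. LBINT y. chi y * \<omega> (x + \<rho> *\<^sub>R y)) has_real_derivative \<rho> * (LBINT y. Xi y * laplacian \<omega> (x + \<rho> *\<^sub>R y))) (at \<rho>)" by simp
qed

text \<open>\<open>G\<close> is any primitive that dominates the rate at which the mean can
  decrease. It is a quadratic when the Laplacian is bounded, and a power of the radius when only its
  averages are.\<close>

lemma mean_increment:
 fixes \<omega> :: "'a::euclidean_space => real"
 assumes \<omega>: "C1_on UNIV \<omega>" "!!b. C1_on UNIV (pd b \<omega>)" and "a <= b"
  and G: "!!\<rho>. a <= \<rho> ==> \<rho> <= b ==> (G has_real_derivative G' \<rho>) (at \<rho>)"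
   "!!\<rho>. a <= \<rho> ==> \<rho> <= b ==> \<rho> * (LBINT y. Xi y * - laplacian \<omega> (x + \<rho> *\<^sub>R y)) <= G' \<rho>"
 shows "(LBINT y. chi y * \<omega> (x + a *\<^sub>R y)) <= (LBINT y. chi y * \<omega> (x + b *\<^sub>R y)) + (G b - G a)"
proof -
 have "(LBINT y. chi y * \<omega> (x + a *\<^sub>R y)) + G a <= (LBINT y. chi y * \<omega> (x + b *\<^sub>R y)) + G b"
 proof (rule DERIV_nonneg_imp_nondecreasing[OF \<open>a <= b\<close>])
  fix \<rho> assume "a <= \<rho>" "\<rho> <= b"
  then show "\<exists>y. ((%\<rho>. (LBINT y. chi y * \<omega> (x + \<rho> *\<^sub>R y)) + G \<rho>) has_real_derivative y) (at \<rho>) & 0 <= y"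
   using DERIV_add[OF mean_DERIV(1)[OF \<omega>, of x \<rho>] G(1)[of \<rho>]] G(2)[of \<rho>] by (intro exI conjI) auto
 qed
 then show ?thesis by simp
qed

context navier
begin

text \<open>The cube of the truncation has two continuous derivatives and compact support in
  \<Omega>, so mean values may be taken over balls that leave \<Omega>. The second derivative of the
  cube contributes 6 (g - \<eta>)_+ |grad g|^2 to the Laplacian, which has the favourable sign and
  is dropped.\<close>

lemma cube_cutoff:
 assumes g: "smooth_on \<Omega> g" "continuous_on UNIV g" "!!x. x \<notin> \<Omega> ==> g x = 0" and \<eta>: "\<eta> > 0"
 defines "\<omega> \<equiv> %x. pp 3 (g x - \<eta>)"
 shows "C1_on UNIV \<omega>" "C1_on UNIV (pd b \<omega>)"
  "x \<in> \<Omega> ==> - laplacian \<omega> x <= 3 * pp 2 (g x - \<eta>) * - laplacian g x" "x \<notin> \<Omega> ==> laplacian \<omega> x = 0"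
proof -
 let ?K = "{x. \<eta> <= g x}"
 have K: "compact ?K" "?K \<subseteq> \<Omega>" by (rule superlevel[OF g(2) _ \<eta>], rule g(3), assumption)+
 have D: "((%s. pp a (s - \<eta>)) has_real_derivative a * pp (a - 1) (s - \<eta>)) (at s)" if "a > 1" for a s
  by (rule DERIV_cong[OF DERIV_chain2[OF pp_DERIV[OF that]]]) (auto intro!: derivative_eq_intros)
 have C1: "C1_on \<Omega> (%x. pp a (g x - \<eta>))" "!!x v. x \<in> \<Omega> ==> pd v (%x. pp a (g x - \<eta>)) x = a * pp (a - 1) (g x - \<eta>) * pd v g x" if "a > 1" for a
  by (rule C1_real_comp[OF smooth_C1[OF g(1)] D[OF that]]; use that in \<open>auto intro!: continuous_on_mult continuous_on_pp continuous_intros\<close>)+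
 have \<omega>: "C1_on \<Omega> \<omega>" "!!x. x \<notin> ?K ==> \<omega> x = 0" unfolding \<omega>_def by (rule C1(1)) (simp_all add: pp_simps)
 show "C1_on UNIV \<omega>" by (rule C1_extend(1)[OF K _ \<omega>(1)]) (rule \<omega>(2))
 have p: "pd b \<omega> x = 3 * pp 2 (g x - \<eta>) * pd b g x" for b x
 proof (cases "x \<in> \<Omega>")
  case True
  then show ?thesis unfolding \<omega>_def using C1(2)[of 3 x b] by simp
 next
  case False
  then have "x \<notin> ?K" using K(2) by blast
  then show ?thesis using C1_extend(2)[OF K \<omega>(2,1)] by (simp add: pp_simps)
 qed
 have 2: "C1_on \<Omega> (pd b \<omega>)" for b
 proof -
  have "C1_on \<Omega> (%x. 3 * (pp 2 (g x - \<eta>) * pd b g x))"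
   by (intro C1_mult smooth_C1[OF smooth_on_const[OF open_\<Omega>]] C1(1) smooth_C1[OF smooth_on_pd[OF g(1)]]) simp
  then show ?thesis unfolding p[abs_def] by (simp add: mult.assoc)
 qed
 have p0: "pd b \<omega> x = 0" if "x \<notin> ?K" for b x by (rule C1_extend(2)[OF K _ \<omega>(1) that]) (rule \<omega>(2))
 show "C1_on UNIV (pd b \<omega>)" for b by (rule C1_extend(1)[OF K _ 2]) (rule p0)
 show "laplacian \<omega> x = 0" if "x \<notin> \<Omega>"
 proof -
  have "x \<notin> ?K" using that K(2) by blast
  then show ?thesis unfolding laplacian_pd using C1_extend(2)[OF K p0 2] by simp
 qed
 show "- laplacian \<omega> x <= 3 * pp 2 (g x - \<eta>) * - laplacian g x" if x: "x \<in> \<Omega>"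
 proof -
  have "3 * pp 2 (g x - \<eta>) * pd b (pd b g) x <= pd b (pd b \<omega>) x" for b
  proof -
   have "pd b (pd b \<omega>) x = pd b (%x. 3 * (pp 2 (g x - \<eta>) * pd b g x)) x" unfolding p[abs_def] by (simp add: mult.assoc)
   also have "... = 3 * (2 * pp 1 (g x - \<eta>) * pd b g x * pd b g x + pp 2 (g x - \<eta>) * pd b (pd b g) x)"
    using C1(2)[of 2 x b] x pd_mult[OF C1_onD(2)[OF C1(1)[of 2] x] smooth_on_differentiable[OF smooth_on_pd[OF g(1), of b] x], of b]
     pd_cmult[OF differentiable_mult[OF C1_onD(2)[OF C1(1)[of 2] x] smooth_on_differentiable[OF smooth_on_pd[OF g(1), of b] x]], of b 3]
    by simp
   finally show ?thesis using mult_nonneg_nonneg[OF zero_le_square[of "pd b g x"] pp_simps(3)[of 1 "g x - \<eta>"]]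
    by (simp add: algebra_simps)
  qed
  then have "3 * pp 2 (g x - \<eta>) * laplacian g x <= laplacian \<omega> x"
   unfolding laplacian_pd sum_distrib_left by (intro sum_mono)
  then show ?thesis by simp
 qed
qed

end


section \<open>The extremal solution\<close>

text \<open>Either s^(-p) is below the level \<kappa>, or it exceeds \<kappa> and then the higher
  power s^(-q) controls it. The level is chosen later in terms of the radius.\<close>

lemma powr_split:
 fixes s \<kappa> :: real assumes "\<kappa> > 0" "s > 0" "0 < p" "p < q"
 shows "s powr (- p) <= \<kappa> + \<kappa> powr (1 - q / p) * s powr (- q)"
proof (cases "s powr (- p) <= \<kappa>")
 case False
 have "(s powr (- p)) powr (1 - q / p) <= \<kappa> powr (1 - q / p)"
  using False assms by (intro powr_mono2') (auto simp: field_simps)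
 moreover have "(s powr (- p)) powr (1 - q / p) * s powr (- q) = s powr (- p)"
  using assms unfolding powr_powr powr_add[symmetric] by (intro arg_cong[where f = "%x. s powr x"]) (simp add: field_simps)
 ultimately have "s powr (- p) <= \<kappa> powr (1 - q / p) * s powr (- q)" by (metis mult_right_mono powr_ge_zero)
 then show ?thesis using assms by simp
qed (use assms in \<open>simp add: add_increasing2\<close>)

lemma pp_le: "s <= G ==> a >= 0 ==> 0 <= G ==> pp a s <= G powr a"
 unfolding pp_def by (intro powr_mono2) auto

lemma mean_increment_const:
 fixes \<omega> :: "'a::euclidean_space => real"
 assumes \<omega>: "C1_on UNIV \<omega>" "!!b. C1_on UNIV (pd b \<omega>)" and Q: "!!x. - laplacian \<omega> x <= Q" and r: "0 <= r"
 shows "(LBINT y. chi (y :: 'a)) * \<omega> x0 <= (LBINT y. chi y * \<omega> (x0 + r *\<^sub>R y)) + (LBINT y. Xi (y :: 'a)) * Q / 2 * r\<^sup>2"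
proof -
 define Y where "Y = (LBINT y. Xi (y :: 'a))"
 have "(LBINT y. chi y * \<omega> (x0 + 0 *\<^sub>R y)) <= (LBINT y. chi y * \<omega> (x0 + r *\<^sub>R y)) + (Y * Q / 2 * r\<^sup>2 - Y * Q / 2 * 0\<^sup>2)"
 proof (rule mean_increment[OF \<omega> r, where G' = "%\<rho>. \<rho> * (Y * Q)"])
  fix \<rho> :: real assume \<rho>: "0 <= \<rho>" "\<rho> <= r"
  show "((%\<rho>. Y * Q / 2 * \<rho>\<^sup>2) has_real_derivative \<rho> * (Y * Q)) (at \<rho>)" by (auto intro!: derivative_eq_intros)
  have "(LBINT y. Xi y * - laplacian \<omega> (x0 + \<rho> *\<^sub>R y)) <= (LBINT y. Xi (y :: 'a) * Q)"
  proof (rule integral_mono)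
   show "integrable lborel (%y. Xi y * - laplacian \<omega> (x0 + \<rho> *\<^sub>R y))" using mean_DERIV(2)[OF \<omega>] by simp
   show "integrable lborel (%y. Xi (y :: 'a) * Q)" using chi_Xi(10)[where 'a = 'a] by simp
  qed (intro mult_left_mono Q chi_Xi)
  then show "\<rho> * (LBINT y. Xi y * - laplacian \<omega> (x0 + \<rho> *\<^sub>R y)) <= \<rho> * (Y * Q)"
   using \<rho>(1) by (intro mult_left_mono) (simp_all add: Y_def)
 qed
 then show ?thesis by (simp add: Y_def)
qed

section \<open>Bounds at the maximum points of \<open>V\<close> and \<open>u\<close>\<close>

context navier
begin

lemma attains_max:
 assumes g: "continuous_on UNIV g" "!!x. x \<notin> \<Omega> ==> g x = 0" "!!x. (g x :: real) >= 0"
 obtains x0 where "!!x. g x <= g x0"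
proof (cases "\<Omega> = {}")
 case True
 then show ?thesis using that g(2) by auto
next
 case False
 then obtain x0 where x0: "!!y. y \<in> closure \<Omega> ==> g y <= g x0"
  using continuous_attains_sup[OF compact_\<Omega> _ continuous_on_subset[OF g(1) subset_UNIV]] by auto
 have "g y <= g x0" for y using x0[of y] closure_subset[of \<Omega>] g(2)[of y] g(3)[of x0] by (cases "y \<in> \<Omega>") auto
 then show ?thesis using that by blast
qed

text \<open>The two quantities controlled by the energy estimate in one nonnegative function; the
  summand \<open>V\<close> is what bounds the mean at radius 1 in
  \<open>V_upper_bound\<close>.\<close>

definition mass :: "real => 'a => real" where
 "mass q x = indicator \<Omega> x * ((1 - u x) powr (- q) + V x)"

lemma integrable_mass: "integrable lborel (mass q)"
proof -
 define h where "h x = (1 - u x) powr (- q) + V x" for x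
 have c: "continuous_on UNIV h" unfolding h_def
  by (intro continuous_intros cont) (use less_1 in \<open>auto simp: less_imp_neq[THEN not_sym]\<close>)
 obtain B where B: "B >= 0" "!!x. x \<in> closure \<Omega> ==> \<bar>h x\<bar> <= B"
  by (rule compact_bound[OF compact_\<Omega> continuous_on_subset[OF c subset_UNIV]]) blast
 have m: "mass q x = indicator \<Omega> x * h x" for x by (simp add: mass_def h_def)
 show ?thesis
 proof (rule integrable_bounded_support[OF _ _ bounded_\<Omega>])
  have [measurable]: "h \<in> borel_measurable borel" "\<Omega> \<in> sets borel"
   using borel_measurable_continuous_onI[OF c] open_\<Omega> by auto
  show "mass q \<in> borel_measurable borel" unfolding m[abs_def] by measurable
  show "\<bar>mass q x\<bar> <= B" for x using B(1) B(2)[of x] closure_subset[of \<Omega>] by (cases "x \<in> \<Omega>") (auto simp: m)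
 qed (simp add: mass_def)
qed

text \<open>Means of the truncated cube are followed from the maximum point of \<open>V\<close> out
  to radius 1. Up to radius \<delta>^((p+1)/4) the pointwise bound \<delta>^(-p) is used, beyond it
  the integral bound. Both parts contribute the same power of \<delta>.\<close>

lemma V_upper_bound:
 assumes p: "p > 1" and lam: "0 <= lam" "lam <= L" and \<delta>: "0 < \<delta>" "\<delta> <= 1" "!!x. u x <= 1 - \<delta>"
  and q: "p < q" "real DIM('a) <= 4 * q / (p + 1)" and I: "(LBINT x. mass q x) <= I"
 defines "X \<equiv> (LBINT y. chi (y :: 'a))" and "Y \<equiv> (LBINT y. Xi (y :: 'a))" and "\<beta> \<equiv> 4 * p / (p + 1)"
 shows "V x <= (1 + (I + 3 / 2 * L * Y + 3 * L * (Y + I) / (\<beta> - 2)) / X) * \<delta> powr ((1 - p) / 2)"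
proof -
 define Z where "Z = \<delta> powr ((1 - p) / 2)"
 define C where "C = I + 3 / 2 * L * Y + 3 * L * (Y + I) / (\<beta> - 2)"
 have Z: "Z >= 1" unfolding Z_def using \<delta> p powr_mono2'[of "(1 - p) / 2" \<delta> 1] by simp
 have X: "X > 0" unfolding X_def by (rule integral_chi_pos)
 have Y: "Y >= 0" unfolding Y_def using chi_Xi(3) by (intro Bochner_Integration.integral_nonneg) auto
 have m0: "mass q x >= 0" for x using nonneg[OF lam(1)] by (simp add: mass_def)
 have I0: "I >= 0" using I Bochner_Integration.integral_nonneg[of lborel "mass q"] m0 by fastforce
 have \<beta>: "\<beta> > 2" using p by (simp add: \<beta>_def field_simps)
 have L: "L >= 0" using lam by linarith
 have C: "C >= 0" using I0 L Y \<beta> by (simp add: C_def)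
 obtain x0 where x0: "!!x. V x <= V x0" by (rule attains_max[OF cont(2)]) (use off(2) nonneg(1)[OF lam(1)] in auto)
 define G where "G = V x0 - 1"
 have "G <= C / X * Z"
 proof (cases "G > 0")
  case True
  define \<omega> where "\<omega> x = pp 3 (V x - 1)" for x
  have \<omega>: "C1_on UNIV \<omega>" "!!b. C1_on UNIV (pd b \<omega>)" "!!x. x \<in> \<Omega> ==> - laplacian \<omega> x <= 3 * pp 2 (V x - 1) * - laplacian V x"
   "!!x. x \<notin> \<Omega> ==> laplacian \<omega> x = 0"
   unfolding \<omega>_def by (rule cube_cutoff[OF smooth(2) cont(2) _ zero_less_one]; use off(2) in simp)+
  \<comment> \<open>Every term carries this factor, because the square of the truncation is at most
    G^2. Dividing by it turns the estimate for G^3 into a linear bound on \<open>G\<close>.\<close>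
  define G2 where "G2 = G powr 2"
  have G2: "G2 > 0" "G powr 3 = G2 * G" using True powr_add[of G 2 1] by (simp_all add: G2_def)
  have ppG: "pp 2 (V x - 1) <= G2" for x unfolding G2_def using x0[of x] True by (intro pp_le) (auto simp: G_def)
  have lapw: "- laplacian \<omega> x <= 3 * G2 * L * (1 - u x) powr (- p)" if "x \<in> \<Omega>" for x
  proof -
   have "- laplacian \<omega> x <= 3 * (pp 2 (V x - 1) * (lam * (1 - u x) powr (- p)))"
    using \<omega>(3)[OF that] laplacian_V[OF that] by (simp add: nonlinearity_powr)
   also have "... <= 3 * (G2 * (L * (1 - u x) powr (- p)))"
    using ppG[of x] lam G2 by (intro mult_left_mono mult_mono mult_right_mono) (auto simp: pp_simps)
   finally show ?thesis by (simp add: mult.assoc)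
  qed
  \<comment> \<open>The radius at which the two regimes balance: \<delta>^(-p) r^2 and r^(2-\<beta>)
    both equal \<open>Z\<close>.\<close>
  define r where "r = \<delta> powr ((p + 1) / 4)"
  have r: "r > 0" "r <= 1" using \<delta> p by (auto simp: r_def powr_le1)
  have rZ: "\<delta> powr (- p) * r\<^sup>2 = Z" "r powr (2 - \<beta>) = Z"
  proof -
   have "\<delta> powr (- p) * r\<^sup>2 = \<delta> powr (- p + ((p + 1) / 4 + (p + 1) / 4))" unfolding r_def power2_eq_square powr_add ..
   also have "- p + ((p + 1) / 4 + (p + 1) / 4) = (1 - p) / 2" by (simp add: field_simps)
   finally show "\<delta> powr (- p) * r\<^sup>2 = Z" by (simp add: Z_def)
   have "(p + 1) / 4 * (2 - \<beta>) = (1 - p) / 2" using p by (simp add: \<beta>_def field_simps)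
   then show "r powr (2 - \<beta>) = Z" by (simp only: r_def Z_def powr_powr)
  qed
  define Q where "Q = 3 * G2 * L * \<delta> powr (- p)"
  have lQ: "- laplacian \<omega> x <= Q" for x
  proof (cases "x \<in> \<Omega>")
   case True
   have "(1 - u x) powr (- p) <= \<delta> powr (- p)" using \<delta>(1) \<delta>(3)[of x] p by (intro powr_mono2') auto
   then have "3 * G2 * L * (1 - u x) powr (- p) <= Q" unfolding Q_def using G2 L by (intro mult_left_mono) auto
   then show ?thesis using lapw[OF True] by linarith
  qed (use \<omega>(4) G2 L in \<open>simp add: Q_def\<close>)
  have "X * \<omega> x0 <= (LBINT y. chi y * \<omega> (x0 + r *\<^sub>R y)) + Y * Q / 2 * r\<^sup>2"
   unfolding X_def Y_def by (rule mean_increment_const[OF \<omega>(1,2) lQ]) (use r in simp)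
  moreover define A where "A = 3 * G2 * L * (Y + I)"
  have "(LBINT y. chi y * \<omega> (x0 + r *\<^sub>R y)) <= (LBINT y. chi y * \<omega> (x0 + 1 *\<^sub>R y))
    + (- A / (\<beta> - 2) * 1 powr (2 - \<beta>) - - A / (\<beta> - 2) * r powr (2 - \<beta>))"
  proof (rule mean_increment[OF \<omega>(1,2) r(2), where G' = "%\<rho>. A * \<rho> powr (1 - \<beta>)"])
   fix \<rho> :: real assume "r <= \<rho>" "\<rho> <= 1"
   then have \<rho>: "\<rho> > 0" "\<rho> <= 1" using r(1) by auto
   have "((%\<rho>. - A / (\<beta> - 2) * \<rho> powr (2 - \<beta>)) has_real_derivative - A / (\<beta> - 2) * ((2 - \<beta>) * \<rho> powr (2 - \<beta> - 1))) (at \<rho>)"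
    by (rule DERIV_cmult[OF has_real_derivative_powr[OF \<rho>(1)]])
   moreover have "- A / (\<beta> - 2) * ((2 - \<beta>) * \<rho> powr (2 - \<beta> - 1)) = A * \<rho> powr (1 - \<beta>)" using \<beta> by (simp add: field_simps)
   ultimately show "((%\<rho>. - A / (\<beta> - 2) * \<rho> powr (2 - \<beta>)) has_real_derivative A * \<rho> powr (1 - \<beta>)) (at \<rho>)" by simp
   \<comment> \<open>The splitting level at radius \<rho>; this is the growth that the scaling of
     the equation suggests for (1 - u)^(-p) at distance \<rho>.\<close>
   define \<kappa> where "\<kappa> = \<rho> powr (- \<beta>)"
   define \<kappa>' where "\<kappa>' = \<kappa> powr (1 - q / p)"
   have \<kappa>: "\<kappa> > 0" "\<kappa>' > 0" using \<rho> by (auto simp: \<kappa>_def \<kappa>'_def)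
   have l: "- laplacian \<omega> x <= 3 * G2 * L * (\<kappa> + \<kappa>' * mass q x)" for x
   proof (cases "x \<in> \<Omega>")
    case True
    have "(1 - u x) powr (- p) <= \<kappa> + \<kappa>' * (1 - u x) powr (- q)"
     unfolding \<kappa>'_def by (rule powr_split) (use \<kappa> less_1[of x] p q in auto)
    also have "... <= \<kappa> + \<kappa>' * mass q x" using True \<kappa> nonneg(1)[OF lam(1), of x] by (simp add: mass_def)
    finally show ?thesis using lapw[OF True] mult_left_mono[of _ _ "3 * G2 * L"] G2 L by (smt (verit) mult_nonneg_nonneg)
   next
    case False
    then show ?thesis using \<omega>(4)[OF False] G2 L \<kappa> m0[of x] by simp
   qed
   note aff = lborel_integral_affine[OF integrable_mass \<rho>(1), of q x0]
   have i2: "integrable lborel (%y. 3 * G2 * L * (\<kappa> * Xi y + \<kappa>' * mass q (x0 + \<rho> *\<^sub>R y)))"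
    using aff(1) chi_Xi(10)[where 'a = 'a] by simp
   have "(LBINT y. Xi y * - laplacian \<omega> (x0 + \<rho> *\<^sub>R y)) <= (LBINT y. 3 * G2 * L * (\<kappa> * Xi y + \<kappa>' * mass q (x0 + \<rho> *\<^sub>R y)))"
   proof (rule integral_mono'[OF i2])
    fix y :: 'a
    have "Xi y * - laplacian \<omega> (x0 + \<rho> *\<^sub>R y) <= Xi y * (3 * G2 * L * (\<kappa> + \<kappa>' * mass q (x0 + \<rho> *\<^sub>R y)))"
     by (intro mult_left_mono l chi_Xi)
    also have "... = 3 * G2 * L * (\<kappa> * Xi y + Xi y * (\<kappa>' * mass q (x0 + \<rho> *\<^sub>R y)))" by (simp add: algebra_simps)
    also have "... <= 3 * G2 * L * (\<kappa> * Xi y + \<kappa>' * mass q (x0 + \<rho> *\<^sub>R y))"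
     using G2 L \<kappa> m0 chi_Xi(3,4)[of y] by (intro mult_left_mono add_left_mono mult_left_le_one_le) auto
    finally show "Xi y * - laplacian \<omega> (x0 + \<rho> *\<^sub>R y) <= 3 * G2 * L * (\<kappa> * Xi y + \<kappa>' * mass q (x0 + \<rho> *\<^sub>R y))" .
    show "0 <= 3 * G2 * L * (\<kappa> * Xi y + \<kappa>' * mass q (x0 + \<rho> *\<^sub>R y))"
     using G2 L \<kappa> m0 chi_Xi(3)[of y] by (intro mult_nonneg_nonneg add_nonneg_nonneg) auto
   qed
   also have "... = 3 * G2 * L * (\<kappa> * Y + \<kappa>' * ((LBINT y. mass q y) / \<rho> ^ DIM('a)))"
    using aff chi_Xi(10)[where 'a = 'a] by (simp add: Y_def)
   also have "... <= 3 * G2 * L * (\<kappa> * Y + \<kappa> * I)"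
   proof -
    \<comment> \<open>The factor \<rho>^(-N) from rescaling the integral is compensated precisely
      because N <= 4q/(p+1), which is \<beta> q/p.\<close>
    have "\<kappa>' / \<rho> ^ DIM('a) = \<rho> powr (- \<beta> * (1 - q / p) - real DIM('a))"
     unfolding \<kappa>'_def \<kappa>_def powr_powr powr_diff[of \<rho> "- \<beta> * (1 - q / p)"] using \<rho> by (simp only: powr_realpow)
    also have "... <= \<rho> powr (- \<beta>)"
    proof (rule powr_mono')
     have "\<beta> * (q / p) = 4 * q / (p + 1)" using p by (simp add: \<beta>_def)
     then show "- \<beta> <= - \<beta> * (1 - q / p) - real DIM('a)" using q(2) by (simp add: algebra_simps)
    qed (use \<rho> in auto)
    finally have "\<kappa>' / \<rho> ^ DIM('a) * (LBINT y. mass q y) <= \<kappa> * I"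
     using I \<kappa> I0 m0 by (intro mult_mono) (auto simp: \<kappa>_def intro!: Bochner_Integration.integral_nonneg)
    then show ?thesis using G2 L by (intro mult_left_mono) auto
   qed
   also have "... = A * \<rho> powr (- \<beta>)" by (simp add: A_def \<kappa>_def algebra_simps)
   finally have "\<rho> * (LBINT y. Xi y * - laplacian \<omega> (x0 + \<rho> *\<^sub>R y)) <= \<rho> * (A * \<rho> powr (- \<beta>))"
    using \<rho> by (intro mult_left_mono) auto
   also have "... = A * \<rho> powr (1 - \<beta>)" using \<rho> powr_add[of \<rho> 1 "- \<beta>"] by simp
   finally show "\<rho> * (LBINT y. Xi y * - laplacian \<omega> (x0 + \<rho> *\<^sub>R y)) <= A * \<rho> powr (1 - \<beta>)" .
  qed
  \<comment> \<open>At radius 1 the truncated cube is at most G^2 times \<open>V\<close>, whose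
    integral is part of \<open>mass\<close>.\<close>
  moreover have "(LBINT y. chi y * \<omega> (x0 + 1 *\<^sub>R y)) <= G2 * I"
  proof -
   note aff = lborel_integral_affine[OF integrable_mass zero_less_one, of q x0]
   have i2: "integrable lborel (%y. G2 * mass q (x0 + 1 *\<^sub>R y))" using aff(1) by (intro integrable_mult_right)
   have "(LBINT y. chi y * \<omega> (x0 + 1 *\<^sub>R y)) <= (LBINT y. G2 * mass q (x0 + 1 *\<^sub>R y))"
   proof (rule integral_mono'[OF i2])
    have \<omega>m: "\<omega> x <= G2 * mass q x" for x
    proof (cases "x \<in> \<Omega>")
     case True
     have "\<omega> x = pp 2 (V x - 1) * pp 1 (V x - 1)" by (simp add: \<omega>_def pp_add)
     also have "... <= G2 * mass q x"
     proof (rule mult_mono[OF ppG])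
      have "pp 1 (V x - 1) <= V x" using nonneg(1)[OF lam(1), of x] by (simp add: pp_def)
      also have "V x <= mass q x" using True by (simp add: mass_def)
      finally show "pp 1 (V x - 1) <= mass q x" .
     qed (use G2 in \<open>auto simp: pp_simps\<close>)
     finally show ?thesis .
    qed (simp add: \<omega>_def pp_simps off mass_def)
    have "chi y * \<omega> x <= 1 * \<omega> x" for y :: 'a and x by (intro mult_right_mono chi_Xi) (simp add: \<omega>_def pp_simps)
    then show "chi y * \<omega> (x0 + 1 *\<^sub>R y) <= G2 * mass q (x0 + 1 *\<^sub>R y)" for y using \<omega>m by (metis mult_1 order_trans)
    show "0 <= G2 * mass q (x0 + 1 *\<^sub>R y)" for y using G2 m0 by simp
   qed
   also have "... = G2 * (LBINT y. mass q y)" using aff(2) by simp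
   finally show ?thesis using I G2 mult_left_mono[of _ I G2] by (meson less_imp_le order_trans)
  qed
  moreover have "X * \<omega> x0 = X * (G2 * G)" using True G2(2) by (simp add: \<omega>_def G_def pp_simps)
  moreover have "Y * Q / 2 * r\<^sup>2 = G2 * (3 / 2 * L * Y * Z)" using rZ(1) by (simp add: Q_def mult.assoc mult.left_commute)
  moreover have "A / (\<beta> - 2) * r powr (2 - \<beta>) = G2 * (3 * L * (Y + I) / (\<beta> - 2) * Z)" by (simp add: A_def rZ(2))
  moreover have "A / (\<beta> - 2) >= 0" using G2 L Y I0 \<beta> by (simp add: A_def)
  moreover have "- A / (\<beta> - 2) * 1 powr (2 - \<beta>) - - A / (\<beta> - 2) * r powr (2 - \<beta>) = A / (\<beta> - 2) * r powr (2 - \<beta>) - A / (\<beta> - 2)" by simp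
  ultimately have "X * (G2 * G) <= G2 * I + G2 * (3 / 2 * L * Y * Z) + G2 * (3 * L * (Y + I) / (\<beta> - 2) * Z)" by linarith
  then have "G2 * (X * G) <= G2 * (I + 3 / 2 * L * Y * Z + 3 * L * (Y + I) / (\<beta> - 2) * Z)" by (simp only: distrib_left mult.left_commute)
  then have "X * G <= I + 3 / 2 * L * Y * Z + 3 * L * (Y + I) / (\<beta> - 2) * Z" using G2(1) by simp
  also have "... <= C * Z" using mult_left_mono[OF Z I0] by (simp add: C_def distrib_right)
  finally have "G <= C * Z / X" using X by (simp only: pos_le_divide_eq mult.commute[of G])
  then show ?thesis by simp
 next
  case False
  have "0 <= C / X * Z" by (intro mult_nonneg_nonneg divide_nonneg_nonneg) (use C X Z in linarith)+
  then show ?thesis using False by linarith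
 qed
 then have "V x0 <= (1 + C / X) * Z" using Z by (simp add: G_def distrib_right)
 then show ?thesis using x0[of x] by (simp add: C_def Z_def)
qed

text \<open>On a ball of radius r = \<delta>^((p+1)/4) about the maximum point, the Laplacian of
  \<open>u\<close> times r^2 is of order \<delta>, so the mean of 1 - u is at most a multiple \<tau>
  of \<delta>. Convexity bounds the mean of (1 - u)^(-q) below by \<tau>^(-q), up to the
  normalisation, while rescaling \<open>mass\<close> bounds it above by a multiple of
  r^(-N).\<close>

lemma gap_estimate:
 assumes p: "p > 1" and lam: "0 <= lam" and \<delta>: "0 < \<delta>" "\<delta> <= 1" "!!x. u x <= 1 - \<delta>" "u x0 = 1 - \<delta>"
  and C: "C >= 0" "!!x. V x <= C * \<delta> powr ((1 - p) / 2)" and q: "q > 0" and I: "(LBINT x. mass q x) <= I"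
 defines "X \<equiv> (LBINT y. chi (y :: 'a))" and "Y \<equiv> (LBINT y. Xi (y :: 'a))"
 shows "((6 + 3 / 2 * Y * C / X) * \<delta>) powr (- q) * X <= (X + I) * \<delta> powr (- (real DIM('a) * (p + 1) / 4))"
proof -
 define Z where "Z = \<delta> powr ((1 - p) / 2)"
 define r where "r = \<delta> powr ((p + 1) / 4)"
 have X: "X > 0" unfolding X_def by (rule integral_chi_pos)
 have Y: "Y >= 0" unfolding Y_def using chi_Xi(3) by (intro Bochner_Integration.integral_nonneg) auto
 have m0: "mass q x >= 0" for x using nonneg[OF lam(1)] by (simp add: mass_def)
 have I0: "I >= 0" using I Bochner_Integration.integral_nonneg[of lborel "mass q"] m0 by fastforce
 have r: "r > 0" using \<delta> by (simp add: r_def)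
 have rZ: "Z * r\<^sup>2 = \<delta>"
 proof -
  have "Z * r\<^sup>2 = \<delta> powr ((1 - p) / 2 + ((p + 1) / 4 + (p + 1) / 4))" unfolding Z_def r_def power2_eq_square powr_add ..
  also have "(1 - p) / 2 + ((p + 1) / 4 + (p + 1) / 4) = 1" by (simp add: field_simps)
  finally show ?thesis using \<delta> by simp
 qed
 define \<omega> where "\<omega> x = pp 3 (u x - \<delta>)" for x
 have \<omega>: "C1_on UNIV \<omega>" "!!b. C1_on UNIV (pd b \<omega>)" "!!x. x \<in> \<Omega> ==> - laplacian \<omega> x <= 3 * pp 2 (u x - \<delta>) * - laplacian u x"
  "!!x. x \<notin> \<Omega> ==> laplacian \<omega> x = 0"
  unfolding \<omega>_def by (rule cube_cutoff[OF smooth(1) cont(1) _ \<delta>(1)]; use off(1) in simp)+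
 define Q where "Q = 3 * C * Z"
 have Q: "- laplacian \<omega> x <= Q" for x
 proof (cases "x \<in> \<Omega>")
  case True
  have "pp 2 (u x - \<delta>) <= 1 powr 2" using less_1[of x] \<delta> by (intro pp_le) auto
  then have "pp 2 (u x - \<delta>) * V x <= 1 * (C * Z)" using C(2)[of x] nonneg(1)[OF lam, of x] by (intro mult_mono) (auto simp: Z_def)
  then show ?thesis using \<omega>(3)[OF True] laplacian_u[OF True] by (simp add: Q_def)
 qed (use \<omega>(4) C(1) in \<open>simp add: Q_def Z_def\<close>)
 have "X * \<omega> x0 <= (LBINT y. chi y * \<omega> (x0 + r *\<^sub>R y)) + Y * Q / 2 * r\<^sup>2"
  unfolding X_def Y_def by (rule mean_increment_const[OF \<omega>(1,2) Q]) (use r in simp)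
 moreover have "X * \<omega> x0 >= X * (1 - 6 * \<delta>)"
 proof -
  \<comment> \<open>At the maximum point the truncation equals 1 - 2\<delta>, and Bernoulli's
    inequality applies to its cube; if 2\<delta> >= 1 the left side is negative.\<close>
  have "1 - 6 * \<delta> <= pp 3 (1 - 2 * \<delta>)"
  proof (cases "2 * \<delta> < 1")
   case True
   have "1 + real 3 * (- 2 * \<delta>) <= (1 + - 2 * \<delta>) ^ 3" by (rule Bernoulli_inequality) (use True in simp)
   then show ?thesis using True by (simp add: pp_simps)
  qed (use pp_simps(3)[of 3 "1 - 2 * \<delta>"] in linarith)
  then show ?thesis using X \<delta>(4) by (simp add: \<omega>_def)
 qed
 moreover
 have iu: "integrable lborel (%y. chi y * u (x0 + r *\<^sub>R y))"
  by (rule integrable_compact_support[OF _ bounded_cball[of 0 1]])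
   (auto intro!: continuous_on_mult chi_Xi continuous_on_compose2[OF cont(1)] continuous_intros)
 have "(LBINT y. chi y * \<omega> (x0 + r *\<^sub>R y)) <= (LBINT y. chi y * u (x0 + r *\<^sub>R y))"
 proof (rule integral_mono'[OF iu])
  have "\<omega> x <= u x" for x
  proof -
   have "\<omega> x = pp 2 (u x - \<delta>) * pp 1 (u x - \<delta>)" by (simp add: \<omega>_def pp_add)
   also have "... <= 1 powr 2 * u x"
    using less_1[of x] \<delta>(1) nonneg(2)[OF lam, of x] by (intro mult_mono pp_le) (auto simp: pp_def)
   finally show ?thesis by simp
  qed
  then show "chi y * \<omega> (x0 + r *\<^sub>R y) <= chi y * u (x0 + r *\<^sub>R y)" for y by (intro mult_left_mono chi_Xi)
  show "0 <= chi y * u (x0 + r *\<^sub>R y)" for y by (rule mult_nonneg_nonneg[OF chi_Xi(1) nonneg(2)[OF lam]])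
 qed
 ultimately have "X * (1 - 6 * \<delta>) <= (LBINT y. chi y * u (x0 + r *\<^sub>R y)) + Y * Q / 2 * r\<^sup>2" by simp
 moreover have "Y * Q / 2 * r\<^sup>2 = 3 / 2 * Y * C * \<delta>" unfolding Q_def rZ[symmetric] by simp
 \<comment> \<open>The weighted mean of 1 - u is at most \<tau>: the 6 stems from truncating and
   cubing, the other summand from the Laplacian over the radius \<open>r\<close>.\<close>
 moreover define \<tau> where "\<tau> = (6 + 3 / 2 * Y * C / X) * \<delta>"
 moreover have "X * \<tau> = 6 * (X * \<delta>) + 3 / 2 * Y * C * \<delta>" using X by (simp add: \<tau>_def field_simps)
 moreover have "X * (1 - 6 * \<delta>) = X - 6 * (X * \<delta>)" by (simp add: algebra_simps)
 ultimately have uX: "X - X * \<tau> <= (LBINT y. chi y * u (x0 + r *\<^sub>R y))" by linarith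
 have \<tau>: "\<tau> > 0" using \<delta>(1) X Y C(1) by (simp add: \<tau>_def add_pos_nonneg)
 note aff = lborel_integral_affine[OF integrable_mass r, of q x0]
 \<comment> \<open>The integrand on the left is \<open>chi\<close> times the tangent line of s^(-q)
   at s = \<tau>, written in terms of u = 1 - s.\<close>
 have "(LBINT y. \<tau> powr (- q) * ((1 + q - q / \<tau>) * chi y + q / \<tau> * (chi y * u (x0 + r *\<^sub>R y))))
  <= (LBINT y. chi y + mass q (x0 + r *\<^sub>R y))"
 proof (rule integral_mono)
  show "integrable lborel (%y. \<tau> powr (- q) * ((1 + q - q / \<tau>) * chi y + q / \<tau> * (chi y * u (x0 + r *\<^sub>R y))))"
   using chi_Xi(9)[where 'a = 'a] iu by (intro integrable_mult_right Bochner_Integration.integrable_add)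
  show "integrable lborel (%y. chi y + mass q (x0 + r *\<^sub>R y))" using chi_Xi(9)[where 'a = 'a] aff(1) by (intro Bochner_Integration.integrable_add)
  fix y :: 'a
  define s where "s = 1 - u (x0 + r *\<^sub>R y)"
  have s: "s > 0" using less_1 by (simp add: s_def)
  have "\<tau> powr (- q) * (1 + q * (1 - s / \<tau>)) <= \<tau> powr (- q) * (s / \<tau>) powr (- q)"
   using s \<tau> q by (intro mult_left_mono powr_neg_tangent) auto
  also have "... = s powr (- q)" using s \<tau> by (simp add: powr_divide)
  finally have "chi y * (\<tau> powr (- q) * (1 + q * (1 - s / \<tau>))) <= chi y * s powr (- q)" by (intro mult_left_mono chi_Xi)
  \<comment> \<open>The summand \<open>chi y\<close> takes care of points outside \<Omega>, where u
    = 0 and the power equals 1 but \<open>mass\<close> vanishes.\<close>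
  also have "... <= chi y + mass q (x0 + r *\<^sub>R y)"
  proof (cases "x0 + r *\<^sub>R y \<in> \<Omega>")
   case True
   have "chi y * s powr (- q) <= 1 * s powr (- q)" by (intro mult_right_mono chi_Xi) simp
   then show ?thesis using True chi_Xi(1)[of y] nonneg(1)[OF lam, of "x0 + r *\<^sub>R y"] by (simp add: mass_def s_def)
  next
   case False
   then show ?thesis using off(1)[OF False] m0[of "x0 + r *\<^sub>R y"] by (simp add: s_def)
  qed
  finally show "\<tau> powr (- q) * ((1 + q - q / \<tau>) * chi y + q / \<tau> * (chi y * u (x0 + r *\<^sub>R y))) <= chi y + mass q (x0 + r *\<^sub>R y)"
   using \<tau> by (simp add: s_def field_simps)
 qed
 then have "\<tau> powr (- q) * ((1 + q - q / \<tau>) * X + q / \<tau> * (LBINT y. chi y * u (x0 + r *\<^sub>R y))) <= X + (LBINT x. mass q x) / r ^ DIM('a)"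
  using chi_Xi(9)[where 'a = 'a] iu aff by (simp add: X_def)
 moreover have "\<tau> powr (- q) * X <= \<tau> powr (- q) * ((1 + q - q / \<tau>) * X + q / \<tau> * (LBINT y. chi y * u (x0 + r *\<^sub>R y)))"
 proof (rule mult_left_mono)
  have "q / \<tau> * (X - X * \<tau>) <= q / \<tau> * (LBINT y. chi y * u (x0 + r *\<^sub>R y))" using uX q \<tau> by (intro mult_left_mono) auto
  moreover have "(1 + q - q / \<tau>) * X + q / \<tau> * (X - X * \<tau>) = X" using \<tau> by (simp add: field_simps)
  ultimately show "X <= (1 + q - q / \<tau>) * X + q / \<tau> * (LBINT y. chi y * u (x0 + r *\<^sub>R y))" by linarith
 qed simp
 moreover have "X + (LBINT x. mass q x) / r ^ DIM('a) <= (X + I) * \<delta> powr (- (real DIM('a) * (p + 1) / 4))"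
 proof -
  have "r ^ DIM('a) = \<delta> powr (real DIM('a) * (p + 1) / 4)" using r by (simp add: r_def powr_powr mult.commute flip: powr_realpow)
  then have "(LBINT x. mass q x) / r ^ DIM('a) <= I * \<delta> powr (- (real DIM('a) * (p + 1) / 4))"
   using I \<delta>(1) by (simp add: powr_minus field_simps)
  moreover have "1 <= \<delta> powr (- (real DIM('a) * (p + 1) / 4))"
   using \<delta> p powr_mono2'[of "- (real DIM('a) * (p + 1) / 4)" \<delta> 1] by simp
  from mult_left_mono[OF this less_imp_le[OF X]] have "X <= X * \<delta> powr (- (real DIM('a) * (p + 1) / 4))" by simp
  ultimately show ?thesis unfolding distrib_right by linarith
 qed
 ultimately show ?thesis unfolding \<tau>_def by linarith
qed

lemma mass_bound:
 assumes n2: "navier \<Omega> p \<mu> U W" and lam: "0 <= lam" "lam < \<mu>" and p: "p > 1" and le: "!!x. u x <= U x" and t: "t > 1"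
  and c: "c > 0" "C >= 0" and bd: "!!s V. 0 < s ==> s <= 1 ==> 0 <= V ==>
  sqrt (lam / ((p - 1) / 2)) * (s powr (- ((p - 1) / 2)) - 1) <= V ==>
  t\<^sup>2 / (2 * t - 1) * (lam * s powr (- p)) * pp (2 * t - 1) (V - 1) - sqrt (lam * p) * s powr (- (p + 1) / 2) * pp (2 * t) (V - 1)
   <= C - c * (s powr (- q) + V)"
 shows "(LBINT x. mass q x) <= C * measure lborel \<Omega> / c"
proof -
 define E where "E x = t\<^sup>2 / (2 * t - 1) * (lam * (1 - u x) powr (- p)) * pp (2 * t - 1) (V x - 1)
  - sqrt (lam * p) * (1 - u x) powr (- (p + 1) / 2) * pp (2 * t) (V x - 1)" for x
 have p0: "p >= 0" using p by simp
 note e = energy[OF n2 lam p0 le t, folded E_def]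
 have "emeasure lborel \<Omega> < \<infinity>" by (rule emeasure_bounded_finite[OF bounded_\<Omega>])
 then have ii: "integrable lborel (indicator \<Omega> :: 'a => real)" using open_\<Omega> by (intro integrable_real_indicator) auto
 have i2: "integrable lborel (%x. C * indicator \<Omega> x - c * mass q x)" using ii integrable_mass by simp
 have "E x <= C * indicator \<Omega> x - c * mass q x" for x
 proof (cases "x \<in> \<Omega>")
  case True
  then show ?thesis
   using bd[of "1 - u x" "V x"] less_1[of x] nonneg[OF lam(1), of x] V_lower_bound[OF lam(1) p, of x] by (simp add: E_def mass_def)
 qed (simp add: E_def mass_def off pp_simps)
 then have "(LBINT x. E x) <= (LBINT x. C * indicator \<Omega> x - c * mass q x)" by (intro integral_mono e i2)
 also have "... = C * measure lborel \<Omega> - c * (LBINT x. mass q x)" using ii integrable_mass by simp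
 finally show ?thesis using e(2) c by (simp add: field_simps)
qed

end

text \<open>The quadratic condition reads (t - a)^2 < a^2 - a. Multiplied by p + 1, the hypothesis
  on N says that N (p+1)/4 stays below (p+1)/2 + (p-1)(a + b), where a + b is the upper root; so
  some t slightly below that root works.\<close>

lemma exponent_choice:
 fixes p N :: real
 assumes p: "p > 1" and N: "N / 4 < p / (p + 1) + (p - 1) / (p + 1) * (sqrt (2 * p / (p - 1)) + sqrt (2 * p / (p - 1) - sqrt (2 * p / (p - 1))) - 1 / 2)"
 obtains t where "t > 1" "t\<^sup>2 < sqrt (2 * p / (p - 1)) * (2 * t - 1)" "N * (p + 1) / 4 < (p + 1) / 2 + (p - 1) * t"
proof -
 define a where "a = sqrt (2 * p / (p - 1))"
 have "2 * p / (p - 1) > 1" using p by (simp add: field_simps)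
 then have a: "a > 1" "2 * p / (p - 1) = a\<^sup>2" by (auto simp: a_def)
 define b where "b = sqrt (a\<^sup>2 - a)"
 have a2: "a\<^sup>2 - a > 0" using a(1) by (simp add: power2_eq_square)
 then have b: "b > 0" "b\<^sup>2 = a\<^sup>2 - a" by (auto simp: b_def)
 have "N / 4 * (p + 1) < (p / (p + 1) + (p - 1) / (p + 1) * (a + b - 1 / 2)) * (p + 1)"
  using N[folded a_def, unfolded a(2), folded b_def] p by (intro mult_strict_right_mono) auto
 also have "... = p + (p - 1) * (a + b - 1 / 2)" using p by (simp add: distrib_right)
 also have "... = (p + 1) / 2 + (p - 1) * (a + b)" by (simp add: field_simps)
 finally have "(N * (p + 1) / 4 - (p + 1) / 2) / (p - 1) < a + b" using p by (simp add: field_simps)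
 then obtain t where t: "max 1 (max a ((N * (p + 1) / 4 - (p + 1) / 2) / (p - 1))) < t" "t < a + b"
  using dense[of "max 1 (max a ((N * (p + 1) / 4 - (p + 1) / 2) / (p - 1)))" "a + b"] a(1) b(1) by auto
 have "(t - a)\<^sup>2 < b\<^sup>2" using t by (intro power_strict_mono) auto
 then have "t\<^sup>2 < a * (2 * t - 1)" unfolding b(2) by (simp add: power2_eq_square algebra_simps)
 then show ?thesis using that[of t] t p by (simp add: a_def pos_divide_less_eq algebra_simps)
qed

theorem theorem3:
  fixes \<Omega> :: "(real ^ 'n) set" and p :: real and ustar :: "real ^ 'n \<Rightarrow> real"
  assumes "CARD('n) \<ge> 2"
    and "smooth_bounded_domain \<Omega>"
    and "p > 1" and "p \<noteq> 3"
    and "real CARD('n) / 4 <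
           p / (p + 1) + (p - 1) / (p + 1) *
             (sqrt (2 * p / (p - 1)) + sqrt (2 * p / (p - 1) - sqrt (2 * p / (p - 1))) - 1 / 2)"
    and "extremal_solution \<Omega> p ustar"
  shows "(SUP x\<in>\<Omega>. ustar x) < 1"
proof -
 let ?N = "real CARD('n)"
 have \<Omega>: "open \<Omega>" "bounded \<Omega>" "smooth_boundary \<Omega>" "\<Omega> \<noteq> {}" using assms(2) unfolding smooth_bounded_domain_def by auto
 have p: "p > 1" by (rule assms)
 obtain L U where L: "ereal L = extremal_parameter \<Omega> p"
  and U: "!!lam. 0 < lam ==> lam < L ==> minimal_solution \<Omega> p lam (U lam)"
  and lim: "!!x. x \<in> \<Omega> ==> ((%lam. U lam x) \<longlongrightarrow> ustar x) (at_left L)"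
  using assms(6) unfolding extremal_solution_def by blast
 \<comment> \<open>Every admissible parameter is positive, so a supremum that is not positive would
   be that of the empty set, which is minus infinity and not of the form
   \<open>ereal L\<close>.\<close>
 have "L > 0"
 proof (rule ccontr)
  let ?A = "{ereal lam |lam. lam > 0 & (\<exists>u. smooth_solution \<Omega> p lam u)}"
  assume *: "\<not> L > 0"
  have LA: "ereal L = Sup ?A" using L unfolding extremal_parameter_def .
  have "lam <= L" if "lam > 0" "smooth_solution \<Omega> p lam u" for lam u
  proof -
   have "ereal lam \<in> ?A" using that by blast
   from Sup_upper[OF this] show ?thesis unfolding LA[symmetric] by simp
  qed
  then have "?A = {}" using * by force
  then have "ereal L = - \<infinity>" unfolding LA by (simp only: Sup_empty bot_ereal_def)
  then show False by simp
 qed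
 obtain t where t: "t > 1" "t\<^sup>2 < sqrt (2 * p / (p - 1)) * (2 * t - 1)" "?N * (p + 1) / 4 < (p + 1) / 2 + (p - 1) * t"
  by (rule exponent_choice[OF p assms(5)])
 define q where "q = (p + 1) / 2 + (p - 1) * t"
 have "(p - 1) * 1 < (p - 1) * t" using p t(1) by (intro mult_strict_left_mono) auto
 then have q: "p < q" "?N * (p + 1) / 4 < q" using t(3) p unfolding q_def by (simp_all add: field_simps)
 have qN: "real DIM(real ^ 'n) <= 4 * q / (p + 1)" using q(2) p by (simp add: field_simps)
 obtain c C where c: "c > 0" "C >= 0" and bd: "!!lam s V. L / 2 <= lam ==> lam <= L ==> 0 < s ==> s <= 1 ==> 0 <= V ==>
  sqrt (lam / ((p - 1) / 2)) * (s powr (- ((p - 1) / 2)) - 1) <= V ==>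
  t\<^sup>2 / (2 * t - 1) * (lam * s powr (- p)) * pp (2 * t - 1) (V - 1) - sqrt (lam * p) * s powr (- (p + 1) / 2) * pp (2 * t) (V - 1)
   <= C - c * (s powr (- q) + V)"
  using pointwise_energy_bound[OF p \<open>L > 0\<close> t(1,2), folded q_def] by blast
 \<comment> \<open>None of these constants involves \<open>lam\<close>; this uniformity on [L/2, L)
   is what permits the passage to the limit. \<open>K\<close> and \<open>M\<close> are the factors
   produced by \<open>V_upper_bound\<close> and \<open>gap_estimate\<close>.\<close>
 define I where "I = C * measure lborel \<Omega> / c"
 define X where "X = (LBINT y. chi (y :: real ^ 'n))"
 define Y where "Y = (LBINT y. Xi (y :: real ^ 'n))"
 define K where "K = 1 + (I + 3 / 2 * L * Y + 3 * L * (Y + I) / (4 * p / (p + 1) - 2)) / X"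
 define M where "M = 6 + 3 / 2 * Y * K / X"
 have X: "X > 0" unfolding X_def by (rule integral_chi_pos)
 have Y: "Y >= 0" unfolding Y_def using chi_Xi(3) by (intro Bochner_Integration.integral_nonneg) auto
 have I: "I >= 0" using c by (simp add: I_def)
 have "4 * p / (p + 1) > 2" using p by (simp add: field_simps)
 then have K: "K >= 0" using I X Y \<open>L > 0\<close> by (simp add: K_def add_nonneg_nonneg)
 then have M: "M > 0" using X Y by (simp add: M_def add_pos_nonneg)
 define d where "d = q - ?N * (p + 1) / 4"
 have d: "d > 0" using q(2) by (simp add: d_def)
 \<comment> \<open>Obtained by solving M^(-q) X <= (X + I) \<delta>^d for \<delta>, where d > 0 is
   the distance of q from N (p+1)/4.\<close>
 define \<delta>0 where "\<delta>0 = min 1 ((M powr (- q) * X / (X + I)) powr (1 / d))"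
 have \<delta>0: "\<delta>0 > 0" using M X I by (simp add: \<delta>0_def)
 have main: "U lam x <= 1 - \<delta>0" if lam: "L / 2 <= lam" "lam < L" and x: "x \<in> \<Omega>" for lam x
 proof -
  \<comment> \<open>Any parameter strictly between \<open>lam\<close> and \<open>L\<close> would do;
    its minimal solution is the larger solution that \<open>stability\<close> compares with.\<close>
  define \<mu> where "\<mu> = (lam + L) / 2"
  have \<mu>: "lam < \<mu>" "\<mu> < L" "lam > 0" using lam \<open>L > 0\<close> by (auto simp: \<mu>_def)
  have s: "smooth_solution \<Omega> p l (U l)" if "0 < l" "l < L" for l using U[OF that] unfolding minimal_solution_def by blast
  define u where "u l x = (if x \<in> \<Omega> then U l x else 0)" for l x
  define V where "V l x = (if x \<in> \<Omega> then - laplacian (U l) x else 0)" for l x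
  have nv: "navier \<Omega> p l (u l) (V l)" if "0 < l" "l < L" for l
   using smooth_solution_navier(1)[OF \<Omega>(1,2) s[OF that]] unfolding u_def[abs_def] V_def[abs_def] .
  have le: "u lam y <= u \<mu> y" for y
   using minimal_solution_le[OF \<Omega>(1-3) _ _ _ U[of lam] s[of \<mu>], of y] \<mu> p by (auto simp: u_def)
  interpret navier \<Omega> p lam "u lam" "V lam" by (rule nv) (use \<mu> in auto)
  have lam0: "lam >= 0" using \<mu> by simp
  have mass: "(LBINT x. mass q x) <= I"
   unfolding I_def by (rule mass_bound[OF nv[of \<mu>] lam0 \<mu>(1) p le t(1) c]) (use \<mu> lam bd in auto)
  obtain x0 where x0: "!!x. u lam x <= u lam x0" by (rule attains_max[OF cont(1)]) (use off(1) nonneg(2)[OF lam0] in auto)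
  define \<delta> where "\<delta> = 1 - u lam x0"
  have \<delta>: "0 < \<delta>" "\<delta> <= 1" "!!x. u lam x <= 1 - \<delta>" "u lam x0 = 1 - \<delta>"
   using less_1[of x0] nonneg(2)[OF lam0, of x0] x0 by (auto simp: \<delta>_def)
  have "V lam y <= K * \<delta> powr ((1 - p) / 2)" for y
   using V_upper_bound[OF p lam0 _ \<delta>(1-3) q(1) qN mass, of L y] lam unfolding K_def X_def Y_def by simp
  from gap_estimate[OF p lam0 \<delta> K this _ mass]
  have "(M * \<delta>) powr (- q) * X <= (X + I) * \<delta> powr (- (?N * (p + 1) / 4))" using q p by (simp add: M_def X_def Y_def)
  then have "M powr (- q) * X * \<delta> powr (- q) <= (X + I) * \<delta> powr (- (?N * (p + 1) / 4))" using M \<delta> by (simp add: powr_mult mult_ac)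
  then have "M powr (- q) * X * \<delta> powr (- q) * \<delta> powr q <= (X + I) * \<delta> powr (- (?N * (p + 1) / 4)) * \<delta> powr q" by (intro mult_right_mono) auto
  then have "M powr (- q) * X <= (X + I) * \<delta> powr d" using \<delta>(1) by (simp add: d_def mult.assoc flip: powr_add)
  then have "M powr (- q) * X / (X + I) <= \<delta> powr d" using X I by (simp add: pos_divide_le_eq mult.commute)
  then have "(M powr (- q) * X / (X + I)) powr (1 / d) <= (\<delta> powr d) powr (1 / d)" using X I d by (intro powr_mono2) auto
  then have "\<delta>0 <= \<delta>" using d \<delta>(1) by (simp add: \<delta>0_def powr_powr min_le_iff_disj)
  then show ?thesis using \<delta>(3)[of x] x by (simp add: u_def)
 qed
 have "ustar x <= 1 - \<delta>0" if x: "x \<in> \<Omega>" for x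
 proof (rule tendsto_upperbound[OF lim[OF x]])
  have "eventually (%lam. lam \<in> {L/2<..<L}) (at_left L)" using \<open>L > 0\<close> by (intro eventually_at_leftI[of "L/2"]) auto
  then show "\<forall>\<^sub>F lam in at_left L. U lam x <= 1 - \<delta>0" by eventually_elim (use main x in auto)
 qed simp
 then have "(SUP x\<in>\<Omega>. ustar x) <= 1 - \<delta>0" using \<Omega>(4) by (intro cSUP_least)
 then show ?thesis using \<delta>0 by linarith
qed

end
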